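(* Let $X$ be an orbifold. Then the orbifold stratification of $X$ is equal to the set $\mathcal{O}_X$ of orbits of the family $\mathrm{vect}(X)$ of all vector fields on the subcartesian space $(X,C^\infty(X))$.
   Context: Orbifolds (all effective). Let $X$ be a Hausdorff, paracompact, second-countable space, $n\ge 0$. An $n$-dimensional orbifold chart is a triple $(U,\Gamma,\phi)$ with $U\subseteq\mathbb{R}^n$ open, $\Gamma$ a finite group of diffeomorphisms of $U$, and $\phi:U\to X$ a $\Gamma$-invariant map inducing a homeomorphism $U/\Gamma\to\phi(U)$ onto an open subset of $X$. An embedding $\lambda:(U,\Gamma,\phi)\to(V,\Delta,\psi)$ is a smooth embedding $\lambda:U\to V$ with $\psi\circ\lambda=\phi$. An orbifold atlas is a family of $n$-dimensional charts covering $X$ such that for any two of its charts $(U,\Gamma,\phi),(V,\Delta,\psi)$ there are charts $(W_\alpha,\Gamma_\alpha,\chi_\alpha)$ embedding into both, with $\{\chi_\alpha(W_\alpha)\}$ an open cover of $\phi(U)\cap\psi(V)$. Atlases are equivalent if they have a common refinement ($\mathcal{U}$ refines $\mathcal{V}$ if each chart of $\mathcal{U}$ embeds into one of $\mathcal{V}$); an orbifold is $X$ with a maximal atlas. Differential structure. $C^\infty(X)$ is the set of $f:X\to\mathbb{R}$ such that $f\circ\phi$ is smooth for every chart $(U,\Gamma,\phi)$. A differential structure on a set is a family of real functions closed under composition with smooth functions of finitely many of its members and closed under being locally (in the initial topology it generates) equal to its members; maps pulling back such functions to such functions are called smooth. Any subset $Y$ of a differential space carries the subspace differential structure (functions locally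 equal to restrictions). A subcartesian space is a paracompact, second-countable, Hausdorff differential space locally diffeomorphic to differential subspaces of Euclidean spaces. $(X,C^\infty(X))$ is subcartesian. Orbifold stratification. For a chart $(U,\Gamma,\phi)$ and a subgroup $H\le\Gamma$ let $U_{(H)}$ be the set of points of $U$ whose stabiliser is conjugate to $H$ in $\Gamma$. The strata of $\phi(U)$ are the connected components of the sets $\phi(U_{(H)})$. These local partitions are compatible and glue: the orbifold stratification of $X$ is the unique partition of $X$ into connected subsets $M$ such that for every chart the strata of $\phi(U)$ are the connected components of the sets $M\cap\phi(U)$. Vector fields. Let $S$ be a subcartesian space. A derivation of $C^\infty(S)$ is a linear map $Y:C^\infty(S)\to C^\infty(S)$ satisfying Leibniz' rule. An integral curve of $Y$ through $x\in S$ is a smooth map $t\mapsto\exp(tY)(x)$ from a connected subset of $\mathbb{R}$ containing $0$ to $S$ with value $x$ at $t=0$ and $\frac{d}{dt}f(\exp(tY)(x))=(Yf)(\exp(tY)(x))$ for all $f\in C^\infty(S)$ (by convention a curve with domain $\{0\}$ is always an integral curve); each $x$ has a unique maximal one, also denoted $\exp(\cdot Y)(x)$. A vector field on $S$ is a derivation $Y$ such that $(t,x)\mapsto\exp(tY)(x)$ (maximal integral curves) is a local flow, i.e. its domain is an open subset $D\subseteq\mathbb{R}\times S$ containing $\{0\}\times S$ with $D\cap(\mathbb{R}\times\{x\})$ connected for each $x$, $\exp(0Y)(x)=x$, and $\exp(tY)(\exp(sY)(x))=\exp((t+s)Y)(x)$ whenever both sides are defined. $\mathrm{vect}(S)$ is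 the set of all vector fields. The orbit of $\mathrm{vect}(S)$ through $x$ is the set of all points $\exp(t_kY_k)\circ\cdots\circ\exp(t_1Y_1)(x)$ with $Y_1,\dots,Y_k\in\mathrm{vect}(S)$ and $t_1,\dots,t_k\in\mathbb{R}$ for which this is defined. $\mathcal{O}_S$ is the set of all orbits. *)

theory Defs
  imports "HOL-Analysis.Analysis" "HOL-Algebra.Bij" "HOL-Algebra.Group_Action"
begin

section \<open>Smooth maps between open subsets of Euclidean spaces\<close>

text \<open>The space of dimension \<open>n\<close> is \<^term>\<open>Euclidean_space n\<close>, whose points are the sequences
  vanishing from index \<open>n\<close> on. Thus \<open>n\<close> is a term, and \<open>n = 0\<close> is included.\<close>

definition partial_deriv :: "nat \<Rightarrow> ((nat \<Rightarrow> real) \<Rightarrow> real) \<Rightarrow> (nat \<Rightarrow> real) \<Rightarrow> real" where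
  "partial_deriv i f x = deriv (\<lambda>t. f (x(i := t))) (x i)"

text \<open>All iterated partial derivatives exist and are continuous on the open set \<open>U\<close>. Since \<open>U\<close> is
  open, they do not depend on the values of \<open>f\<close> outside \<open>U\<close>.\<close>

definition smooth_fun :: "nat \<Rightarrow> (nat \<Rightarrow> real) set \<Rightarrow> ((nat \<Rightarrow> real) \<Rightarrow> real) \<Rightarrow> bool" where
  "smooth_fun n U f \<longleftrightarrow>
     (\<forall>is. set is \<subseteq> {..<n} \<longrightarrow>
        (let g = fold partial_deriv is f in
           continuous_map (subtopology (Euclidean_space n) U) euclideanreal g \<and>
           (\<forall>i<n. \<forall>x\<in>U. (\<lambda>t. g (x(i := t))) differentiable (at (x i)))))"

definition smooth_map ::
  "nat \<Rightarrow> (nat \<Rightarrow> real) set \<Rightarrow> (nat \<Rightarrow> real) set \<Rightarrow> ((nat \<Rightarrow> real) \<Rightarrow> nat \<Rightarrow> real) \<Rightarrow> bool" where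
  "smooth_map n U V g \<longleftrightarrow> g \<in> U \<rightarrow> V \<and> (\<forall>j<n. smooth_fun n U (\<lambda>x. g x j))"

text \<open>An immersion that is a homeomorphism onto its image.\<close>

definition smooth_embedding ::
  "nat \<Rightarrow> (nat \<Rightarrow> real) set \<Rightarrow> (nat \<Rightarrow> real) set \<Rightarrow> ((nat \<Rightarrow> real) \<Rightarrow> nat \<Rightarrow> real) \<Rightarrow> bool" where
  "smooth_embedding n U V g \<longleftrightarrow>
     smooth_map n U V g \<and>
     embedding_map (subtopology (Euclidean_space n) U) (subtopology (Euclidean_space n) V) g \<and>
     (\<forall>x\<in>U. \<forall>v\<in>topspace (Euclidean_space n).
        (\<forall>j<n. (\<Sum>i<n. partial_deriv i (\<lambda>y. g y j) x * v i) = 0) \<longrightarrow> v = (\<lambda>_. 0))"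


section \<open>Orbifolds\<close>

definition paracompact_space :: "'a topology \<Rightarrow> bool" where
  "paracompact_space X \<longleftrightarrow>
     (\<forall>\<U>. (\<forall>U\<in>\<U>. openin X U) \<and> \<Union>\<U> = topspace X \<longrightarrow>
        (\<exists>\<V>. (\<forall>V\<in>\<V>. openin X V \<and> (\<exists>U\<in>\<U>. V \<subseteq> U)) \<and> \<Union>\<V> = topspace X \<and>
              locally_finite_in X \<V>))"

text \<open>The final topology on the image of \<open>q\<close>.\<close>

definition quotient_topology :: "'a topology \<Rightarrow> ('a \<Rightarrow> 'b) \<Rightarrow> 'b topology" where
  "quotient_topology T q =
     topology (\<lambda>V. V \<subseteq> q ` topspace T \<and> openin T {x \<in> topspace T. q x \<in> V})"

lemma openin_quotient_topology:
  "openin (quotient_topology T q) V \<longleftrightarrow>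
     V \<subseteq> q ` topspace T \<and> openin T {x \<in> topspace T. q x \<in> V}"
proof -
  have 1: "{x \<in> topspace T. q x \<in> A \<inter> B} = {x \<in> topspace T. q x \<in> A} \<inter> {x \<in> topspace T. q x \<in> B}"
    for A B by auto
  have 2: "{x \<in> topspace T. q x \<in> \<Union>\<K>} = (\<Union>K\<in>\<K>. {x \<in> topspace T. q x \<in> K})"
    for \<K> by auto
  have "istopology (\<lambda>V. V \<subseteq> q ` topspace T \<and> openin T {x \<in> topspace T. q x \<in> V})"
    unfolding istopology_def 1 2 by (auto intro!: openin_Int openin_Union)
  then show ?thesis
    by (simp add: quotient_topology_def topology_inverse')
qed

lemma quotient_map_quotient_topology: "quotient_map T (quotient_topology T q) q"
proof -
  have "topspace (quotient_topology T q) = q ` topspace T"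
  proof
    show "topspace (quotient_topology T q) \<subseteq> q ` topspace T"
      using openin_quotient_topology[of T q] by (metis openin_topspace)
    have "openin (quotient_topology T q) (q ` topspace T)"
      by (auto simp: openin_quotient_topology cong: conj_cong)
    then show "q ` topspace T \<subseteq> topspace (quotient_topology T q)"
      by (rule openin_subset)
  qed
  then show ?thesis
    by (simp add: quotient_map_def openin_quotient_topology)
qed

text \<open>A chart \<open>(U, \<Gamma>, \<phi>)\<close>. The elements of \<open>\<Gamma>\<close> and the map \<open>\<phi>\<close> are extensional, so that functions
  on \<open>U\<close> have a unique representation.\<close>

type_synonym 'a chart =
  "(nat \<Rightarrow> real) set \<times> ((nat \<Rightarrow> real) \<Rightarrow> nat \<Rightarrow> real) set \<times> ((nat \<Rightarrow> real) \<Rightarrow> 'a)"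

definition chart_group ::
  "'b set \<Rightarrow> ('b \<Rightarrow> 'b) set \<Rightarrow> ('b \<Rightarrow> 'b) monoid" where
  "chart_group U \<Gamma> = BijGroup U\<lparr>carrier := \<Gamma>\<rparr>"

definition orbit_space ::
  "nat \<Rightarrow> (nat \<Rightarrow> real) set \<Rightarrow> ((nat \<Rightarrow> real) \<Rightarrow> nat \<Rightarrow> real) set \<Rightarrow> (nat \<Rightarrow> real) set topology" where
  "orbit_space n U \<Gamma> =
     quotient_topology (subtopology (Euclidean_space n) U) (orbit (chart_group U \<Gamma>) (\<lambda>\<gamma>. \<gamma>))"

text \<open>As \<open>\<Gamma>\<close> is closed under inverses, its elements are diffeomorphisms as soon as they are
  smooth.\<close>

definition orbifold_chart :: "'a topology \<Rightarrow> nat \<Rightarrow> 'a chart \<Rightarrow> bool" where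
  "orbifold_chart X n = (\<lambda>(U, \<Gamma>, \<phi>).
     openin (Euclidean_space n) U \<and>
     finite \<Gamma> \<and> subgroup \<Gamma> (BijGroup U) \<and> (\<forall>\<gamma>\<in>\<Gamma>. smooth_map n U U \<gamma>) \<and>
     \<phi> \<in> U \<rightarrow>\<^sub>E topspace X \<and>
     (\<forall>\<gamma>\<in>\<Gamma>. \<forall>x\<in>U. \<phi> (\<gamma> x) = \<phi> x) \<and>
     openin X (\<phi> ` U) \<and>
     (\<exists>h. homeomorphic_map (orbit_space n U \<Gamma>) (subtopology X (\<phi> ` U)) h \<and>
          (\<forall>x\<in>U. h (orbit (chart_group U \<Gamma>) (\<lambda>\<gamma>. \<gamma>) x) = \<phi> x)))"

definition chart_embeds :: "nat \<Rightarrow> 'a chart \<Rightarrow> 'a chart \<Rightarrow> bool" where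
  "chart_embeds n = (\<lambda>(U, \<Gamma>, \<phi>) (V, \<Delta>, \<psi>).
     \<exists>l. smooth_embedding n U V l \<and> (\<forall>x\<in>U. \<psi> (l x) = \<phi> x))"

definition chart_image :: "'a chart \<Rightarrow> 'a set" where
  "chart_image = (\<lambda>(U, \<Gamma>, \<phi>). \<phi> ` U)"

definition orbifold_atlas :: "'a topology \<Rightarrow> nat \<Rightarrow> 'a chart set \<Rightarrow> bool" where
  "orbifold_atlas X n \<A> \<longleftrightarrow>
     (\<forall>c\<in>\<A>. orbifold_chart X n c) \<and>
     (\<Union>c\<in>\<A>. chart_image c) = topspace X \<and>
     (\<forall>c\<in>\<A>. \<forall>d\<in>\<A>. \<exists>\<W>.
        (\<forall>w\<in>\<W>. orbifold_chart X n w \<and> chart_embeds n w c \<and> chart_embeds n w d) \<and>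
        (\<Union>w\<in>\<W>. chart_image w) = chart_image c \<inter> chart_image d)"

definition atlas_refines :: "nat \<Rightarrow> 'a chart set \<Rightarrow> 'a chart set \<Rightarrow> bool" where
  "atlas_refines n \<U> \<V> \<longleftrightarrow> (\<forall>c\<in>\<U>. \<exists>d\<in>\<V>. chart_embeds n c d)"

definition atlas_equivalent :: "'a topology \<Rightarrow> nat \<Rightarrow> 'a chart set \<Rightarrow> 'a chart set \<Rightarrow> bool" where
  "atlas_equivalent X n \<U> \<V> \<longleftrightarrow>
     (\<exists>\<W>. orbifold_atlas X n \<W> \<and> atlas_refines n \<W> \<U> \<and> atlas_refines n \<W> \<V>)"

definition maximal_atlas :: "'a topology \<Rightarrow> nat \<Rightarrow> 'a chart set \<Rightarrow> bool" where
  "maximal_atlas X n \<A> \<longleftrightarrow>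
     orbifold_atlas X n \<A> \<and>
     (\<forall>\<B>. orbifold_atlas X n \<B> \<and> atlas_equivalent X n \<B> \<A> \<longrightarrow> \<B> \<subseteq> \<A>)"

definition orbifold :: "'a topology \<Rightarrow> nat \<Rightarrow> 'a chart set \<Rightarrow> bool" where
  "orbifold X n \<A> \<longleftrightarrow>
     Hausdorff_space X \<and> paracompact_space X \<and> second_countable X \<and> maximal_atlas X n \<A>"

definition orbifold_smooth :: "'a topology \<Rightarrow> nat \<Rightarrow> 'a chart set \<Rightarrow> ('a \<Rightarrow> real) set" where
  "orbifold_smooth X n \<A> =
     {f \<in> extensional (topspace X). \<forall>(U, \<Gamma>, \<phi>)\<in>\<A>. smooth_fun n U (f \<circ> \<phi>)}"


section \<open>The orbifold stratification\<close>

definition orbit_type_set :: "'b set \<Rightarrow> ('b \<Rightarrow> 'b) set \<Rightarrow> ('b \<Rightarrow> 'b) set \<Rightarrow> 'b set" where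
  "orbit_type_set U \<Gamma> H =
     {x \<in> U. \<exists>\<gamma>\<in>\<Gamma>. stabilizer (chart_group U \<Gamma>) (\<lambda>\<gamma>. \<gamma>) x =
        \<gamma> <#\<^bsub>chart_group U \<Gamma>\<^esub> H #>\<^bsub>chart_group U \<Gamma>\<^esub> (inv\<^bsub>chart_group U \<Gamma>\<^esub> \<gamma>)}"

definition chart_strata :: "'a topology \<Rightarrow> 'a chart \<Rightarrow> 'a set set" where
  "chart_strata X = (\<lambda>(U, \<Gamma>, \<phi>).
     \<Union>H \<in> {H. subgroup H (chart_group U \<Gamma>)}.
       connected_components_of (subtopology X (\<phi> ` orbit_type_set U \<Gamma> H)))"

definition is_orbifold_stratification :: "'a topology \<Rightarrow> 'a chart set \<Rightarrow> 'a set set \<Rightarrow> bool" where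
  "is_orbifold_stratification X \<A> P \<longleftrightarrow>
     partition_on (topspace X) P \<and>
     (\<forall>M\<in>P. connectedin X M) \<and>
     (\<forall>c\<in>\<A>. chart_strata X c =
        (\<Union>M\<in>P. connected_components_of (subtopology X (M \<inter> chart_image c))))"

definition orbifold_stratification :: "'a topology \<Rightarrow> 'a chart set \<Rightarrow> 'a set set" where
  "orbifold_stratification X \<A> = (THE P. is_orbifold_stratification X \<A> P)"


section \<open>Vector fields on differential spaces\<close>

text \<open>A differential space is given by its underlying set \<open>S\<close> and its differential structure \<open>F\<close>,
  a set of real functions that are extensional on \<open>S\<close>.\<close>

definition initial_topology :: "'a set \<Rightarrow> ('a \<Rightarrow> real) set \<Rightarrow> 'a topology" where
  "initial_topology S F =
     topology_generated_by (insert S {f -` V \<inter> S | f V. f \<in> F \<and> open V})"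

definition subspace_structure ::
  "'a set \<Rightarrow> ('a \<Rightarrow> real) set \<Rightarrow> 'a set \<Rightarrow> ('a \<Rightarrow> real) set" where
  "subspace_structure S F A =
     {g \<in> extensional A. \<forall>x\<in>A. \<exists>W f. openin (initial_topology S F) W \<and> x \<in> W \<and> f \<in> F \<and>
        (\<forall>y\<in>W \<inter> A. g y = f y)}"

definition diff_smooth ::
  "'a set \<Rightarrow> ('a \<Rightarrow> real) set \<Rightarrow> 'b set \<Rightarrow> ('b \<Rightarrow> real) set \<Rightarrow> ('a \<Rightarrow> 'b) \<Rightarrow> bool" where
  "diff_smooth S F T G c \<longleftrightarrow> c \<in> S \<rightarrow> T \<and> (\<forall>g\<in>G. compose S g c \<in> F)"

definition real_smooth :: "(real \<Rightarrow> real) set" where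
  "real_smooth = {f. \<forall>k x. ((deriv ^^ k) f) differentiable (at x)}"

definition derivation :: "'a set \<Rightarrow> ('a \<Rightarrow> real) set \<Rightarrow> (('a \<Rightarrow> real) \<Rightarrow> 'a \<Rightarrow> real) \<Rightarrow> bool" where
  "derivation S F Y \<longleftrightarrow>
     Y \<in> F \<rightarrow>\<^sub>E F \<and>
     (\<forall>f\<in>F. \<forall>g\<in>F. Y (\<lambda>x\<in>S. f x + g x) = (\<lambda>x\<in>S. Y f x + Y g x)) \<and>
     (\<forall>a. \<forall>f\<in>F. Y (\<lambda>x\<in>S. a * f x) = (\<lambda>x\<in>S. a * Y f x)) \<and>
     (\<forall>f\<in>F. \<forall>g\<in>F. Y (\<lambda>x\<in>S. f x * g x) = (\<lambda>x\<in>S. f x * Y g x + g x * Y f x))"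

text \<open>The filter \<open>at 0 within {0}\<close> is trivial, so a curve with domain \<open>{0}\<close> is an integral curve of
  every derivation.\<close>

definition integral_curve ::
  "'a set \<Rightarrow> ('a \<Rightarrow> real) set \<Rightarrow> (('a \<Rightarrow> real) \<Rightarrow> 'a \<Rightarrow> real) \<Rightarrow> 'a \<Rightarrow> real set \<Rightarrow> (real \<Rightarrow> 'a) \<Rightarrow> bool"
  where
  "integral_curve S F Y x I c \<longleftrightarrow>
     connected I \<and> 0 \<in> I \<and> c \<in> extensional I \<and>
     diff_smooth I (subspace_structure UNIV real_smooth I) S F c \<and>
     c 0 = x \<and>
     (\<forall>f\<in>F. \<forall>t\<in>I. ((\<lambda>s. f (c s)) has_real_derivative Y f (c t)) (at t within I))"

definition maximal_integral_curve ::
  "'a set \<Rightarrow> ('a \<Rightarrow> real) set \<Rightarrow> (('a \<Rightarrow> real) \<Rightarrow> 'a \<Rightarrow> real) \<Rightarrow> 'a \<Rightarrow> real set \<Rightarrow> (real \<Rightarrow> 'a) \<Rightarrow> bool"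
  where
  "maximal_integral_curve S F Y x I c \<longleftrightarrow>
     integral_curve S F Y x I c \<and>
     (\<forall>J d. integral_curve S F Y x J d \<and> I \<subseteq> J \<and> (\<forall>t\<in>I. d t = c t) \<longrightarrow> J = I)"

definition exp_curve ::
  "'a set \<Rightarrow> ('a \<Rightarrow> real) set \<Rightarrow> (('a \<Rightarrow> real) \<Rightarrow> 'a \<Rightarrow> real) \<Rightarrow> 'a \<Rightarrow> real set \<times> (real \<Rightarrow> 'a)" where
  "exp_curve S F Y x = (THE (I, c). maximal_integral_curve S F Y x I c)"

definition exp_domain ::
  "'a set \<Rightarrow> ('a \<Rightarrow> real) set \<Rightarrow> (('a \<Rightarrow> real) \<Rightarrow> 'a \<Rightarrow> real) \<Rightarrow> (real \<times> 'a) set" where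
  "exp_domain S F Y = {(t, x). x \<in> S \<and> t \<in> fst (exp_curve S F Y x)}"

definition exp_flow ::
  "'a set \<Rightarrow> ('a \<Rightarrow> real) set \<Rightarrow> (('a \<Rightarrow> real) \<Rightarrow> 'a \<Rightarrow> real) \<Rightarrow> real \<Rightarrow> 'a \<Rightarrow> 'a" where
  "exp_flow S F Y t x = snd (exp_curve S F Y x) t"

definition local_flow :: "'a topology \<Rightarrow> (real \<times> 'a) set \<Rightarrow> (real \<Rightarrow> 'a \<Rightarrow> 'a) \<Rightarrow> bool" where
  "local_flow T D \<Phi> \<longleftrightarrow>
     openin (prod_topology euclideanreal T) D \<and>
     {0} \<times> topspace T \<subseteq> D \<and>
     (\<forall>x\<in>topspace T. connectedin (prod_topology euclideanreal T) (D \<inter> UNIV \<times> {x})) \<and>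
     (\<forall>x\<in>topspace T. \<Phi> 0 x = x) \<and>
     (\<forall>s t x. (s, x) \<in> D \<and> (t, \<Phi> s x) \<in> D \<and> (t + s, x) \<in> D \<longrightarrow> \<Phi> t (\<Phi> s x) = \<Phi> (t + s) x)"

definition vect :: "'a set \<Rightarrow> ('a \<Rightarrow> real) set \<Rightarrow> (('a \<Rightarrow> real) \<Rightarrow> 'a \<Rightarrow> real) set" where
  "vect S F =
     {Y. derivation S F Y \<and>
         local_flow (initial_topology S F) (exp_domain S F Y) (exp_flow S F Y)}"

definition vect_orbit :: "'a set \<Rightarrow> ('a \<Rightarrow> real) set \<Rightarrow> 'a \<Rightarrow> 'a set" where
  "vect_orbit S F x =
     {y. (\<lambda>u v. \<exists>Y\<in>vect S F. \<exists>t. (t, u) \<in> exp_domain S F Y \<and> v = exp_flow S F Y t u)\<^sup>*\<^sup>* x y}"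

definition vect_orbits :: "'a set \<Rightarrow> ('a \<Rightarrow> real) set \<Rightarrow> 'a set set" where
  "vect_orbits S F = vect_orbit S F ` S"

end

theory Submission
  imports Defs "HOL-Homology.Invariance_of_Domain" "Jordan_Normal_Form.Determinant"
begin

text \<open>
  Near a point \<open>x\<close> a chart is the quotient of a ball by the linear action of the stabiliser \<open>G\<close>, and the
  stratum through \<open>x\<close> is the image of the fixed space of \<open>G\<close>. Cut-off constant fields along the fixed
  space are vector fields on \<open>X\<close>, so a neighbourhood of \<open>x\<close> in its stratum lies in the orbit of \<open>x\<close>.
  Conversely let \<open>\<rho>\<close> be an invariant squared distance to the fixed space, cut off, and \<open>Y\<close> a vector field.
  Domains of maximal integral curves being open, \<open>\<rho>\<close> has interior minima along the curves through points
  of the stratum, so \<open>Y\<rho>\<close> vanishes there. An invariant function that vanishes on the fixed space is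
  locally bounded by a multiple of \<open>\<rho>\<close>, and Gronwall's inequality gives \<open>\<rho> = 0\<close> along the integral curve
  through \<open>x\<close>, which therefore stays in the stratum for a short time.

  To see that the whole orbit, and not just each integral curve, is locally a stratum, note that an orbit
  \<open>M\<close> contains every stratum that it meets, and that the strata near \<open>x\<close> are cones that accumulate at all
  points of the stratum of \<open>x\<close> nearby. So the condition that \<open>M\<close> coincides with the stratum near a
  point propagates along \<open>M\<close>; it holds where the stabiliser is smallest. The same two properties hold for
  the blocks of any partition that is compatible with the strata of all charts, which gives uniqueness.
\<close>

text \<open>\<open>exp_curve\<close> is a definite description, so nothing can be said about flows
  before every point is known to have exactly one maximal integral curve. X is not a manifold and a
  derivation need not lift to a chart, so ordinary ODE theory does not apply directly. Uniqueness
  rests on a Lipschitz estimate for all smooth functions on X in terms of finitely many of them. It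
  comes from polynomial interpolation at the coordinates of two whole orbits, with coefficients
  bounded however close the nodes are. Openness of the flow domains is essential: on the line modulo
  reflection, with y = x^2, d/dy is a derivation, but its curve from the fixed point has domain [0,
  infinity). The fields along the strata are built to be complete, so that their flow domain is the
  whole product, and their flow is written down explicitly. Stabilisers belong to a chart and
  transition maps are not known to be equivariant, so strata in different charts are compared
  through the shape of the fibres alone.\<close>

abbreviation Esp :: "nat \<Rightarrow> (nat \<Rightarrow> real) set" where
  "Esp n \<equiv> topspace (Euclidean_space n)"

lemma Esp_iff: "x \<in> Esp n \<longleftrightarrow> (\<forall>i\<ge>n. x i = 0)"
  by (simp add: topspace_Euclidean_space)

lemma Esp_ext: "x \<in> Esp n \<Longrightarrow> y \<in> Esp n \<Longrightarrow> (\<And>i. i < n \<Longrightarrow> x i = y i) \<Longrightarrow> x = y"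
  by (rule ext) (metis Esp_iff not_less)

lemma Euclidean_space_eq_top_of_set: "Euclidean_space n = top_of_set {x. \<forall>i\<ge>n. x i = 0}"
  by (simp add: Euclidean_space_def euclidean_product_topology)

lemma openin_Euclidean_open: "openin (Euclidean_space n) U \<longleftrightarrow> (\<exists>T. open T \<and> U = Esp n \<inter> T)"
  by (simp add: Euclidean_space_eq_top_of_set openin_open)

lemma subtopology_Euclidean_space:
  assumes "U \<subseteq> Esp n" shows "subtopology (Euclidean_space n) U = top_of_set U"
proof -
  have "U \<subseteq> {x. \<forall>i\<ge>n. x i = 0}" using assms by (simp add: topspace_Euclidean_space)
  then show ?thesis by (simp add: Euclidean_space_eq_top_of_set subtopology_subtopology inf.absorb2)
qed

lemma continuous_map_Euclidean_subspace_iff: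
  "U \<subseteq> Esp n \<Longrightarrow> continuous_map (subtopology (Euclidean_space n) U) euclideanreal g \<longleftrightarrow> continuous_on U g"
  by (simp add: subtopology_Euclidean_space)

section \<open>Coordinate boxes, which take the place of metric balls\<close>

definition cbx :: "nat \<Rightarrow> (nat \<Rightarrow> real) \<Rightarrow> real \<Rightarrow> (nat \<Rightarrow> real) set" where
  "cbx n x e = {y \<in> Esp n. \<forall>i<n. \<bar>y i - x i\<bar> \<le> e}"

definition obx :: "nat \<Rightarrow> (nat \<Rightarrow> real) \<Rightarrow> real \<Rightarrow> (nat \<Rightarrow> real) set" where
  "obx n x e = {y \<in> Esp n. \<forall>i<n. \<bar>y i - x i\<bar> < e}"

lemma openin_obx: "openin (Euclidean_space n) (obx n x e)"
proof -
  have "open (\<Inter>i\<in>{..<n}. {y::nat\<Rightarrow>real. \<bar>y i - x i\<bar> < e})"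
    by (intro open_INT finite_lessThan ballI open_Collect_less continuous_on_rabs continuous_on_diff
        continuous_on_const continuous_on_product_coordinates)
  moreover have "obx n x e = Esp n \<inter> (\<Inter>i\<in>{..<n}. {y::nat\<Rightarrow>real. \<bar>y i - x i\<bar> < e})"
    unfolding obx_def set_eq_iff Int_iff INT_iff mem_Collect_eq lessThan_iff by blast
  ultimately show ?thesis
    unfolding openin_Euclidean_open by blast
qed

lemma obx_self: "x \<in> Esp n \<Longrightarrow> 0 < e \<Longrightarrow> x \<in> obx n x e"
  by (auto simp: obx_def)

lemma obx_subset_cbx: "obx n x e \<subseteq> cbx n x e"
  by (auto simp: obx_def cbx_def less_imp_le)

text \<open>A basic open set of the product topology may restrict coordinates beyond
  \<open>n\<close> as well, but there both points are 0. A minimum over the first \<open>n\<close>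
  side lengths is therefore enough.\<close>

lemma open_contains_cbx:
  assumes U: "openin (Euclidean_space n) U" and x: "x \<in> U"
  shows "\<exists>e>0. cbx n x e \<subseteq> U"
proof -
  have xE: "x \<in> Esp n" using openin_subset[OF U] x by auto
  obtain T where T: "openin (powertop_real UNIV) T" "U = T \<inter> Esp n"
    using U unfolding Euclidean_space_def topspace_Euclidean_space openin_subtopology
    by (auto simp: topspace_Euclidean_space)
  with x have "x \<in> T" by auto
  then obtain V where V: "finite {i. V i \<noteq> (UNIV::real set)}" "\<And>i. open (V i)" "x \<in> Pi\<^sub>E UNIV V" "Pi\<^sub>E UNIV V \<subseteq> T"
    using T(1)[unfolded openin_product_topology_alt, rule_format, OF \<open>x \<in> T\<close>]
    by (auto simp flip: open_openin)
  have "\<exists>e>0. \<forall>y. \<bar>y - x i\<bar> \<le> e \<longrightarrow> y \<in> V i" for i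
  proof -
    have "x i \<in> V i" using V(3) by auto
    then obtain e where "e > 0" "cball (x i) e \<subseteq> V i" using V(2) open_contains_cball by blast
    then show ?thesis by (intro exI[of _ e]) (auto simp: dist_real_def subset_iff abs_minus_commute)
  qed
  then obtain e where e: "\<And>i. e i > 0" "\<And>i y. \<bar>y - x i\<bar> \<le> e i \<Longrightarrow> y \<in> V i" by metis
  \<comment> \<open>The extra 1 keeps the set nonempty when \<open>n = 0\<close>.\<close>
  define d where "d = Min (insert 1 (e ` {..<n}))"
  have d0: "d > 0" unfolding d_def using e(1) by (subst Min_gr_iff) auto
  have de: "d \<le> e i" if "i < n" for i unfolding d_def using that by (intro Min_le) auto
  have "cbx n x d \<subseteq> U"
  proof
    fix y assume y: "y \<in> cbx n x d"
    have "y i \<in> V i" for i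
    proof (cases "i < n")
      case True
      then show ?thesis using y de[OF True] by (intro e(2)) (auto simp: cbx_def)
    next
      case False
      then have "y i = x i" using y xE by (auto simp: cbx_def Esp_iff)
      then show ?thesis using V(3) by auto
    qed
    then have "y \<in> T" using V(4) by auto
    then show "y \<in> U" using y T(2) by (auto simp: cbx_def)
  qed
  with d0 show ?thesis by blast
qed

lemma eventually_fun_upd_in:
  assumes "openin (Euclidean_space n) U" "x \<in> U" "i < n"
  shows "eventually (\<lambda>t. x(i := t) \<in> U) (nhds (x i))"
proof -
  obtain e where e: "e > 0" "cbx n x e \<subseteq> U" using open_contains_cbx[OF assms(1,2)] by blast
  have "x \<in> Esp n" using assms(2) openin_subset[OF assms(1)] by blast
  then have "x(i := t) \<in> U" if "dist t (x i) < e" for t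
    using that e assms(3) by (intro subsetD[OF e(2)]) (auto simp: cbx_def Esp_iff dist_real_def)
  then show ?thesis unfolding eventually_nhds_metric using e(1) by blast
qed

section \<open>Calculus of smooth functions\<close>

lemma smooth_funD:
  assumes "smooth_fun n U f" "i < n"
  shows "x \<in> U \<Longrightarrow> ((\<lambda>t. f (x(i := t))) has_real_derivative partial_deriv i f x) (at (x i))"
    and "smooth_fun n U (partial_deriv i f)"
proof -
  have *: "set is \<subseteq> {..<n} \<Longrightarrow> continuous_map (subtopology (Euclidean_space n) U) euclideanreal (fold partial_deriv is f) \<and>
           (\<forall>i<n. \<forall>x\<in>U. (\<lambda>t. fold partial_deriv is f (x(i := t))) differentiable (at (x i)))" for "is"
    using assms(1) unfolding smooth_fun_def Let_def by blast
  show "((\<lambda>t. f (x(i := t))) has_real_derivative partial_deriv i f x) (at (x i))" if "x \<in> U"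
  proof -
    have "(\<lambda>t. f (x(i := t))) differentiable at (x i)"
      using *[of "[]"] assms(2) that by simp
    then show ?thesis
      unfolding partial_deriv_def by (simp only: DERIV_deriv_iff_real_differentiable)
  qed
  show "smooth_fun n U (partial_deriv i f)"
    unfolding smooth_fun_def Let_def
  proof (intro allI impI)
    fix "is" assume "set is \<subseteq> {..<n}"
    then have "set (i # is) \<subseteq> {..<n}" using assms(2) by simp
    from *[OF this] show "continuous_map (subtopology (Euclidean_space n) U) euclideanreal (fold partial_deriv is (partial_deriv i f)) \<and>
        (\<forall>ia<n. \<forall>x\<in>U. (\<lambda>t. fold partial_deriv is (partial_deriv i f) (x(ia := t))) differentiable at (x ia))"
      by simp
  qed
qed

lemma smooth_fun_continuous_on:
  assumes "smooth_fun n U f" "U \<subseteq> Esp n" shows "continuous_on U f"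
  using assms(1) continuous_map_Euclidean_subspace_iff[OF assms(2)] unfolding smooth_fun_def Let_def
  by (metis empty_subsetI empty_set fold_simps(1))

lemma smooth_fun_fold:
  assumes "smooth_fun n U f" "set is \<subseteq> {..<n}" shows "smooth_fun n U (fold partial_deriv is f)"
  using assms by (induction "is" arbitrary: f) (auto intro: smooth_funD(2))

lemma has_derivative_cong_open:
  assumes U: "openin (Euclidean_space n) U" and x: "x \<in> U" "i < n" and eq: "\<And>y. y \<in> U \<Longrightarrow> h y = g y"
  shows "((\<lambda>t. h (x(i := t))) has_real_derivative D) (at (x i)) \<longleftrightarrow>
         ((\<lambda>t. g (x(i := t))) has_real_derivative D) (at (x i))"
proof (rule DERIV_cong_ev[OF refl _ refl])
  show "\<forall>\<^sub>F t in nhds (x i). h (x(i := t)) = g (x(i := t))"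
    using eventually_fun_upd_in[OF U x] by eventually_elim (rule eq)
qed

text \<open>Coinduction: every iterated partial derivative of a member of \<open>P\<close> agrees on
  \<open>U\<close> with a member of \<open>P\<close>. Agreement is asked for on \<open>U\<close>
  only, because nothing is known about \<open>partial_deriv\<close> elsewhere. Most closure
  properties below amount to a choice of \<open>P\<close>.\<close>

lemma smooth_fun_coinduct:
  assumes U: "openin (Euclidean_space n) U" and f: "P f"
    and cont: "\<And>g. P g \<Longrightarrow> continuous_on U g"
    and der: "\<And>g i. P g \<Longrightarrow> i < n \<Longrightarrow>
      \<exists>g'. P g' \<and> (\<forall>x\<in>U. ((\<lambda>t. g (x(i := t))) has_real_derivative g' x) (at (x i)))"
  shows "smooth_fun n U f"
proof -
  have UE: "U \<subseteq> Esp n" by (rule openin_subset[OF U])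
  \<comment> \<open>\<open>fold\<close> applies the last index last, hence the induction from the
    right end of the list.\<close>
  have *: "\<exists>g. P g \<and> (\<forall>x\<in>U. fold partial_deriv is f x = g x)" if "set is \<subseteq> {..<n}" for "is"
    using that
  proof (induction "is" rule: rev_induct)
    case Nil
    then show ?case using f by auto
  next
    case (snoc i "is")
    then obtain g where g: "P g" "\<forall>x\<in>U. fold partial_deriv is f x = g x" by auto
    obtain g' where g': "P g'" "\<forall>x\<in>U. ((\<lambda>t. g (x(i := t))) has_real_derivative g' x) (at (x i))"
      using der[OF g(1), of i] snoc.prems by auto
    have "fold partial_deriv (is @ [i]) f x = g' x" if "x \<in> U" for x
    proof -
      have "((\<lambda>t. fold partial_deriv is f (x(i := t))) has_real_derivative g' x) (at (x i))"
        using has_derivative_cong_open[OF U that, of i "fold partial_deriv is f" g "g' x"] g(2) g'(2) snoc.prems that by auto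
      then show ?thesis by (simp add: partial_deriv_def DERIV_imp_deriv)
    qed
    then show ?case using g'(1) by blast
  qed
  show ?thesis
    unfolding smooth_fun_def Let_def
  proof (intro allI impI conjI ballI)
    fix "is" assume s: "set is \<subseteq> {..<n}"
    then obtain g where g: "P g" "\<forall>x\<in>U. fold partial_deriv is f x = g x" using * by blast
    show "continuous_map (subtopology (Euclidean_space n) U) euclideanreal (fold partial_deriv is f)"
      unfolding continuous_map_Euclidean_subspace_iff[OF UE]
      using cont[OF g(1)] g(2) by (metis continuous_on_cong)
    fix i x assume ix: "i < n" "x \<in> U"
    obtain g' where g': "\<forall>x\<in>U. ((\<lambda>t. g (x(i := t))) has_real_derivative g' x) (at (x i))"
      using der[OF g(1) ix(1)] by auto
    then have "((\<lambda>t. fold partial_deriv is f (x(i := t))) has_real_derivative g' x) (at (x i))"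
      using has_derivative_cong_open[OF U ix(2,1), of "fold partial_deriv is f" g "g' x"] g(2) ix by auto
    then show "(\<lambda>t. fold partial_deriv is f (x(i := t))) differentiable at (x i)"
      using real_differentiable_def by blast
  qed
qed

lemma smooth_fun_cong:
  assumes U: "openin (Euclidean_space n) U" and "smooth_fun n U f" "\<And>x. x \<in> U \<Longrightarrow> g x = f x"
  shows "smooth_fun n U g"
proof (rule smooth_fun_coinduct[OF U, where P = "\<lambda>g. \<exists>f. smooth_fun n U f \<and> (\<forall>x\<in>U. g x = f x)"])
  show "\<exists>f. smooth_fun n U f \<and> (\<forall>x\<in>U. g x = f x)" using assms by blast
next
  fix g assume "\<exists>f. smooth_fun n U f \<and> (\<forall>x\<in>U. g x = f x)"
  then show "continuous_on U g"
    using smooth_fun_continuous_on openin_subset[OF U] by (metis continuous_on_cong)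
next
  fix g i assume "\<exists>f. smooth_fun n U f \<and> (\<forall>x\<in>U. g x = f x)" and i: "i < n"
  then obtain f where f: "smooth_fun n U f" "\<forall>x\<in>U. g x = f x" by auto
  have "((\<lambda>t. g (x(i := t))) has_real_derivative partial_deriv i f x) (at (x i))" if "x \<in> U" for x
    using has_derivative_cong_open[OF U that i, of g f] smooth_funD(1)[OF f(1) i that] f(2) by auto
  then show "\<exists>g'. (\<exists>f. smooth_fun n U f \<and> (\<forall>x\<in>U. g' x = f x)) \<and>
     (\<forall>x\<in>U. ((\<lambda>t. g (x(i := t))) has_real_derivative g' x) (at (x i)))"
    using smooth_funD(2)[OF f(1) i] by blast
qed

lemma smooth_fun_local:
  assumes loc: "\<And>x. x \<in> U \<Longrightarrow> \<exists>W. openin (Euclidean_space n) W \<and> x \<in> W \<and> smooth_fun n W f"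
    and U: "openin (Euclidean_space n) U"
  shows "smooth_fun n U f"
proof (rule smooth_fun_coinduct[OF U, where P = "\<lambda>f. \<forall>x\<in>U. \<exists>W. openin (Euclidean_space n) W \<and> x \<in> W \<and> smooth_fun n W f"])
  show "\<forall>x\<in>U. \<exists>W. openin (Euclidean_space n) W \<and> x \<in> W \<and> smooth_fun n W f" using loc by blast
next
  fix g assume *: "\<forall>x\<in>U. \<exists>W. openin (Euclidean_space n) W \<and> x \<in> W \<and> smooth_fun n W g"
  show "continuous_on U g"
    unfolding continuous_on_eq_continuous_within
  proof
    fix x assume x: "x \<in> U"
    then obtain W where W: "openin (Euclidean_space n) W" "x \<in> W" "smooth_fun n W g" using * by blast
    obtain T where T: "open T" "W = Esp n \<inter> T"
      using W(1) unfolding openin_Euclidean_open by blast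
    have "continuous (at x within W) g"
      using smooth_fun_continuous_on[OF W(3)] openin_subset[OF W(1)] W(2)
      by (simp add: continuous_on_eq_continuous_within)
    moreover have "at x within (W \<inter> U) = at x within U"
    proof -
      have "W \<inter> U = U \<inter> T" using T(2) openin_subset[OF U] by auto
      moreover have "x \<in> T" using W(2) T(2) by auto
      ultimately show ?thesis using T(1) by (intro at_within_nhd[of x T]) auto
    qed
    ultimately show "continuous (at x within U) g"
      using continuous_within_subset[of x W g "W \<inter> U"] by simp
  qed
next
  fix g i assume *: "\<forall>x\<in>U. \<exists>W. openin (Euclidean_space n) W \<and> x \<in> W \<and> smooth_fun n W g" and i: "i < n"
  show "\<exists>g'. (\<forall>x\<in>U. \<exists>W. openin (Euclidean_space n) W \<and> x \<in> W \<and> smooth_fun n W g') \<and>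
     (\<forall>x\<in>U. ((\<lambda>t. g (x(i := t))) has_real_derivative g' x) (at (x i)))"
    using * smooth_funD[OF _ i, of _ g] by (intro exI[of _ "partial_deriv i g"] conjI ballI) blast+
qed

lemma smooth_fun_subset:
  assumes "smooth_fun n U f" "openin (Euclidean_space n) W" "W \<subseteq> U" "U \<subseteq> Esp n"
  shows "smooth_fun n W f"
proof (rule smooth_fun_coinduct[OF assms(2), where P = "smooth_fun n U"])
  show "smooth_fun n U f" by fact
  show "continuous_on W g" if "smooth_fun n U g" for g
    using smooth_fun_continuous_on[OF that assms(4)] assms(3) continuous_on_subset by blast
  show "\<exists>g'. smooth_fun n U g' \<and> (\<forall>x\<in>W. ((\<lambda>t. g (x(i := t))) has_real_derivative g' x) (at (x i)))"
    if "smooth_fun n U g" "i < n" for g i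
    using smooth_funD[OF that] assms(3) by blast
qed

inductive salg :: "nat \<Rightarrow> (nat \<Rightarrow> real) set \<Rightarrow> (((nat \<Rightarrow> real) \<Rightarrow> real) \<Rightarrow> bool) \<Rightarrow> ((nat \<Rightarrow> real) \<Rightarrow> real) \<Rightarrow> bool"
  for n U K where
  gen: "K g \<Longrightarrow> salg n U K g"
| smooth: "smooth_fun n U g \<Longrightarrow> salg n U K g"
| add: "salg n U K f \<Longrightarrow> salg n U K g \<Longrightarrow> salg n U K (\<lambda>x. f x + g x)"
| mult: "salg n U K f \<Longrightarrow> salg n U K g \<Longrightarrow> salg n U K (\<lambda>x. f x * g x)"

text \<open>The algebra generated by the smooth functions and some further functions \<open>K\<close> consists of smooth
  functions as soon as the partial derivatives of the generators lie in the algebra.\<close>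

lemma salg_smooth:
  assumes U: "openin (Euclidean_space n) U"
    and cont: "\<And>g. K g \<Longrightarrow> continuous_on U g"
    and der: "\<And>g i. K g \<Longrightarrow> i < n \<Longrightarrow>
      \<exists>g'. salg n U K g' \<and> (\<forall>x\<in>U. ((\<lambda>t. g (x(i := t))) has_real_derivative g' x) (at (x i)))"
    and f: "salg n U K f"
  shows "smooth_fun n U f"
proof (rule smooth_fun_coinduct[OF U, where P = "salg n U K"])
  show "salg n U K f" by fact
  show "continuous_on U g" if "salg n U K g" for g
    using that
  proof induction
    case (gen g)
    then show ?case by (rule cont)
  next
    case (smooth g)
    then show ?case using smooth_fun_continuous_on openin_subset[OF U] by blast
  qed (auto intro: continuous_on_add continuous_on_mult)
  show "\<exists>g'. salg n U K g' \<and> (\<forall>x\<in>U. ((\<lambda>t. g (x(i := t))) has_real_derivative g' x) (at (x i)))"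
    if "salg n U K g" "i < n" for g i
    using that
  proof induction
    case (gen g)
    then show ?case using der by blast
  next
    case (smooth g)
    then show ?case using smooth_funD salg.smooth by blast
  next
    case (add f g)
    then obtain f' g' where *: "salg n U K f'" "salg n U K g'"
      "\<forall>x\<in>U. ((\<lambda>t. f (x(i := t))) has_real_derivative f' x) (at (x i))"
      "\<forall>x\<in>U. ((\<lambda>t. g (x(i := t))) has_real_derivative g' x) (at (x i))" by blast
    then show ?case by (intro exI[of _ "\<lambda>x. f' x + g' x"] conjI salg.add ballI DERIV_add) blast+
  next
    case (mult f g)
    then obtain f' g' where *: "salg n U K f'" "salg n U K g'"
      "\<forall>x\<in>U. ((\<lambda>t. f (x(i := t))) has_real_derivative f' x) (at (x i))"
      "\<forall>x\<in>U. ((\<lambda>t. g (x(i := t))) has_real_derivative g' x) (at (x i))" by blast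
    have "((\<lambda>t. f (x(i := t)) * g (x(i := t))) has_real_derivative f' x * g x + g' x * f x) (at (x i))" if "x \<in> U" for x
      using DERIV_mult[OF *(3)[rule_format, OF that] *(4)[rule_format, OF that]] by simp
    then show ?case
      by (intro exI[of _ "\<lambda>x. f' x * g x + g' x * f x"] conjI salg.add salg.mult mult.hyps * ballI)
  qed
qed

lemma smooth_fun_add:
  assumes "openin (Euclidean_space n) U" "smooth_fun n U f" "smooth_fun n U g"
  shows "smooth_fun n U (\<lambda>x. f x + g x)"
  by (rule salg_smooth[where K = "\<lambda>_. False"]) (auto intro: salg.intros assms)

lemma smooth_fun_mult:
  assumes "openin (Euclidean_space n) U" "smooth_fun n U f" "smooth_fun n U g"
  shows "smooth_fun n U (\<lambda>x. f x * g x)"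
  by (rule salg_smooth[where K = "\<lambda>_. False"]) (auto intro: salg.intros assms)

lemma smooth_fun_const:
  assumes "openin (Euclidean_space n) U" shows "smooth_fun n U (\<lambda>x. c)"
proof (rule smooth_fun_coinduct[OF assms, where P = "\<lambda>f. \<exists>c. f = (\<lambda>x. c)"])
  show "\<exists>g'. (\<exists>c. g' = (\<lambda>x. c)) \<and> (\<forall>x\<in>U. ((\<lambda>t. g (x(i := t))) has_real_derivative g' x) (at (x i)))"
    if "\<exists>c. g = (\<lambda>x. c)" for g :: "(nat \<Rightarrow> real) \<Rightarrow> real" and i
    using that by (intro exI[of _ "\<lambda>x. 0"]) auto
qed auto

lemma smooth_fun_coord:
  assumes "openin (Euclidean_space n) U" shows "smooth_fun n U (\<lambda>x. x j)"
proof (rule smooth_fun_coinduct[OF assms, where P = "\<lambda>f. smooth_fun n U f \<or> f = (\<lambda>x. x j)"])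
  show "continuous_on U g" if "smooth_fun n U g \<or> g = (\<lambda>x. x j)" for g
    using that smooth_fun_continuous_on[OF _ openin_subset[OF assms]]
      by (auto intro: continuous_on_subset[OF continuous_on_product_coordinates])
  show "\<exists>g'. (smooth_fun n U g' \<or> g' = (\<lambda>x. x j)) \<and> (\<forall>x\<in>U. ((\<lambda>t. g (x(i := t))) has_real_derivative g' x) (at (x i)))"
    if "smooth_fun n U g \<or> g = (\<lambda>x. x j)" "i < n" for g i
  proof (cases "smooth_fun n U g")
    case True
    then show ?thesis using smooth_funD[OF _ that(2)] by blast
  next
    case False
    then have g: "g = (\<lambda>x. x j)" using that by auto
    then show ?thesis
      by (intro exI[of _ "\<lambda>x. if i = j then 1 else 0"]) (auto intro!: disjI1 smooth_fun_const[OF assms])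
  qed
qed auto

lemma smooth_fun_uminus:
  assumes "openin (Euclidean_space n) U" "smooth_fun n U f"
  shows "smooth_fun n U (\<lambda>x. - f x)"
  using smooth_fun_mult[OF assms(1) smooth_fun_const[OF assms(1)] assms(2), of "-1"] by simp

lemma smooth_fun_diff:
  assumes "openin (Euclidean_space n) U" "smooth_fun n U f" "smooth_fun n U g"
  shows "smooth_fun n U (\<lambda>x. f x - g x)"
  using smooth_fun_add[OF assms(1,2) smooth_fun_uminus[OF assms(1,3)]] by simp

lemma smooth_fun_sum:
  assumes "openin (Euclidean_space n) U" "\<And>i. i \<in> I \<Longrightarrow> smooth_fun n U (f i)"
  shows "smooth_fun n U (\<lambda>x. \<Sum>i\<in>I. f i x)"
  using assms(2) by (induction I rule: infinite_finite_induct)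
    (auto intro: smooth_fun_add smooth_fun_const assms(1))

lemma smooth_fun_prod:
  assumes "openin (Euclidean_space n) U" "\<And>i. i \<in> I \<Longrightarrow> smooth_fun n U (f i)"
  shows "smooth_fun n U (\<lambda>x. \<Prod>i\<in>I. f i x)"
  using assms(2) by (induction I rule: infinite_finite_induct)
    (auto intro: smooth_fun_mult smooth_fun_const assms(1))

lemma smooth_fun_power:
  assumes "openin (Euclidean_space n) U" "smooth_fun n U f"
  shows "smooth_fun n U (\<lambda>x. f x ^ k)"
  by (induction k) (auto intro: smooth_fun_mult smooth_fun_const assms)

lemmas smooth_fun_intros = smooth_fun_add smooth_fun_mult smooth_fun_const smooth_fun_coord
  smooth_fun_uminus smooth_fun_diff smooth_fun_sum smooth_fun_prod smooth_fun_power

text \<open>\<open>Q\<close> is a class of real functions closed under differentiation on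
  \<open>D\<close>. This serves both reciprocals, with \<open>Q\<close> the multiples of negative
  powers, and the members of \<open>real_smooth\<close>.\<close>

lemma smooth_fun_comp_real:
  assumes U: "openin (Euclidean_space n) U" and f: "smooth_fun n U f" "\<And>x. x \<in> U \<Longrightarrow> f x \<in> D" and "Q \<phi>"
    and Q: "\<And>\<phi>. Q \<phi> \<Longrightarrow> \<exists>\<phi>'. Q \<phi>' \<and> (\<forall>t\<in>D. (\<phi> has_real_derivative \<phi>' t) (at t))"
  shows "smooth_fun n U (\<lambda>x. \<phi> (f x))"
proof (rule salg_smooth[OF U, where K = "\<lambda>h. \<exists>\<phi>. Q \<phi> \<and> h = (\<lambda>x. \<phi> (f x))"])
  show "salg n U (\<lambda>h. \<exists>\<phi>. Q \<phi> \<and> h = (\<lambda>x. \<phi> (f x))) (\<lambda>x. \<phi> (f x))"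
    using \<open>Q \<phi>\<close> by (intro salg.gen) auto
  fix g assume "\<exists>\<phi>. Q \<phi> \<and> g = (\<lambda>x. \<phi> (f x))"
  then obtain \<phi> where \<phi>: "Q \<phi>" "g = (\<lambda>x. \<phi> (f x))" by auto
  obtain \<phi>' where \<phi>': "Q \<phi>'" "\<forall>t\<in>D. (\<phi> has_real_derivative \<phi>' t) (at t)" using Q[OF \<phi>(1)] by auto
  have "continuous_on D \<phi>"
    using \<phi>'(2) by (meson DERIV_isCont continuous_at_imp_continuous_on)
  moreover have "continuous_on U f" using f(1) smooth_fun_continuous_on openin_subset[OF U] by blast
  ultimately show "continuous_on U g"
    unfolding \<phi>(2) using f(2) by (auto intro: continuous_on_compose2)
  fix i assume i: "i < n"
  have "((\<lambda>t. \<phi> (f (x(i := t)))) has_real_derivative \<phi>' (f x) * partial_deriv i f x) (at (x i))" if "x \<in> U" for x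
    using DERIV_chain2[of \<phi> "\<phi>' (f x)" "\<lambda>t. f (x(i := t))" "x i"] smooth_funD(1)[OF f(1) i that] \<phi>'(2) f(2)[OF that] by auto
  then show "\<exists>g'. salg n U (\<lambda>h. \<exists>\<phi>. Q \<phi> \<and> h = (\<lambda>x. \<phi> (f x))) g' \<and>
      (\<forall>x\<in>U. ((\<lambda>t. g (x(i := t))) has_real_derivative g' x) (at (x i)))"
    unfolding \<phi>(2) using \<phi>'(1) smooth_funD(2)[OF f(1) i]
    by (intro exI[of _ "\<lambda>x. \<phi>' (f x) * partial_deriv i f x"] conjI ballI salg.mult)
       (auto intro: salg.gen salg.smooth)
qed

lemma smooth_fun_inverse:
  assumes U: "openin (Euclidean_space n) U" and f: "smooth_fun n U f" "\<And>x. x \<in> U \<Longrightarrow> f x \<noteq> 0"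
  shows "smooth_fun n U (\<lambda>x. inverse (f x))"
proof (rule smooth_fun_comp_real[OF U f(1), where D = "- {0}" and Q = "\<lambda>\<phi>. \<exists>c k. \<phi> = (\<lambda>t. c * inverse t ^ k)" and \<phi> = inverse])
  show "\<exists>\<phi>'. (\<exists>c k. \<phi>' = (\<lambda>t. c * inverse t ^ k)) \<and> (\<forall>t\<in>-{0}. (\<phi> has_real_derivative \<phi>' t) (at t))"
    if p: "\<exists>c k. \<phi> = (\<lambda>t. c * inverse t ^ k)" for \<phi> :: "real \<Rightarrow> real"
  proof -
    obtain c k where \<phi>: "\<phi> = (\<lambda>t. c * inverse t ^ k)" using p by blast
    show ?thesis
    proof (cases k)
      case 0
      then show ?thesis unfolding \<phi>
        by (intro exI[of _ "\<lambda>t. 0"] conjI exI[of _ 0]) auto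
    next
      case (Suc m)
      have "((\<lambda>t. c * inverse t ^ k) has_real_derivative (- c * k) * inverse t ^ (k + 1)) (at t)" if "t \<noteq> 0" for t
        using DERIV_cmult[OF DERIV_power[OF DERIV_inverse[OF that]], of c k] unfolding Suc
        by (simp add: algebra_simps)
      then show ?thesis unfolding \<phi> by blast
    qed
  qed
  show "\<exists>c k. inverse = (\<lambda>t::real. c * inverse t ^ k)"
    by (intro exI[of _ 1] exI[of _ 1]) auto
qed (use f in auto)

lemma smooth_fun_divide:
  assumes "openin (Euclidean_space n) U" "smooth_fun n U f" "smooth_fun n U g" "\<And>x. x \<in> U \<Longrightarrow> g x \<noteq> 0"
  shows "smooth_fun n U (\<lambda>x. f x / g x)"
  using smooth_fun_mult[OF assms(1,2) smooth_fun_inverse[OF assms(1,3,4)]] by (simp add: field_simps)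

lemma smooth_fun_comp_real_smooth:
  assumes U: "openin (Euclidean_space n) U" and f: "smooth_fun n U f" and \<phi>: "\<phi> \<in> real_smooth"
  shows "smooth_fun n U (\<lambda>x. \<phi> (f x))"
proof (rule smooth_fun_comp_real[OF U f, where D = UNIV and Q = "\<lambda>\<phi>. \<phi> \<in> real_smooth"])
  fix \<phi> assume p: "\<phi> \<in> real_smooth"
  then have "((deriv ^^ k) (deriv \<phi>)) differentiable (at x)" for k x
    unfolding real_smooth_def by (metis (mono_tags, lifting) funpow_Suc_right comp_apply mem_Collect_eq)
  then have "deriv \<phi> \<in> real_smooth" by (auto simp: real_smooth_def)
  moreover have "(\<phi> has_real_derivative deriv \<phi> t) (at t)" for t
    using p unfolding real_smooth_def
    by (metis (mono_tags, lifting) DERIV_deriv_iff_real_differentiable funpow_0 mem_Collect_eq)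
  ultimately show "\<exists>\<phi>'. \<phi>' \<in> real_smooth \<and> (\<forall>t\<in>UNIV. (\<phi> has_real_derivative \<phi>' t) (at t))" by blast
qed (use \<phi> in auto)


section \<open>Mean value theorem, chain rule and inverse functions\<close>

lemma mvt_segment:
  fixes g :: "real \<Rightarrow> real"
  assumes "\<And>t. t \<in> closed_segment a b \<Longrightarrow> (g has_real_derivative g' t) (at t)"
  shows "\<exists>t\<in>closed_segment a b. g b - g a = g' t * (b - a)"
proof -
  consider "a < b" | "a = b" | "b < a" by linarith
  then show ?thesis
  proof cases
    case 1
    then obtain z where "a < z" "z < b" "g b - g a = (b - a) * g' z"
      using MVT2[of a b g g'] assms by (auto simp: closed_segment_eq_real_ivl)
    then show ?thesis using 1 by (intro bexI[of _ z]) (auto simp: closed_segment_eq_real_ivl mult.commute)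
  next
    case 2
    then show ?thesis by auto
  next
    case 3
    then obtain z where "b < z" "z < a" "g a - g b = (a - b) * g' z"
      using MVT2[of b a g g'] assms by (auto simp: closed_segment_eq_real_ivl)
    then show ?thesis using 3 by (intro bexI[of _ z]) (auto simp: closed_segment_eq_real_ivl algebra_simps)
  qed
qed

text \<open>Only partial derivatives are available, so the increment is telescoped along the polygon
  that replaces the coordinates of \<open>z\<close> by those of \<open>y\<close> one at a time. Each
  edge contributes its own intermediate point.\<close>

lemma mvt_box:
  assumes y: "y \<in> Esp n" and z: "z \<in> Esp n"
    and sub: "\<And>x. x \<in> Esp n \<Longrightarrow> (\<And>i. i < n \<Longrightarrow> x i \<in> closed_segment (z i) (y i)) \<Longrightarrow> x \<in> U"
    and der: "\<And>x i. x \<in> U \<Longrightarrow> i < n \<Longrightarrow> ((\<lambda>t. f (x(i := t))) has_real_derivative f' i x) (at (x i))"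
  shows "\<exists>\<xi>. (\<forall>i<n. \<xi> i \<in> Esp n \<and> (\<forall>j<n. \<xi> i j \<in> closed_segment (z j) (y j))) \<and>
            f y - f z = (\<Sum>i<n. f' i (\<xi> i) * (y i - z i))"
proof -
  define w where "w k = (\<lambda>j. if j < k then y j else z j)" for k :: nat
  have wE: "w k \<in> Esp n" for k using y z by (auto simp: w_def Esp_iff)
  have w0: "w 0 = z" by (simp add: w_def)
  have wn: "w n = y" using y z by (intro ext) (auto simp: w_def Esp_iff)
  have "\<exists>\<xi>. \<xi> \<in> Esp n \<and> (\<forall>j<n. \<xi> j \<in> closed_segment (z j) (y j)) \<and>
           f (w (Suc k)) - f (w k) = f' k \<xi> * (y k - z k)" if k: "k < n" for k
  proof -
    have inseg: "(w k)(k := t) \<in> Esp n \<and> (\<forall>j<n. ((w k)(k := t)) j \<in> closed_segment (z j) (y j))"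
      if "t \<in> closed_segment (z k) (y k)" for t
      using that wE[of k] k by (auto simp: w_def Esp_iff)
    have "((\<lambda>t. f ((w k)(k := t))) has_real_derivative f' k ((w k)(k := t))) (at t)"
      if "t \<in> closed_segment (z k) (y k)" for t
      using der[OF sub, of "(w k)(k := t)" k] inseg[OF that] k by simp
    from mvt_segment[OF this] obtain t where t: "t \<in> closed_segment (z k) (y k)"
      "f ((w k)(k := y k)) - f ((w k)(k := z k)) = f' k ((w k)(k := t)) * (y k - z k)" by auto
    have "(w k)(k := y k) = w (Suc k)" "(w k)(k := z k) = w k" by (auto simp: w_def fun_eq_iff)
    with t inseg[OF t(1)] show ?thesis by metis
  qed
  then obtain \<xi> where \<xi>: "\<And>k. k < n \<Longrightarrow> \<xi> k \<in> Esp n \<and> (\<forall>j<n. \<xi> k j \<in> closed_segment (z j) (y j)) \<and>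
           f (w (Suc k)) - f (w k) = f' k (\<xi> k) * (y k - z k)" by metis
  have "f y - f z = (\<Sum>k<n. f (w (Suc k)) - f (w k))"
    using sum_lessThan_telescope[of "\<lambda>k. f (w k)" n] by (simp add: w0 wn)
  also have "\<dots> = (\<Sum>k<n. f' k (\<xi> k) * (y k - z k))" using \<xi> by (intro sum.cong) auto
  finally show ?thesis using \<xi> by blast
qed

lemma mvt_cbx:
  assumes "cbx n a e \<subseteq> U" "y \<in> cbx n a e" "z \<in> cbx n a e"
    and der: "\<And>x i. x \<in> U \<Longrightarrow> i < n \<Longrightarrow> ((\<lambda>t. f (x(i := t))) has_real_derivative f' i x) (at (x i))"
  shows "\<exists>\<xi>. (\<forall>i<n. \<xi> i \<in> cbx n a e \<and> (\<forall>j<n. \<xi> i j \<in> closed_segment (z j) (y j))) \<and>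
            f y - f z = (\<Sum>i<n. f' i (\<xi> i) * (y i - z i))"
proof -
  have *: "x \<in> cbx n a e" if "x \<in> Esp n" "\<And>j. j < n \<Longrightarrow> x j \<in> closed_segment (z j) (y j)" for x
  proof -
    have "\<bar>x j - a j\<bar> \<le> e" if j: "j < n" for j
      using \<open>\<And>j. j < n \<Longrightarrow> x j \<in> closed_segment (z j) (y j)\<close>[OF j] assms(2,3) j
      by (auto simp: cbx_def closed_segment_eq_real_ivl abs_le_iff split: if_splits)
    then show ?thesis using that(1) by (auto simp: cbx_def)
  qed
  have "y \<in> Esp n" "z \<in> Esp n" using assms(2,3) by (auto simp: cbx_def)
  from mvt_box[OF this, of U f f'] obtain \<xi> where
    "\<forall>i<n. \<xi> i \<in> Esp n \<and> (\<forall>j<n. \<xi> i j \<in> closed_segment (z j) (y j))"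
    "f y - f z = (\<Sum>i<n. f' i (\<xi> i) * (y i - z i))"
    using * assms(1) der by blast
  then show ?thesis using * by blast
qed

lemma tendsto_fun_iff:
  fixes f :: "'b \<Rightarrow> nat \<Rightarrow> real"
  shows "(f \<longlongrightarrow> l) F \<longleftrightarrow> (\<forall>i. ((\<lambda>x. f x i) \<longlongrightarrow> l i) F)"
  using limitin_componentwise[of "\<lambda>_. euclideanreal" UNIV f l F]
  by (simp add: euclidean_product_topology)

lemma tendsto_on_openE:
  assumes U: "openin (Euclidean_space n) U" and f: "continuous_on U f" and a: "a \<in> U"
    and ev: "eventually (\<lambda>s. \<xi> s \<in> U) F"
    and lim: "\<And>i. i < n \<Longrightarrow> ((\<lambda>s. \<xi> s i) \<longlongrightarrow> a i) F"
  shows "((\<lambda>s. f (\<xi> s)) \<longlongrightarrow> f a) F"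
proof -
  have "((\<lambda>s. \<xi> s i) \<longlongrightarrow> a i) F" for i
  proof (cases "i < n")
    case False
    have "eventually (\<lambda>s. \<xi> s i = a i) F"
      using ev
    proof eventually_elim
      case (elim s)
      then have "\<xi> s \<in> Esp n" "a \<in> Esp n" using openin_subset[OF U] a by blast+
      then show ?case using False by (simp add: Esp_iff)
    qed
    then show ?thesis by (rule tendsto_eventually)
  qed (rule lim)
  then have "(\<xi> \<longlongrightarrow> a) F" unfolding tendsto_fun_iff by blast
  then show ?thesis by (rule continuous_on_tendsto_compose[OF f _ a ev])
qed

text \<open>The difference quotient of f along \<open>c\<close> is a sum of partial derivatives at
  intermediate points times difference quotients of the coordinates, and the intermediate points are
  squeezed between \<open>c t\<close> and \<open>c s\<close>. Working within an arbitrary set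
  \<open>A\<close> covers end points of integral curves.\<close>

lemma chain_curve:
  assumes U: "openin (Euclidean_space n) U"
    and der: "\<And>x i. x \<in> U \<Longrightarrow> i < n \<Longrightarrow> ((\<lambda>t. f (x(i := t))) has_real_derivative f' i x) (at (x i))"
    and cont: "\<And>i. i < n \<Longrightarrow> continuous_on U (f' i)"
    and c: "c t \<in> U" "\<And>i. i < n \<Longrightarrow> ((\<lambda>s. c s i) has_real_derivative c' i) (at t within A)"
    and cE: "eventually (\<lambda>s. c s \<in> Esp n) (at t within A)"
  shows "((\<lambda>s. f (c s)) has_real_derivative (\<Sum>i<n. f' i (c t) * c' i)) (at t within A)"
proof -
  obtain e where e: "e > 0" "cbx n (c t) e \<subseteq> U" using open_contains_cbx[OF U c(1)] by blast
  have ctE: "c t \<in> Esp n" using c(1) openin_subset[OF U] by blast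
  have ci: "((\<lambda>s. c s i) \<longlongrightarrow> c t i) (at t within A)" if "i < n" for i
    using DERIV_continuous[OF c(2)[OF that]] by (simp add: continuous_within)
  have "eventually (\<lambda>s. \<forall>i<n. \<bar>c s i - c t i\<bar> < e) (at t within A)"
  proof -
    have "eventually (\<lambda>s. \<forall>i\<in>{..<n}. \<bar>c s i - c t i\<bar> < e) (at t within A)"
      using tendstoD[OF ci e(1)] by (intro eventually_ball_finite) (auto simp: dist_real_def)
    then show ?thesis by (rule eventually_mono) auto
  qed
  with cE have near: "eventually (\<lambda>s. c s \<in> cbx n (c t) e) (at t within A)"
    by eventually_elim (auto simp: cbx_def less_imp_le)
  have ctb: "c t \<in> cbx n (c t) e" using ctE e(1) by (auto simp: cbx_def)
  have "\<exists>\<xi>. (\<forall>i<n. \<xi> i \<in> cbx n (c t) e \<and> (\<forall>j<n. \<xi> i j \<in> closed_segment (c t j) (c s j))) \<and>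
            f (c s) - f (c t) = (\<Sum>i<n. f' i (\<xi> i) * (c s i - c t i))"
    if "c s \<in> cbx n (c t) e" for s
    by (rule mvt_cbx[OF e(2) that ctb der])
  then obtain \<xi> where \<xi>: "\<And>s. c s \<in> cbx n (c t) e \<Longrightarrow>
      (\<forall>i<n. \<xi> s i \<in> cbx n (c t) e \<and> (\<forall>j<n. \<xi> s i j \<in> closed_segment (c t j) (c s j))) \<and>
            f (c s) - f (c t) = (\<Sum>i<n. f' i (\<xi> s i) * (c s i - c t i))" by metis
  have \<xi>lim: "((\<lambda>s. f' i (\<xi> s i)) \<longlongrightarrow> f' i (c t)) (at t within A)" if i: "i < n" for i
  proof (rule tendsto_on_openE[OF U cont[OF i] c(1)])
    show "eventually (\<lambda>s. \<xi> s i \<in> U) (at t within A)"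
      using near by eventually_elim (use \<xi> e(2) i in blast)
    fix j assume j: "j < n"
    have "((\<lambda>s. \<bar>c s j - c t j\<bar>) \<longlongrightarrow> 0) (at t within A)"
      using ci[OF j] by (simp add: LIM_zero_iff tendsto_rabs_zero_iff)
    then have "((\<lambda>s. \<xi> s i j - c t j) \<longlongrightarrow> 0) (at t within A)"
    proof (rule Lim_null_comparison[rotated])
      show "eventually (\<lambda>s. norm (\<xi> s i j - c t j) \<le> \<bar>c s j - c t j\<bar>) (at t within A)"
        using near
      proof eventually_elim
        case (elim s)
        have "\<xi> s i j \<in> closed_segment (c t j) (c s j)" using \<xi>[OF elim] i j by blast
        then show ?case by (auto simp: closed_segment_eq_real_ivl split: if_splits)
      qed
    qed
    then show "((\<lambda>s. \<xi> s i j) \<longlongrightarrow> c t j) (at t within A)" by (simp add: LIM_zero_iff)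
  qed
  have "((\<lambda>s. \<Sum>i<n. f' i (\<xi> s i) * ((c s i - c t i) / (s - t))) \<longlongrightarrow> (\<Sum>i<n. f' i (c t) * c' i)) (at t within A)"
    using c(2) by (intro tendsto_sum tendsto_mult \<xi>lim) (auto simp: has_field_derivative_iff)
  moreover have "eventually (\<lambda>s. (\<Sum>i<n. f' i (\<xi> s i) * ((c s i - c t i) / (s - t))) = (f (c s) - f (c t)) / (s - t)) (at t within A)"
    using near
  proof eventually_elim
    case (elim s)
    then show ?case using \<xi>[OF elim] by (simp add: sum_divide_distrib)
  qed
  ultimately show ?thesis unfolding has_field_derivative_iff by (rule Lim_transform_eventually)
qed

lemma smooth_fun_chain_curve:
  assumes "openin (Euclidean_space n) U" "smooth_fun n U f" "c t \<in> U"
    and "\<And>i. i < n \<Longrightarrow> ((\<lambda>s. c s i) has_real_derivative c' i) (at t within A)"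
    and "eventually (\<lambda>s. c s \<in> Esp n) (at t within A)"
  shows "((\<lambda>s. f (c s)) has_real_derivative (\<Sum>i<n. partial_deriv i f (c t) * c' i)) (at t within A)"
proof (rule chain_curve[where f' = "\<lambda>i. partial_deriv i f", OF assms(1) _ _ assms(3-5)])
  show "((\<lambda>t. f (x(i := t))) has_real_derivative partial_deriv i f x) (at (x i))" if "x \<in> U" "i < n" for x i
    using smooth_funD(1)[OF assms(2) that(2,1)] .
  show "continuous_on U (partial_deriv i f)" if "i < n" for i
    using smooth_fun_continuous_on[OF smooth_funD(2)[OF assms(2) that] openin_subset[OF assms(1)]] .
qed

lemma continuous_on_into_Esp:
  fixes g :: "'b::topological_space \<Rightarrow> nat \<Rightarrow> real"
  assumes "g ` U \<subseteq> Esp n" "\<And>j. j < n \<Longrightarrow> continuous_on U (\<lambda>x. g x j)"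
  shows "continuous_on U g"
proof (rule continuous_on_coordinatewise_then_product)
  fix j show "continuous_on U (\<lambda>x. g x j)"
  proof (cases "j < n")
    case False
    then have "g x j = 0" if "x \<in> U" for x using assms(1) that by (auto simp: Esp_iff)
    then show ?thesis by (metis (no_types, lifting) continuous_on_cong continuous_on_const)
  qed (rule assms(2))
qed

text \<open>With \<open>K\<close> the functions that factor through \<open>g\<close>, the chain rule
  writes a derivative as a sum of products of such functions with derivatives of the components of
  \<open>g\<close>, so it stays in the algebra.\<close>

lemma smooth_fun_compose:
  assumes U: "openin (Euclidean_space m) U" and V: "openin (Euclidean_space n) V"
    and g: "g ` U \<subseteq> V" "\<And>j. j < n \<Longrightarrow> smooth_fun m U (\<lambda>x. g x j)" and f: "smooth_fun n V f"
  shows "smooth_fun m U (\<lambda>x. f (g x))"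
proof (rule salg_smooth[OF U, where K = "\<lambda>h. \<exists>f. smooth_fun n V f \<and> h = (\<lambda>x. f (g x))"])
  have gE: "g ` U \<subseteq> Esp n" using g(1) openin_subset[OF V] by blast
  show "salg m U (\<lambda>h. \<exists>f. smooth_fun n V f \<and> h = (\<lambda>x. f (g x))) (\<lambda>x. f (g x))"
    using f by (intro salg.gen) auto
  fix h assume "\<exists>f. smooth_fun n V f \<and> h = (\<lambda>x. f (g x))"
  then obtain f where f: "smooth_fun n V f" "h = (\<lambda>x. f (g x))" by auto
  have "continuous_on U g"
    using g(2) smooth_fun_continuous_on openin_subset[OF U] by (intro continuous_on_into_Esp[OF gE]) blast
  then show "continuous_on U h"
    unfolding f(2) by (rule continuous_on_compose2[OF smooth_fun_continuous_on[OF f(1) openin_subset[OF V]] _ g(1)])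
  fix i assume i: "i < m"
  let ?h' = "\<lambda>x. \<Sum>j<n. partial_deriv j f (g x) * partial_deriv i (\<lambda>x. g x j) x"
  let ?K = "\<lambda>h. \<exists>f. smooth_fun n V f \<and> h = (\<lambda>x. f (g x))"
  have "((\<lambda>t. h (x(i := t))) has_real_derivative ?h' x) (at (x i))" if x: "x \<in> U" for x
  proof -
    have "((\<lambda>t. f (g (x(i := t)))) has_real_derivative
        (\<Sum>j<n. partial_deriv j f (g (x(i := x i))) * partial_deriv i (\<lambda>x. g x j) x)) (at (x i))"
    proof (rule smooth_fun_chain_curve[OF V f(1)])
      show "g (x(i := x i)) \<in> V" using g(1) x by auto
      show "((\<lambda>s. g (x(i := s)) j) has_real_derivative partial_deriv i (\<lambda>x. g x j) x) (at (x i))" if "j < n" for j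
        using smooth_funD(1)[OF g(2)[OF that] i x] .
      show "\<forall>\<^sub>F s in at (x i). g (x(i := s)) \<in> Esp n"
        unfolding eventually_at_filter
        by (rule eventually_mono[OF eventually_fun_upd_in[OF U x i]]) (use gE in blast)
    qed
    then show ?thesis unfolding f(2) by simp
  qed
  moreover have "salg m U ?K ?h'"
  proof -
    have "salg m U ?K (\<lambda>x. \<Sum>j\<in>J. partial_deriv j f (g x) * partial_deriv i (\<lambda>x. g x j) x)"
      if "finite J" "J \<subseteq> {..<n}" for J
      using that
    proof (induction J rule: finite_induct)
      case empty
      then show ?case using smooth_fun_const[OF U, of 0] by (auto intro: salg.smooth)
    next
      case (insert j J)
      then have j: "j < n" by auto
      have "salg m U ?K (\<lambda>x. partial_deriv j f (g x) * partial_deriv i (\<lambda>x. g x j) x)"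
        using smooth_funD(2)[OF f(1) j] smooth_funD(2)[OF g(2)[OF j] i]
        by (intro salg.mult) (auto intro: salg.gen salg.smooth)
      then show ?case using insert by (simp add: salg.add)
    qed
    then show ?thesis by simp
  qed
  ultimately show "\<exists>g'. salg m U ?K g' \<and> (\<forall>x\<in>U. ((\<lambda>t. h (x(i := t))) has_real_derivative g' x) (at (x i)))"
    by blast
qed

section \<open>Determinants and the inverse of an injective map with invertible Jacobian\<close>

definition dt :: "nat \<Rightarrow> (nat \<Rightarrow> nat \<Rightarrow> real) \<Rightarrow> real" where
  "dt n M = Determinant.det (Matrix.mat n n (\<lambda>(i, j). M i j))"

lemma dt_sum: "dt n M = (\<Sum>p\<in>{p. p permutes {0..<n}}. signof p * (\<Prod>i=0..<n. M i (p i)))"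
proof -
  have "dt n M = (\<Sum>p\<in>{p. p permutes {0..<n}}. signof p * (\<Prod>i=0..<n. Matrix.mat n n (\<lambda>(i, j). M i j) $$ (i, p i)))"
    unfolding dt_def by (rule det_def') simp
  also have "\<dots> = (\<Sum>p\<in>{p. p permutes {0..<n}}. signof p * (\<Prod>i=0..<n. M i (p i)))"
  proof (intro sum.cong refl arg_cong2[where f = "(*)"] prod.cong)
    fix p i assume "p \<in> {p. p permutes {0..<n}}" "i \<in> {0..<n}"
    then have "i < n" "p i < n" using permutes_in_image[of p "{0..<n}" i] by auto
    then show "Matrix.mat n n (\<lambda>(i, j). M i j) $$ (i, p i) = M i (p i)" by simp
  qed
  finally show ?thesis .
qed

lemma dt_cramer:
  assumes "\<And>i. i < n \<Longrightarrow> (\<Sum>j<n. M i j * x j) = b i" and k: "k < n"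
  shows "x k * dt n M = dt n (\<lambda>i j. if j = k then b i else M i j)"
proof -
  let ?A = "Matrix.mat n n (\<lambda>(i, j). M i j)" and ?x = "Matrix.vec n x"
  have A: "?A \<in> carrier_mat n n" and xc: "?x \<in> carrier_vec n" by auto
  have "replace_col ?A (?A *\<^sub>v ?x) k = Matrix.mat n n (\<lambda>(i, j). if j = k then b i else M i j)"
    unfolding replace_col_def
  proof (rule eq_matI, goal_cases)
    case (1 i j)
    have "vec_index (?A *\<^sub>v ?x) i = (\<Sum>j<n. M i j * x j)"
      using 1 by (simp add: scalar_prod_def lessThan_atLeast0)
    then show ?case using 1 assms(1)[of i] by auto
  qed auto
  then show ?thesis using cramer_lemma_mat[OF A xc k] k unfolding dt_def by simp
qed

lemma dt_nonzero:
  assumes "\<And>v. v \<in> Esp n \<Longrightarrow> (\<And>i. i < n \<Longrightarrow> (\<Sum>j<n. M i j * v j) = 0) \<Longrightarrow> v = (\<lambda>_. 0)"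
  shows "dt n M \<noteq> 0"
proof
  let ?A = "Matrix.mat n n (\<lambda>(i, j). M i j)"
  have A: "?A \<in> carrier_mat n n" by auto
  assume "dt n M = 0"
  then obtain v where v: "v \<in> carrier_vec n" "v \<noteq> 0\<^sub>v n" "?A *\<^sub>v v = 0\<^sub>v n"
    using det_0_iff_vec_prod_zero_field[OF A] unfolding dt_def by auto
  define w where "w = (\<lambda>i. if i < n then vec_index v i else 0)"
  have "(\<Sum>j<n. M i j * w j) = 0" if "i < n" for i
  proof -
    have "vec_index (?A *\<^sub>v v) i = (\<Sum>j<n. M i j * w j)"
      using that v(1) by (simp add: scalar_prod_def lessThan_atLeast0 w_def)
    then show ?thesis using v(3) that by simp
  qed
  then have "w = (\<lambda>_. 0)" using assms[of w] by (auto simp: w_def Esp_iff)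
  then have "vec_index v i = 0" if "i < n" for i using that by (metis w_def)
  then show False using v(1,2) by auto
qed

lemma smooth_fun_dt:
  assumes "openin (Euclidean_space m) U" "\<And>i j. i < n \<Longrightarrow> j < n \<Longrightarrow> smooth_fun m U (\<lambda>x. M x i j)"
  shows "smooth_fun m U (\<lambda>x. dt n (M x))"
  unfolding dt_sum
proof (intro smooth_fun_sum smooth_fun_mult smooth_fun_prod smooth_fun_const assms)
  fix p i assume "p \<in> {p. p permutes {0..<n}}" "i \<in> {0..<n}"
  then show "i < n" "p i < n" using permutes_in_image[of p "{0..<n}" i] by auto
qed

lemma tendsto_dt:
  assumes "\<And>i j. i < n \<Longrightarrow> j < n \<Longrightarrow> ((\<lambda>s. M s i j) \<longlongrightarrow> N i j) F"
  shows "((\<lambda>s. dt n (M s)) \<longlongrightarrow> dt n N) F"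
  unfolding dt_sum
proof (intro tendsto_sum tendsto_mult tendsto_const tendsto_prod assms)
  fix p i assume "p \<in> {p. p permutes {0..<n}}" "i \<in> {0..<n}"
  then show "i < n" "p i < n" using permutes_in_image[of p "{0..<n}" i] by auto
qed

definition jac :: "((nat \<Rightarrow> real) \<Rightarrow> nat \<Rightarrow> real) \<Rightarrow> (nat \<Rightarrow> real) \<Rightarrow> nat \<Rightarrow> nat \<Rightarrow> real" where
  "jac g x r c = partial_deriv c (\<lambda>y. g y r) x"

text \<open>Injectivity is given, so openness of the image and continuity of the inverse follow from
  invariance of domain, without a contraction argument. The partial derivatives of the inverse come
  from solving the mean value equations by Cramer's rule. They have the form of a smooth function on
  \<open>U\<close> composed with the inverse, and coinduction over such composites gives
  smoothness.\<close>

lemma smooth_inverse: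
  assumes U: "openin (Euclidean_space n) U" and gE: "g ` U \<subseteq> Esp n"
    and g: "\<And>j. j < n \<Longrightarrow> smooth_fun n U (\<lambda>x. g x j)" and inj: "inj_on g U"
    and nz: "\<And>x. x \<in> U \<Longrightarrow> dt n (jac g x) \<noteq> 0"
  shows "openin (Euclidean_space n) (g ` U)"
    and "continuous_on (g ` U) (inv_into U g)"
    and "smooth_fun n U f \<Longrightarrow> smooth_fun n (g ` U) (\<lambda>x. f (inv_into U g x))"
proof -
  let ?h = "inv_into U g"
  have UE: "U \<subseteq> Esp n" by (rule openin_subset[OF U])
  have gc: "continuous_on U g"
    by (rule continuous_on_into_Esp[OF gE smooth_fun_continuous_on[OF g UE]])
  have op: "openin (Euclidean_space n) (g ` W)" if "openin (Euclidean_space n) W" "W \<subseteq> U" for W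
  proof (rule invariance_of_domain_Euclidean_space[OF that(1)])
    have "continuous_on W g" by (rule continuous_on_subset[OF gc that(2)])
    then show "continuous_map (subtopology (Euclidean_space n) W) (Euclidean_space n) g"
      unfolding cm_Euclidean_space_iff_continuous_on using that UE gE by (auto simp: inf.absorb2 intro: continuous_on_subset)
    show "inj_on g W" using inj that(2) inj_on_subset by blast
  qed
  show opU: "openin (Euclidean_space n) (g ` U)" by (rule op[OF U]) simp
  have hU: "?h \<in> g ` U \<rightarrow> U" by (auto intro: inv_into_into)
  show hc: "continuous_on (g ` U) ?h"
    unfolding continuous_on_open_gen[OF hU]
  proof (intro allI impI)
    fix B assume "openin (top_of_set U) B"
    then obtain T where T: "open T" "B = U \<inter> T" unfolding openin_open by blast
    obtain T' where T': "open T'" "U = Esp n \<inter> T'" using U unfolding openin_Euclidean_open by blast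
    have BT: "B = Esp n \<inter> (T' \<inter> T)" using T(2) T'(2) by auto
    have B: "openin (Euclidean_space n) B"
      unfolding openin_Euclidean_open by (intro exI[of _ "T' \<inter> T"] conjI open_Int T(1) T'(1) BT)
    have BU: "B \<subseteq> U" using T(2) by simp
    have "g ` U \<inter> ?h -` B = g ` B"
    proof
      show "g ` U \<inter> ?h -` B \<subseteq> g ` B"
      proof
        fix y assume "y \<in> g ` U \<inter> ?h -` B"
        then have "?h y \<in> B" "g (?h y) = y" by (simp_all add: f_inv_into_f)
        then show "y \<in> g ` B" by (metis imageI)
      qed
      show "g ` B \<subseteq> g ` U \<inter> ?h -` B" using BU inv_into_f_f[OF inj] by auto
    qed
    moreover obtain T'' where "open T''" "g ` B = Esp n \<inter> T''"
      using op[OF B BU] unfolding openin_Euclidean_open by (elim exE conjE)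
    moreover have "g ` B \<subseteq> g ` U" using BU by (rule image_mono)
    ultimately have "g ` U \<inter> ?h -` B = g ` U \<inter> T''" using gE by auto
    then show "openin (top_of_set (g ` U)) (g ` U \<inter> ?h -` B)"
      unfolding openin_open using \<open>open T''\<close> by blast
  qed
  \<comment> \<open>The entries of the inverse Jacobian by Cramer's rule, as quotients of
    determinants evidently smooth.\<close>
  define Bm where "Bm i j x = dt n (\<lambda>r c. if c = i then (if r = j then 1 else 0) else jac g x r c) / dt n (jac g x)" for i j x
  have jac_smooth: "smooth_fun n U (\<lambda>x. jac g x r c)" if "r < n" "c < n" for r c
    unfolding jac_def by (rule smooth_funD(2)[OF g[OF that(1)] that(2)])
  have Bm_smooth: "smooth_fun n U (Bm i j)" for i j
    unfolding Bm_def
  proof (intro smooth_fun_divide[OF U] smooth_fun_dt[OF U] nz)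
    show "smooth_fun n U (\<lambda>x. if c = i then if r = j then 1 else 0 else jac g x r c)" if "r < n" "c < n" for r c
      using jac_smooth[OF that] smooth_fun_const[OF U] by (cases "c = i") auto
  qed (use jac_smooth in auto)
  have hder: "((\<lambda>t. ?h (b(j := t)) i) has_real_derivative Bm i j (?h b)) (at (b j))"
    if b: "b \<in> g ` U" and i: "i < n" and j: "j < n" for b i j
  proof -
    let ?a = "?h b"
    have aU: "?a \<in> U" and ga: "g ?a = b" using b by (auto intro: inv_into_into simp: f_inv_into_f)
    obtain e where e: "e > 0" "cbx n ?a e \<subseteq> U" using open_contains_cbx[OF U aU] by blast
    let ?F = "at (b j)"
    have ev: "eventually (\<lambda>t. b(j := t) \<in> g ` U) ?F"
      using eventually_fun_upd_in[OF opU b j] by (auto simp: eventually_at_filter elim!: eventually_mono)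
    have "((\<lambda>t. ?h (b(j := t))) \<longlongrightarrow> ?h b) ?F"
    proof (rule continuous_on_tendsto_compose[OF hc _ b ev])
      show "((\<lambda>t. b(j := t)) \<longlongrightarrow> b) ?F"
        unfolding tendsto_fun_iff
      proof
        fix i show "((\<lambda>t. (b(j := t)) i) \<longlongrightarrow> b i) ?F" by (cases "i = j") auto
      qed
    qed
    then have hlim: "((\<lambda>t. ?h (b(j := t)) c) \<longlongrightarrow> ?a c) ?F" for c unfolding tendsto_fun_iff by blast
    have "eventually (\<lambda>t. \<forall>c\<in>{..<n}. \<bar>?h (b(j := t)) c - ?a c\<bar> < e) ?F"
      using tendstoD[OF hlim e(1)] by (intro eventually_ball_finite) (auto simp: dist_real_def)
    with ev have near: "eventually (\<lambda>t. ?h (b(j := t)) \<in> cbx n ?a e \<and> b(j := t) \<in> g ` U) ?F"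
    proof eventually_elim
      case (elim t)
      then have "?h (b(j := t)) \<in> Esp n" using UE hU by blast
      with elim show ?case by (auto simp: cbx_def less_imp_le)
    qed
    have ab: "?a \<in> cbx n ?a e" using aU UE e(1) by (auto simp: cbx_def)
    define Q where "Q y r \<xi> \<longleftrightarrow> (\<forall>c<n. \<xi> c \<in> cbx n ?a e \<and> (\<forall>k<n. \<xi> c k \<in> closed_segment (?a k) (y k))) \<and>
            g y r - g ?a r = (\<Sum>c<n. jac g (\<xi> c) r c * (y c - ?a c))" for y r \<xi>
    have exQ: "\<exists>\<xi>. Q y r \<xi>" if "y \<in> cbx n ?a e" "r < n" for y r
      unfolding Q_def jac_def
      by (rule mvt_cbx[OF e(2) that(1) ab]) (rule smooth_funD(1)[OF g[OF that(2)]])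
    define \<xi> where "\<xi> y r = (SOME \<xi>. Q y r \<xi>)" for y r
    have Q: "Q y r (\<xi> y r)" if "y \<in> cbx n ?a e" "r < n" for y r
      unfolding \<xi>_def by (rule someI_ex[OF exQ[OF that]])
    have \<xi>: "(\<forall>c<n. \<xi> y r c \<in> cbx n ?a e \<and> (\<forall>k<n. \<xi> y r c k \<in> closed_segment (?a k) (y k))) \<and>
            g y r - g ?a r = (\<Sum>c<n. jac g (\<xi> y r c) r c * (y c - ?a c))"
      if "y \<in> cbx n ?a e" "r < n" for y r
      using Q[OF that] unfolding Q_def .
    \<comment> \<open>The entries are taken at different intermediate points, so \<open>N t\<close>
      need not be the Jacobian at any point. Still it maps the increment of the argument exactly to
      the increment of \<open>g\<close>, and it tends to the Jacobian at \<open>?a\<close>.\<close>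
    define N where "N t r c = jac g (\<xi> (?h (b(j := t))) r c) r c" for t r c
    have Nlim: "((\<lambda>t. N t r c) \<longlongrightarrow> jac g ?a r c) ?F" if r: "r < n" and c: "c < n" for r c
      unfolding N_def
    proof (rule tendsto_on_openE[OF U smooth_fun_continuous_on[OF jac_smooth[OF r c] UE] aU])
      show "eventually (\<lambda>t. \<xi> (?h (b(j := t))) r c \<in> U) ?F"
        using near by eventually_elim (use \<xi> e(2) r c in blast)
      fix k assume k: "k < n"
      have "((\<lambda>t. \<bar>?h (b(j := t)) k - ?a k\<bar>) \<longlongrightarrow> 0) ?F"
        using hlim[of k] by (simp add: LIM_zero_iff tendsto_rabs_zero_iff)
      then have "((\<lambda>t. \<xi> (?h (b(j := t))) r c k - ?a k) \<longlongrightarrow> 0) ?F"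
      proof (rule Lim_null_comparison[rotated])
        show "eventually (\<lambda>t. norm (\<xi> (?h (b(j := t))) r c k - ?a k) \<le> \<bar>?h (b(j := t)) k - ?a k\<bar>) ?F"
          using near
        proof eventually_elim
          case (elim t)
          then have "\<xi> (?h (b(j := t))) r c k \<in> closed_segment (?a k) (?h (b(j := t)) k)" using \<xi> r c k by blast
          then show ?case by (auto simp: closed_segment_eq_real_ivl split: if_splits)
        qed
      qed
      then show "((\<lambda>t. \<xi> (?h (b(j := t))) r c k) \<longlongrightarrow> ?a k) ?F" by (simp add: LIM_zero_iff)
    qed
    have lim1: "((\<lambda>t. dt n (N t)) \<longlongrightarrow> dt n (jac g ?a)) ?F"
      by (rule tendsto_dt) (rule Nlim)
    have lim2: "((\<lambda>t. dt n (\<lambda>r c. if c = i then (if r = j then 1 else 0) else N t r c)) \<longlongrightarrow>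
        dt n (\<lambda>r c. if c = i then (if r = j then 1 else 0) else jac g ?a r c)) ?F"
      by (rule tendsto_dt) (auto intro: Nlim)
    have "((\<lambda>t. dt n (\<lambda>r c. if c = i then (if r = j then 1 else 0) else N t r c) / dt n (N t)) \<longlongrightarrow> Bm i j ?a) ?F"
      unfolding Bm_def by (rule tendsto_divide[OF lim2 lim1 nz[OF aU]])
    moreover have "eventually (\<lambda>t. dt n (N t) \<noteq> 0) ?F"
      using lim1 nz[OF aU] by (rule tendsto_imp_eventually_ne)
    then have "eventually (\<lambda>t. dt n (\<lambda>r c. if c = i then (if r = j then 1 else 0) else N t r c) / dt n (N t)
        = (?h (b(j := t)) i - ?h (b(j := b j)) i) / (t - b j)) ?F"
      using near eventually_neq_at_within[of "b j" "b j"]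
    proof eventually_elim
      case (elim t)
      let ?y = "?h (b(j := t))"
      have gy: "g ?y = b(j := t)" using elim by (auto simp: f_inv_into_f)
      have "(\<Sum>c<n. N t r c * ((?y c - ?a c) / (t - b j))) = (if r = j then 1 else 0)" if "r < n" for r
      proof -
        have "(\<Sum>c<n. N t r c * (?y c - ?a c)) = g ?y r - g ?a r"
          using \<xi>[of ?y r] elim that unfolding N_def by auto
        also have "\<dots> = (if r = j then t - b j else 0)" by (simp add: gy ga)
        finally show ?thesis using elim by (simp add: sum_divide_distrib[symmetric] field_simps)
      qed
      from dt_cramer[OF this i] have "((?y i - ?a i) / (t - b j)) * dt n (N t) =
         dt n (\<lambda>r c. if c = i then (if r = j then 1 else 0) else N t r c)" by simp
      then show ?case using elim by (simp add: field_simps)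
    qed
    ultimately show ?thesis unfolding has_field_derivative_iff by (rule Lim_transform_eventually)
  qed
  show "smooth_fun n (g ` U) (\<lambda>x. f (?h x))" if f: "smooth_fun n U f"
  proof (rule smooth_fun_coinduct[OF opU, where P = "\<lambda>k. \<exists>f. smooth_fun n U f \<and> k = (\<lambda>x. f (?h x))"])
    show "\<exists>f'. smooth_fun n U f' \<and> (\<lambda>x. f (?h x)) = (\<lambda>x. f' (?h x))" using f by blast
    fix k assume "\<exists>f. smooth_fun n U f \<and> k = (\<lambda>x. f (?h x))"
    then obtain f where f: "smooth_fun n U f" "k = (\<lambda>x. f (?h x))" by auto
    show "continuous_on (g ` U) k"
      unfolding f(2) by (rule continuous_on_compose2[OF smooth_fun_continuous_on[OF f(1) UE] hc]) (use hU in blast)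
    fix j assume j: "j < n"
    have "((\<lambda>t. k (b(j := t))) has_real_derivative (\<Sum>i<n. partial_deriv i f (?h b) * Bm i j (?h b))) (at (b j))"
      if b: "b \<in> g ` U" for b
    proof -
      have "((\<lambda>t. f (?h (b(j := t)))) has_real_derivative (\<Sum>i<n. partial_deriv i f (?h (b(j := b j))) * Bm i j (?h b))) (at (b j))"
      proof (rule smooth_fun_chain_curve[OF U f(1)])
        show "?h (b(j := b j)) \<in> U" using hU b by auto
        show "\<forall>\<^sub>F s in at (b j). ?h (b(j := s)) \<in> Esp n"
          using eventually_fun_upd_in[OF opU b j] hU UE by (auto simp: eventually_at_filter elim!: eventually_mono)
      qed (rule hder[OF b _ j])
      then show ?thesis unfolding f(2) by simp
    qed
    moreover have "smooth_fun n U (\<lambda>x. \<Sum>i<n. partial_deriv i f x * Bm i j x)"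
      using smooth_funD(2)[OF f(1)] Bm_smooth by (intro smooth_fun_sum smooth_fun_mult U) auto
    ultimately show "\<exists>g'. (\<exists>f. smooth_fun n U f \<and> g' = (\<lambda>x. f (?h x))) \<and>
        (\<forall>x\<in>g ` U. ((\<lambda>t. k (x(j := t))) has_real_derivative g' x) (at (x j)))"
      by (intro exI[of _ "\<lambda>b. \<Sum>i<n. partial_deriv i f (?h b) * Bm i j (?h b)"]) blast
  qed
qed

section \<open>Polynomial interpolation with uniformly bounded coefficients\<close>

text \<open>The zeros that Rolle's theorem supplies between consecutive points are strictly
  increasing, so exactly one node is lost per derivative.\<close>

lemma rolle_iterated:
  fixes D :: "nat \<Rightarrow> real \<Rightarrow> real"
  assumes "finite A" "card A = Suc k" "A \<subseteq> {a..b}" "\<And>x. x \<in> A \<Longrightarrow> D 0 x = 0"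
    and "\<And>j x. j < k \<Longrightarrow> x \<in> {a..b} \<Longrightarrow> (D j has_real_derivative D (Suc j) x) (at x)"
  shows "\<exists>\<xi>\<in>{a..b}. D k \<xi> = 0"
  using assms
proof (induction k arbitrary: A D)
  case 0
  then obtain x where "A = {x}" by (metis One_nat_def card_1_singletonE)
  then show ?case using 0 by auto
next
  case (Suc k)
  define xs where "xs = sorted_list_of_set A"
  have xs: "set xs = A" "length xs = Suc (Suc k)" using Suc.prems(1,2) by (auto simp: xs_def)
  have lt: "xs ! i < xs ! j" if "i < j" "j < Suc (Suc k)" for i j
    using sorted_wrt_nth_less[OF strict_sorted_list_of_set[of A] that(1)] that(2) xs(2) by (simp add: xs_def)
  have mem: "xs ! i \<in> A" if "i < Suc (Suc k)" for i using that xs by (metis nth_mem)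
  have "\<exists>z. xs ! i < z \<and> z < xs ! Suc i \<and> D 1 z = 0" if i: "i < Suc k" for i
  proof -
    have sub: "{xs ! i..xs ! Suc i} \<subseteq> {a..b}" using mem[of i] mem[of "Suc i"] i Suc.prems(3) by fastforce
    have der: "(D 0 has_real_derivative D 1 x) (at x)" if "x \<in> {xs ! i..xs ! Suc i}" for x
      using Suc.prems(5)[of 0 x] sub that by auto
    have "\<exists>z. xs ! i < z \<and> z < xs ! Suc i \<and> D 0 (xs ! Suc i) - D 0 (xs ! i) = (xs ! Suc i - xs ! i) * D 1 z"
      using lt[of i "Suc i"] i der by (intro MVT2) auto
    moreover have "D 0 (xs ! Suc i) = 0" "D 0 (xs ! i) = 0" using mem i Suc.prems(4) by auto
    ultimately show ?thesis using lt[of i "Suc i"] i by auto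
  qed
  then obtain z where z: "\<And>i. i < Suc k \<Longrightarrow> xs ! i < z i \<and> z i < xs ! Suc i \<and> D 1 (z i) = 0" by metis
  have zlt: "z i < z j" if "i < j" "j < Suc k" for i j
  proof -
    have "xs ! Suc i \<le> xs ! j" using lt[of "Suc i" j] that by (cases "Suc i = j") auto
    then show ?thesis using z[of i] z[of j] that by force
  qed
  have inj: "inj_on z {..<Suc k}"
    by (rule inj_onI) (metis lessThan_iff zlt less_irrefl linorder_neqE_nat)
  have "\<exists>\<xi>\<in>{a..b}. (\<lambda>j. D (Suc j)) k \<xi> = 0"
  proof (rule Suc.IH)
    show "card (z ` {..<Suc k}) = Suc k" using inj by (simp add: card_image)
    show "z ` {..<Suc k} \<subseteq> {a..b}"
    proof
      fix y assume "y \<in> z ` {..<Suc k}"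
      then obtain i where i: "i < Suc k" "y = z i" by auto
      have "xs ! i \<in> {a..b}" "xs ! Suc i \<in> {a..b}" using mem[of i] mem[of "Suc i"] i(1) Suc.prems(3) by auto
      then show "y \<in> {a..b}" using z[OF i(1)] i(2) by auto
    qed
  qed (use z Suc.prems in auto)
  then show ?case by simp
qed

lemma coeff_prod_linear_bound:
  assumes "finite A" "\<And>a. a \<in> A \<Longrightarrow> \<bar>a\<bar> \<le> (1::real)"
  shows "\<bar>Polynomial.coeff (\<Prod>a\<in>A. [:- a, 1:]) k\<bar> \<le> 2 ^ card A"
  using assms
proof (induction A arbitrary: k rule: finite_induct)
  case empty
  then show ?case by (auto simp: coeff_1)
next
  case (insert a A)
  have *: "\<bar>Polynomial.coeff (\<Prod>a\<in>A. [:- a, 1:]) i\<bar> \<le> 2 ^ card A" for i using insert by auto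
  have a: "\<bar>a\<bar> \<le> 1" using insert by auto
  have "\<bar>a * Polynomial.coeff (\<Prod>a\<in>A. [:- a, 1:]) k\<bar> \<le> 1 * 2 ^ card A"
    unfolding abs_mult using a * by (intro mult_mono) auto
  moreover have "\<bar>Polynomial.coeff (pCons 0 (\<Prod>a\<in>A. [:- a, 1:])) k\<bar> \<le> 2 ^ card A"
    using * by (cases k) auto
  moreover have "Polynomial.coeff (\<Prod>a\<in>insert a A. [:- a, 1:]) k =
     Polynomial.coeff (pCons 0 (\<Prod>a\<in>A. [:- a, 1:])) k - a * Polynomial.coeff (\<Prod>a\<in>A. [:- a, 1:]) k"
    using insert.hyps by simp
  ultimately show ?case using insert.hyps by simp
qed

lemma degree_prod_linear:
  assumes "finite A"
  shows "Polynomial.degree (\<Prod>a\<in>A. [:- a, 1::real:]) = card A" "Polynomial.coeff (\<Prod>a\<in>A. [:- a, 1::real:]) (card A) = 1"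
proof -
  show d: "Polynomial.degree (\<Prod>a\<in>A. [:- a, 1::real:]) = card A"
    by (subst degree_prod_eq_sum_degree) auto
  have "Polynomial.lead_coeff (\<Prod>a\<in>A. [:- a, 1::real:]) = 1" by (subst lead_coeff_prod) auto
  then show "Polynomial.coeff (\<Prod>a\<in>A. [:- a, 1::real:]) (card A) = 1" using d by simp
qed

text \<open>The coefficients of the interpolating polynomial are linear functionals of the values at
  the nodes; linearity permits treating one variable after the other. In the second clause
  \<open>D j\<close> plays the j-th derivative of the interpolated function, and the bound must not
  depend on the position of the nodes.\<close>

definition interp_weights :: "nat \<Rightarrow> real \<Rightarrow> real \<Rightarrow> real set \<Rightarrow> (nat \<Rightarrow> real \<Rightarrow> real) \<Rightarrow> bool" where
  "interp_weights m e C A w \<longleftrightarrow>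
     (\<forall>f::real\<Rightarrow>real. \<forall>x\<in>A. f x = (\<Sum>k<m. (\<Sum>a\<in>A. w k a * f a) * x ^ k)) \<and>
     (\<forall>D M. (\<forall>j<m. \<forall>x\<in>{-e..e}. (D j has_real_derivative D (Suc j) x) (at x)) \<and>
            (\<forall>j\<le>m. \<forall>x\<in>{-e..e}. \<bar>D j x\<bar> \<le> M) \<longrightarrow>
        (\<forall>k<m. \<bar>\<Sum>a\<in>A. w k a * D 0 a\<bar> \<le> C * M))"

text \<open>Newton's interpolation: the leading coefficient for \<open>m + 1\<close> nodes is \<open>f\<^sup>(\<^sup>m\<^sup>)(\<xi>) / m!\<close>, so the
  coefficients are bounded independently of how close the nodes are to each other.\<close>

lemma interpolation_one_variable:
  assumes e: "0 \<le> e" "e \<le> 1"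
  shows "\<exists>C\<ge>0. \<forall>A. finite A \<and> A \<subseteq> {-e..e} \<and> card A = m \<longrightarrow> (\<exists>w. interp_weights m e C A w)"
proof (induction m)
  case 0
  show ?case by (rule exI[of _ 0]) (auto simp: interp_weights_def)
next
  case (Suc m)
  then obtain C where C: "C \<ge> 0" "\<And>A. finite A \<Longrightarrow> A \<subseteq> {-e..e} \<Longrightarrow> card A = m \<Longrightarrow> \<exists>w. interp_weights m e C A w"
    by auto
  show ?case
  proof (intro exI[of _ "C + 2 ^ m"] conjI allI impI)
    show "0 \<le> C + 2 ^ m" using C(1) by simp
    fix A assume A: "finite A \<and> A \<subseteq> {-e..e} \<and> card A = Suc m"
    then obtain b where b: "b \<in> A" by fastforce
    define A0 where "A0 = A - {b}"
    have A0: "finite A0" "A0 \<subseteq> {-e..e}" "card A0 = m" "b \<notin> A0" "A = insert b A0"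
      using A b by (auto simp: A0_def)
    obtain w0 where w0: "interp_weights m e C A0 w0" using C(2)[OF A0(1-3)] by auto
    define N where "N = (\<Prod>a\<in>A0. [:- a, 1::real:])"
    have Ndeg: "Polynomial.degree N = m" "Polynomial.coeff N m = 1" using degree_prod_linear[OF A0(1)] A0(3) by (auto simp: N_def)
    have N0: "poly N x = 0" if "x \<in> A0" for x using that A0(1) by (auto simp: N_def poly_prod)
    have Nb: "poly N b \<noteq> 0" using A0(1,4) by (auto simp: N_def poly_prod)
    have Ncoeff: "\<bar>Polynomial.coeff N k\<bar> \<le> 2 ^ m" for k
      using coeff_prod_linear_bound[OF A0(1), of k] A0(2,3) e by (fastforce simp: N_def)
    have Npoly: "poly N x = (\<Sum>k<Suc m. Polynomial.coeff N k * x ^ k)" for x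
      by (simp add: poly_altdef Ndeg lessThan_Suc_atMost)
    \<comment> \<open>Weights of the new leading coefficient: they are chosen so that
      \<open>c f\<close> is the error at \<open>b\<close> of the interpolant on \<open>A0\<close>,
      divided by \<open>poly N b\<close>. Adding \<open>c f\<close> times \<open>N\<close> then
      corrects the value at \<open>b\<close> and changes nothing on \<open>A0\<close>.\<close>
    define u where "u a = (if a = b then 1 else - (\<Sum>k<m. w0 k a * b ^ k)) / poly N b" for a
    define w where "w k a = (if k < m \<and> a \<noteq> b then w0 k a else 0) + u a * Polynomial.coeff N k" for k a
    define q where "q f k = (\<Sum>a\<in>A0. w0 k a * f a)" for f :: "real \<Rightarrow> real" and k
    define c where "c f = (\<Sum>a\<in>A. u a * f a)" for f :: "real \<Rightarrow> real"
    have c_eq: "c f * poly N b = f b - (\<Sum>k<m. q f k * b ^ k)" for f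
    proof -
      have "c f * poly N b = (u b * poly N b) * f b + (\<Sum>a\<in>A0. (u a * poly N b) * f a)"
        unfolding c_def A0(5) using A0(1,4) by (simp add: sum_distrib_right sum_distrib_left algebra_simps)
      also have "u b * poly N b = 1" using Nb by (simp add: u_def)
      also have "(\<Sum>a\<in>A0. (u a * poly N b) * f a) = (\<Sum>a\<in>A0. - (\<Sum>k<m. w0 k a * b ^ k) * f a)"
        using Nb A0(4) by (intro sum.cong) (auto simp: u_def)
      also have "\<dots> = - (\<Sum>k<m. q f k * b ^ k)"
        unfolding q_def sum_distrib_right sum_negf[symmetric] 
        by (subst sum.swap) (simp add: sum_negf mult_ac)
      finally show ?thesis by simp
    qed
    have wsum: "(\<Sum>a\<in>A. w k a * f a) = (if k < m then q f k else 0) + c f * Polynomial.coeff N k" for f k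
    proof -
      have "(\<Sum>a\<in>A. w k a * f a) = (\<Sum>a\<in>A. (if k < m \<and> a \<noteq> b then w0 k a else 0) * f a) + c f * Polynomial.coeff N k"
        by (simp add: w_def c_def algebra_simps sum.distrib sum_distrib_left sum_distrib_right)
      also have "(\<Sum>a\<in>A. (if k < m \<and> a \<noteq> b then w0 k a else 0) * f a) = (if k < m then q f k else 0)"
        unfolding A0(5) q_def using A0(1,4) by (auto intro!: sum.cong)
      finally show ?thesis .
    qed
    show "\<exists>w. interp_weights (Suc m) e (C + 2 ^ m) A w"
    proof (rule exI[of _ w], unfold interp_weights_def, intro conjI allI ballI impI)
      fix f x assume x: "x \<in> A"
      have "(\<Sum>k<Suc m. (\<Sum>a\<in>A. w k a * f a) * x ^ k) = (\<Sum>k<m. q f k * x ^ k) + c f * poly N x"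
        unfolding wsum Npoly by (simp add: algebra_simps sum.distrib sum_distrib_left)
      also have "\<dots> = f x"
      proof (cases "x = b")
        case True
        then show ?thesis using c_eq[of f] by simp
      next
        case False
        then have "x \<in> A0" using x A0(5) by auto
        then show ?thesis using w0 N0 unfolding interp_weights_def q_def by simp
      qed
      finally show "f x = (\<Sum>k<Suc m. (\<Sum>a\<in>A. w k a * f a) * x ^ k)" by simp
    next
      fix D M k
      assume "(\<forall>j<Suc m. \<forall>x\<in>{-e..e}. (D j has_real_derivative D (Suc j) x) (at x)) \<and>
            (\<forall>j\<le>Suc m. \<forall>x\<in>{-e..e}. \<bar>D j x\<bar> \<le> M)" and k: "k < Suc m"
      then have D: "\<And>j x. j < Suc m \<Longrightarrow> x \<in> {-e..e} \<Longrightarrow> (D j has_real_derivative D (Suc j) x) (at x)"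
        "\<And>j x. j \<le> Suc m \<Longrightarrow> x \<in> {-e..e} \<Longrightarrow> \<bar>D j x\<bar> \<le> M" by auto
      have M0: "M \<ge> 0" using D(2)[of 0 0] e(1) by auto
      define Q where "Q = (\<Sum>k<m. Polynomial.monom (q (D 0) k) k)"
      have Qpoly: "poly Q x = (\<Sum>k<m. q (D 0) k * x ^ k)" for x by (simp add: Q_def poly_sum poly_monom)
      have Qc: "Polynomial.coeff Q i = 0" if "i \<ge> m" for i using that by (simp add: Q_def coeff_sum)
      \<comment> \<open>\<open>G 0\<close> is the interpolation error, with \<open>m + 1\<close>
        zeros. At a zero of \<open>G m\<close> the polynomial \<open>Q\<close> no longer contributes
        and \<open>N\<close> contributes the constant \<open>fact m\<close>.\<close>
      define G where "G j x = D j x - poly ((pderiv ^^ j) Q) x - c (D 0) * poly ((pderiv ^^ j) N) x" for j x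
      have "\<exists>\<xi>\<in>{-e..e}. G m \<xi> = 0"
      proof (rule rolle_iterated)
        show "finite A" "card A = Suc m" "A \<subseteq> {-e..e}" using A by auto
        show "G 0 x = 0" if "x \<in> A" for x
        proof (cases "x = b")
          case True
          then show ?thesis using c_eq[of "D 0"] by (simp add: G_def Qpoly)
        next
          case False
          then have "x \<in> A0" using that A0(5) by auto
          have "D 0 x = (\<Sum>k<m. q (D 0) k * x ^ k)"
            using w0 \<open>x \<in> A0\<close> unfolding interp_weights_def q_def by blast
          then show ?thesis using N0[OF \<open>x \<in> A0\<close>] by (simp add: G_def Qpoly)
        qed
        show "(G j has_real_derivative G (Suc j) x) (at x)" if "j < m" "x \<in> {-e..e}" for j x
          unfolding G_def using D(1)[of j x] that
          by (auto intro!: derivative_eq_intros poly_DERIV)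
      qed
      then obtain \<xi> where \<xi>: "\<xi> \<in> {-e..e}" "G m \<xi> = 0" by blast
      have "(pderiv ^^ m) Q = 0" by (rule poly_eqI) (simp add: coeff_higher_pderiv Qc)
      moreover have "(pderiv ^^ m) N = [:fact m:]"
      proof (rule poly_eqI)
        fix i
        show "Polynomial.coeff ((pderiv ^^ m) N) i = Polynomial.coeff [:fact m:] i"
        proof (cases i)
          case 0
          then show ?thesis by (simp add: coeff_higher_pderiv Ndeg pochhammer_fact)
        next
          case (Suc i')
          then have "Polynomial.coeff N (i + m) = 0" by (intro coeff_eq_0) (simp add: Ndeg)
          then show ?thesis using Suc by (simp add: coeff_higher_pderiv)
        qed
      qed
      ultimately have "D m \<xi> = c (D 0) * fact m" using \<xi>(2) by (simp add: G_def)
      then have "\<bar>c (D 0)\<bar> * fact m \<le> M" using D(2)[of m \<xi>] \<xi>(1) by (simp add: abs_mult)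
      moreover have "\<bar>c (D 0)\<bar> * 1 \<le> \<bar>c (D 0)\<bar> * fact m" by (intro mult_left_mono) auto
      ultimately have cb: "\<bar>c (D 0)\<bar> \<le> M" by linarith
      have "\<bar>if k < m then q (D 0) k else 0\<bar> \<le> C * M"
      proof (cases "k < m")
        case True
        have "\<bar>q (D 0) k\<bar> \<le> C * M" using w0 D True unfolding interp_weights_def q_def by auto
        then show ?thesis using True by simp
      next
        case False
        then show ?thesis using C(1) M0 by simp
      qed
      moreover have "\<bar>c (D 0) * Polynomial.coeff N k\<bar> \<le> M * 2 ^ m"
        unfolding abs_mult using cb Ncoeff M0 by (intro mult_mono) auto
      ultimately show "\<bar>\<Sum>a\<in>A. w k a * D 0 a\<bar> \<le> (C + 2 ^ m) * M"
        unfolding wsum by (simp add: algebra_simps)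
    qed
  qed
qed

section \<open>Interpolation on grids in several variables; lists carry the exponent of the last
  variable at their head\<close>

primrec monl :: "nat list \<Rightarrow> (nat \<Rightarrow> real) \<Rightarrow> real" where
  "monl [] x = 1"
| "monl (k # ks) x = x (length ks) ^ k * monl ks x"

text \<open>The one-variable coefficient functionals are applied in the variables below
  \<open>length ks\<close>; the others stay free. Hence the value at \<open>x\<close> depends only
  on the coordinates from \<open>length ks\<close> on.\<close>

primrec cf :: "(nat \<Rightarrow> real \<Rightarrow> real) \<Rightarrow> real set \<Rightarrow> nat list \<Rightarrow> ((nat \<Rightarrow> real) \<Rightarrow> real) \<Rightarrow> (nat \<Rightarrow> real) \<Rightarrow> real" where
  "cf w A [] f = f"
| "cf w A (k # ks) f = (\<lambda>x. \<Sum>a\<in>A. w k a * cf w A ks f (x(length ks := a)))"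

lemma cf_interp:
  assumes w: "interp_weights m e C A w" and x: "\<And>j. j < d \<Longrightarrow> x j \<in> A"
  shows "f x = (\<Sum>ks\<in>{ks. set ks \<subseteq> {..<m} \<and> length ks = d}. cf w A ks f x * monl ks x)"
  using x
proof (induction d)
  case 0
  then show ?case by (simp cong: conj_cong)
next
  case (Suc d)
  let ?L = "{ks. set ks \<subseteq> {..<m} \<and> length ks = d}"
  have L: "cf w A ks f x = (\<Sum>k<m. cf w A (k # ks) f x * x d ^ k)" if "ks \<in> ?L" for ks
  proof -
    have ip: "g y = (\<Sum>k<m. (\<Sum>a\<in>A. w k a * g a) * y ^ k)" if "y \<in> A" for g y
      using w that unfolding interp_weights_def by blast
    show ?thesis using ip[of "x d" "\<lambda>t. cf w A ks f (x(d := t))"] Suc.prems[of d] that by simp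
  qed
  have "f x = (\<Sum>ks\<in>?L. cf w A ks f x * monl ks x)"
    by (rule Suc.IH) (use Suc.prems in auto)
  also have "\<dots> = (\<Sum>ks\<in>?L. (\<Sum>k<m. cf w A (k # ks) f x * x d ^ k) * monl ks x)"
    by (intro sum.cong refl) (simp only: L)
  also have "\<dots> = (\<Sum>ks\<in>?L. \<Sum>k<m. cf w A (k # ks) f x * monl (k # ks) x)"
    by (intro sum.cong) (auto simp: sum_distrib_right sum_distrib_left mult_ac)
  also have "\<dots> = (\<Sum>(ks, k)\<in>?L \<times> {..<m}. cf w A (k # ks) f x * monl (k # ks) x)"
    by (rule sum.cartesian_product)
  also have "\<dots> = (\<Sum>ks\<in>(\<lambda>(ks, k). k # ks) ` (?L \<times> {..<m}). cf w A ks f x * monl ks x)"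
    by (subst sum.reindex) (auto simp: inj_on_def intro!: sum.cong)
  also have "(\<lambda>(ks, k). k # ks) ` (?L \<times> {..<m}) = {ks. set ks \<subseteq> {..<m} \<and> length ks = Suc d}"
    by (simp add: lists_length_Suc_eq)
  finally show ?case .
qed

lemma cf_cong:
  "(\<And>j. j \<ge> length ks \<Longrightarrow> x j = y j) \<Longrightarrow> cf w A ks f x = cf w A ks f y"
proof (induction ks arbitrary: x y)
  case Nil
  then have "x = y" by auto
  then show ?case by simp
next
  case (Cons k ks)
  have "cf w A ks f (x(length ks := a)) = cf w A ks f (y(length ks := a))" for a
    by (rule Cons.IH) (use Cons.prems in auto)
  then show ?case by simp
qed

text \<open>\<open>cf\<close> is a finite linear combination of values of \<open>f\<close> with the
  first \<open>length ks\<close> variables frozen at nodes, hence commutes with differentiation in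
  the variable \<open>l\<close>.\<close>

lemma cf_deriv:
  assumes V: "cbx n (\<lambda>_. 0) e \<subseteq> V" and A: "A \<subseteq> {-e..e}"
    and f: "smooth_fun n V f" and l: "length ks \<le> l" "l < n" and x: "x \<in> cbx n (\<lambda>_. 0) e"
  shows "((\<lambda>t. cf w A ks f (x(l := t))) has_real_derivative cf w A ks (partial_deriv l f) x) (at (x l))"
  using l(1) x
proof (induction ks arbitrary: x)
  case Nil
  then have "x \<in> V" using V by blast
  from smooth_funD(1)[OF f l(2) this] show ?case by (simp only: cf.simps)
next
  case (Cons k ks)
  let ?d = "length ks"
  have "((\<lambda>t. cf w A ks f ((x(?d := a))(l := t))) has_real_derivative cf w A ks (partial_deriv l f) (x(?d := a))) (at (x l))"
    if "a \<in> A" for a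
  proof -
    have "x(?d := a) \<in> cbx n (\<lambda>_. 0) e" using Cons.prems l(2) A that by (auto simp: cbx_def Esp_iff abs_le_iff)
    from Cons.IH[OF _ this] Cons.prems(1)
    have "((\<lambda>t. cf w A ks f ((x(?d := a))(l := t))) has_real_derivative cf w A ks (partial_deriv l f) (x(?d := a)))
      (at ((x(?d := a)) l))" by (simp only: list.size(4))
    moreover have "(x(?d := a)) l = x l" using Cons.prems(1) by simp
    ultimately show ?thesis by (simp only:)
  qed
  moreover have "(x(?d := a))(l := t) = (x(l := t))(?d := a)" for a t using Cons.prems by (auto simp: fun_upd_twist)
  ultimately show ?case unfolding cf.simps by (intro DERIV_sum DERIV_cmult) (simp only:)
qed

text \<open>Each variable costs a factor \<open>C\<close> and at most \<open>m\<close> further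
  derivatives. Since the hypothesis bounds the iterated partial derivatives in every order, mixed
  ones never have to be interchanged.\<close>

lemma cf_bound:
  assumes V: "cbx n (\<lambda>_. 0) e \<subseteq> V" and A: "A \<subseteq> {-e..e}" and w: "interp_weights m e C A w"
    and "smooth_fun n V f" "set ks \<subseteq> {..<m}" "length ks \<le> n" "x \<in> cbx n (\<lambda>_. 0) e"
    and "\<And>is x. set is \<subseteq> {..<n} \<Longrightarrow> length is \<le> m * length ks \<Longrightarrow> x \<in> cbx n (\<lambda>_. 0) e \<Longrightarrow>
           \<bar>fold partial_deriv is f x\<bar> \<le> M"
  shows "\<bar>cf w A ks f x\<bar> \<le> C ^ length ks * M"
  using assms(4-)
proof (induction ks arbitrary: f x)
  case Nil
  then show ?case using Nil(5)[of "[]" x] by auto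
next
  case (Cons k ks)
  let ?d = "length ks"
  have d: "?d < n" using Cons.prems(3) by simp
  have rep: "(partial_deriv ?d ^^ j) f = fold partial_deriv (replicate j ?d) f" for j
    by (induction j) (auto simp: funpow_swap1 fold_replicate)
  have sm: "smooth_fun n V ((partial_deriv ?d ^^ j) f)" for j
    unfolding rep by (rule smooth_fun_fold[OF Cons.prems(1)]) (use d in auto)
  have upd: "x(?d := t) \<in> cbx n (\<lambda>_. 0) e" if "t \<in> {-e..e}" for t
    using Cons.prems(4) d that by (auto simp: cbx_def Esp_iff abs_le_iff)
  define D where "D j t = cf w A ks ((partial_deriv ?d ^^ j) f) (x(?d := t))" for j t
  have Dj: "D j = (\<lambda>t. cf w A ks ((partial_deriv ?d ^^ j) f) (x(?d := t)))" for j
    by (rule ext) (simp add: D_def)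
  have "(D j has_real_derivative D (Suc j) t) (at t)" if "t \<in> {-e..e}" for j t
    using cf_deriv[OF V A sm order_refl d upd[OF that], of w j] by (simp add: Dj)
  moreover have "\<bar>D j t\<bar> \<le> C ^ ?d * M" if "j \<le> m" "t \<in> {-e..e}" for j t
    unfolding D_def
  proof (rule Cons.IH[OF sm _ _ upd[OF that(2)]])
    show "set ks \<subseteq> {..<m}" "length ks \<le> n" using Cons.prems by auto
    fix "is" y assume "is": "set is \<subseteq> {..<n}" "length is \<le> m * length ks" "y \<in> cbx n (\<lambda>_. 0) e"
    have "set (replicate j ?d @ is) \<subseteq> {..<n}" using "is"(1) d by auto
    moreover have "length (replicate j ?d @ is) \<le> m * length (k # ks)" using "is"(2) that(1) by simp
    ultimately have "\<bar>fold partial_deriv (replicate j ?d @ is) f y\<bar> \<le> M" by (rule Cons.prems(5)[OF _ _ "is"(3)])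
    then show "\<bar>fold partial_deriv is ((partial_deriv ?d ^^ j) f) y\<bar> \<le> M" unfolding rep by simp
  qed
  ultimately have "\<bar>\<Sum>a\<in>A. w k a * D 0 a\<bar> \<le> C * (C ^ ?d * M)"
    using w Cons.prems(2) unfolding interp_weights_def by auto
  then show ?case by (simp add: D_def mult.assoc)
qed

lemma compact_cbx: "compact (cbx n a e)"
proof -
  define K where "K i = (if i < n then {a i - e..a i + e} else {0})" for i
  have "compactin (powertop_real UNIV) (Pi\<^sub>E UNIV K)"
    unfolding compactin_PiE by (auto simp: K_def)
  moreover have "Pi\<^sub>E UNIV K = cbx n a e"
    unfolding cbx_def topspace_Euclidean_space
    by (fastforce simp: K_def PiE_iff abs_le_iff algebra_simps split: if_splits)
  ultimately show ?thesis by (simp add: euclidean_product_topology)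
qed

lemma bounded_on_cbx:
  assumes "cbx n a e \<subseteq> V" "V \<subseteq> Esp n" "smooth_fun n V f"
  shows "\<exists>M. \<forall>x\<in>cbx n a e. \<bar>f x\<bar> \<le> M"
proof -
  have "continuous_on (cbx n a e) f"
    using smooth_fun_continuous_on[OF assms(3,2)] assms(1) by (rule continuous_on_subset)
  then have "bounded (f ` cbx n a e)" using compact_cbx compact_continuous_image compact_imp_bounded by blast
  then show ?thesis unfolding bounded_iff by auto
qed

text \<open>The constant is fixed before the nodes are. The nodes will be coordinates of two orbits,
  which may be arbitrarily close to each other or partly coincide.\<close>

proposition interpolation_cube:
  assumes V: "openin (Euclidean_space n) V" "cbx n (\<lambda>_. 0) e \<subseteq> V" and e: "0 < e" "e \<le> 1"
    and f: "smooth_fun n V f"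
  shows "\<exists>C\<ge>0. \<forall>A. finite A \<and> A \<subseteq> {-e..e} \<and> card A \<le> m \<longrightarrow>
     (\<exists>q. (\<forall>ks\<in>{ks. set ks \<subseteq> {..<m} \<and> length ks = n}. \<bar>q ks\<bar> \<le> C) \<and>
          (\<forall>x\<in>Esp n. (\<forall>j<n. x j \<in> A) \<longrightarrow>
             f x = (\<Sum>ks\<in>{ks. set ks \<subseteq> {..<m} \<and> length ks = n}. q ks * monl ks x)))"
proof -
  obtain C where C: "C \<ge> 0" "\<And>A. finite A \<Longrightarrow> A \<subseteq> {-e..e} \<Longrightarrow> card A = m \<Longrightarrow> \<exists>w. interp_weights m e C A w"
    using interpolation_one_variable[of e m] e by auto
  let ?I = "{is. set is \<subseteq> {..<n} \<and> length is \<le> m * n}"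
  have fin: "finite ?I" by (rule finite_lists_length_le) simp
  have "\<exists>M. \<forall>x\<in>cbx n (\<lambda>_. 0) e. \<bar>fold partial_deriv is f x\<bar> \<le> M" if "is \<in> ?I" for "is"
    by (rule bounded_on_cbx[OF V(2) openin_subset[OF V(1)] smooth_fun_fold[OF f]]) (use that in auto)
  then have "\<forall>is\<in>?I. \<exists>M. \<forall>x\<in>cbx n (\<lambda>_. 0) e. \<bar>fold partial_deriv is f x\<bar> \<le> M" by (rule ballI)
  from bchoice[OF this] obtain B where
    B: "\<forall>is\<in>?I. \<forall>x\<in>cbx n (\<lambda>_. 0) e. \<bar>fold partial_deriv is f x\<bar> \<le> B is" ..
  define M where "M = (\<Sum>is\<in>?I. \<bar>B is\<bar>)"
  have M: "\<bar>fold partial_deriv is f x\<bar> \<le> M" if "is \<in> ?I" "x \<in> cbx n (\<lambda>_. 0) e" for "is" x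
  proof -
    have "\<bar>B is\<bar> \<le> M" unfolding M_def using that(1) fin by (intro member_le_sum) auto
    then show ?thesis using bspec[OF bspec[OF B that(1)] that(2)] by linarith
  qed
  have M0: "M \<ge> 0" unfolding M_def by (intro sum_nonneg) auto
  let ?L = "{ks. set ks \<subseteq> {..<m} \<and> length ks = n}"
  show ?thesis
  proof (intro exI[of _ "C ^ n * M"] conjI allI impI)
    show "0 \<le> C ^ n * M" using C(1) M0 by simp
    fix A assume A: "finite A \<and> A \<subseteq> {-e..e} \<and> card A \<le> m"
    \<comment> \<open>The one-variable result wants exactly \<open>m\<close> nodes, so a smaller set
      is filled up inside the interval.\<close>
    have "infinite ({-e..e} - A)" using A e infinite_Icc[of "-e" e] by auto
    then have "\<exists>B. finite B \<and> card B = m - card A \<and> B \<subseteq> {-e..e} - A"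
      by (rule infinite_arbitrarily_large)
    then obtain B where B: "finite B" "card B = m - card A" "B \<subseteq> {-e..e} - A"
      by (elim exE conjE)
    define A' where "A' = A \<union> B"
    have "card A' = card A + card B"
      unfolding A'_def using A B by (intro card_Un_disjoint) blast+
    then have A': "finite A'" "A' \<subseteq> {-e..e}" "card A' = m" "A \<subseteq> A'"
      using A B unfolding A'_def by auto
    then obtain w where w: "interp_weights m e C A' w" using C(2) by blast
    show "\<exists>q. (\<forall>ks\<in>?L. \<bar>q ks\<bar> \<le> C ^ n * M) \<and>
          (\<forall>x\<in>Esp n. (\<forall>j<n. x j \<in> A) \<longrightarrow> f x = (\<Sum>ks\<in>?L. q ks * monl ks x))"
    \<comment> \<open>Once all \<open>n\<close> variables are used up, the coefficient is the same
      at every point of \<open>Esp n\<close>, so it may be evaluated at the origin.\<close>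
    proof (intro exI[of _ "\<lambda>ks. cf w A' ks f (\<lambda>_. 0)"] conjI ballI impI)
      fix ks assume ks: "ks \<in> ?L"
      have "\<bar>cf w A' ks f (\<lambda>_. 0)\<bar> \<le> C ^ length ks * M"
        by (rule cf_bound[OF V(2) A'(2) w f]) (use ks e M in \<open>auto simp: cbx_def Esp_iff\<close>)
      then show "\<bar>cf w A' ks f (\<lambda>_. 0)\<bar> \<le> C ^ n * M" using ks by simp
    next
      fix x assume x: "x \<in> Esp n" "\<forall>j<n. x j \<in> A"
      have "f x = (\<Sum>ks\<in>?L. cf w A' ks f x * monl ks x)"
        by (rule cf_interp[OF w]) (use x A'(4) in auto)
      also have "\<dots> = (\<Sum>ks\<in>?L. cf w A' ks f (\<lambda>_. 0) * monl ks x)"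
      proof (intro sum.cong refl arg_cong2[where f = "(*)"])
        fix ks assume "ks \<in> ?L"
        then show "cf w A' ks f x = cf w A' ks f (\<lambda>_. 0)" using x(1) by (intro cf_cong) (auto simp: Esp_iff)
      qed
      finally show "f x = (\<Sum>ks\<in>?L. cf w A' ks f (\<lambda>_. 0) * monl ks x)" .
    qed
  qed
qed

section \<open>Diffeomorphisms between open sets\<close>

text \<open>Keeping the inverse as an explicit argument makes symmetry, restriction and composition
  immediate.\<close>

definition dif :: "nat \<Rightarrow> (nat \<Rightarrow> real) set \<Rightarrow> (nat \<Rightarrow> real) set \<Rightarrow> ((nat \<Rightarrow> real) \<Rightarrow> nat \<Rightarrow> real) \<Rightarrow>
    ((nat \<Rightarrow> real) \<Rightarrow> nat \<Rightarrow> real) \<Rightarrow> bool" where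
  "dif n P Q f g \<longleftrightarrow> openin (Euclidean_space n) P \<and> openin (Euclidean_space n) Q \<and>
     (\<forall>x\<in>P. f x \<in> Q \<and> g (f x) = x) \<and> (\<forall>y\<in>Q. g y \<in> P \<and> f (g y) = y) \<and>
     (\<forall>j<n. smooth_fun n P (\<lambda>x. f x j)) \<and> (\<forall>j<n. smooth_fun n Q (\<lambda>y. g y j))"

lemma dif_sym: "dif n P Q f g \<Longrightarrow> dif n Q P g f"
  by (simp add: dif_def)

lemma difD:
  assumes "dif n P Q f g"
  shows "openin (Euclidean_space n) P" "openin (Euclidean_space n) Q"
    "x \<in> P \<Longrightarrow> f x \<in> Q" "x \<in> P \<Longrightarrow> g (f x) = x" "y \<in> Q \<Longrightarrow> g y \<in> P" "y \<in> Q \<Longrightarrow> f (g y) = y"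
    "P \<subseteq> Esp n" "Q \<subseteq> Esp n"
    "f ` P = Q" "j < n \<Longrightarrow> smooth_fun n P (\<lambda>x. f x j)"
proof -
  show "openin (Euclidean_space n) P" "openin (Euclidean_space n) Q"
    "x \<in> P \<Longrightarrow> f x \<in> Q" "x \<in> P \<Longrightarrow> g (f x) = x" "y \<in> Q \<Longrightarrow> g y \<in> P" "y \<in> Q \<Longrightarrow> f (g y) = y"
    "j < n \<Longrightarrow> smooth_fun n P (\<lambda>x. f x j)"
    using assms by (simp_all add: dif_def)
  show "P \<subseteq> Esp n" "Q \<subseteq> Esp n" using assms openin_subset by (auto simp: dif_def)
  show "f ` P = Q"
  proof
    show "f ` P \<subseteq> Q" using assms by (auto simp: dif_def)
    show "Q \<subseteq> f ` P"
    proof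
      fix y assume "y \<in> Q"
      then have "y = f (g y)" "g y \<in> P" using assms by (auto simp: dif_def)
      then show "y \<in> f ` P" by (rule image_eqI)
    qed
  qed
qed

lemma dif_continuous: "dif n P Q f g \<Longrightarrow> continuous_on P f"
  by (rule continuous_on_into_Esp[of f P n])
    (simp add: difD(8,9), rule smooth_fun_continuous_on[OF difD(10) difD(7)])

lemma dif_smooth_comp:
  assumes "dif n P Q f g" "smooth_fun n Q h" shows "smooth_fun n P (\<lambda>x. h (f x))"
  by (rule smooth_fun_compose[OF difD(1,2)[OF assms(1)] _ _ assms(2)]) (use difD[OF assms(1)] in auto)

lemma openin_Euclidean_preimage:
  assumes P: "openin (Euclidean_space n) P" and f: "continuous_on P f" and Q: "openin (Euclidean_space m) Q"
    and fE: "f ` P \<subseteq> Esp m"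
  shows "openin (Euclidean_space n) {x \<in> P. f x \<in> Q}"
proof -
  obtain T where T: "open T" "Q = Esp m \<inter> T" using Q unfolding openin_Euclidean_open by (elim exE conjE)
  obtain T' where T': "open T'" "P = Esp n \<inter> T'" using P unfolding openin_Euclidean_open by (elim exE conjE)
  have "openin (top_of_set P) (P \<inter> f -` T)" using continuous_openin_preimage_gen[OF f T(1)] .
  then obtain T'' where T'': "open T''" "P \<inter> f -` T = P \<inter> T''" unfolding openin_open by (elim exE conjE)
  have "{x \<in> P. f x \<in> Q} = Esp n \<inter> (T' \<inter> T'')" using T'' T'(2) T(2) fE by blast
  then show ?thesis unfolding openin_Euclidean_open using open_Int[OF T'(1) T''(1)] by metis
qed

lemma dif_image_open:
  assumes d: "dif n P Q f g" and P': "openin (Euclidean_space n) P'" "P' \<subseteq> P"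
  shows "openin (Euclidean_space n) (f ` P')"
proof -
  have "f ` P' = {y \<in> Q. g y \<in> P'}" (is "_ = ?R")
  proof (intro subset_antisym subsetI)
    fix y assume "y \<in> f ` P'"
    then show "y \<in> ?R" using P'(2) difD(3,4)[OF d] by auto
  next
    fix y assume y: "y \<in> ?R"
    then have "y = f (g y)" using difD(6)[OF d] by auto
    then show "y \<in> f ` P'" using y by blast
  qed
  moreover have "openin (Euclidean_space n) ?R"
    by (rule openin_Euclidean_preimage[OF difD(2)[OF d] dif_continuous[OF dif_sym[OF d]] P'(1)])
       (use difD(9)[OF dif_sym[OF d]] difD(7)[OF d] in simp)
  ultimately show ?thesis by simp
qed

lemma dif_restrict:
  assumes d: "dif n P Q f g" and P': "openin (Euclidean_space n) P'" "P' \<subseteq> P"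
  shows "dif n P' (f ` P') f g"
proof -
  have op: "openin (Euclidean_space n) (f ` P')" by (rule dif_image_open[OF assms])
  have "smooth_fun n P' (\<lambda>x. f x j)" if "j < n" for j
    using smooth_fun_subset[OF difD(10)[OF d that] P' difD(7)[OF d]] .
  moreover have "f ` P' \<subseteq> Q" using difD(3)[OF d] P'(2) by blast
  then have "smooth_fun n (f ` P') (\<lambda>x. g x j)" if "j < n" for j
    using smooth_fun_subset[OF difD(10)[OF dif_sym[OF d] that] op _ difD(8)[OF d]] by blast
  ultimately show ?thesis
    unfolding dif_def using P' op difD(4)[OF d] by auto
qed

lemma dif_trans:
  assumes a: "dif n P Q f g" and b: "dif n Q R f' g'"
  shows "dif n P R (\<lambda>x. f' (f x)) (\<lambda>x. g (g' x))"
  unfolding dif_def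
proof (intro conjI ballI allI impI)
  show "smooth_fun n P (\<lambda>x. f' (f x) j)" if "j < n" for j
    by (rule dif_smooth_comp[OF a difD(10)[OF b that]])
  show "smooth_fun n R (\<lambda>x. g (g' x) j)" if "j < n" for j
    by (rule dif_smooth_comp[OF dif_sym[OF b] difD(10)[OF dif_sym[OF a] that]])
qed (use difD(1-6)[OF a] difD(1-6)[OF b] in auto)

text \<open>The kernel condition is the one in \<open>smooth_embedding\<close>; as source and target
  have the same dimension, it makes the Jacobian determinant nonzero.\<close>

lemma dif_of_smooth_inj:
  assumes U: "openin (Euclidean_space n) U" and gE: "g ` U \<subseteq> Esp n"
    and g: "\<And>j. j < n \<Longrightarrow> smooth_fun n U (\<lambda>x. g x j)" and inj: "inj_on g U"
    and nz: "\<And>x v. x \<in> U \<Longrightarrow> v \<in> Esp n \<Longrightarrow> (\<And>j. j < n \<Longrightarrow> (\<Sum>i<n. partial_deriv i (\<lambda>y. g y j) x * v i) = 0) \<Longrightarrow> v = (\<lambda>_. 0)"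
  shows "dif n U (g ` U) g (inv_into U g)"
proof -
  have dz: "dt n (jac g x) \<noteq> 0" if "x \<in> U" for x
    by (rule dt_nonzero) (use nz[OF that] in \<open>auto simp: jac_def\<close>)
  note si = smooth_inverse[OF U gE g inj dz]
  show ?thesis
    unfolding dif_def
  proof (intro conjI ballI allI impI)
    show "openin (Euclidean_space n) (g ` U)" by (rule si(1))
    show "smooth_fun n (g ` U) (\<lambda>y. inv_into U g y j)" if "j < n" for j
      by (rule si(3)) (auto intro: smooth_fun_coord[OF U])
  qed (use U g inj in \<open>auto simp: inv_into_f_f f_inv_into_f intro: inv_into_into\<close>)
qed

section \<open>Charts\<close>

locale orb_chart =
  fixes X :: "'a topology" and n :: nat and U :: "(nat \<Rightarrow> real) set" and \<Gamma> and \<phi> :: "(nat \<Rightarrow> real) \<Rightarrow> 'a"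
  assumes chart: "orbifold_chart X n (U, \<Gamma>, \<phi>)"
begin

abbreviation mul (infixl "\<odot>" 70) where "\<gamma> \<odot> \<delta> \<equiv> \<gamma> \<otimes>\<^bsub>BijGroup U\<^esub> \<delta>"
abbreviation gi where "gi \<gamma> \<equiv> inv\<^bsub>BijGroup U\<^esub> \<gamma>"

lemma open_U: "openin (Euclidean_space n) U"
  and finite_\<Gamma>: "finite \<Gamma>"
  and sub_\<Gamma>: "subgroup \<Gamma> (BijGroup U)"
  and smooth_\<Gamma>: "\<gamma> \<in> \<Gamma> \<Longrightarrow> smooth_map n U U \<gamma>"
  and \<phi>_ext: "\<phi> \<in> U \<rightarrow>\<^sub>E topspace X"
  and \<phi>_inv: "\<gamma> \<in> \<Gamma> \<Longrightarrow> x \<in> U \<Longrightarrow> \<phi> (\<gamma> x) = \<phi> x"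
  and open_image: "openin X (\<phi> ` U)"
  using chart by (auto simp: orbifold_chart_def)

lemma U_Esp: "U \<subseteq> Esp n" by (rule openin_subset[OF open_U])

lemma \<Gamma>_Bij: "\<gamma> \<in> \<Gamma> \<Longrightarrow> \<gamma> \<in> Bij U"
  using subgroup.subset[OF sub_\<Gamma>] by (auto simp: BijGroup_def)

lemma \<Gamma>_into: "\<gamma> \<in> \<Gamma> \<Longrightarrow> x \<in> U \<Longrightarrow> \<gamma> x \<in> U"
  using smooth_\<Gamma> by (auto simp: smooth_map_def)

lemma \<phi>_into: "x \<in> U \<Longrightarrow> \<phi> x \<in> topspace X"
  using \<phi>_ext by (auto simp: PiE_iff)

lemma mul_apply: "\<gamma> \<in> \<Gamma> \<Longrightarrow> \<delta> \<in> \<Gamma> \<Longrightarrow> x \<in> U \<Longrightarrow> (\<gamma> \<odot> \<delta>) x = \<gamma> (\<delta> x)"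
  using \<Gamma>_Bij by (simp add: BijGroup_def compose_def)

lemma one_apply: "x \<in> U \<Longrightarrow> \<one>\<^bsub>BijGroup U\<^esub> x = x"
  by (simp add: BijGroup_def)

lemma \<Gamma>_closed: "\<one>\<^bsub>BijGroup U\<^esub> \<in> \<Gamma>" "\<gamma> \<in> \<Gamma> \<Longrightarrow> \<delta> \<in> \<Gamma> \<Longrightarrow> \<gamma> \<odot> \<delta> \<in> \<Gamma>" "\<gamma> \<in> \<Gamma> \<Longrightarrow> gi \<gamma> \<in> \<Gamma>"
  using subgroup.one_closed[OF sub_\<Gamma>] subgroup.m_closed[OF sub_\<Gamma>] subgroup.m_inv_closed[OF sub_\<Gamma>] by auto

lemma \<Gamma>_carrier: "\<gamma> \<in> \<Gamma> \<Longrightarrow> \<gamma> \<in> carrier (BijGroup U)"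
  using subgroup.mem_carrier[OF sub_\<Gamma>] .

lemma gi_mul: "\<gamma> \<in> \<Gamma> \<Longrightarrow> gi \<gamma> \<odot> \<gamma> = \<one>\<^bsub>BijGroup U\<^esub>" "\<gamma> \<in> \<Gamma> \<Longrightarrow> \<gamma> \<odot> gi \<gamma> = \<one>\<^bsub>BijGroup U\<^esub>"
  using group.l_inv[OF group_BijGroup \<Gamma>_carrier] group.r_inv[OF group_BijGroup \<Gamma>_carrier] by auto

lemma gi_apply: "\<gamma> \<in> \<Gamma> \<Longrightarrow> x \<in> U \<Longrightarrow> gi \<gamma> (\<gamma> x) = x" "\<gamma> \<in> \<Gamma> \<Longrightarrow> x \<in> U \<Longrightarrow> \<gamma> (gi \<gamma> x) = x"
  using mul_apply[of "gi \<gamma>" \<gamma> x] mul_apply[of \<gamma> "gi \<gamma>" x] gi_mul[of \<gamma>] one_apply[of x] \<Gamma>_closed(3)[of \<gamma>] by auto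

lemma smooth_coord: "\<gamma> \<in> \<Gamma> \<Longrightarrow> j < n \<Longrightarrow> smooth_fun n U (\<lambda>x. \<gamma> x j)"
  using smooth_\<Gamma> by (auto simp: smooth_map_def)

lemma dif_\<Gamma>: "\<gamma> \<in> \<Gamma> \<Longrightarrow> dif n U U \<gamma> (gi \<gamma>)"
  unfolding dif_def using open_U \<Gamma>_into gi_apply \<Gamma>_closed(3) smooth_coord by auto

lemma orbit_eq: "orbit (chart_group U \<Gamma>) (\<lambda>\<gamma>. \<gamma>) x = (\<lambda>\<gamma>. \<gamma> x) ` \<Gamma>"
  by (auto simp: orbit_def chart_group_def)

lemma \<phi>_eq_iff:
  assumes "x \<in> U" "y \<in> U" shows "\<phi> x = \<phi> y \<longleftrightarrow> (\<exists>\<gamma>\<in>\<Gamma>. y = \<gamma> x)"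
proof
  assume eq: "\<phi> x = \<phi> y"
  let ?o = "orbit (chart_group U \<Gamma>) (\<lambda>\<gamma>. \<gamma>)"
  obtain h where h: "homeomorphic_map (orbit_space n U \<Gamma>) (subtopology X (\<phi> ` U)) h" "\<forall>x\<in>U. h (?o x) = \<phi> x"
    using chart by (auto simp: orbifold_chart_def)
  have "topspace (orbit_space n U \<Gamma>) = ?o ` U"
    using quotient_map_quotient_topology[of "subtopology (Euclidean_space n) U" ?o, THEN quotient_imp_surjective_map] U_Esp
    by (simp add: orbit_space_def inf.absorb2)
  moreover have "inj_on h (topspace (orbit_space n U \<Gamma>))" using h(1) by (simp add: homeomorphic_eq_everything_map)
  ultimately have inj: "inj_on h (?o ` U)" by simp
  have "h (?o x) = h (?o y)" using h(2) eq assms by simp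
  then have "?o x = ?o y" by (rule inj_onD[OF inj]) (use assms in blast)+
  moreover have "y \<in> ?o y" unfolding orbit_eq using one_apply[OF assms(2)] \<Gamma>_closed(1) by (metis image_eqI)
  ultimately show "\<exists>\<gamma>\<in>\<Gamma>. y = \<gamma> x" unfolding orbit_eq by blast
next
  assume "\<exists>\<gamma>\<in>\<Gamma>. y = \<gamma> x" then show "\<phi> x = \<phi> y" using \<phi>_inv assms by auto
qed

lemma \<phi>_continuous: "continuous_map (top_of_set U) X \<phi>"
proof -
  let ?o = "orbit (chart_group U \<Gamma>) (\<lambda>\<gamma>. \<gamma>)"
  obtain h where h: "homeomorphic_map (orbit_space n U \<Gamma>) (subtopology X (\<phi> ` U)) h" "\<forall>x\<in>U. h (?o x) = \<phi> x"
    using chart by (auto simp: orbifold_chart_def)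
  have "continuous_map (subtopology (Euclidean_space n) U) (orbit_space n U \<Gamma>) ?o"
    unfolding orbit_space_def by (rule quotient_imp_continuous_map[OF quotient_map_quotient_topology])
  moreover have "continuous_map (orbit_space n U \<Gamma>) X h"
    using homeomorphic_imp_continuous_map[OF h(1)] by (simp add: continuous_map_in_subtopology)
  ultimately have "continuous_map (subtopology (Euclidean_space n) U) X (h \<circ> ?o)"
    by (rule continuous_map_compose)
  then have "continuous_map (top_of_set U) X (h \<circ> ?o)" by (simp add: subtopology_Euclidean_space[OF U_Esp])
  then show ?thesis by (rule continuous_map_eq) (use h(2) in auto)
qed

lemma \<phi>_preimage_open:
  assumes "openin X N" shows "openin (Euclidean_space n) {x \<in> U. \<phi> x \<in> N}"
proof -
  have "openin (top_of_set U) {x \<in> U. \<phi> x \<in> N}"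
    using openin_continuous_map_preimage[OF \<phi>_continuous assms] by simp
  then have "openin (subtopology (Euclidean_space n) U) {x \<in> U. \<phi> x \<in> N}"
    by (simp add: subtopology_Euclidean_space[OF U_Esp])
  then show ?thesis using openin_open_subtopology[OF open_U] by blast
qed

text \<open>The preimage in \<open>U\<close> of the image of \<open>P\<close> in the orbit space is
  the union of the translates of \<open>P\<close>, open because the elements of \<Gamma> are
  diffeomorphisms.\<close>

lemma \<phi>_open:
  assumes P: "openin (Euclidean_space n) P" "P \<subseteq> U" shows "openin X (\<phi> ` P)"
proof -
  let ?o = "orbit (chart_group U \<Gamma>) (\<lambda>\<gamma>. \<gamma>)"
  obtain h where h: "homeomorphic_map (orbit_space n U \<Gamma>) (subtopology X (\<phi> ` U)) h" "\<forall>x\<in>U. h (?o x) = \<phi> x"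
    using chart by (auto simp: orbifold_chart_def)
  have "{x \<in> U. ?o x \<in> ?o ` P} = (\<Union>\<gamma>\<in>\<Gamma>. \<gamma> ` P)"
  proof (intro subset_antisym subsetI)
    fix x assume "x \<in> {x \<in> U. ?o x \<in> ?o ` P}"
    then obtain y where y: "x \<in> U" "y \<in> P" "?o x = ?o y" by auto
    have "x \<in> ?o x" unfolding orbit_eq using one_apply[OF y(1)] \<Gamma>_closed(1) by (metis image_eqI)
    then have "x \<in> ?o y" using y(3) by simp
    then show "x \<in> (\<Union>\<gamma>\<in>\<Gamma>. \<gamma> ` P)" unfolding orbit_eq using y(2) by blast
  next
    fix x assume "x \<in> (\<Union>\<gamma>\<in>\<Gamma>. \<gamma> ` P)"
    then obtain \<gamma> y where y: "\<gamma> \<in> \<Gamma>" "y \<in> P" "x = \<gamma> y" by auto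
    have yU: "y \<in> U" using y(2) P(2) by auto
    have "?o x = ?o y"
      unfolding orbit_eq
    proof (intro subset_antisym image_subsetI)
      fix \<delta> assume d: "\<delta> \<in> \<Gamma>"
      show "\<delta> x \<in> (\<lambda>\<gamma>. \<gamma> y) ` \<Gamma>"
        using mul_apply[OF d y(1) yU] \<Gamma>_closed(2)[OF d y(1)] y(3) by (metis image_eqI)
      have "(\<delta> \<odot> gi \<gamma>) x = \<delta> y"
        using mul_apply[OF d \<Gamma>_closed(3)[OF y(1)]] gi_apply(1)[OF y(1) yU] y(3) \<Gamma>_into[OF y(1) yU] by simp
      then show "\<delta> y \<in> (\<lambda>\<gamma>. \<gamma> x) ` \<Gamma>"
        using \<Gamma>_closed(2)[OF d \<Gamma>_closed(3)[OF y(1)]] by (metis image_eqI)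
    qed
    then show "x \<in> {x \<in> U. ?o x \<in> ?o ` P}" using y yU \<Gamma>_into by auto
  qed
  moreover have "openin (Euclidean_space n) (\<Union>\<gamma>\<in>\<Gamma>. \<gamma> ` P)"
    using dif_image_open[OF dif_\<Gamma> P] by auto
  ultimately have "openin (Euclidean_space n) {x \<in> U. ?o x \<in> ?o ` P}" by simp
  then have "openin (subtopology (Euclidean_space n) U) {x \<in> U. ?o x \<in> ?o ` P}"
    by (simp add: openin_open_subtopology[OF open_U] Collect_restrict)
  then have "openin (orbit_space n U \<Gamma>) (?o ` P)"
    unfolding orbit_space_def openin_quotient_topology using P(2) U_Esp
    by (simp add: inf.absorb2 image_mono)
  then have "openin (subtopology X (\<phi> ` U)) (h ` ?o ` P)"
    using homeomorphic_imp_open_map[OF h(1)] by (simp add: open_map_def)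
  moreover have "h ` ?o ` P = \<phi> ` P" using h(2) P(2) by (auto simp: image_iff subset_iff)
  ultimately show ?thesis using openin_open_subtopology[OF open_image] by simp
qed

end

section \<open>Smooth functions on an orbifold\<close>

locale orbifold_ctx =
  fixes X :: "'a topology" and n :: nat and \<A> :: "'a chart set"
  assumes orb: "orbifold X n \<A>"
begin

abbreviation F where "F \<equiv> orbifold_smooth X n \<A>"

lemma Hausdorff_X: "Hausdorff_space X" using orb by (simp add: orbifold_def)

lemma atlas: "orbifold_atlas X n \<A>" using orb by (simp add: orbifold_def maximal_atlas_def)

lemma chart_in: "(U, \<Gamma>, \<phi>) \<in> \<A> \<Longrightarrow> orb_chart X n U \<Gamma> \<phi>"
  using atlas[unfolded orbifold_atlas_def, THEN conjunct1, rule_format] by (rule orb_chart.intro)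

lemma cover: "x \<in> topspace X \<Longrightarrow> \<exists>U \<Gamma> \<phi>. (U, \<Gamma>, \<phi>) \<in> \<A> \<and> x \<in> \<phi> ` U"
proof -
  assume "x \<in> topspace X"
  then have "x \<in> (\<Union>c\<in>\<A>. chart_image c)" using atlas by (simp add: orbifold_atlas_def)
  then obtain c where "c \<in> \<A>" "x \<in> chart_image c" by (elim UN_E)
  then show ?thesis by (cases c) (auto simp: chart_image_def)
qed

lemma dif_of_embedding:
  assumes l: "smooth_embedding n W V l" and W: "openin (Euclidean_space n) W" and V: "V \<subseteq> Esp n"
  shows "dif n W (l ` W) l (inv_into W l)"
proof (rule dif_of_smooth_inj[OF W])
  have lV: "l ` W \<subseteq> V" using l unfolding smooth_embedding_def smooth_map_def by auto
  then show "l ` W \<subseteq> Esp n" using V by auto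
  show "smooth_fun n W (\<lambda>x. l x j)" if "j < n" for j
    using l that unfolding smooth_embedding_def smooth_map_def by auto
  have "inj_on l (topspace (subtopology (Euclidean_space n) W))"
    using l unfolding smooth_embedding_def embedding_map_def by (auto simp: homeomorphic_eq_everything_map)
  then show "inj_on l W" using openin_subset[OF W] by (simp add: inf.absorb2)
  show "v = (\<lambda>_. 0)" if "x \<in> W" "v \<in> Esp n" "\<And>j. j < n \<Longrightarrow> (\<Sum>i<n. partial_deriv i (\<lambda>y. l y j) x * v i) = 0" for x v
    using l that unfolding smooth_embedding_def by blast
qed

text \<open>A common chart embeds into both charts, but its point over \<open>\<phi> u\<close> lands
  only in the orbits of \<open>u\<close> and \<open>v\<close>. Correcting both embeddings by group
  elements makes it hit \<open>u\<close> and \<open>v\<close> exactly.\<close>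

lemma transition:
  assumes c: "(U, \<Gamma>, \<phi>) \<in> \<A>" and d: "(V, \<Delta>, \<psi>) \<in> \<A>" and uv: "u \<in> U" "v \<in> V" "\<phi> u = \<psi> v"
  shows "\<exists>P Q f g. dif n P Q f g \<and> P \<subseteq> U \<and> Q \<subseteq> V \<and> u \<in> P \<and> f u = v \<and> (\<forall>y\<in>P. \<psi> (f y) = \<phi> y)"
proof -
  interpret c: orb_chart X n U \<Gamma> \<phi> by (rule chart_in[OF c])
  interpret d: orb_chart X n V \<Delta> \<psi> by (rule chart_in[OF d])
  obtain \<W> where \<W>: "\<forall>w\<in>\<W>. orbifold_chart X n w \<and> chart_embeds n w (U, \<Gamma>, \<phi>) \<and> chart_embeds n w (V, \<Delta>, \<psi>)"
     "(\<Union>w\<in>\<W>. chart_image w) = chart_image (U, \<Gamma>, \<phi>) \<inter> chart_image (V, \<Delta>, \<psi>)"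
    using atlas[unfolded orbifold_atlas_def, THEN conjunct2, THEN conjunct2, rule_format, OF c d] by (elim exE conjE)
  have "\<phi> u \<in> chart_image (U, \<Gamma>, \<phi>) \<inter> chart_image (V, \<Delta>, \<psi>)"
    using imageI[OF uv(1), of \<phi>] imageI[OF uv(2), of \<psi>] uv(3) by (simp add: chart_image_def)
  then obtain w where w: "w \<in> \<W>" "\<phi> u \<in> chart_image w" using \<W>(2) by blast
  obtain W \<Theta> \<omega> where weq: "w = (W, \<Theta>, \<omega>)" by (cases w)
  interpret w: orb_chart X n W \<Theta> \<omega> using \<W>(1) w(1) weq by unfold_locales auto
  obtain w0 where w0: "w0 \<in> W" "\<omega> w0 = \<phi> u" using w(2) weq by (auto simp: chart_image_def)
  obtain k where k: "smooth_embedding n W U k" "\<forall>x\<in>W. \<phi> (k x) = \<omega> x"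
    using \<W>(1) w(1) weq by (auto simp: chart_embeds_def)
  obtain l where l: "smooth_embedding n W V l" "\<forall>x\<in>W. \<psi> (l x) = \<omega> x"
    using \<W>(1) w(1) weq by (auto simp: chart_embeds_def)
  have kU: "k ` W \<subseteq> U" using k(1) unfolding smooth_embedding_def smooth_map_def by auto
  have lV: "l ` W \<subseteq> V" using l(1) unfolding smooth_embedding_def smooth_map_def by auto
  have dk: "dif n W (k ` W) k (inv_into W k)" by (rule dif_of_embedding[OF k(1) w.open_U c.U_Esp])
  have dl: "dif n W (l ` W) l (inv_into W l)" by (rule dif_of_embedding[OF l(1) w.open_U d.U_Esp])
  obtain \<gamma> where \<gamma>: "\<gamma> \<in> \<Gamma>" "u = \<gamma> (k w0)" using c.\<phi>_eq_iff[of "k w0" u] k(2) w0 kU uv(1) by auto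
  obtain \<delta> where \<delta>: "\<delta> \<in> \<Delta>" "v = \<delta> (l w0)" using d.\<phi>_eq_iff[of "l w0" v] l(2) w0 lV uv by auto
  have dk': "dif n W (\<gamma> ` k ` W) (\<lambda>x. \<gamma> (k x)) (\<lambda>x. inv_into W k (c.gi \<gamma> x))"
    by (rule dif_trans[OF dk dif_restrict[OF c.dif_\<Gamma>[OF \<gamma>(1)] difD(2)[OF dk] kU]])
  have dl': "dif n W (\<delta> ` l ` W) (\<lambda>x. \<delta> (l x)) (\<lambda>x. inv_into W l (d.gi \<delta> x))"
    by (rule dif_trans[OF dl dif_restrict[OF d.dif_\<Gamma>[OF \<delta>(1)] difD(2)[OF dl] lV]])
  let ?f = "\<lambda>y. \<delta> (l (inv_into W k (c.gi \<gamma> y)))"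
  have D: "dif n (\<gamma> ` k ` W) (\<delta> ` l ` W) ?f (\<lambda>y. \<gamma> (k (inv_into W l (d.gi \<delta> y))))"
    by (rule dif_trans[OF dif_sym[OF dk'] dl'])
  have fk: "?f (\<gamma> (k x)) = \<delta> (l x)" if "x \<in> W" for x using difD(4)[OF dk' that] by simp
  have "\<psi> (?f y) = \<phi> y" if "y \<in> \<gamma> ` k ` W" for y
  proof -
    obtain x where x: "x \<in> W" "y = \<gamma> (k x)" using \<open>y \<in> \<gamma> ` k ` W\<close> by auto
    have "\<psi> (?f y) = \<psi> (l x)" using fk[OF x(1)] x d.\<phi>_inv[OF \<delta>(1)] lV by auto
    also have "\<dots> = \<phi> (k x)" using k(2) l(2) x(1) by simp
    also have "\<dots> = \<phi> y" using c.\<phi>_inv[OF \<gamma>(1)] x kU by auto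
    finally show ?thesis .
  qed
  moreover have "\<gamma> ` k ` W \<subseteq> U" using c.\<Gamma>_into[OF \<gamma>(1)] kU by blast
  moreover have "\<delta> ` l ` W \<subseteq> V" using d.\<Gamma>_into[OF \<delta>(1)] lV by blast
  moreover have "u \<in> \<gamma> ` k ` W" using \<gamma>(2) w0(1) by blast
  moreover have "?f u = v" using fk[OF w0(1)] \<gamma>(2) \<delta>(2) by simp
  ultimately show ?thesis using D by blast
qed

lemma F_pull: "f \<in> F \<Longrightarrow> (U, \<Gamma>, \<phi>) \<in> \<A> \<Longrightarrow> smooth_fun n U (\<lambda>x. f (\<phi> x))"
  unfolding orbifold_smooth_def comp_def by blast

lemma F_ext: "f \<in> F \<Longrightarrow> f \<in> extensional (topspace X)"
  unfolding orbifold_smooth_def by blast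

text \<open>\<open>F\<close> asks for smoothness in all charts of the atlas; transition maps reduce
  this to one chart around each point.\<close>

lemma F_local:
  assumes ext: "g \<in> extensional (topspace X)"
    and loc: "\<And>x. x \<in> topspace X \<Longrightarrow> \<exists>U \<Gamma> \<phi> u P. (U, \<Gamma>, \<phi>) \<in> \<A> \<and> u \<in> P \<and> \<phi> u = x \<and> P \<subseteq> U \<and>
       openin (Euclidean_space n) P \<and> smooth_fun n P (\<lambda>y. g (\<phi> y))"
  shows "g \<in> F"
proof -
  have "smooth_fun n V (g \<circ> \<psi>)" if d: "(V, \<Delta>, \<psi>) \<in> \<A>" for V \<Delta> \<psi>
  proof -
    interpret d: orb_chart X n V \<Delta> \<psi> by (rule chart_in[OF d])
    show ?thesis
    proof (rule smooth_fun_local[OF _ d.open_U])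
      fix v assume v: "v \<in> V"
      obtain U \<Gamma> \<phi> u P where P: "(U, \<Gamma>, \<phi>) \<in> \<A>" "u \<in> P" "\<phi> u = \<psi> v" "P \<subseteq> U"
        "openin (Euclidean_space n) P" "smooth_fun n P (\<lambda>y. g (\<phi> y))"
        using loc[OF d.\<phi>_into[OF v]] by blast
      have "u \<in> U" using P by auto
      from transition[OF d P(1) v this P(3)[symmetric]] obtain P' Q f f' where
        t: "dif n P' Q f f'" "P' \<subseteq> V" "Q \<subseteq> U" "v \<in> P'" "f v = u" "\<forall>y\<in>P'. \<phi> (f y) = \<psi> y" by blast
      let ?W = "{y \<in> P'. f y \<in> P}"
      have W: "openin (Euclidean_space n) ?W"
        by (rule openin_Euclidean_preimage[OF difD(1)[OF t(1)] dif_continuous[OF t(1)] P(5)])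
           (use difD(8,9)[OF t(1)] in simp)
      have "smooth_fun n ?W (\<lambda>y. g (\<phi> (f y)))"
      proof (rule smooth_fun_compose[OF W P(5) _ _ P(6)])
        show "smooth_fun n ?W (\<lambda>x. f x j)" if "j < n" for j
          using smooth_fun_subset[OF difD(10)[OF t(1) that] W _ difD(7)[OF t(1)]] by blast
      qed auto
      then have "smooth_fun n ?W (g \<circ> \<psi>)"
        by (rule smooth_fun_cong[OF W]) (use t(6) in auto)
      then show "\<exists>W. openin (Euclidean_space n) W \<and> v \<in> W \<and> smooth_fun n W (g \<circ> \<psi>)"
        using W t(4,5) P(2) by blast
    qed
  qed
  then show ?thesis using ext unfolding orbifold_smooth_def by blast
qed

end

section \<open>Linearisation of a chart at a point\<close>

definition mv :: "nat \<Rightarrow> (nat \<Rightarrow> nat \<Rightarrow> real) \<Rightarrow> (nat \<Rightarrow> real) \<Rightarrow> nat \<Rightarrow> real" where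
  "mv n M v = (\<lambda>k. if k < n then \<Sum>i<n. M k i * v i else 0)"

lemma mv_Esp: "mv n M v \<in> Esp n"
  by (simp add: mv_def Esp_iff)

lemma mv_cong: "(\<And>k i. k < n \<Longrightarrow> i < n \<Longrightarrow> M k i = N k i) \<Longrightarrow> mv n M v = mv n N v"
  by (auto simp: mv_def fun_eq_iff intro!: sum.cong)

lemma mv_mult: "mv n (\<lambda>k i. \<Sum>j<n. M k j * N j i) v = mv n M (mv n N v)"
proof
  fix k
  have "(\<Sum>i<n. (\<Sum>j<n. M k j * N j i) * v i) = (\<Sum>j<n. M k j * (\<Sum>i<n. N j i * v i))"
    unfolding sum_distrib_right sum_distrib_left by (subst sum.swap) (simp add: mult.assoc)
  then show "mv n (\<lambda>k i. \<Sum>j<n. M k j * N j i) v k = mv n M (mv n N v) k" by (simp add: mv_def)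
qed

lemma mv_lin: "mv n M (\<lambda>i. a * v i + b * w i) = (\<lambda>i. a * mv n M v i + b * mv n M w i)"
  by (auto simp: mv_def fun_eq_iff sum.distrib sum_distrib_left algebra_simps)

lemma mv_sum: "mv n M (\<lambda>i. (\<Sum>s\<in>I. w s i) / c) k = (\<Sum>s\<in>I. mv n M (w s) k) / c"
proof (cases "k < n")
  case True
  have "(\<Sum>i<n. M k i * ((\<Sum>s\<in>I. w s i) / c)) = (\<Sum>s\<in>I. \<Sum>i<n. M k i * w s i) / c"
    unfolding sum_divide_distrib sum_distrib_left by (subst sum.swap) simp
  then show ?thesis using True by (simp add: mv_def)
qed (simp add: mv_def)

lemma smooth_fun_mv:
  assumes "openin (Euclidean_space m) P" "\<And>i. i < n \<Longrightarrow> smooth_fun m P (\<lambda>x. v x i)"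
  shows "smooth_fun m P (\<lambda>x. mv n M (v x) k)"
  by (cases "k < n") (auto simp: mv_def intro!: smooth_fun_intros assms)

text \<open>With S the sum of the absolute values of the \<open>d i\<close>, every
  \<open>d k\<close> is at most S / (2 (n + 1)). Summing over \<open>k < n\<close> gives S at most S
  / 2, so S = 0. The rows of \<open>M\<close> may come from different points, as the mean value
  theorem supplies them.\<close>

lemma near_id_zero:
  fixes M :: "nat \<Rightarrow> nat \<Rightarrow> real"
  assumes z: "\<And>k. k < n \<Longrightarrow> (\<Sum>i<n. M k i * d i) = 0"
    and c: "\<And>k i. k < n \<Longrightarrow> i < n \<Longrightarrow> \<bar>M k i - (if k = i then 1 else 0)\<bar> \<le> 1 / (2 * (real n + 1))"
    and i: "i < n"
  shows "d i = 0"
proof -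
  define S where "S = (\<Sum>i<n. \<bar>d i\<bar>)"
  have "\<bar>d k\<bar> \<le> S / (2 * (real n + 1))" if k: "k < n" for k
  proof -
    have "(\<Sum>i<n. ((if k = i then 1 else 0) - M k i) * d i) = (\<Sum>i<n. (if k = i then d i else 0)) - (\<Sum>i<n. M k i * d i)"
      unfolding sum_subtractf[symmetric] by (intro sum.cong) (auto simp: algebra_simps)
    also have "\<dots> = d k" using z[OF k] k by simp
    finally have "\<bar>d k\<bar> = \<bar>\<Sum>i<n. ((if k = i then 1 else 0) - M k i) * d i\<bar>" by simp
    also have "\<dots> \<le> (\<Sum>i<n. \<bar>((if k = i then 1 else 0) - M k i) * d i\<bar>)" by (rule sum_abs)
    also have "\<dots> \<le> (\<Sum>i<n. 1 / (2 * (real n + 1)) * \<bar>d i\<bar>)"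
      unfolding abs_mult using c[OF k] by (intro sum_mono mult_right_mono) (auto simp: abs_minus_commute)
    also have "\<dots> = S / (2 * (real n + 1))" unfolding S_def sum_distrib_left[symmetric] by simp
    finally show ?thesis .
  qed
  then have "S \<le> (\<Sum>k<n. S / (2 * (real n + 1)))" unfolding S_def by (intro sum_mono) (auto simp: S_def)
  also have "\<dots> = S * (real n / (2 * (real n + 1)))" by simp
  finally have le: "S * (1 - real n / (2 * (real n + 1))) \<le> 0" by (simp add: algebra_simps)
  have "1 - real n / (2 * (real n + 1)) > 0" by (simp add: field_simps)
  then have "S \<le> 0" using le by (simp add: mult_le_0_iff not_le)
  moreover have "\<bar>d i\<bar> \<le> S" unfolding S_def using i by (intro member_le_sum) auto
  ultimately show ?thesis by linarith
qed

lemma openin_preimage_real: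
  fixes f :: "(nat \<Rightarrow> real) \<Rightarrow> real"
  assumes P: "openin (Euclidean_space n) P" and f: "continuous_on P f" and Q: "open Q"
  shows "openin (Euclidean_space n) {x \<in> P. f x \<in> Q}"
proof -
  obtain T' where T': "open T'" "P = Esp n \<inter> T'" using P unfolding openin_Euclidean_open by (elim exE conjE)
  have "openin (top_of_set P) (P \<inter> f -` Q)" using continuous_openin_preimage_gen[OF f Q] .
  then obtain T'' where T'': "open T''" "P \<inter> f -` Q = P \<inter> T''" unfolding openin_open by (elim exE conjE)
  have "{x \<in> P. f x \<in> Q} = Esp n \<inter> (T' \<inter> T'')" using T'' T'(2) by blast
  then show ?thesis unfolding openin_Euclidean_open using open_Int[OF T'(1) T''(1)] by metis
qed

lemma openin_smooth_less:
  assumes P: "openin (Euclidean_space n) P" and f: "smooth_fun n P f"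
  shows "openin (Euclidean_space n) {x \<in> P. f x < c}" "openin (Euclidean_space n) {x \<in> P. \<bar>f x - a\<bar> < c}"
proof -
  note fc = smooth_fun_continuous_on[OF f openin_subset[OF P]]
  show "openin (Euclidean_space n) {x \<in> P. f x < c}"
    using openin_preimage_real[OF P fc, of "{..<c}"] by simp
  show "openin (Euclidean_space n) {x \<in> P. \<bar>f x - a\<bar> < c}"
    using openin_preimage_real[OF P fc, of "ball a c"] by (simp add: dist_real_def abs_minus_commute)
qed

lemma openin_Collect_ball:
  assumes "finite I" "openin T P" "\<And>i. i \<in> I \<Longrightarrow> openin T {x \<in> P. Q i x}"
  shows "openin T {x \<in> P. \<forall>i\<in>I. Q i x}"
  using assms(1,3)
proof (induction I rule: finite_induct)
  case empty
  then show ?case using assms(2) by simp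
next
  case (insert i I)
  have "{x \<in> P. \<forall>i\<in>insert i I. Q i x} = {x \<in> P. Q i x} \<inter> {x \<in> P. \<forall>i\<in>I. Q i x}" by auto
  then show ?case using insert by auto
qed

section \<open>The stabiliser of a point, its derivative action and equivariant coordinates\<close>

locale orb_pt = orb_chart +
  fixes u assumes u: "u \<in> U"
begin

definition G where "G = {\<gamma> \<in> \<Gamma>. \<gamma> u = u}"

definition A where "A \<gamma> = mv n (jac \<gamma> u)"

text \<open>An invariant positive definite quadratic form, the squared norm summed over the group.
  Its sublevel sets serve as invariant balls.\<close>

definition qG where "qG v = (\<Sum>\<gamma>\<in>G. \<Sum>k<n. (A \<gamma> v k)\<^sup>2)"

lemma G_\<Gamma>: "\<gamma> \<in> G \<Longrightarrow> \<gamma> \<in> \<Gamma>" and G_fix: "\<gamma> \<in> G \<Longrightarrow> \<gamma> u = u"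
  by (auto simp: G_def)

lemma finite_G: "finite G" using finite_\<Gamma> by (simp add: G_def)

lemma G_closed: "\<one>\<^bsub>BijGroup U\<^esub> \<in> G" "\<gamma> \<in> G \<Longrightarrow> \<delta> \<in> G \<Longrightarrow> \<gamma> \<odot> \<delta> \<in> G" "\<gamma> \<in> G \<Longrightarrow> gi \<gamma> \<in> G"
proof -
  show "\<one>\<^bsub>BijGroup U\<^esub> \<in> G" using \<Gamma>_closed(1) one_apply[OF u] by (simp add: G_def)
  show "\<gamma> \<odot> \<delta> \<in> G" if "\<gamma> \<in> G" "\<delta> \<in> G" using \<Gamma>_closed(2) mul_apply u that by (simp add: G_def)
  show "gi \<gamma> \<in> G" if "\<gamma> \<in> G"
  proof -
    have "gi \<gamma> (\<gamma> u) = u" using gi_apply(1)[OF G_\<Gamma>[OF that] u] .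
    then show ?thesis using \<Gamma>_closed(3) that by (simp add: G_def)
  qed
qed

lemma card_G: "card G > 0"
  using finite_G G_closed(1) by (auto simp: card_gt_0_iff)

lemma reindex_G: assumes "\<delta> \<in> G"
  shows "(\<Sum>\<gamma>\<in>G. f (\<gamma> \<odot> \<delta>)) = (\<Sum>\<gamma>\<in>G. f \<gamma>)" "(\<Sum>\<gamma>\<in>G. f (\<delta> \<odot> \<gamma>)) = (\<Sum>\<gamma>\<in>G. f \<gamma>)"
proof -
  interpret B: group "BijGroup U" by (rule group_BijGroup)
  have c: "\<gamma> \<in> G \<Longrightarrow> \<gamma> \<in> carrier (BijGroup U)" for \<gamma> using \<Gamma>_carrier G_\<Gamma> by blast
  show "(\<Sum>\<gamma>\<in>G. f (\<gamma> \<odot> \<delta>)) = (\<Sum>\<gamma>\<in>G. f \<gamma>)"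
    by (rule sum.reindex_bij_witness[where i = "\<lambda>\<gamma>. \<gamma> \<odot> gi \<delta>" and j = "\<lambda>\<gamma>. \<gamma> \<odot> \<delta>"])
       (use assms c G_closed in \<open>auto simp: B.m_assoc\<close>)
  show "(\<Sum>\<gamma>\<in>G. f (\<delta> \<odot> \<gamma>)) = (\<Sum>\<gamma>\<in>G. f \<gamma>)"
    by (rule sum.reindex_bij_witness[where i = "\<lambda>\<gamma>. gi \<delta> \<odot> \<gamma>" and j = "\<lambda>\<gamma>. \<delta> \<odot> \<gamma>"])
       (use assms c G_closed in \<open>auto simp: B.m_assoc[symmetric]\<close>)
qed

lemma gi_split: "\<gamma> \<in> G \<Longrightarrow> \<delta> \<in> G \<Longrightarrow> \<delta> \<odot> gi (\<gamma> \<odot> \<delta>) = gi \<gamma>"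
proof -
  interpret B: group "BijGroup U" by (rule group_BijGroup)
  have c: "\<gamma> \<in> G \<Longrightarrow> \<gamma> \<in> carrier (BijGroup U)" for \<gamma> using \<Gamma>_carrier G_\<Gamma> by blast
  assume "\<gamma> \<in> G" "\<delta> \<in> G"
  then show ?thesis using c[of \<gamma>] c[of \<delta>] by (simp add: B.inv_mult_group B.m_assoc[symmetric])
qed

lemma jac_mul:
  assumes g: "\<gamma> \<in> G" "\<delta> \<in> G" and k: "k < n" "i < n"
  shows "jac (\<gamma> \<odot> \<delta>) u k i = (\<Sum>j<n. jac \<gamma> u k j * jac \<delta> u j i)"
proof -
  have "((\<lambda>t. \<gamma> (\<delta> (u(i := t))) k) has_real_derivative
     (\<Sum>j<n. partial_deriv j (\<lambda>y. \<gamma> y k) (\<delta> (u(i := u i))) * jac \<delta> u j i)) (at (u i))"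
  proof (rule smooth_fun_chain_curve[OF open_U smooth_coord[OF G_\<Gamma>[OF g(1)] k(1)]])
    show "\<delta> (u(i := u i)) \<in> U" using \<Gamma>_into[OF G_\<Gamma>[OF g(2)] u] by simp
    show "((\<lambda>s. \<delta> (u(i := s)) j) has_real_derivative jac \<delta> u j i) (at (u i))" if "j < n" for j
      unfolding jac_def by (rule smooth_funD(1)[OF smooth_coord[OF G_\<Gamma>[OF g(2)] that] k(2) u])
    show "\<forall>\<^sub>F s in at (u i). \<delta> (u(i := s)) \<in> Esp n"
      unfolding eventually_at_filter
      by (rule eventually_mono[OF eventually_fun_upd_in[OF open_U u k(2)]])
         (use \<Gamma>_into[OF G_\<Gamma>[OF g(2)]] U_Esp in blast)
  qed
  then have "((\<lambda>t. \<gamma> (\<delta> (u(i := t))) k) has_real_derivative (\<Sum>j<n. jac \<gamma> u k j * jac \<delta> u j i)) (at (u i))"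
    by (simp add: jac_def G_fix[OF g(2)])
  then have "((\<lambda>t. (\<gamma> \<odot> \<delta>) (u(i := t)) k) has_real_derivative (\<Sum>j<n. jac \<gamma> u k j * jac \<delta> u j i)) (at (u i))"
    by (subst has_derivative_cong_open[OF open_U u k(2), where g = "\<lambda>y. \<gamma> (\<delta> y) k"])
       (simp add: mul_apply[OF G_\<Gamma>[OF g(1)] G_\<Gamma>[OF g(2)]])
  then have "partial_deriv i (\<lambda>y. (\<gamma> \<odot> \<delta>) y k) u = (\<Sum>j<n. jac \<gamma> u k j * jac \<delta> u j i)"
    unfolding partial_deriv_def by (rule DERIV_imp_deriv)
  then show ?thesis by (simp only: jac_def)
qed

lemma jac_one: assumes k: "k < n" "i < n" shows "jac \<one>\<^bsub>BijGroup U\<^esub> u k i = (if k = i then 1 else 0)"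
proof -
  have "((\<lambda>t. (u(i := t)) k) has_real_derivative (if k = i then 1 else 0)) (at (u i))" by simp
  then have "((\<lambda>t. \<one>\<^bsub>BijGroup U\<^esub> (u(i := t)) k) has_real_derivative (if k = i then 1 else 0)) (at (u i))"
    by (subst has_derivative_cong_open[OF open_U u k(2), where g = "\<lambda>y. y k"]) (simp add: one_apply)
  then have "partial_deriv i (\<lambda>y. \<one>\<^bsub>BijGroup U\<^esub> y k) u = (if k = i then 1 else 0)"
    unfolding partial_deriv_def by (rule DERIV_imp_deriv)
  then show ?thesis by (simp only: jac_def)
qed

lemma A_Esp: "A \<gamma> v \<in> Esp n" by (simp add: A_def mv_Esp)

lemma A_mul: "\<gamma> \<in> G \<Longrightarrow> \<delta> \<in> G \<Longrightarrow> A (\<gamma> \<odot> \<delta>) v = A \<gamma> (A \<delta> v)"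
  unfolding A_def mv_mult[symmetric] by (rule mv_cong) (rule jac_mul)

lemma A_one: "v \<in> Esp n \<Longrightarrow> A \<one>\<^bsub>BijGroup U\<^esub> v = v"
proof -
  assume v: "v \<in> Esp n"
  have "A \<one>\<^bsub>BijGroup U\<^esub> v = mv n (\<lambda>k i. if k = i then 1 else 0) v"
    unfolding A_def by (rule mv_cong) (rule jac_one)
  also have "\<dots> = v"
  proof
    fix k
    have "(\<Sum>i<n. (if k = i then 1 else 0) * v i) = (\<Sum>i<n. if k = i then v i else 0)"
      by (intro sum.cong) auto
    then show "mv n (\<lambda>k i. if k = i then 1 else 0) v k = v k"
      using v by (auto simp: mv_def Esp_iff)
  qed
  finally show ?thesis .
qed

lemma A_lin: "A \<gamma> (\<lambda>i. a * v i + b * w i) = (\<lambda>i. a * A \<gamma> v i + b * A \<gamma> w i)"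
  unfolding A_def by (rule mv_lin)

lemma A_zero: "A \<gamma> (\<lambda>_. 0) = (\<lambda>_. 0)"
  by (auto simp: A_def mv_def)

lemma reindex_right: "\<delta> \<in> G \<Longrightarrow> (\<Sum>\<gamma>\<in>G. f (A \<gamma> (A \<delta> v))) = (\<Sum>\<gamma>\<in>G. f (A \<gamma> v))"
  using reindex_G(1)[of \<delta> "\<lambda>\<gamma>. f (A \<gamma> v)"] by (simp add: A_mul cong: sum.cong)

lemma reindex_left: "\<delta> \<in> G \<Longrightarrow> (\<Sum>\<gamma>\<in>G. f (A \<delta> (A \<gamma> v))) = (\<Sum>\<gamma>\<in>G. f (A \<gamma> v))"
  using reindex_G(2)[of \<delta> "\<lambda>\<gamma>. f (A \<gamma> v)"] by (simp add: A_mul cong: sum.cong)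

lemma qG_inv: "\<delta> \<in> G \<Longrightarrow> qG (A \<delta> v) = qG v"
  unfolding qG_def by (rule reindex_right)

lemma qG_ge: assumes "v \<in> Esp n" shows "(\<Sum>k<n. (v k)\<^sup>2) \<le> qG v"
proof -
  have "(\<Sum>k<n. (A \<one>\<^bsub>BijGroup U\<^esub> v k)\<^sup>2) \<le> qG v"
    unfolding qG_def using finite_G G_closed(1) by (intro member_le_sum[of _ G "\<lambda>\<gamma>. \<Sum>k<n. (A \<gamma> v k)\<^sup>2"] sum_nonneg) auto
  then show ?thesis using A_one[OF assms] by simp
qed

lemma qG_nonneg: "0 \<le> qG v"
  unfolding qG_def by (intro sum_nonneg) auto

lemma qG_zero: "qG (\<lambda>_. 0) = 0"
  by (simp add: qG_def A_zero)

lemma qG_eq_0: assumes "v \<in> Esp n" "qG v = 0" shows "v = (\<lambda>_. 0)"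
proof (rule Esp_ext[OF assms(1)])
  show "(\<lambda>_. 0) \<in> Esp n" by (simp add: Esp_iff)
  fix k assume "k < n"
  then have "(v k)\<^sup>2 \<le> (\<Sum>k<n. (v k)\<^sup>2)" by (intro member_le_sum) auto
  then have "(v k)\<^sup>2 \<le> 0" using qG_ge[OF assms(1)] assms(2) by linarith
  then show "v k = 0" by simp
qed

lemma smooth_A: "openin (Euclidean_space m) P \<Longrightarrow> (\<And>i. i < n \<Longrightarrow> smooth_fun m P (\<lambda>x. v x i)) \<Longrightarrow> smooth_fun m P (\<lambda>x. A \<gamma> (v x) k)"
  unfolding A_def by (rule smooth_fun_mv)

lemma smooth_qG: "openin (Euclidean_space m) P \<Longrightarrow> (\<And>i. i < n \<Longrightarrow> smooth_fun m P (\<lambda>x. v x i)) \<Longrightarrow> smooth_fun m P (\<lambda>x. qG (v x))"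
  unfolding qG_def by (intro smooth_fun_sum smooth_fun_power smooth_A)

lemma open_Esp: "openin (Euclidean_space n) (Esp n)" by simp

lemma open_qG_ball: "openin (Euclidean_space n) {v \<in> Esp n. qG v < r}"
  by (rule openin_smooth_less(1)[OF open_Esp smooth_qG[OF open_Esp smooth_fun_coord[OF open_Esp]]])

lemma qG_ball_box:
  assumes "0 < e" shows "{v \<in> Esp n. qG v < e\<^sup>2} \<subseteq> obx n (\<lambda>_. 0) e"
proof
  fix v assume v: "v \<in> {v \<in> Esp n. qG v < e\<^sup>2}"
  have "\<bar>v k\<bar> < e" if "k < n" for k
  proof -
    have "(v k)\<^sup>2 \<le> (\<Sum>k<n. (v k)\<^sup>2)" using that by (intro member_le_sum) auto
    then have "\<bar>v k\<bar>\<^sup>2 < e\<^sup>2" using qG_ge[of v] v by (auto simp: power2_abs)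
    then show ?thesis using assms by (meson less_imp_le power_less_imp_less_base)
  qed
  then show "v \<in> obx n (\<lambda>_. 0) e" using v by (auto simp: obx_def)
qed

text \<open>Bochner's linearisation: the average over the stabiliser of the inverse derivative
  applied to the displacement. It is equivariant and its derivative at \<open>u\<close> is the
  identity.\<close>

definition Tm where "Tm y = (\<lambda>k. (\<Sum>\<gamma>\<in>G. A (gi \<gamma>) (\<lambda>j. \<gamma> y j - u j) k) / card G)"

lemma Tm_equivariant: assumes d: "\<delta> \<in> G" and y: "y \<in> U" shows "Tm (\<delta> y) = A \<delta> (Tm y)"
proof
  fix k
  have "(\<Sum>\<gamma>\<in>G. A (gi \<gamma>) (\<lambda>j. \<gamma> (\<delta> y) j - u j) k) = (\<Sum>\<gamma>\<in>G. A \<delta> (A (gi (\<gamma> \<odot> \<delta>)) (\<lambda>j. (\<gamma> \<odot> \<delta>) y j - u j)) k)"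
  proof (intro sum.cong refl)
    fix \<gamma> assume g: "\<gamma> \<in> G"
    have "A \<delta> (A (gi (\<gamma> \<odot> \<delta>)) (\<lambda>j. (\<gamma> \<odot> \<delta>) y j - u j)) = A (gi \<gamma>) (\<lambda>j. (\<gamma> \<odot> \<delta>) y j - u j)"
      using A_mul[OF d G_closed(3)[OF G_closed(2)[OF g d]]] gi_split[OF g d] by simp
    then show "A (gi \<gamma>) (\<lambda>j. \<gamma> (\<delta> y) j - u j) k = A \<delta> (A (gi (\<gamma> \<odot> \<delta>)) (\<lambda>j. (\<gamma> \<odot> \<delta>) y j - u j)) k"
      using mul_apply[OF G_\<Gamma>[OF g] G_\<Gamma>[OF d] y] by simp
  qed
  also have "\<dots> = (\<Sum>\<gamma>\<in>G. A \<delta> (A (gi \<gamma>) (\<lambda>j. \<gamma> y j - u j)) k)"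
    by (rule reindex_G(1)[OF d])
  finally show "Tm (\<delta> y) k = A \<delta> (Tm y) k"
    unfolding Tm_def A_def[of \<delta>] mv_sum by simp
qed

lemma Tm_Esp: "Tm y \<in> Esp n"
  using A_Esp by (auto simp: Tm_def Esp_iff)

lemma Tm_u: "Tm u = (\<lambda>_. 0)"
  by (auto simp: Tm_def G_fix A_zero)

lemma Tm_smooth: "smooth_fun n U (\<lambda>y. Tm y k)"
  unfolding Tm_def divide_inverse
  by (intro smooth_fun_mult smooth_fun_sum smooth_fun_const smooth_A smooth_fun_diff open_U smooth_coord G_\<Gamma>)

lemma Tm_jac: assumes k: "k < n" "i < n" shows "jac Tm u k i = (if k = i then 1 else 0)"
proof -
  have "((\<lambda>t. Tm (u(i := t)) k) has_real_derivative
      (\<Sum>\<gamma>\<in>G. \<Sum>j<n. jac (gi \<gamma>) u k j * (jac \<gamma> u j i - 0)) / card G) (at (u i))"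
    unfolding Tm_def A_def mv_def using k(1)
    apply (simp only: if_True)
    apply (intro DERIV_cdivide DERIV_sum DERIV_cmult DERIV_diff DERIV_const)
    unfolding jac_def by (rule smooth_funD(1)[OF smooth_coord[OF G_\<Gamma>] k(2) u]) auto
  also have "(\<Sum>\<gamma>\<in>G. \<Sum>j<n. jac (gi \<gamma>) u k j * (jac \<gamma> u j i - 0)) / card G = (\<Sum>\<gamma>\<in>G. if k = i then 1 else 0) / card G"
  proof (intro arg_cong2[where f = "(/)"] sum.cong refl)
    fix \<gamma> assume g: "\<gamma> \<in> G"
    have "(\<Sum>j<n. jac (gi \<gamma>) u k j * (jac \<gamma> u j i - 0)) = jac (gi \<gamma> \<odot> \<gamma>) u k i"
      using jac_mul[OF G_closed(3)[OF g] g k] by simp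
    then show "(\<Sum>j<n. jac (gi \<gamma>) u k j * (jac \<gamma> u j i - 0)) = (if k = i then 1 else 0)"
      using gi_mul(1)[OF G_\<Gamma>[OF g]] jac_one[OF k] by simp
  qed
  also have "\<dots> = (if k = i then 1 else 0)" using card_G by auto
  finally have "partial_deriv i (\<lambda>y. Tm y k) u = (if k = i then 1 else 0)"
    unfolding partial_deriv_def by (rule DERIV_imp_deriv)
  then show ?thesis by (simp only: jac_def)
qed

text \<open>An element outside \<open>G\<close> moves \<open>u\<close> in some coordinate by three
  times \<open>d \<gamma>\<close>. If both \<open>y\<close> and its image lay in the neighbourhood,
  this distance would be less than two times \<open>d \<gamma>\<close>.\<close>

lemma separating_nbhd:
  "\<exists>P. openin (Euclidean_space n) P \<and> u \<in> P \<and> P \<subseteq> U \<and> (\<forall>\<gamma>\<in>\<Gamma> - G. \<forall>y\<in>P. \<gamma> y \<notin> P)"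
proof -
  have "\<exists>i<n. \<gamma> u i \<noteq> u i" if "\<gamma> \<in> \<Gamma> - G" for \<gamma>
  proof (rule ccontr)
    assume "\<not> (\<exists>i<n. \<gamma> u i \<noteq> u i)"
    then have "\<gamma> u = u" using Esp_ext[of "\<gamma> u" n u] \<Gamma>_into[of \<gamma> u] that u U_Esp by blast
    then show False using that by (auto simp: G_def)
  qed
  then have "\<forall>\<gamma>\<in>\<Gamma> - G. \<exists>i. i < n \<and> \<gamma> u i \<noteq> u i" by blast
  from bchoice[OF this] obtain c where c: "\<forall>\<gamma>\<in>\<Gamma> - G. c \<gamma> < n \<and> \<gamma> u (c \<gamma>) \<noteq> u (c \<gamma>)" ..
  define d where "d \<gamma> = \<bar>\<gamma> u (c \<gamma>) - u (c \<gamma>)\<bar> / 3" for \<gamma>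
  have d: "d \<gamma> > 0" if "\<gamma> \<in> \<Gamma> - G" for \<gamma> using c that by (simp add: d_def)
  let ?Q = "\<lambda>\<gamma> y. \<bar>y (c \<gamma>) - u (c \<gamma>)\<bar> < d \<gamma> \<and> \<bar>\<gamma> y (c \<gamma>) - \<gamma> u (c \<gamma>)\<bar> < d \<gamma>"
  let ?P = "{y \<in> U. \<forall>\<gamma>\<in>\<Gamma> - G. ?Q \<gamma> y}"
  have "openin (Euclidean_space n) ?P"
  proof (rule openin_Collect_ball)
    fix \<gamma> assume g: "\<gamma> \<in> \<Gamma> - G"
    have "{x \<in> U. ?Q \<gamma> x} = {x \<in> U. \<bar>x (c \<gamma>) - u (c \<gamma>)\<bar> < d \<gamma>} \<inter> {x \<in> U. \<bar>\<gamma> x (c \<gamma>) - \<gamma> u (c \<gamma>)\<bar> < d \<gamma>}" by auto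
    then show "openin (Euclidean_space n) {x \<in> U. ?Q \<gamma> x}"
      using openin_smooth_less(2)[OF open_U smooth_fun_coord[OF open_U], of "c \<gamma>" "u (c \<gamma>)" "d \<gamma>"]
        openin_smooth_less(2)[OF open_U smooth_coord, of \<gamma> "c \<gamma>" "\<gamma> u (c \<gamma>)" "d \<gamma>"] c g by auto
  qed (use finite_\<Gamma> open_U in auto)
  moreover have "u \<in> ?P" using u d by auto
  moreover have "\<gamma> y \<notin> ?P" if g: "\<gamma> \<in> \<Gamma> - G" and y: "y \<in> ?P" for \<gamma> y
  proof
    assume "\<gamma> y \<in> ?P"
    then have "\<bar>\<gamma> y (c \<gamma>) - u (c \<gamma>)\<bar> < d \<gamma>" "\<bar>\<gamma> y (c \<gamma>) - \<gamma> u (c \<gamma>)\<bar> < d \<gamma>" using g y by auto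
    moreover have "\<bar>\<gamma> u (c \<gamma>) - u (c \<gamma>)\<bar> \<le> \<bar>\<gamma> y (c \<gamma>) - u (c \<gamma>)\<bar> + \<bar>\<gamma> y (c \<gamma>) - \<gamma> u (c \<gamma>)\<bar>"
      by linarith
    moreover have "a < D / 3 \<Longrightarrow> b < D / 3 \<Longrightarrow> D \<le> a + b \<Longrightarrow> 0 < D / 3 \<Longrightarrow> False" for a b D :: real by linarith
    ultimately show False using d[OF g] unfolding d_def by blast
  qed
  ultimately show ?thesis by blast
qed

text \<open>A slice at \<open>u\<close>: an invariant ball on which \<open>G\<close> acts linearly,
  and in which only elements of \<open>G\<close> can identify points, so that \<phi> on
  \<open>B\<close> is the quotient by \<open>G\<close> alone.\<close>

definition lin_chart where
  "lin_chart r B S \<longleftrightarrow> r > 0 \<and> dif n B {v \<in> Esp n. qG v < r} Tm S \<and> B \<subseteq> U \<and> S (\<lambda>_. 0) = u \<and>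
     (\<forall>\<gamma>\<in>G. \<forall>v\<in>Esp n. qG v < r \<longrightarrow> \<gamma> (S v) = S (A \<gamma> v)) \<and>
     (\<forall>\<gamma>\<in>\<Gamma>. \<forall>v\<in>Esp n. \<forall>w\<in>Esp n. qG v < r \<longrightarrow> qG w < r \<longrightarrow> \<gamma> (S v) = S w \<longrightarrow> \<gamma> \<in> G)"

text \<open>On a small box the Jacobian of \<open>Tm\<close> is so close to the identity that the
  mean value theorem makes \<open>Tm\<close> injective and \<open>near_id_zero\<close> makes it an
  immersion. The box is then shrunk to an invariant set and finally to the preimage of a ball of
  \<open>qG\<close>.\<close>

proposition lin_chart_exists: "\<exists>r B S. lin_chart r B S"
proof -
  obtain P where P: "openin (Euclidean_space n) P" "u \<in> P" "P \<subseteq> U" "\<forall>\<gamma>\<in>\<Gamma> - G. \<forall>y\<in>P. \<gamma> y \<notin> P"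
    using separating_nbhd by blast
  define eps where "eps = 1 / (2 * (real n + 1))"
  have eps: "eps > 0" by (simp add: eps_def)
  have js: "smooth_fun n U (\<lambda>y. jac Tm y k i)" if "i < n" for k i
    unfolding jac_def by (rule smooth_funD(2)[OF Tm_smooth that])
  let ?O = "{y \<in> U. \<forall>(k, i)\<in>{..<n} \<times> {..<n}. \<bar>jac Tm y k i - (if k = i then 1 else 0)\<bar> < eps}"
  have "openin (Euclidean_space n) ?O"
  proof (rule openin_Collect_ball)
    fix p assume "p \<in> {..<n} \<times> {..<n}"
    then obtain k i where p: "p = (k, i)" "i < n" by auto
    show "openin (Euclidean_space n) {y \<in> U. case p of (k, i) \<Rightarrow> \<bar>jac Tm y k i - (if k = i then 1 else 0)\<bar> < eps}"
      unfolding p(1) prod.case by (rule openin_smooth_less(2)[OF open_U js[OF p(2)]])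
  qed (auto intro: open_U)
  then have "openin (Euclidean_space n) (?O \<inter> P)" using P(1) by blast
  moreover have "u \<in> ?O \<inter> P" using u Tm_jac eps P(2) by auto
  ultimately obtain e where e: "e > 0" "cbx n u e \<subseteq> ?O \<inter> P" using open_contains_cbx[of n "?O \<inter> P" u] by blast
  have cU: "cbx n u e \<subseteq> U" using e(2) by blast
  have jb: "\<bar>jac Tm y k i - (if k = i then 1 else 0)\<bar> \<le> eps" if "y \<in> cbx n u e" "k < n" "i < n" for y k i
  proof -
    have "y \<in> ?O" using e(2) that(1) by blast
    then have "\<bar>jac Tm y k i - (if k = i then 1 else 0)\<bar> < eps" using that(2,3) by blast
    then show ?thesis by simp
  qed
  have inj: "y = z" if y: "y \<in> cbx n u e" and z: "z \<in> cbx n u e" and eq: "Tm y = Tm z" for y z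
  proof -
    have "\<exists>\<xi>. (\<forall>i<n. \<xi> i \<in> cbx n u e \<and> (\<forall>j<n. \<xi> i j \<in> closed_segment (z j) (y j))) \<and>
            Tm y k - Tm z k = (\<Sum>i<n. partial_deriv i (\<lambda>y. Tm y k) (\<xi> i) * (y i - z i))" (is "\<exists>\<xi>. ?R k \<xi>") for k
      by (rule mvt_cbx[OF cU y z]) (rule smooth_funD(1)[OF Tm_smooth])
    have "\<exists>\<xi>. (\<forall>i<n. \<xi> i \<in> cbx n u e) \<and> (\<Sum>i<n. jac Tm (\<xi> i) k i * (y i - z i)) = 0" for k
    proof -
      obtain \<xi> where "?R k \<xi>" using \<open>\<And>k. \<exists>\<xi>. ?R k \<xi>\<close>[of k] ..
      then show ?thesis unfolding jac_def using eq by (intro exI[of _ \<xi>]) auto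
    qed
    then have "\<forall>k. \<exists>\<xi>. (\<forall>i<n. \<xi> i \<in> cbx n u e) \<and> (\<Sum>i<n. jac Tm (\<xi> i) k i * (y i - z i)) = 0" by (rule allI)
    from choice[OF this] obtain \<xi> where \<xi>: "\<forall>k. (\<forall>i<n. \<xi> k i \<in> cbx n u e) \<and> (\<Sum>i<n. jac Tm (\<xi> k i) k i * (y i - z i)) = 0" ..
    have "y i - z i = 0" if i: "i < n" for i
      by (rule near_id_zero[where M = "\<lambda>k i. jac Tm (\<xi> k i) k i" and d = "\<lambda>i. y i - z i", OF _ _ i])
         (use \<xi> jb in \<open>auto simp: eps_def\<close>)
    then show "y = z" using Esp_ext[of y n z] y z by (auto simp: cbx_def)
  qed
  define Q where "Q = obx n u e"
  have Qc: "Q \<subseteq> cbx n u e" unfolding Q_def by (rule obx_subset_cbx)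
  have Qo: "openin (Euclidean_space n) Q" unfolding Q_def by (rule openin_obx)
  have uQ: "u \<in> Q" unfolding Q_def using u U_Esp e(1) by (intro obx_self) auto
  have QP: "Q \<subseteq> P" using Qc e(2) by blast
  have QU: "Q \<subseteq> U" using Qc cU by blast
  \<comment> \<open>The largest \<open>G\<close>-invariant part of the box; it is open because
    \<open>G\<close> is finite.\<close>
  define B' where "B' = {y \<in> Q. \<forall>\<gamma>\<in>G. \<gamma> y \<in> Q}"
  have B'o: "openin (Euclidean_space n) B'"
    unfolding B'_def
  proof (rule openin_Collect_ball[OF finite_G Qo])
    fix \<gamma> assume g: "\<gamma> \<in> G"
    show "openin (Euclidean_space n) {x \<in> Q. \<gamma> x \<in> Q}"
      using continuous_on_subset[OF dif_continuous[OF dif_\<Gamma>[OF G_\<Gamma>[OF g]]] QU] \<Gamma>_into[OF G_\<Gamma>[OF g]] QU U_Esp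
      by (intro openin_Euclidean_preimage[OF Qo _ Qo]) blast+
  qed
  have uB': "u \<in> B'" using uQ by (auto simp: B'_def G_fix)
  have B'Q: "B' \<subseteq> Q" by (auto simp: B'_def)
  have B'G: "\<gamma> y \<in> B'" if g: "\<gamma> \<in> G" and y: "y \<in> B'" for \<gamma> y
  proof -
    have yU: "y \<in> U" using y B'Q QU by auto
    have "\<delta> (\<gamma> y) \<in> Q" if d: "\<delta> \<in> G" for \<delta>
      using y G_closed(2)[OF d g] mul_apply[OF G_\<Gamma>[OF d] G_\<Gamma>[OF g] yU] by (force simp: B'_def)
    then show ?thesis using y g by (auto simp: B'_def)
  qed
  have D: "dif n B' (Tm ` B') Tm (inv_into B' Tm)"
  proof (rule dif_of_smooth_inj[OF B'o])
    show "Tm ` B' \<subseteq> Esp n" using Tm_Esp by auto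
    show "smooth_fun n B' (\<lambda>x. Tm x j)" if "j < n" for j
      using smooth_fun_subset[OF Tm_smooth B'o _ U_Esp] B'Q QU by blast
    show "inj_on Tm B'" using inj B'Q Qc by (intro inj_onI) blast
    fix x v assume x: "x \<in> B'" and v: "v \<in> Esp n" and z: "\<And>j. j < n \<Longrightarrow> (\<Sum>i<n. partial_deriv i (\<lambda>y. Tm y j) x * v i) = 0"
    have xc: "x \<in> cbx n u e" using x B'Q Qc by blast
    have "v i = 0" if "i < n" for i
      by (rule near_id_zero[where M = "jac Tm x" and d = v, OF _ _ that])
         (use z jb[OF xc] in \<open>auto simp: jac_def eps_def\<close>)
    then show "v = (\<lambda>_. 0)" using v by (auto simp: Esp_iff fun_eq_iff) (metis not_le)
  qed
  have zB: "(\<lambda>_. 0) \<in> Tm ` B'" using Tm_u uB' by (metis image_eqI)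
  obtain e' where e': "e' > 0" "cbx n (\<lambda>_. 0) e' \<subseteq> Tm ` B'" using open_contains_cbx[OF difD(2)[OF D] zB] by blast
  \<comment> \<open>The form \<open>qG\<close> dominates the squared norm, so this ball lies in the
    box of size \<open>e'\<close>.\<close>
  define r where "r = e'\<^sup>2"
  define V where "V = {v \<in> Esp n. qG v < r}"
  define S where "S = inv_into B' Tm"
  have VB: "V \<subseteq> Tm ` B'" using qG_ball_box[OF e'(1)] obx_subset_cbx e'(2) unfolding V_def r_def by blast
  have Vo: "openin (Euclidean_space n) V" unfolding V_def by (rule open_qG_ball)
  have VA: "A \<gamma> v \<in> V" if "\<gamma> \<in> G" "v \<in> V" for \<gamma> v using that by (simp add: V_def A_Esp qG_inv)
  have DS: "dif n (S ` V) V Tm S"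
    using dif_sym[OF dif_restrict[OF dif_sym[OF D] Vo VB]] by (simp add: S_def)
  have SB: "S v \<in> B'" if "v \<in> V" for v using difD(5)[OF D] VB that by (auto simp: S_def)
  have TS: "Tm (S v) = v" if "v \<in> V" for v using difD(6)[OF DS that] .
  have "lin_chart r (S ` V) S"
    unfolding lin_chart_def V_def[symmetric]
  proof (intro conjI ballI impI)
    show "r > 0" using e'(1) by (simp add: r_def)
    show "dif n (S ` V) V Tm S" by (rule DS)
    show "S ` V \<subseteq> U" using SB B'Q QU by blast
    show "S (\<lambda>_. 0) = u" unfolding S_def using difD(4)[OF D uB'] Tm_u by simp
    fix \<gamma> v assume g: "\<gamma> \<in> G" and v: "v \<in> Esp n" "qG v < r"
    then have vV: "v \<in> V" by (simp add: V_def)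
    have "Tm (\<gamma> (S v)) = A \<gamma> v" using Tm_equivariant[OF g] SB[OF vV] B'Q QU TS[OF vV] by auto
    then show "\<gamma> (S v) = S (A \<gamma> v)"
      using difD(4)[OF D B'G[OF g SB[OF vV]]] by (simp add: S_def)
  next
    fix \<gamma> v w assume g: "\<gamma> \<in> \<Gamma>" and "v \<in> Esp n" "w \<in> Esp n" "qG v < r" "qG w < r" and eq: "\<gamma> (S v) = S w"
    then have vV: "v \<in> V" "w \<in> V" by (auto simp: V_def)
    then have "S v \<in> P" "S w \<in> P" using SB B'Q QP by blast+
    moreover have "\<gamma> (S v) \<notin> P" if "\<gamma> \<notin> G"
      using bspec[OF bspec[OF P(4), of \<gamma>] \<open>S v \<in> P\<close>] that g by blast
    ultimately show "\<gamma> \<in> G" using eq by auto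
  qed
  then show ?thesis by blast
qed

end

section \<open>Bump functions\<close>

lemma real_smooth_coinduct:
  assumes "P f" and d: "\<And>f. P f \<Longrightarrow> \<exists>f'. P f' \<and> (\<forall>t. (f has_real_derivative f' t) (at t))"
  shows "f \<in> real_smooth"
proof -
  have *: "P ((deriv ^^ k) f)" for k
  proof (induction k)
    case (Suc k)
    obtain f' where f': "P f'" "\<forall>t. ((deriv ^^ k) f has_real_derivative f' t) (at t)" using d[OF Suc] by blast
    then have "deriv ((deriv ^^ k) f) = f'" by (auto simp: fun_eq_iff DERIV_imp_deriv)
    then show ?case using f'(1) by simp
  qed (simp add: assms(1))
  show ?thesis
    unfolding real_smooth_def using d[OF *] real_differentiable_def by blast
qed

definition ebump :: "real \<Rightarrow> real" where "ebump t = (if t \<le> 0 then 0 else exp (- 1 / t))"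

lemma ebump_pos: "t > 0 \<Longrightarrow> ebump t > 0" and ebump_nonneg: "ebump t \<ge> 0" and ebump_zero: "t \<le> 0 \<Longrightarrow> ebump t = 0"
  by (auto simp: ebump_def)

text \<open>For positive t put s = 1 / t. Functions q(s) exp(-s) with polynomial q, extended by 0,
  are closed under differentiation: q becomes \<open>s\<^sup>2\<close> times the difference of q and
  its derivative. At t = 0 the exponential beats the polynomial.\<close>

lemma ebump_smooth: "ebump \<in> real_smooth"
proof (rule real_smooth_coinduct[where P = "\<lambda>f. \<exists>q. f = (\<lambda>t. if t \<le> 0 then 0 else poly q (1 / t) * exp (- 1 / t))"])
  show "\<exists>q. ebump = (\<lambda>t. if t \<le> 0 then 0 else poly q (1 / t) * exp (- 1 / t))"
    by (rule exI[of _ 1]) (auto simp: ebump_def fun_eq_iff)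
  fix f :: "real \<Rightarrow> real"
  assume "\<exists>q. f = (\<lambda>t. if t \<le> 0 then 0 else poly q (1 / t) * exp (- 1 / t))"
  then obtain q where f: "f = (\<lambda>t. if t \<le> 0 then 0 else poly q (1 / t) * exp (- 1 / t))" by (elim exE)
  define q' where "q' = [:0, 0, 1:] * (q - pderiv q)"
  let ?f' = "\<lambda>t. if t \<le> 0 then 0 else poly q' (1 / t) * exp (- 1 / t)"
  have "(f has_real_derivative ?f' t) (at t)" for t
  proof -
    consider "t > 0" | "t < 0" | "t = 0" by linarith
    then show ?thesis
    proof cases
      case 1
      have "((\<lambda>t. poly q (1 / t) * exp (- 1 / t)) has_real_derivative ?f' t) (at t)"
        using 1 by (auto intro!: derivative_eq_intros DERIV_chain'[where g = "poly q"] simp: q'_def field_simps power2_eq_square)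
      moreover have ev: "\<forall>\<^sub>F x in nhds t. poly q (1 / x) * exp (- 1 / x) = f x"
        using eventually_nhds_in_open[of "{0<..}" t] 1 by (auto simp: f elim!: eventually_mono)
      ultimately show ?thesis using DERIV_cong_ev[OF refl ev refl] by simp
    next
      case 2
      have "((\<lambda>t. 0::real) has_real_derivative ?f' t) (at t)" using 2 by simp
      moreover have ev: "\<forall>\<^sub>F x in nhds t. 0 = f x"
        using eventually_nhds_in_open[of "{..<0}" t] 2 by (auto simp: f elim!: eventually_mono)
      ultimately show ?thesis using DERIV_cong_ev[OF refl ev refl] by simp
    next
      case 3
      have mon: "((\<lambda>s::real. c * (s ^ k / exp s)) \<longlongrightarrow> 0) at_top" for c k
        using tendsto_mult[OF tendsto_const tendsto_power_div_exp_0, of c k] by simp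
      have "((\<lambda>s. \<Sum>k\<le>Polynomial.degree q. Polynomial.coeff q k * (s ^ Suc k / exp s)) \<longlongrightarrow> (\<Sum>k\<le>Polynomial.degree q. 0)) at_top"
        by (intro tendsto_sum mon)
      moreover have "(\<Sum>k\<le>Polynomial.degree q. Polynomial.coeff q k * (s ^ Suc k / exp s)) = poly q s * s * exp (- s)" for s
        by (simp add: poly_altdef sum_distrib_right sum_distrib_left exp_minus field_simps)
      ultimately have "((\<lambda>s. poly q s * s * exp (- s)) \<longlongrightarrow> 0) at_top" by simp
      from filterlim_compose[OF this filterlim_inverse_at_top_right]
      have R: "((\<lambda>y. poly q (inverse y) * inverse y * exp (- inverse y)) \<longlongrightarrow> 0) (at_right 0)" .
      have "((\<lambda>y. (f y - f 0) / (y - 0)) \<longlongrightarrow> 0) (at_right 0)"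
        by (rule Lim_transform_eventually[OF R])
           (auto simp: f eventually_at_filter divide_inverse intro!: always_eventually)
      moreover have "((\<lambda>y. (f y - f 0) / (y - 0)) \<longlongrightarrow> 0) (at_left 0)"
        by (rule Lim_transform_eventually[OF tendsto_const])
           (auto simp: f eventually_at_filter intro!: always_eventually)
      ultimately have "((\<lambda>y. (f y - f 0) / (y - 0)) \<longlongrightarrow> 0) (at 0)"
        by (rule filterlim_split_at[rotated])
      then show ?thesis unfolding 3 has_field_derivative_iff by simp
    qed
  qed
  then show "\<exists>f'. (\<exists>q. f' = (\<lambda>t. if t \<le> 0 then 0 else poly q (1 / t) * exp (- 1 / t))) \<and>
      (\<forall>t. (f has_real_derivative f' t) (at t))"
    by (intro exI[of _ ?f'] conjI exI[of _ q'] refl allI)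
qed

definition plateau :: "real \<Rightarrow> real" where
  "plateau t = ebump (2 - t) / (ebump (2 - t) + ebump (t - 1))"

lemma plateau_denom: "ebump (2 - t) + ebump (t - 1) > 0"
  using ebump_pos[of "2 - t"] ebump_pos[of "t - 1"] ebump_nonneg[of "2 - t"] ebump_nonneg[of "t - 1"]
  by (cases "t < 2") auto

lemma plateau_1: "t \<le> 1 \<Longrightarrow> plateau t = 1"
  using plateau_denom[of t] by (simp add: plateau_def ebump_zero)

lemma plateau_0: "2 \<le> t \<Longrightarrow> plateau t = 0"
  by (simp add: plateau_def ebump_zero)

lemma plateau_nonneg: "0 \<le> plateau t"
  using plateau_denom[of t] ebump_nonneg by (simp add: plateau_def)

lemma plateau_smooth:
  assumes P: "openin (Euclidean_space n) P" and f: "smooth_fun n P f"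
  shows "smooth_fun n P (\<lambda>x. plateau (f x))"
  unfolding plateau_def
proof (rule smooth_fun_divide[OF P])
  show "ebump (2 - f x) + ebump (f x - 1) \<noteq> 0" for x using plateau_denom[of "f x"] by simp
qed (intro P smooth_fun_add smooth_fun_comp_real_smooth[where \<phi> = ebump] ebump_smooth smooth_fun_diff smooth_fun_const f)+

section \<open>The linear model of a chart\<close>

locale lin_model = orbifold_ctx X n \<A> + orb_pt X n U \<Gamma> \<phi> u for X n \<A> U \<Gamma> \<phi> u +
  fixes r B S
  assumes in_\<A>: "(U, \<Gamma>, \<phi>) \<in> \<A>" and lin: "lin_chart r B S"
begin

definition V where "V = {v \<in> Esp n. qG v < r}"

text \<open>The chart map in linear coordinates; its fibres on \<open>V\<close> are precisely the
  orbits of \<open>G\<close>.\<close>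

definition p where "p v = \<phi> (S v)"

lemma r_pos: "r > 0" and dif_BV: "dif n B V Tm S" and B_U: "B \<subseteq> U" and S_zero: "S (\<lambda>_. 0) = u"
  using lin by (auto simp: lin_chart_def V_def)

lemma V_Esp: "v \<in> V \<Longrightarrow> v \<in> Esp n" and V_iff: "v \<in> V \<longleftrightarrow> v \<in> Esp n \<and> qG v < r"
  by (auto simp: V_def)

lemma S_A: "\<gamma> \<in> G \<Longrightarrow> v \<in> V \<Longrightarrow> \<gamma> (S v) = S (A \<gamma> v)"
  using lin by (auto simp: lin_chart_def V_def)

lemma S_sep:
  assumes "\<gamma> \<in> \<Gamma>" "v \<in> V" "w \<in> V" "\<gamma> (S v) = S w" shows "\<gamma> \<in> G"
proof -
  have "\<forall>\<gamma>\<in>\<Gamma>. \<forall>v\<in>Esp n. \<forall>w\<in>Esp n. qG v < r \<longrightarrow> qG w < r \<longrightarrow> \<gamma> (S v) = S w \<longrightarrow> \<gamma> \<in> G"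
    using lin unfolding lin_chart_def by (elim conjE)
  from this[rule_format, OF assms(1) _ _ _ _ assms(4)] show ?thesis using assms(2,3) V_iff by simp
qed

lemma open_V: "openin (Euclidean_space n) V" by (rule difD(2)[OF dif_BV])

lemma V_sub: "V \<subseteq> Esp n" by (rule difD(8)[OF dif_BV])

lemma S_B: "v \<in> V \<Longrightarrow> S v \<in> B" by (rule difD(5)[OF dif_BV])

lemma S_U: "v \<in> V \<Longrightarrow> S v \<in> U" using S_B B_U by auto

lemma T_S: "v \<in> V \<Longrightarrow> Tm (S v) = v" by (rule difD(6)[OF dif_BV])

lemma S_inj: "v \<in> V \<Longrightarrow> w \<in> V \<Longrightarrow> S v = S w \<Longrightarrow> v = w" using T_S by metis

lemma A_V: "\<gamma> \<in> G \<Longrightarrow> v \<in> V \<Longrightarrow> A \<gamma> v \<in> V" by (simp add: V_iff A_Esp qG_inv)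

lemma zero_V: "(\<lambda>_. 0) \<in> V" using r_pos by (simp add: V_iff qG_zero Esp_iff)

lemma p_zero: "p (\<lambda>_. 0) = \<phi> u" by (simp add: p_def S_zero)

lemma p_into: "v \<in> V \<Longrightarrow> p v \<in> topspace X" by (simp add: p_def \<phi>_into S_U)

lemma p_inv: "\<gamma> \<in> G \<Longrightarrow> v \<in> V \<Longrightarrow> p (A \<gamma> v) = p v"
  using S_A[of \<gamma> v] \<phi>_inv[OF G_\<Gamma> S_U, of \<gamma> v] by (simp add: p_def)

lemma p_eqD:
  assumes "v \<in> V" "w \<in> V" "p v = p w" obtains \<gamma> where "\<gamma> \<in> G" "w = A \<gamma> v"
proof -
  obtain \<gamma> where g: "\<gamma> \<in> \<Gamma>" "S w = \<gamma> (S v)"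
    using \<phi>_eq_iff[OF S_U[OF assms(1)] S_U[OF assms(2)]] assms(3) unfolding p_def by blast
  have gG: "\<gamma> \<in> G" by (rule S_sep[OF g(1) assms(1,2) g(2)[symmetric]])
  have "S w = S (A \<gamma> v)" using S_A[OF gG assms(1)] g(2) by simp
  then have "w = A \<gamma> v" by (rule S_inj[OF assms(2) A_V[OF gG assms(1)]])
  with gG show ?thesis by (rule that)
qed

lemma stab_S:
  assumes v: "v \<in> V" shows "{\<gamma> \<in> \<Gamma>. \<gamma> (S v) = S v} = {\<gamma> \<in> G. A \<gamma> v = v}"
proof (intro subset_antisym subsetI)
  fix \<gamma> assume "\<gamma> \<in> {\<gamma> \<in> \<Gamma>. \<gamma> (S v) = S v}"
  then have g: "\<gamma> \<in> \<Gamma>" "\<gamma> (S v) = S v" by auto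
  have gG: "\<gamma> \<in> G" by (rule S_sep[OF g(1) v v g(2)])
  have "A \<gamma> v = v" using S_A[OF gG v] g(2) by (intro S_inj[OF A_V[OF gG v] v]) simp
  then show "\<gamma> \<in> {\<gamma> \<in> G. A \<gamma> v = v}" using gG by simp
next
  fix \<gamma> assume "\<gamma> \<in> {\<gamma> \<in> G. A \<gamma> v = v}"
  then show "\<gamma> \<in> {\<gamma> \<in> \<Gamma>. \<gamma> (S v) = S v}" using S_A[of \<gamma> v] v G_\<Gamma> by auto
qed

lemma S_image_open: "openin (Euclidean_space n) P \<Longrightarrow> P \<subseteq> V \<Longrightarrow> openin (Euclidean_space n) (S ` P)"
  by (rule dif_image_open[OF dif_sym[OF dif_BV]])

lemma p_open: "openin (Euclidean_space n) P \<Longrightarrow> P \<subseteq> V \<Longrightarrow> openin X (p ` P)"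
  using \<phi>_open[OF S_image_open] S_U by (force simp: p_def[abs_def] image_image)

lemma p_continuous: "continuous_map (top_of_set V) X p"
proof -
  have "continuous_map (top_of_set V) (top_of_set U) S"
    using dif_continuous[OF dif_sym[OF dif_BV]] S_U by (simp add: continuous_map_in_subtopology image_subset_iff_funcset Pi_iff)
  from continuous_map_compose[OF this \<phi>_continuous] show ?thesis by (simp add: comp_def p_def[abs_def])
qed

lemma p_preimage_open: assumes "openin X N" shows "openin (Euclidean_space n) {v \<in> V. p v \<in> N}"
proof -
  have "openin (top_of_set V) {v \<in> V. p v \<in> N}"
    using openin_continuous_map_preimage[OF p_continuous assms] by simp
  then have "openin (subtopology (Euclidean_space n) V) {v \<in> V. p v \<in> N}"
    by (simp add: subtopology_Euclidean_space[OF V_sub])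
  then show ?thesis using openin_open_subtopology[OF open_V] by blast
qed

lemma p_smooth: assumes "f \<in> F" shows "smooth_fun n V (\<lambda>v. f (p v))"
  unfolding p_def
  by (rule smooth_fun_compose[OF open_V open_U _ _ F_pull[OF assms in_\<A>]])
     (use S_U difD(10)[OF dif_sym[OF dif_BV]] in auto)

lemma smooth_V_qG: "smooth_fun n V qG"
  by (rule smooth_qG[OF open_V smooth_fun_coord[OF open_V]])

section \<open>Transfer of invariant functions from the linear model to X\<close>

lemma compact_qG: assumes "s < r" shows "compact {v \<in> Esp n. qG v \<le> s}"
proof -
  define e where "e = \<bar>s\<bar> + 1"
  have "e\<^sup>2 = s\<^sup>2 + 2 * \<bar>s\<bar> + 1" by (simp add: e_def power2_eq_square algebra_simps)
  then have "s < e\<^sup>2" using zero_le_power2[of s] by linarith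
  then have sub: "{v \<in> Esp n. qG v \<le> s} \<subseteq> cbx n (\<lambda>_. 0) e"
    using qG_ball_box[of e] obx_subset_cbx[of n "\<lambda>_. 0" e] by (force simp: e_def)
  have "continuous_on (cbx n (\<lambda>_. 0) e) qG"
    using smooth_fun_continuous_on[OF smooth_qG[OF open_Esp smooth_fun_coord[OF open_Esp]] order_refl]
    by (rule continuous_on_subset) (auto simp: cbx_def)
  then have "closedin (top_of_set (cbx n (\<lambda>_. 0) e)) (cbx n (\<lambda>_. 0) e \<inter> qG -` {..s})"
    by (rule continuous_closedin_preimage) simp
  then have "compact (cbx n (\<lambda>_. 0) e \<inter> qG -` {..s})"
    by (rule closedin_compact[OF compact_cbx])
  moreover have "cbx n (\<lambda>_. 0) e \<inter> qG -` {..s} = {v \<in> Esp n. qG v \<le> s}" using sub by (auto simp: cbx_def)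
  ultimately show ?thesis by simp
qed

text \<open>The image is compact, and X is Hausdorff. Extension by zero is smooth because the
  complement of this set is open.\<close>

lemma closed_p_ball: assumes "s < r" shows "closedin X (p ` {v \<in> Esp n. qG v \<le> s})"
proof -
  have sub: "{v \<in> Esp n. qG v \<le> s} \<subseteq> V" using assms by (auto simp: V_iff)
  have "compactin (top_of_set V) {v \<in> Esp n. qG v \<le> s}"
    using compact_qG[OF assms] sub by (simp add: compactin_subtopology)
  from image_compactin[OF this p_continuous] show ?thesis by (rule compactin_imp_closedin[OF Hausdorff_X])
qed

text \<open>The chosen preimage matters unless \<open>h\<close> is invariant; for invariant
  \<open>h\<close> this is the descended function, extended by zero.\<close>

definition push where "push h = (\<lambda>x\<in>topspace X. if x \<in> p ` V then h (SOME v. v \<in> V \<and> p v = x) else (0::real))"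

lemma push_p:
  assumes h: "\<And>\<gamma> v. \<gamma> \<in> G \<Longrightarrow> v \<in> V \<Longrightarrow> h (A \<gamma> v) = h v" and v: "v \<in> V"
  shows "push h (p v) = h v"
proof -
  let ?w = "SOME w. w \<in> V \<and> p w = p v"
  have w: "?w \<in> V \<and> p ?w = p v" by (rule someI[of "\<lambda>w. w \<in> V \<and> p w = p v" v]) (simp add: v)
  then obtain \<gamma> where "\<gamma> \<in> G" "?w = A \<gamma> v" using p_eqD[OF v, of ?w] by metis
  then have "h ?w = h v" using h v by metis
  then show ?thesis using v p_into[OF v] by (simp add: push_def)
qed

lemma push_outside: "x \<in> topspace X \<Longrightarrow> x \<notin> p ` V \<Longrightarrow> push h x = 0"
  by (simp add: push_def)

text \<open>X is covered by two open sets: the image of \<open>V\<close>, where the function pulls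
  back to \<open>h\<close> in linear coordinates, and the complement of the closed ball of radius
  \<open>s\<close>, where it vanishes.\<close>

lemma push_F:
  assumes h: "\<And>\<gamma> v. \<gamma> \<in> G \<Longrightarrow> v \<in> V \<Longrightarrow> h (A \<gamma> v) = h v" and sm: "smooth_fun n V h"
    and s: "s < r" and z: "\<And>v. v \<in> V \<Longrightarrow> s < qG v \<Longrightarrow> h v = 0"
  shows "push h \<in> F"
proof (rule F_local)
  show "push h \<in> extensional (topspace X)" by (simp add: push_def)
  fix x assume x: "x \<in> topspace X"
  show "\<exists>U \<Gamma> \<phi> u P. (U, \<Gamma>, \<phi>) \<in> \<A> \<and> u \<in> P \<and> \<phi> u = x \<and> P \<subseteq> U \<and>
       openin (Euclidean_space n) P \<and> smooth_fun n P (\<lambda>y. push h (\<phi> y))"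
  proof (cases "x \<in> p ` V")
    case True
    then obtain v where v: "v \<in> V" "x = p v" by auto
    have "smooth_fun n B (\<lambda>y. push h (\<phi> y))"
    proof (rule smooth_fun_cong[OF difD(1)[OF dif_BV] dif_smooth_comp[OF dif_BV sm]])
      fix y assume "y \<in> B"
      then have "Tm y \<in> V" "S (Tm y) = y" using difD(3,4)[OF dif_BV] by auto
      then show "push h (\<phi> y) = h (Tm y)" using push_p[of h "Tm y", OF h] by (simp add: p_def)
    qed
    then show ?thesis
      by (intro exI[of _ U] exI[of _ \<Gamma>] exI[of _ \<phi>] exI[of _ "S v"] exI[of _ B] conjI in_\<A> S_B[OF v(1)]
          B_U difD(1)[OF dif_BV]) (simp_all add: v(2) p_def)
  next
    case False
    obtain U' \<Gamma>' \<phi>' where c: "(U', \<Gamma>', \<phi>') \<in> \<A>" "x \<in> \<phi>' ` U'" using cover[OF x] by blast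
    then obtain u' where u': "u' \<in> U'" "\<phi>' u' = x" by auto
    interpret c: orb_chart X n U' \<Gamma>' \<phi>' by (rule chart_in[OF c(1)])
    let ?K = "p ` {v \<in> Esp n. qG v \<le> s}"
    let ?P = "{y \<in> U'. \<phi>' y \<in> topspace X - ?K}"
    have "openin X (topspace X - ?K)" using closed_p_ball[OF s] by blast
    then have P: "openin (Euclidean_space n) ?P" by (rule c.\<phi>_preimage_open)
    have "{v \<in> Esp n. qG v \<le> s} \<subseteq> V" using s by (auto simp: V_iff)
    then have "u' \<in> ?P" using u' x False by blast
    moreover have "smooth_fun n ?P (\<lambda>y. push h (\<phi>' y))"
    proof (rule smooth_fun_cong[OF P smooth_fun_const[OF P, of 0]])
      fix y assume y: "y \<in> ?P"
      show "push h (\<phi>' y) = 0"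
      proof (cases "\<phi>' y \<in> p ` V")
        case True
        then obtain v where v: "v \<in> V" "\<phi>' y = p v" by auto
        then have "s < qG v" using y V_Esp by (metis (no_types, lifting) DiffD2 image_eqI mem_Collect_eq not_le)
        then show ?thesis using push_p[of h v, OF h v(1)] z[OF v(1)] v(2) by simp
      next
        case False
        then show ?thesis using y push_outside by blast
      qed
    qed
    ultimately show ?thesis
      by (intro exI[of _ U'] exI[of _ \<Gamma>'] exI[of _ \<phi>'] exI[of _ u'] exI[of _ ?P] conjI c(1) u'(2) P) auto
  qed
qed

definition th where "th s v = plateau (qG v / s)"

lemma th_inv: "\<gamma> \<in> G \<Longrightarrow> th s (A \<gamma> v) = th s v" by (simp add: th_def qG_inv)
lemma th_1: "0 < s \<Longrightarrow> qG v \<le> s \<Longrightarrow> th s v = 1" by (simp add: th_def plateau_1)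
lemma th_0: "0 < s \<Longrightarrow> 2 * s \<le> qG v \<Longrightarrow> th s v = 0" by (simp add: th_def plateau_0 field_simps)
lemma th_nonneg: "0 \<le> th s v" by (simp add: th_def plateau_nonneg)

lemma th_smooth: "smooth_fun n V (th s)"
  unfolding th_def[abs_def] divide_inverse
  by (intro plateau_smooth[OF open_V] smooth_fun_mult[OF open_V] smooth_V_qG smooth_fun_const[OF open_V])

text \<open>Turns an invariant \<open>h\<close> into a function on all of X that keeps its values
  where \<open>qG\<close> is at most \<open>s\<close> and vanishes where \<open>qG\<close> is at
  least \<open>2 * s\<close>.\<close>

definition cut where "cut s h = push (\<lambda>v. h v * th s v)"

lemma
  assumes h: "\<And>\<gamma> v. \<gamma> \<in> G \<Longrightarrow> v \<in> V \<Longrightarrow> h (A \<gamma> v) = h v"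
  shows cut_p: "v \<in> V \<Longrightarrow> cut s h (p v) = h v * th s v"
    and cut_F: "smooth_fun n V h \<Longrightarrow> 0 < s \<Longrightarrow> 2 * s < r \<Longrightarrow> cut s h \<in> F"
    and cut_outside: "x \<in> topspace X \<Longrightarrow> x \<notin> p ` V \<Longrightarrow> cut s h x = 0"
proof -
  show "cut s h (p v) = h v * th s v" if "v \<in> V"
    unfolding cut_def by (rule push_p[of "\<lambda>v. h v * th s v", OF _ that]) (simp add: h th_inv)
  show "cut s h \<in> F" if "smooth_fun n V h" "0 < s" "2 * s < r"
    unfolding cut_def
    by (rule push_F[of "\<lambda>v. h v * th s v", OF _ smooth_fun_mult[OF open_V that(1) th_smooth] that(3)])
       (simp_all add: h th_inv th_0 that(2))
  show "cut s h x = 0" if "x \<in> topspace X" "x \<notin> p ` V"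
    unfolding cut_def by (rule push_outside[OF that])
qed

lemma small_ball:
  assumes P: "openin (Euclidean_space n) P" "(\<lambda>_. 0) \<in> P"
  shows "\<exists>s>0. 2 * s < r \<and> (\<forall>v\<in>Esp n. qG v < 2 * s \<longrightarrow> v \<in> P)"
proof -
  obtain e where e: "e > 0" "cbx n (\<lambda>_. 0) e \<subseteq> P" using open_contains_cbx[OF P] by blast
  \<comment> \<open>Division by 3 leaves room for the factor 2 in the support of
    \<open>th s\<close>.\<close>
  define s where "s = min (e\<^sup>2) r / 3"
  have "s > 0" "2 * s < r" "2 * s < e\<^sup>2" using e(1) r_pos by (auto simp: s_def min_def)
  moreover have "v \<in> P" if "v \<in> Esp n" "qG v < 2 * s" for v
  proof -
    have "qG v < e\<^sup>2" using that(2) \<open>2 * s < e\<^sup>2\<close> by linarith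
    then have "v \<in> obx n (\<lambda>_. 0) e" using qG_ball_box[OF e(1)] that(1) by blast
    then show ?thesis using e(2) obx_subset_cbx by blast
  qed
  ultimately show ?thesis by blast
qed

lemma bump_at:
  assumes N: "openin X N" "\<phi> u \<in> N"
  shows "\<exists>g\<in>F. g (\<phi> u) = 1 \<and> (\<forall>x\<in>topspace X - N. g x = 0)"
proof -
  have "openin (Euclidean_space n) {v \<in> V. p v \<in> N}" "(\<lambda>_. 0) \<in> {v \<in> V. p v \<in> N}"
    using p_preimage_open[OF N(1)] zero_V N(2) p_zero by auto
  from small_ball[OF this] obtain s where s: "s > 0" "2 * s < r" "\<forall>v\<in>Esp n. qG v < 2 * s \<longrightarrow> v \<in> {v \<in> V. p v \<in> N}"
    by blast
  let ?g = "cut s (\<lambda>_. 1)"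
  have "?g \<in> F" by (rule cut_F) (use s smooth_fun_const[OF open_V] in auto)
  moreover have "?g (\<phi> u) = 1" using cut_p[of "\<lambda>_. 1", OF refl zero_V, of s] s(1) by (simp add: p_zero th_1 qG_zero)
  moreover have "?g x = 0" if x: "x \<in> topspace X - N" for x
  proof (cases "x \<in> p ` V")
    case True
    then obtain v where v: "v \<in> V" "x = p v" by auto
    have "2 * s \<le> qG v"
    proof (rule ccontr)
      assume "\<not> 2 * s \<le> qG v"
      then have "p v \<in> N" using s(3) V_Esp[OF v(1)] by auto
      then show False using x v(2) by blast
    qed
    then show ?thesis using cut_p[of "\<lambda>_. 1", OF refl v(1), of s] th_0[OF s(1)] v(2) by simp
  next
    case False
    then show ?thesis using x cut_outside[of "\<lambda>_. 1"] by blast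
  qed
  ultimately show ?thesis by blast
qed

lemma smooth_monl:
  assumes "length ks \<le> n" "openin (Euclidean_space n) P" "\<And>i. i < n \<Longrightarrow> smooth_fun n P (\<lambda>x. f x i)"
  shows "smooth_fun n P (\<lambda>x. monl ks (f x))"
  using assms(1) by (induction ks) (auto intro!: smooth_fun_intros assms(2,3))

text \<open>On invariant functions the averages of finitely many monomials play the role of a Hilbert basis:
  interpolating a smooth function on the at most \<open>2|G|\<close> points of two orbits gives the Lipschitz
  estimate, without appeal to Schwarz' theorem.\<close>

proposition lipschitz_generators:
  "\<exists>N I g. openin X N \<and> \<phi> u \<in> N \<and> finite (I :: nat list set) \<and> (\<forall>i\<in>I. g i \<in> F) \<and>
     (\<forall>h\<in>F. \<exists>C\<ge>0. \<forall>x\<in>N. \<forall>y\<in>N. \<bar>h x - h y\<bar> \<le> C * (\<Sum>i\<in>I. \<bar>g i x - g i y\<bar>))"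
proof -
  obtain e0 where e0: "e0 > 0" "cbx n (\<lambda>_. 0) e0 \<subseteq> V" using open_contains_cbx[OF open_V zero_V] by blast
  define e where "e = min e0 1"
  have e: "e > 0" "e \<le> 1" "cbx n (\<lambda>_. 0) e \<subseteq> V" using e0 by (auto simp: e_def cbx_def subset_iff)
  obtain s where s: "s > 0" "2 * s < r" "\<forall>v\<in>Esp n. qG v < 2 * s \<longrightarrow> v \<in> obx n (\<lambda>_. 0) e"
    using small_ball[OF openin_obx obx_self[of "\<lambda>_. 0" n e]] e(1) by (auto simp: Esp_iff)
  define V0 where "V0 = {v \<in> Esp n. qG v < s}"
  have V0V: "V0 \<subseteq> V" using s by (auto simp: V0_def V_iff)
  have V0A: "A \<gamma> v \<in> V0" if "\<gamma> \<in> G" "v \<in> V0" for \<gamma> v using that by (simp add: V0_def A_Esp qG_inv)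
  have V0e: "\<bar>v i\<bar> \<le> e" if "v \<in> V0" "i < n" for v i
    using s(1,3) that by (fastforce simp: V0_def obx_def)
  \<comment> \<open>Two orbits of at most \<open>card G\<close> points with \<open>n\<close>
    coordinates each: \<open>m\<close> bounds the number of interpolation nodes.\<close>
  define m where "m = 2 * (card G * n)"
  define I where "I = {ks. set ks \<subseteq> {..<m} \<and> length ks = n}"
  have finI: "finite I" unfolding I_def by (rule finite_lists_length_eq) simp
  define P where "P ks v = (\<Sum>\<gamma>\<in>G. monl ks (A \<gamma> v))" for ks v
  have Pinv: "P ks (A \<gamma> v) = P ks v" if "\<gamma> \<in> G" for \<gamma> v ks unfolding P_def by (rule reindex_right[OF that])
  have Psm: "smooth_fun n V (P ks)" if "ks \<in> I" for ks
    unfolding P_def[abs_def] using that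
    by (intro smooth_fun_sum smooth_monl smooth_A smooth_fun_coord open_V) (auto simp: I_def)
  define N where "N = p ` V0"
  have "openin X N" unfolding N_def by (rule p_open[OF _ V0V]) (unfold V0_def, rule open_qG_ball)
  moreover have "\<phi> u \<in> N" unfolding N_def p_zero[symmetric] using s(1) by (intro imageI) (simp add: V0_def qG_zero Esp_iff)
  moreover have "cut s (P ks) \<in> F" if "ks \<in> I" for ks
    by (rule cut_F[of "P ks", OF Pinv Psm[OF that] s(1,2)])
  moreover have "\<exists>C\<ge>0. \<forall>x\<in>N. \<forall>y\<in>N. \<bar>h x - h y\<bar> \<le> C * (\<Sum>ks\<in>I. \<bar>cut s (P ks) x - cut s (P ks) y\<bar>)" if h: "h \<in> F" for h
  proof -
    obtain C where C: "C \<ge> 0" "\<And>D. finite D \<Longrightarrow> D \<subseteq> {-e..e} \<Longrightarrow> card D \<le> m \<Longrightarrow>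
       \<exists>q. (\<forall>ks\<in>I. \<bar>q ks\<bar> \<le> C) \<and> (\<forall>v\<in>Esp n. (\<forall>j<n. v j \<in> D) \<longrightarrow> h (p v) = (\<Sum>ks\<in>I. q ks * monl ks v))"
      using interpolation_cube[OF open_V e(3,1,2) p_smooth[OF h], of m] unfolding I_def by auto
    show ?thesis
    proof (intro exI[of _ C] conjI ballI)
      fix x y assume "x \<in> N" "y \<in> N"
      then obtain v w where vw: "v \<in> V0" "x = p v" "w \<in> V0" "y = p w" unfolding N_def by blast
      \<comment> \<open>With all coordinates of both orbits as nodes, one polynomial with
        coefficients bounded by \<open>C\<close> represents \<open>h\<close> along both orbits at
        once.\<close>
      define D where "D = (\<lambda>(\<gamma>, i). A \<gamma> v i) ` (G \<times> {..<n}) \<union> (\<lambda>(\<gamma>, i). A \<gamma> w i) ` (G \<times> {..<n})"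
      have c1: "card ((\<lambda>(\<gamma>, i). A \<gamma> z i) ` (G \<times> {..<n})) \<le> card G * n" for z
        using card_image_le[of "G \<times> {..<n}" "\<lambda>(\<gamma>, i). A \<gamma> z i"] finite_G by simp
      have "card D \<le> m"
        unfolding D_def m_def using add_mono[OF c1[of v] c1[of w]] by (intro order_trans[OF card_Un_le]) simp
      moreover have "finite D" using finite_G by (auto simp: D_def)
      moreover have "D \<subseteq> {-e..e}"
      proof
        fix d assume "d \<in> D"
        then obtain \<gamma> i z where d: "\<gamma> \<in> G" "i < n" "z = v \<or> z = w" "d = A \<gamma> z i" unfolding D_def by auto
        then have "A \<gamma> z \<in> V0" using V0A vw by blast
        from V0e[OF this d(2)] show "d \<in> {-e..e}" unfolding d(4) by (simp add: abs_le_iff)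
      qed
      ultimately obtain q where q: "\<forall>ks\<in>I. \<bar>q ks\<bar> \<le> C"
        "\<forall>z\<in>Esp n. (\<forall>j<n. z j \<in> D) \<longrightarrow> h (p z) = (\<Sum>ks\<in>I. q ks * monl ks z)"
        using C(2) by blast
      \<comment> \<open>Summing over an orbit turns the monomials into the invariants
        \<open>P ks\<close>, while the coefficients \<open>q ks\<close> are common to both orbits.
        The values of \<open>h\<close> thus differ only through those of the
        \<open>P ks\<close>.\<close>
      have val: "card G * h (p z) = (\<Sum>ks\<in>I. q ks * P ks z)" if z: "z = v \<or> z = w" for z
      proof -
        have zV: "z \<in> V" using z vw V0V by auto
        have "card G * h (p z) = (\<Sum>\<gamma>\<in>G. h (p (A \<gamma> z)))" using p_inv[OF _ zV] by simp
        also have "\<dots> = (\<Sum>\<gamma>\<in>G. \<Sum>ks\<in>I. q ks * monl ks (A \<gamma> z))"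
        proof (intro sum.cong refl)
          fix \<gamma> assume g: "\<gamma> \<in> G"
          have "A \<gamma> z j \<in> D" if "j < n" for j
            using z g that by (auto simp: D_def intro: rev_image_eqI[of "(\<gamma>, j)"])
          then show "h (p (A \<gamma> z)) = (\<Sum>ks\<in>I. q ks * monl ks (A \<gamma> z))" using q(2) A_Esp by blast
        qed
        also have "\<dots> = (\<Sum>ks\<in>I. q ks * P ks z)"
          unfolding P_def sum_distrib_left by (rule sum.swap)
        finally show ?thesis .
      qed
      have cutP: "cut s (P ks) (p z) = P ks z" if "z = v \<or> z = w" for z ks
        using cut_p[of "P ks" z s] Pinv V0V vw that th_1[OF s(1), of z] by (auto simp: V0_def)
      have "\<bar>h x - h y\<bar> \<le> card G * \<bar>h x - h y\<bar>"
        using card_G by (simp add: mult_le_cancel_right1)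
      also have "\<dots> = \<bar>\<Sum>ks\<in>I. q ks * (P ks v - P ks w)\<bar>"
      proof -
        have "card G * (h x - h y) = (\<Sum>ks\<in>I. q ks * (P ks v - P ks w))"
          using val[of v] val[of w] vw by (simp add: right_diff_distrib sum_subtractf)
        then show ?thesis by (metis abs_mult abs_of_nat)
      qed
      also have "\<dots> \<le> (\<Sum>ks\<in>I. \<bar>q ks * (P ks v - P ks w)\<bar>)" by (rule sum_abs)
      also have "\<dots> \<le> (\<Sum>ks\<in>I. C * \<bar>P ks v - P ks w\<bar>)"
        unfolding abs_mult using q(1) by (intro sum_mono mult_right_mono) auto
      also have "\<dots> = C * (\<Sum>ks\<in>I. \<bar>cut s (P ks) x - cut s (P ks) y\<bar>)"
        using cutP[of v] cutP[of w] vw by (simp add: sum_distrib_left)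
      finally show "\<bar>h x - h y\<bar> \<le> C * (\<Sum>ks\<in>I. \<bar>cut s (P ks) x - cut s (P ks) y\<bar>)" .
    qed (rule C(1))
  qed
  ultimately show ?thesis using finI by (intro exI[of _ N] exI[of _ I] exI[of _ "\<lambda>ks. cut s (P ks)"]) blast
qed

end

context orbifold_ctx
begin

lemma model_exists:
  assumes "(U, \<Gamma>, \<phi>) \<in> \<A>" "u \<in> U"
  shows "\<exists>r B S. lin_model X n \<A> U \<Gamma> \<phi> u r B S"
proof -
  interpret orb_pt X n U \<Gamma> \<phi> u
    using chart_in[OF assms(1)] assms(2) by (simp add: orb_pt_def orb_pt_axioms_def)
  obtain r B S where "lin_chart r B S" using lin_chart_exists by blast
  then have "lin_model X n \<A> U \<Gamma> \<phi> u r B S"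
    using assms by unfold_locales
  then show ?thesis by blast
qed

lemma model_at:
  assumes "x \<in> topspace X"
  obtains U \<Gamma> \<phi> u r B S where "lin_model X n \<A> U \<Gamma> \<phi> u r B S" "\<phi> u = x"
proof -
  obtain U \<Gamma> \<phi> where c: "(U, \<Gamma>, \<phi>) \<in> \<A>" "x \<in> \<phi> ` U" using cover[OF assms] by blast
  then obtain u where u: "u \<in> U" "\<phi> u = x" by auto
  show ?thesis using model_exists[OF c(1) u(1)] u(2) that by blast
qed

lemma bump:
  assumes "openin X N" "x \<in> N"
  shows "\<exists>g\<in>F. g x = 1 \<and> (\<forall>y\<in>topspace X - N. g y = 0)"
proof -
  have "x \<in> topspace X" using openin_subset[OF assms(1)] assms(2) by blast
  then obtain U \<Gamma> \<phi> u r B S where m: "lin_model X n \<A> U \<Gamma> \<phi> u r B S" "\<phi> u = x" by (rule model_at)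
  interpret lin_model X n \<A> U \<Gamma> \<phi> u r B S by (rule m(1))
  show ?thesis using bump_at[OF assms(1)] assms(2) m(2) by simp
qed

lemma F_separates:
  assumes "x \<in> topspace X" "y \<in> topspace X" "x \<noteq> y"
  shows "\<exists>g\<in>F. g x \<noteq> g y"
proof -
  obtain N N' where "openin X N" "openin X N'" "x \<in> N" "y \<in> N'" "disjnt N N'"
    using Hausdorff_X[unfolded Hausdorff_space_def, rule_format, OF conjI[OF assms(1) conjI[OF assms(2,3)]]]
    by (elim exE conjE)
  then obtain g where "g \<in> F" "g x = 1" "\<forall>z\<in>topspace X - N. g z = 0" using bump[of N x] by blast
  moreover have "y \<in> topspace X - N" using assms(2) \<open>y \<in> N'\<close> \<open>disjnt N N'\<close> by (auto simp: disjnt_iff)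
  ultimately show ?thesis by (intro bexI[of _ g]) auto
qed

lemma lipschitz_at:
  assumes "x \<in> topspace X"
  shows "\<exists>N I g. openin X N \<and> x \<in> N \<and> finite (I :: nat list set) \<and> (\<forall>i\<in>I. g i \<in> F) \<and>
     (\<forall>h\<in>F. \<exists>C\<ge>0. \<forall>x\<in>N. \<forall>y\<in>N. \<bar>h x - h y\<bar> \<le> C * (\<Sum>i\<in>I. \<bar>g i x - g i y\<bar>))"
proof -
  obtain U \<Gamma> \<phi> u r B S where m: "lin_model X n \<A> U \<Gamma> \<phi> u r B S" "\<phi> u = x" by (rule model_at[OF assms])
  interpret lin_model X n \<A> U \<Gamma> \<phi> u r B S by (rule m(1))
  show ?thesis using lipschitz_generators m(2) by simp
qed

end

section \<open>Real functions\<close>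

lemma at_within_nontrivial:
  fixes J :: "real set"
  assumes "connected J" "s \<in> J" "s' \<in> J" "s \<noteq> s'"
  shows "at s within J \<noteq> bot"
proof (cases "s < s'")
  case True
  have "at_right s \<le> at s within J"
    using at_le[OF connected_contains_Icc[OF assms(1-3)], of s] at_within_Icc_at_right[OF True] by simp
  then show ?thesis using trivial_limit_at_right_real[of s] by (metis bot.extremum_uniqueI)
next
  case False
  then have "s' < s" using assms(4) by simp
  have "at_left s \<le> at s within J"
    using at_le[OF connected_contains_Icc[OF assms(1,3,2)], of s] at_within_Icc_at_left[OF \<open>s' < s\<close>] by simp
  then show ?thesis using trivial_limit_at_left_real[of s] by (metis bot.extremum_uniqueI)
qed

lemma has_real_derivative_unique_within:
  assumes "(f has_real_derivative D) (at s within J)" "(f has_real_derivative E) (at s within J)" "at s within J \<noteq> bot"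
  shows "D = E"
  using tendsto_unique[OF assms(3)] assms(1,2) unfolding has_field_derivative_iff by blast

lemma has_real_derivative_Un:
  assumes "(f has_real_derivative D) (at s within J)" "(f has_real_derivative D) (at s within K)"
  shows "(f has_real_derivative D) (at s within (J \<union> K))"
  using assms unfolding has_field_derivative_iff by (simp add: Lim_within_Un)

text \<open>\<open>w\<close> times exp(-Ct) is nonincreasing to the right of \<open>s0\<close>, and
  \<open>w\<close> times exp(Ct) is nondecreasing to the left of it. \<open>K\<close> may contain
  its end points, as differentiability is only asked within \<open>K\<close>.\<close>

lemma gronwall_zero:
  fixes w w' :: "real \<Rightarrow> real"
  assumes K: "connected K" "s0 \<in> K" "t \<in> K"
    and der: "\<And>s. s \<in> K \<Longrightarrow> (w has_real_derivative w' s) (at s within K)"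
    and bd: "\<And>s. s \<in> K \<Longrightarrow> \<bar>w' s\<bar> \<le> C * w s" and nn: "\<And>s. s \<in> K \<Longrightarrow> 0 \<le> w s" and z: "w s0 = 0"
  shows "w t = 0"
proof -
  have at: "(w has_real_derivative w' s) (at s)" if "{a..b} \<subseteq> K" "a < s" "s < b" for a b s
  proof -
    have "{a<..<b} \<subseteq> K" using that(1) by auto
    moreover have "s \<in> K" using that by auto
    ultimately have "(w has_real_derivative w' s) (at s within {a<..<b})"
      using DERIV_subset[OF der] by blast
    then show ?thesis using that at_within_open[of s "{a<..<b}"] by simp
  qed
  have cont: "continuous_on {a..b} w" if "{a..b} \<subseteq> K" for a b
  proof -
    have "continuous_on K w" by (rule DERIV_continuous_on[OF der])
    then show ?thesis using that by (rule continuous_on_subset)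
  qed
  consider "t = s0" | "s0 < t" | "t < s0" by linarith
  then show ?thesis
  proof cases
    case 1
    then show ?thesis using z by simp
  next
    case 2
    have sub: "{s0..t} \<subseteq> K" using connected_contains_Icc[OF K] .
    have "w t * exp (- C * t) \<le> w s0 * exp (- C * s0)"
    proof (rule DERIV_nonpos_imp_decreasing_open[where f = "\<lambda>s. w s * exp (- C * s)"])
      fix s assume s: "s0 < s" "s < t"
      have "((\<lambda>s. w s * exp (- C * s)) has_real_derivative w' s * exp (- C * s) + w s * (exp (- C * s) * (- C))) (at s)"
        using at[OF sub s] by (auto intro!: derivative_eq_intros)
      moreover have "w' s * exp (- C * s) + w s * (exp (- C * s) * (- C)) = (w' s - C * w s) * exp (- C * s)"
        by (simp add: algebra_simps)
      moreover have "s \<in> K" using sub s by auto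
      then have "w' s - C * w s \<le> 0" using bd[of s] by linarith
      ultimately show "\<exists>y. ((\<lambda>s. w s * exp (- C * s)) has_real_derivative y) (at s) \<and> y \<le> 0"
        by (metis exp_ge_zero mult_nonpos_nonneg)
    qed (use 2 cont[OF sub] in \<open>auto intro!: continuous_intros\<close>)
    then have "w t \<le> 0" using z by (simp add: mult_le_0_iff)
    then show ?thesis using nn[OF K(3)] by simp
  next
    case 3
    have sub: "{t..s0} \<subseteq> K" using connected_contains_Icc[OF K(1,3,2)] .
    have "w t * exp (C * t) \<le> w s0 * exp (C * s0)"
    proof (rule DERIV_nonneg_imp_increasing_open[where f = "\<lambda>s. w s * exp (C * s)"])
      fix s assume s: "t < s" "s < s0"
      have "((\<lambda>s. w s * exp (C * s)) has_real_derivative w' s * exp (C * s) + w s * (exp (C * s) * C)) (at s)"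
        using at[OF sub s] by (auto intro!: derivative_eq_intros)
      moreover have "w' s * exp (C * s) + w s * (exp (C * s) * C) = (w' s + C * w s) * exp (C * s)"
        by (simp add: algebra_simps)
      moreover have "s \<in> K" using sub s by auto
      then have "w' s + C * w s \<ge> 0" using bd[of s] by linarith
      ultimately show "\<exists>y. ((\<lambda>s. w s * exp (C * s)) has_real_derivative y) (at s) \<and> 0 \<le> y"
        by (metis exp_ge_zero mult_nonneg_nonneg)
    qed (use 3 cont[OF sub] in \<open>auto intro!: continuous_intros\<close>)
    then have "w t \<le> 0" using z by (simp add: mult_le_0_iff)
    then show ?thesis using nn[OF K(3)] by simp
  qed
qed

lemma real_smoothD:
  assumes "f \<in> real_smooth"
  shows "deriv f \<in> real_smooth" "(f has_real_derivative deriv f t) (at t)" "(deriv ^^ k) f \<in> real_smooth"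
proof -
  have d: "deriv f \<in> real_smooth" if "f \<in> real_smooth" for f :: "real \<Rightarrow> real"
  proof -
    have "(deriv ^^ k) (deriv f) differentiable at x" for k x
    proof -
      have "(deriv ^^ Suc k) f differentiable at x" using that unfolding real_smooth_def by blast
      then show ?thesis by (simp only: funpow_Suc_right comp_apply)
    qed
    then show ?thesis by (auto simp: real_smooth_def)
  qed
  show "deriv f \<in> real_smooth" by (rule d[OF assms])
  have "(deriv ^^ 0) f differentiable at t" using assms unfolding real_smooth_def by blast
  then show "(f has_real_derivative deriv f t) (at t)" by (simp add: DERIV_deriv_iff_real_differentiable)
  show "(deriv ^^ k) f \<in> real_smooth" using assms d by (induction k) auto
qed

lemma real_smooth_const: "(\<lambda>_. c) \<in> real_smooth"
  by (rule real_smooth_coinduct[where P = "\<lambda>f. \<exists>c. f = (\<lambda>_. c)"]) (auto intro!: exI[of _ "\<lambda>_. 0"])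

lemma real_smooth_id: "(\<lambda>x. x) \<in> real_smooth"
proof (rule real_smooth_coinduct[where P = "\<lambda>f. f = (\<lambda>x. x) \<or> f \<in> real_smooth"])
  fix f :: "real \<Rightarrow> real" assume "f = (\<lambda>x. x) \<or> f \<in> real_smooth"
  then show "\<exists>f'. (f' = (\<lambda>x. x) \<or> f' \<in> real_smooth) \<and> (\<forall>t. (f has_real_derivative f' t) (at t))"
  proof
    assume "f = (\<lambda>x. x)"
    then show ?thesis using real_smooth_const[of 1] by (intro exI[of _ "\<lambda>_. 1"]) auto
  next
    assume "f \<in> real_smooth"
    then show ?thesis using real_smoothD by (intro exI[of _ "deriv f"]) auto
  qed
qed simp

lemma real_smooth_shift: assumes "f \<in> real_smooth" shows "(\<lambda>s. f (s + a)) \<in> real_smooth"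
proof (rule real_smooth_coinduct[where P = "\<lambda>h. \<exists>f\<in>real_smooth. h = (\<lambda>s. f (s + a))"])
  fix h assume "\<exists>f\<in>real_smooth. h = (\<lambda>s. f (s + a))"
  then obtain f where f: "f \<in> real_smooth" "h = (\<lambda>s. f (s + a))" by auto
  have "(h has_real_derivative deriv f (t + a)) (at t)" for t
    unfolding f(2) using real_smoothD(2)[OF f(1), of "t + a"] by (simp add: DERIV_shift)
  then show "\<exists>f'. (\<exists>f\<in>real_smooth. f' = (\<lambda>s. f (s + a))) \<and> (\<forall>t. (h has_real_derivative f' t) (at t))"
    using real_smoothD(1)[OF f(1)] by (intro exI[of _ "\<lambda>s. deriv f (s + a)"]) auto
qed (use assms in auto)

text \<open>The derivative of a glued function is glued from the derivatives, which again agree to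
  infinite order at \<open>t\<close>; such functions form a class closed under
  differentiation.\<close>

lemma real_smooth_glue:
  assumes "f \<in> real_smooth" "g \<in> real_smooth" "\<And>k. (deriv ^^ k) f t = (deriv ^^ k) g t"
  shows "(\<lambda>s. if s \<le> t then f s else g s) \<in> real_smooth"
proof (rule real_smooth_coinduct[where P = "\<lambda>h. \<exists>f\<in>real_smooth. \<exists>g\<in>real_smooth.
    (\<forall>k. (deriv ^^ k) f t = (deriv ^^ k) g t) \<and> h = (\<lambda>s. if s \<le> t then f s else g s)"])
  show "\<exists>fa\<in>real_smooth. \<exists>ga\<in>real_smooth. (\<forall>k. (deriv ^^ k) fa t = (deriv ^^ k) ga t) \<and>
      (\<lambda>s. if s \<le> t then f s else g s) = (\<lambda>s. if s \<le> t then fa s else ga s)"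
    using assms by blast
  fix h assume "\<exists>f\<in>real_smooth. \<exists>g\<in>real_smooth.
    (\<forall>k. (deriv ^^ k) f t = (deriv ^^ k) g t) \<and> h = (\<lambda>s. if s \<le> t then f s else g s)"
  then obtain f g where fg: "f \<in> real_smooth" "g \<in> real_smooth" "\<And>k. (deriv ^^ k) f t = (deriv ^^ k) g t"
    "h = (\<lambda>s. if s \<le> t then f s else g s)" by blast
  have e0: "f t = g t" using fg(3)[of 0] by simp
  have e1: "deriv f t = deriv g t" using fg(3)[of 1] by simp
  let ?h' = "\<lambda>s. if s \<le> t then deriv f s else deriv g s"
  have "(h has_real_derivative ?h' s) (at s)" for s
  proof -
    have L: "(h has_real_derivative deriv f s) (at s within {..t})" if "s \<le> t"
      by (rule has_field_derivative_transform_within[OF DERIV_subset[OF real_smoothD(2)[OF fg(1)]], of _ 1])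
         (use that fg(4) in auto)
    have R: "(h has_real_derivative deriv g s) (at s within {t..})" if "t \<le> s"
      by (rule has_field_derivative_transform_within[OF DERIV_subset[OF real_smoothD(2)[OF fg(2)]], of _ 1])
         (use that fg(4) e0 in auto)
    consider "s < t" | "t < s" | "s = t" by linarith
    then show ?thesis
    proof cases
      case 1
      have "(h has_real_derivative deriv f s) (at s within {..<t})"
        using 1 by (intro DERIV_subset[OF L]) auto
      then show ?thesis using 1 at_within_open[of s "{..<t}"] by simp
    next
      case 2
      have "(h has_real_derivative deriv g s) (at s within {t<..})"
        using 2 by (intro DERIV_subset[OF R]) auto
      then show ?thesis using 2 at_within_open[of s "{t<..}"] by simp
    next
      case 3
      have "(h has_real_derivative deriv f s) (at s within ({..t} \<union> {t..}))"
        using L R 3 e1 by (intro has_real_derivative_Un) auto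
      moreover have "{..t} \<union> {t..} = UNIV" by auto
      ultimately show ?thesis using 3 by simp
    qed
  qed
  moreover have "(deriv ^^ k) (deriv f) t = (deriv ^^ k) (deriv g) t" for k
    using fg(3)[of "Suc k"] by (simp only: funpow_Suc_right comp_apply)
  ultimately show "\<exists>f'. (\<exists>f\<in>real_smooth. \<exists>g\<in>real_smooth. (\<forall>k. (deriv ^^ k) f t = (deriv ^^ k) g t) \<and>
      f' = (\<lambda>s. if s \<le> t then f s else g s)) \<and> (\<forall>t. (h has_real_derivative f' t) (at t))"
    using real_smoothD(1)[OF fg(1)] real_smoothD(1)[OF fg(2)] by (intro exI[of _ ?h'] conjI) blast+
qed

lemma openin_initial_real: "openin (initial_topology UNIV real_smooth) W \<longleftrightarrow> open W"
proof
  assume "openin (initial_topology UNIV real_smooth) W"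
  then have "generate_topology_on (insert UNIV {f -` V \<inter> UNIV |f V. f \<in> real_smooth \<and> open V}) W"
    unfolding initial_topology_def by (rule openin_topology_generated_by)
  then show "open W"
  proof induction
    case (Basis s)
    then consider "s = UNIV" | f V where "s = f -` V" "f \<in> real_smooth" "open V" by auto
    then show ?case
    proof cases
      case 2
      have "continuous_on UNIV f"
        using real_smoothD(2)[OF 2(2)] by (meson DERIV_isCont continuous_at_imp_continuous_on)
      then show ?thesis using 2 by (simp add: open_vimage)
    qed simp
  qed (auto intro: open_Union)
next
  assume "open W"
  then show "openin (initial_topology UNIV real_smooth) W"
    unfolding initial_topology_def openin_topology_generated_by_iff
    by (intro generate_topology_on.Basis insertI2 CollectI exI[of _ "\<lambda>x. x"] exI[of _ W]) (auto intro: real_smooth_id)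
qed

text \<open>Smoothness on a set that need not be open means a local extension to a smooth function
  on the line. At end points these extensions are all that is available.\<close>

lemma subspace_real_iff:
  "g \<in> subspace_structure UNIV real_smooth I \<longleftrightarrow>
     g \<in> extensional I \<and> (\<forall>t\<in>I. \<exists>e>0. \<exists>f\<in>real_smooth. \<forall>s\<in>I. \<bar>s - t\<bar> < e \<longrightarrow> g s = f s)"
proof -
  have "(\<exists>W f. open W \<and> t \<in> W \<and> f \<in> real_smooth \<and> (\<forall>y\<in>W \<inter> I. g y = f y)) \<longleftrightarrow>
      (\<exists>e>0. \<exists>f\<in>real_smooth. \<forall>s\<in>I. \<bar>s - t\<bar> < e \<longrightarrow> g s = f s)" for t
  proof
    assume "\<exists>W f. open W \<and> t \<in> W \<and> f \<in> real_smooth \<and> (\<forall>y\<in>W \<inter> I. g y = f y)"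
    then obtain W f where W: "open W" "t \<in> W" "f \<in> real_smooth" "\<forall>y\<in>W \<inter> I. g y = f y" by blast
    obtain e where "e > 0" "ball t e \<subseteq> W" using W(1,2) open_contains_ball by blast
    then show "\<exists>e>0. \<exists>f\<in>real_smooth. \<forall>s\<in>I. \<bar>s - t\<bar> < e \<longrightarrow> g s = f s"
      using W(3,4) by (intro exI[of _ e] conjI bexI[of _ f]) (auto simp: dist_real_def abs_minus_commute subset_iff)
  next
    assume "\<exists>e>0. \<exists>f\<in>real_smooth. \<forall>s\<in>I. \<bar>s - t\<bar> < e \<longrightarrow> g s = f s"
    then obtain e f where "e > 0" "f \<in> real_smooth" "\<forall>s\<in>I. \<bar>s - t\<bar> < e \<longrightarrow> g s = f s" by blast
    then show "\<exists>W f. open W \<and> t \<in> W \<and> f \<in> real_smooth \<and> (\<forall>y\<in>W \<inter> I. g y = f y)"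
      by (intro exI[of _ "ball t e"] exI[of _ f]) (auto simp: dist_real_def abs_minus_commute)
  qed
  then show ?thesis unfolding subspace_structure_def openin_initial_real by simp
qed

section \<open>Integral curves\<close>

context orbifold_ctx
begin

abbreviation IC where "IC \<equiv> integral_curve (topspace X) F"

lemma ICD:
  assumes "IC Y x I c"
  shows "connected I" "0 \<in> I" "c \<in> extensional I" "c 0 = x" "t \<in> I \<Longrightarrow> c t \<in> topspace X"
    "f \<in> F \<Longrightarrow> t \<in> I \<Longrightarrow> ((\<lambda>s. f (c s)) has_real_derivative Y f (c t)) (at t within I)"
    "f \<in> F \<Longrightarrow> t \<in> I \<Longrightarrow> \<exists>e>0. \<exists>h\<in>real_smooth. \<forall>s\<in>I. \<bar>s - t\<bar> < e \<longrightarrow> f (c s) = h s"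
proof -
  show "connected I" "0 \<in> I" "c \<in> extensional I" "c 0 = x" "t \<in> I \<Longrightarrow> c t \<in> topspace X"
    "f \<in> F \<Longrightarrow> t \<in> I \<Longrightarrow> ((\<lambda>s. f (c s)) has_real_derivative Y f (c t)) (at t within I)"
    using assms by (auto simp: integral_curve_def diff_smooth_def)
  assume f: "f \<in> F" and t: "t \<in> I"
  then have "compose I f c \<in> subspace_structure UNIV real_smooth I"
    using assms by (auto simp: integral_curve_def diff_smooth_def)
  then have "\<exists>e>0. \<exists>h\<in>real_smooth. \<forall>s\<in>I. \<bar>s - t\<bar> < e \<longrightarrow> compose I f c s = h s"
    using t unfolding subspace_real_iff by blast
  then show "\<exists>e>0. \<exists>h\<in>real_smooth. \<forall>s\<in>I. \<bar>s - t\<bar> < e \<longrightarrow> f (c s) = h s"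
    by (simp add: compose_def cong: conj_cong)
qed

lemma ICI:
  assumes "connected I" "0 \<in> I" "c \<in> extensional I" "c 0 = x" "\<And>t. t \<in> I \<Longrightarrow> c t \<in> topspace X"
    "\<And>f t. f \<in> F \<Longrightarrow> t \<in> I \<Longrightarrow> ((\<lambda>s. f (c s)) has_real_derivative Y f (c t)) (at t within I)"
    "\<And>f t. f \<in> F \<Longrightarrow> t \<in> I \<Longrightarrow> \<exists>e>0. \<exists>h\<in>real_smooth. \<forall>s\<in>I. \<bar>s - t\<bar> < e \<longrightarrow> f (c s) = h s"
  shows "IC Y x I c"
proof -
  have "compose I f c \<in> subspace_structure UNIV real_smooth I" if "f \<in> F" for f
    unfolding subspace_real_iff using assms(7)[OF that] by (simp add: compose_def cong: conj_cong)
  then show ?thesis using assms by (auto simp: integral_curve_def diff_smooth_def)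
qed

text \<open>\<open>integral_curve\<close> speaks of \<open>F\<close> only and not of the topology of
  X; bump functions in \<open>F\<close> yield continuity into X.\<close>

lemma IC_near:
  assumes c: "IC Y x I c" and t: "t \<in> I" and N: "openin X N" "c t \<in> N"
  shows "\<exists>e>0. \<forall>s\<in>I. \<bar>s - t\<bar> < e \<longrightarrow> c s \<in> N"
proof -
  obtain g where g: "g \<in> F" "g (c t) = 1" "\<forall>y\<in>topspace X - N. g y = 0" using bump[OF N] by blast
  have "continuous (at t within I) (\<lambda>s. g (c s))"
    using ICD(6)[OF c g(1) t] by (rule DERIV_continuous)
  then obtain e where e: "e > 0" "\<forall>s\<in>I. dist s t < e \<longrightarrow> dist (g (c s)) (g (c t)) < 1"
    unfolding continuous_within_eps_delta by (auto dest!: spec[of _ "1::real"])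
  have "c s \<in> N" if "s \<in> I" "\<bar>s - t\<bar> < e" for s
  proof (rule ccontr)
    assume "c s \<notin> N"
    then have "g (c s) = 0" using g(3) ICD(5)[OF c that(1)] by blast
    moreover have "dist (g (c s)) (g (c t)) < 1" using e(2) that by (simp add: dist_real_def)
    ultimately show False using g(2) by (simp add: dist_real_def)
  qed
  then show ?thesis using e(1) by blast
qed

text \<open>The set of agreement is closed because X is Hausdorff. For openness let \<open>w\<close>
  be the sum of the squared differences of the local generators along both curves: it satisfies a
  linear differential inequality, so Gronwall makes it vanish, and then all of \<open>F\<close>
  agrees and separates points.\<close>

lemma IC_unique:
  assumes Y: "Y \<in> F \<rightarrow> F" and c: "IC Y x I c" and d: "IC Y x J d" and t: "t \<in> I \<inter> J"
  shows "c t = d t"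
proof -
  let ?K = "I \<inter> J"
  have K: "connected ?K" using ICD(1)[OF c] ICD(1)[OF d]
    by (meson is_interval_Int is_interval_connected_1)
  let ?E = "{s \<in> ?K. c s = d s}"
  have "openin (top_of_set ?K) ?E"
    unfolding openin_contains_ball
  proof (intro conjI ballI)
    fix s0 assume s0: "s0 \<in> ?E"
    then have s0I: "s0 \<in> I" "s0 \<in> J" and eq: "c s0 = d s0" by auto
    obtain N A g where N: "openin X N" "c s0 \<in> N" "finite (A :: nat list set)" "\<forall>i\<in>A. g i \<in> F"
      "\<forall>h\<in>F. \<exists>C\<ge>0. \<forall>x\<in>N. \<forall>y\<in>N. \<bar>h x - h y\<bar> \<le> C * (\<Sum>i\<in>A. \<bar>g i x - g i y\<bar>)"
      using lipschitz_at[OF ICD(5)[OF c s0I(1)]] by blast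
    obtain e1 where e1: "e1 > 0" "\<forall>s\<in>I. \<bar>s - s0\<bar> < e1 \<longrightarrow> c s \<in> N" using IC_near[OF c s0I(1) N(1,2)] by blast
    obtain e2 where e2: "e2 > 0" "\<forall>s\<in>J. \<bar>s - s0\<bar> < e2 \<longrightarrow> d s \<in> N" using IC_near[OF d s0I(2) N(1)] N(2) eq by auto
    define e where "e = min e1 e2"
    have e: "e > 0" using e1 e2 by (simp add: e_def)
    let ?L = "?K \<inter> ball s0 e"
    have L: "connected ?L"
      using K by (meson is_interval_Int is_interval_connected_1 connected_ball)
    have LN: "c s \<in> N" "d s \<in> N" if "s \<in> ?L" for s
      using e1(2) e2(2) that by (auto simp: e_def dist_real_def abs_minus_commute)
    \<comment> \<open>The derivatives \<open>Y (g i)\<close> are again members of \<open>F\<close>,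
      hence Lipschitz in the \<open>g i\<close> themselves. This closes the system of
      inequalities.\<close>
    have YF: "\<forall>i\<in>A. \<exists>C\<ge>0. \<forall>x\<in>N. \<forall>y\<in>N. \<bar>Y (g i) x - Y (g i) y\<bar> \<le> C * (\<Sum>i\<in>A. \<bar>g i x - g i y\<bar>)"
      using N(4,5) Y by blast
    from bchoice[OF this] obtain C where C: "\<forall>i\<in>A. C i \<ge> 0 \<and> (\<forall>x\<in>N. \<forall>y\<in>N. \<bar>Y (g i) x - Y (g i) y\<bar> \<le> C i * (\<Sum>i\<in>A. \<bar>g i x - g i y\<bar>))" ..
    define C0 where "C0 = (\<Sum>i\<in>A. C i)"
    have C0: "C i \<le> C0" if "i \<in> A" for i unfolding C0_def using that N(3) C by (intro member_le_sum) auto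
    have C00: "C0 \<ge> 0" unfolding C0_def using C by (intro sum_nonneg) auto
    define D where "D i s = g i (c s) - g i (d s)" for i s
    define w where "w s = (\<Sum>i\<in>A. (D i s)\<^sup>2)" for s
    define w' where "w' s = (\<Sum>i\<in>A. 2 * (D i s * (Y (g i) (c s) - Y (g i) (d s))))" for s
    have wd: "(w has_real_derivative w' s) (at s within ?L)" if s: "s \<in> ?L" for s
    proof -
      have "(D i has_real_derivative Y (g i) (c s) - Y (g i) (d s)) (at s within ?L)" if "i \<in> A" for i
        unfolding D_def[abs_def] using N(4) that s
        by (intro DERIV_diff DERIV_subset[OF ICD(6)[OF c]] DERIV_subset[OF ICD(6)[OF d]]) auto
      then have "((\<lambda>s. (D i s)\<^sup>2) has_real_derivative 2 * (D i s * (Y (g i) (c s) - Y (g i) (d s)))) (at s within ?L)"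
        if "i \<in> A" for i
        using that by (auto intro!: derivative_eq_intros)
      then show ?thesis unfolding w_def[abs_def] w'_def by (intro DERIV_sum) auto
    qed
    have wb: "\<bar>w' s\<bar> \<le> (2 * C0 * card A) * w s" if s: "s \<in> ?L" for s
    proof -
      define T where "T = (\<Sum>i\<in>A. \<bar>D i s\<bar>)"
      have T0: "T \<ge> 0" unfolding T_def by (intro sum_nonneg) auto
      have "\<bar>2 * (D i s * (Y (g i) (c s) - Y (g i) (d s)))\<bar> \<le> 2 * C0 * T * \<bar>D i s\<bar>" if i: "i \<in> A" for i
      proof -
        have "\<bar>Y (g i) (c s) - Y (g i) (d s)\<bar> \<le> C i * T"
          using C i LN[OF s] unfolding T_def D_def by blast
        also have "\<dots> \<le> C0 * T" using C0[OF i] T0 by (rule mult_right_mono)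
        finally have "\<bar>D i s\<bar> * \<bar>Y (g i) (c s) - Y (g i) (d s)\<bar> \<le> \<bar>D i s\<bar> * (C0 * T)"
          by (rule mult_left_mono) simp
        moreover have "\<bar>2 * (D i s * (Y (g i) (c s) - Y (g i) (d s)))\<bar> = 2 * (\<bar>D i s\<bar> * \<bar>Y (g i) (c s) - Y (g i) (d s)\<bar>)"
          by (simp only: abs_mult abs_numeral)
        ultimately show ?thesis by (simp add: mult.commute mult.left_commute)
      qed
      then have le: "(\<Sum>i\<in>A. \<bar>2 * (D i s * (Y (g i) (c s) - Y (g i) (d s)))\<bar>) \<le> (\<Sum>i\<in>A. 2 * C0 * T * \<bar>D i s\<bar>)"
        by (rule sum_mono)
      have "\<bar>w' s\<bar> \<le> (\<Sum>i\<in>A. \<bar>2 * (D i s * (Y (g i) (c s) - Y (g i) (d s)))\<bar>)"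
        unfolding w'_def by (rule sum_abs)
      also note le
      also have "(\<Sum>i\<in>A. 2 * C0 * T * \<bar>D i s\<bar>) = 2 * C0 * T * T"
        unfolding T_def by (rule sum_distrib_left[symmetric])
      also have "\<dots> = 2 * C0 * T\<^sup>2" by (simp add: power2_eq_square)
      also have "T\<^sup>2 \<le> card A * w s"
        using Cauchy_Schwarz_ineq_sum[of "\<lambda>_. 1" "\<lambda>i. \<bar>D i s\<bar>" A] unfolding T_def w_def by simp
      then have "2 * C0 * T\<^sup>2 \<le> 2 * C0 * (card A * w s)" using C00 by (intro mult_left_mono) auto
      finally show ?thesis by (simp add: mult.assoc)
    qed
    have "c s = d s" if s: "s \<in> ?L" for s
    proof -
      have "w s = 0"
      proof (rule gronwall_zero[OF L _ s wd wb])
        show "s0 \<in> ?L" using s0 e by auto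
        show "0 \<le> w s" for s unfolding w_def by (intro sum_nonneg) auto
        show "w s0 = 0" unfolding w_def D_def using eq by simp
      qed
      then have D0: "\<forall>i\<in>A. D i s = 0"
        unfolding w_def using N(3) by (subst (asm) sum_nonneg_eq_0_iff) auto
      have "h (c s) = h (d s)" if h: "h \<in> F" for h
      proof -
        obtain C' where "\<forall>x\<in>N. \<forall>y\<in>N. \<bar>h x - h y\<bar> \<le> C' * (\<Sum>i\<in>A. \<bar>g i x - g i y\<bar>)" using N(5) h by blast
        then have "\<bar>h (c s) - h (d s)\<bar> \<le> C' * (\<Sum>i\<in>A. \<bar>g i (c s) - g i (d s)\<bar>)" using LN[OF s] by blast
        also have "(\<Sum>i\<in>A. \<bar>g i (c s) - g i (d s)\<bar>) = 0" using D0 unfolding D_def by (intro sum.neutral) auto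
        finally show ?thesis by simp
      qed
      then show ?thesis using F_separates ICD(5)[OF c] ICD(5)[OF d] s by blast
    qed
    then show "\<exists>e>0. ball s0 e \<inter> ?K \<subseteq> ?E" using e by blast
  qed auto
  moreover have "closedin (top_of_set ?K) ?E"
    unfolding closedin_def
  proof (intro conjI)
    have "openin (top_of_set ?K) (?K - ?E)"
      unfolding openin_contains_ball
    proof (intro conjI ballI)
      fix s0 assume s0: "s0 \<in> ?K - ?E"
      then have s0I: "s0 \<in> I" "s0 \<in> J" and ne: "c s0 \<noteq> d s0" by auto
      obtain N N' where N: "openin X N" "openin X N'" "c s0 \<in> N" "d s0 \<in> N'" "disjnt N N'"
        using Hausdorff_X[unfolded Hausdorff_space_def, rule_format,
            OF conjI[OF ICD(5)[OF c s0I(1)] conjI[OF ICD(5)[OF d s0I(2)] ne]]] by (elim exE conjE)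
      obtain e1 where e1: "e1 > 0" "\<forall>s\<in>I. \<bar>s - s0\<bar> < e1 \<longrightarrow> c s \<in> N" using IC_near[OF c s0I(1) N(1,3)] by blast
      obtain e2 where e2: "e2 > 0" "\<forall>s\<in>J. \<bar>s - s0\<bar> < e2 \<longrightarrow> d s \<in> N'" using IC_near[OF d s0I(2) N(2,4)] by blast
      have "ball s0 (min e1 e2) \<inter> ?K \<subseteq> ?K - ?E"
      proof
        fix s assume s: "s \<in> ball s0 (min e1 e2) \<inter> ?K"
        then have "c s \<in> N" "d s \<in> N'" using e1(2) e2(2) by (auto simp: dist_real_def abs_minus_commute)
        then have "c s \<noteq> d s" using N(5) by (auto simp: disjnt_iff)
        then show "s \<in> ?K - ?E" using s by blast
      qed
      then show "\<exists>e>0. ball s0 e \<inter> ?K \<subseteq> ?K - ?E" using e1(1) e2(1) by (intro exI[of _ "min e1 e2"]) auto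
    qed auto
    then show "openin (top_of_set ?K) (topspace (top_of_set ?K) - ?E)" by simp
  qed auto
  ultimately have "?E = {} \<or> ?E = ?K" using K unfolding connected_clopen by blast
  moreover have "0 \<in> ?E" using ICD(2,4)[OF c] ICD(2,4)[OF d] by auto
  ultimately have "?E = ?K" by blast
  then show ?thesis using t by blast
qed

lemma IC_shift:
  assumes c: "IC Y x I c" and t0: "t0 \<in> I"
  shows "IC Y (c t0) {s. s + t0 \<in> I} (\<lambda>s\<in>{s. s + t0 \<in> I}. c (s + t0))"
proof (rule ICI)
  let ?J = "{s. s + t0 \<in> I}"
  have J: "?J = (\<lambda>t. t + (- t0)) ` I"
  proof (intro subset_antisym subsetI)
    show "s \<in> (\<lambda>t. t + (- t0)) ` I" if "s \<in> ?J" for s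
      using that by (intro image_eqI[of _ _ "s + t0"]) auto
  qed auto
  show "connected ?J" unfolding J by (intro connected_continuous_image continuous_intros ICD(1)[OF c])
  show "0 \<in> ?J" using t0 by simp
  show "(\<lambda>s\<in>?J. c (s + t0)) 0 = c t0" using t0 by simp
  show "(\<lambda>s\<in>?J. c (s + t0)) t \<in> topspace X" if "t \<in> ?J" for t using ICD(5)[OF c] that by simp
  fix f t assume f: "f \<in> F" and t: "t \<in> ?J"
  have "((\<lambda>s. f (c s)) has_real_derivative Y f (c (t + t0))) (at (t + t0) within I)"
    using ICD(6)[OF c f] t by simp
  moreover have "(\<lambda>s. s + t0) ` ?J = I"
  proof (intro subset_antisym subsetI)
    show "s \<in> (\<lambda>s. s + t0) ` ?J" if "s \<in> I" for s
      using that by (intro image_eqI[of _ _ "s - t0"]) auto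
  qed auto
  ultimately have "((\<lambda>s. f (c s)) has_real_derivative Y f (c (t + t0))) (at (t + t0) within (\<lambda>s. s + t0) ` ?J)" by simp
  moreover have "((\<lambda>s. s + t0) has_real_derivative 1) (at t within ?J)" by (auto intro!: derivative_eq_intros)
  ultimately have "((\<lambda>s. f (c (s + t0))) has_real_derivative Y f (c (t + t0))) (at t within ?J)"
    using DERIV_image_chain[of "\<lambda>s. f (c s)" "Y f (c (t + t0))" "\<lambda>s. s + t0" t ?J 1] by (simp add: comp_def)
  then have "((\<lambda>s. f (c (s + t0))) has_real_derivative Y f ((\<lambda>s\<in>?J. c (s + t0)) t)) (at t within ?J)" using t by simp
  then show "((\<lambda>s. f ((\<lambda>s\<in>?J. c (s + t0)) s)) has_real_derivative Y f ((\<lambda>s\<in>?J. c (s + t0)) t)) (at t within ?J)"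
    by (rule has_field_derivative_transform_within[where d = 1]) (use t in auto)
  obtain e h where h: "e > 0" "h \<in> real_smooth" "\<forall>s\<in>I. \<bar>s - (t + t0)\<bar> < e \<longrightarrow> f (c s) = h s"
    using ICD(7)[OF c f, of "t + t0"] t by blast
  show "\<exists>e>0. \<exists>h\<in>real_smooth. \<forall>s\<in>?J. \<bar>s - t\<bar> < e \<longrightarrow> f ((\<lambda>s\<in>?J. c (s + t0)) s) = h s"
    by (intro exI[of _ e] conjI h(1) bexI[OF _ real_smooth_shift[OF h(2), of t0]]) (use h(3) in auto)
qed simp

text \<open>Two distinct points make \<open>J\<close> a nondegenerate interval, so derivatives
  within \<open>J\<close> are unique, also at its end points. All derivatives of a smooth extension
  of f along \<open>c\<close> are therefore dictated by \<open>Y\<close>.\<close>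

lemma IC_germ_derivs:
  assumes Y: "Y \<in> F \<rightarrow> F" and c: "IC Y x I c" and f: "f \<in> F" and h: "h \<in> real_smooth"
    and J: "connected J" "J \<subseteq> I" "a \<in> J" "b \<in> J" "a \<noteq> b" and eq: "\<And>s. s \<in> J \<Longrightarrow> h s = f (c s)"
    and s: "s \<in> J"
  shows "(deriv ^^ k) h s = (Y ^^ k) f (c s)"
  using s
proof (induction k arbitrary: s)
  case 0
  then show ?case using eq by simp
next
  case (Suc k)
  have fk: "(Y ^^ k) f \<in> F" using f Y by (induction k) auto
  have "(((deriv ^^ k) h) has_real_derivative deriv ((deriv ^^ k) h) s) (at s within J)"
    using real_smoothD(2)[OF real_smoothD(3)[OF h]] by (rule has_field_derivative_at_within)
  then have "((\<lambda>s. (Y ^^ k) f (c s)) has_real_derivative deriv ((deriv ^^ k) h) s) (at s within J)"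
    by (rule has_field_derivative_transform_within[where d = 1]) (use Suc in auto)
  moreover have "((\<lambda>s. (Y ^^ k) f (c s)) has_real_derivative Y ((Y ^^ k) f) (c s)) (at s within J)"
    using DERIV_subset[OF ICD(6)[OF c fk] J(2)] Suc.prems J(2) by blast
  moreover have "at s within J \<noteq> bot"
    using at_within_nontrivial[OF J(1) Suc.prems J(3)] at_within_nontrivial[OF J(1) Suc.prems J(4)] J(5) by blast
  ultimately show ?case using has_real_derivative_unique_within by fastforce
qed

text \<open>The union of all integral curves through \<open>x\<close> is one. Only the smoothness at \<open>0\<close> is delicate, where
  a curve to the left may meet a different curve to the right: the one-sided derivatives of \<open>f \<circ> c\<close>
  are \<open>Y\<^sup>k f\<close> on both sides.\<close>

lemma IC_union:
  assumes Y: "Y \<in> F \<rightarrow> F" and x: "x \<in> topspace X"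
  shows "\<exists>I c. IC Y x I c \<and> (\<forall>J d. IC Y x J d \<longrightarrow> J \<subseteq> I \<and> (\<forall>t\<in>J. d t = c t))"
proof -
  define I where "I = \<Union>{J. \<exists>d. IC Y x J d}"
  define c where "c = (\<lambda>t\<in>I. THE y. \<exists>J d. IC Y x J d \<and> t \<in> J \<and> d t = y)"
  \<comment> \<open>The curve with domain \<open>{0}\<close> shows that the family over which the
    union is taken is nonempty.\<close>
  have triv: "IC Y x {0} (\<lambda>t\<in>{0}. x)"
  proof (rule ICI)
    show "((\<lambda>s. f ((\<lambda>t\<in>{0}. x) s)) has_real_derivative Y f ((\<lambda>t\<in>{0}. x) t)) (at t within {0})" if "t \<in> {0}" for f t
      using that by (simp add: has_field_derivative_iff at_within_def)
    show "\<exists>e>0. \<exists>h\<in>real_smooth. \<forall>s\<in>{0}. \<bar>s - t\<bar> < e \<longrightarrow> f ((\<lambda>t\<in>{0}. x) s) = h s" for f and t :: real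
      by (intro exI[of _ 1] conjI bexI[OF _ real_smooth_const[of "f x"]]) auto
  qed (use x in auto)
  have ceq: "d t = c t" "t \<in> I" if d: "IC Y x J d" and t: "t \<in> J" for J d t
  proof -
    show tI: "t \<in> I" unfolding I_def using d t by blast
    have "(THE y. \<exists>J d. IC Y x J d \<and> t \<in> J \<and> d t = y) = d t"
    proof (rule the_equality)
      show "\<exists>J d'. IC Y x J d' \<and> t \<in> J \<and> d' t = d t" using d t by blast
      fix y assume "\<exists>J d. IC Y x J d \<and> t \<in> J \<and> d t = y"
      then obtain J' d' where d': "IC Y x J' d'" "t \<in> J'" "d' t = y" by blast
      then show "y = d t" using IC_unique[OF Y d'(1) d, of t] t by simp
    qed
    then show "d t = c t" unfolding c_def using tI by simp
  qed
  have conn: "connected I" unfolding I_def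
  proof (rule connected_Union)
    show "connected J" if "J \<in> {J. \<exists>d. IC Y x J d}" for J using that ICD(1) by blast
    have "0 \<in> \<Inter>{J. \<exists>d. IC Y x J d}" using ICD(2) by blast
    then show "\<Inter>{J. \<exists>d. IC Y x J d} \<noteq> {}" by blast
  qed
  have z: "0 \<in> I" "c 0 = x" using ceq[OF triv, of 0] by auto
  have mem: "\<exists>J d. IC Y x J d \<and> t \<in> J" if "t \<in> I" for t using that unfolding I_def by blast
  \<comment> \<open>Immediately to the right of \<open>t\<close> a single curve suffices: for
    negative \<open>t\<close> any curve reaching \<open>t\<close>, since its domain contains
    everything from \<open>t\<close> to 0; otherwise any curve reaching beyond \<open>t\<close>; and
    at the right end of \<open>I\<close> nothing remains to be covered.\<close>
  have right: "\<exists>J d e. IC Y x J d \<and> t \<in> J \<and> e > 0 \<and> I \<inter> {t..<t + e} \<subseteq> J" if t: "t \<in> I" for t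
  proof -
    obtain J d where J: "IC Y x J d" "t \<in> J" using mem[OF t] by blast
    show ?thesis
    proof (cases "t < 0")
      case True
      have "{t..0} \<subseteq> J" using connected_contains_Icc[OF ICD(1)[OF J(1)] J(2) ICD(2)[OF J(1)]] .
      then have "I \<inter> {t..<t + (- t)} \<subseteq> J" by auto
      then show ?thesis using J True by (intro exI[of _ J] exI[of _ d] exI[of _ "- t"]) auto
    next
      case nn: False
      show ?thesis
      proof (cases "\<exists>t'\<in>I. t < t'")
        case True
        then obtain t' where t': "t' \<in> I" "t < t'" by blast
        obtain J' d' where J': "IC Y x J' d'" "t' \<in> J'" using mem[OF t'(1)] by blast
        have sub: "{0..t'} \<subseteq> J'" using connected_contains_Icc[OF ICD(1)[OF J'(1)] ICD(2)[OF J'(1)] J'(2)] .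
        then have "I \<inter> {t..<t + (t' - t)} \<subseteq> J'" using nn by auto
        then show ?thesis using J'(1) sub nn t'(2) by (intro exI[of _ J'] exI[of _ d'] exI[of _ "t' - t"]) auto
      next
        case False
        then have "I \<inter> {t..<t + 1} \<subseteq> J" using J(2) by (auto simp: not_less)
        then show ?thesis using J by (intro exI[of _ J] exI[of _ d] exI[of _ 1]) auto
      qed
    qed
  qed
  have left: "\<exists>J d e. IC Y x J d \<and> t \<in> J \<and> e > 0 \<and> I \<inter> {t - e<..t} \<subseteq> J" if t: "t \<in> I" for t
  proof -
    obtain J d where J: "IC Y x J d" "t \<in> J" using mem[OF t] by blast
    show ?thesis
    proof (cases "t > 0")
      case True
      have "{0..t} \<subseteq> J" using connected_contains_Icc[OF ICD(1)[OF J(1)] ICD(2)[OF J(1)] J(2)] .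
      then have "I \<inter> {t - t<..t} \<subseteq> J" by auto
      then show ?thesis using J True by (intro exI[of _ J] exI[of _ d] exI[of _ t]) auto
    next
      case nn: False
      show ?thesis
      proof (cases "\<exists>t'\<in>I. t' < t")
        case True
        then obtain t' where t': "t' \<in> I" "t' < t" by blast
        obtain J' d' where J': "IC Y x J' d'" "t' \<in> J'" using mem[OF t'(1)] by blast
        have sub: "{t'..0} \<subseteq> J'" using connected_contains_Icc[OF ICD(1)[OF J'(1)] J'(2) ICD(2)[OF J'(1)]] .
        then have "I \<inter> {t - (t - t')<..t} \<subseteq> J'" using nn by auto
        then show ?thesis using J'(1) sub nn t'(2) by (intro exI[of _ J'] exI[of _ d'] exI[of _ "t - t'"]) auto
      next
        case False
        then have "I \<inter> {t - 1<..t} \<subseteq> J" using J(2) by (auto simp: not_less)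
        then show ?thesis using J by (intro exI[of _ J] exI[of _ d] exI[of _ 1]) auto
      qed
    qed
  qed
  have "IC Y x I c"
  proof (rule ICI)
    show "connected I" "0 \<in> I" "c 0 = x" using conn z by auto
    show "c \<in> extensional I" by (simp add: c_def)
    show "c t \<in> topspace X" if "t \<in> I" for t using mem[OF that] ceq ICD(5) by metis
    fix f t assume f: "f \<in> F" and t: "t \<in> I"
    obtain J d e where R: "IC Y x J d" "t \<in> J" "e > 0" "I \<inter> {t..<t + e} \<subseteq> J" using right[OF t] by blast
    obtain J' d' e' where L: "IC Y x J' d'" "t \<in> J'" "e' > 0" "I \<inter> {t - e'<..t} \<subseteq> J'" using left[OF t] by blast
    let ?R = "I \<inter> {t..<t + e}" and ?L = "I \<inter> {t - e'<..t}"
    have "((\<lambda>s. f (c s)) has_real_derivative Y f (c t)) (at t within ?R)"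
    proof -
      have "((\<lambda>s. f (d s)) has_real_derivative Y f (d t)) (at t within ?R)"
        using DERIV_subset[OF ICD(6)[OF R(1) f R(2)] R(4)] .
      then have "((\<lambda>s. f (c s)) has_real_derivative Y f (d t)) (at t within ?R)"
        by (rule has_field_derivative_transform_within[where d = 1]) (use ceq[OF R(1)] R(3,4) t in auto)
      then show ?thesis using ceq[OF R(1,2)] by simp
    qed
    moreover have "((\<lambda>s. f (c s)) has_real_derivative Y f (c t)) (at t within ?L)"
    proof -
      have "((\<lambda>s. f (d' s)) has_real_derivative Y f (d' t)) (at t within ?L)"
        using DERIV_subset[OF ICD(6)[OF L(1) f L(2)] L(4)] .
      then have "((\<lambda>s. f (c s)) has_real_derivative Y f (d' t)) (at t within ?L)"
        by (rule has_field_derivative_transform_within[where d = 1]) (use ceq[OF L(1)] L(3,4) t in auto)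
      then show ?thesis using ceq[OF L(1,2)] by simp
    qed
    ultimately have "((\<lambda>s. f (c s)) has_real_derivative Y f (c t)) (at t within ?L \<union> ?R)"
      by (intro has_real_derivative_Un)
    moreover have "at t within ?L \<union> ?R = at t within I"
      by (rule at_within_nhd[of t "{t - e'<..<t + e}"]) (use R(3) L(3) in auto)
    ultimately show "((\<lambda>s. f (c s)) has_real_derivative Y f (c t)) (at t within I)" by simp
    obtain a g where g: "a > 0" "g \<in> real_smooth" "\<forall>s\<in>J. \<bar>s - t\<bar> < a \<longrightarrow> f (d s) = g s"
      using ICD(7)[OF R(1) f R(2)] by blast
    obtain a' g' where g': "a' > 0" "g' \<in> real_smooth" "\<forall>s\<in>J'. \<bar>s - t\<bar> < a' \<longrightarrow> f (d' s) = g' s"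
      using ICD(7)[OF L(1) f L(2)] by blast
    define b where "b = min (min a a') (min e e')"
    have b: "b > 0" "b \<le> a" "b \<le> a'" "b \<le> e" "b \<le> e'" using g(1) g'(1) R(3) L(3) by (auto simp: b_def)
    have cR: "f (c s) = g s" if "s \<in> I" "t \<le> s" "s < t + b" for s
    proof -
      have sJ: "s \<in> J" using R(4) that b by (auto simp: subset_iff)
      then show ?thesis using g(3) ceq(1)[OF R(1) sJ] that b by auto
    qed
    have cL: "f (c s) = g' s" if "s \<in> I" "s \<le> t" "t - b < s" for s
    proof -
      have sJ: "s \<in> J'" using L(4) that b by (auto simp: subset_iff)
      then show ?thesis using g'(3) ceq(1)[OF L(1) sJ] that b by auto
    qed
    \<comment> \<open>At an end point of \<open>I\<close> one germ serves; only at interior points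
      must two germs be glued.\<close>
    consider "\<forall>s\<in>I. s \<le> t" | "\<forall>s\<in>I. t \<le> s" | s1 s2 where "s1 \<in> I" "s2 \<in> I" "s1 < t" "t < s2"
      by (meson not_le)
    then show "\<exists>e>0. \<exists>h\<in>real_smooth. \<forall>s\<in>I. \<bar>s - t\<bar> < e \<longrightarrow> f (c s) = h s"
    proof cases
      case 1
      then show ?thesis using cL by (intro exI[of _ b] conjI b(1) bexI[OF _ g'(2)]) auto
    next
      case 2
      then show ?thesis using cR by (intro exI[of _ b] conjI b(1) bexI[OF _ g(2)]) auto
    next
      case 3
      have sub: "{s1..s2} \<subseteq> I" by (rule connected_contains_Icc[OF conn 3(1,2)])
      \<comment> \<open>The intervals from \<open>r1\<close> to \<open>t\<close> and from
        \<open>t\<close> to \<open>r2\<close> are nondegenerate and lie where f along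
        \<open>c\<close> equals \<open>g'\<close> and \<open>g\<close> respectively, so both germs
        have the same derivatives at \<open>t\<close>.\<close>
      define r1 where "r1 = max s1 (t - b / 2)"
      define r2 where "r2 = min s2 (t + b / 2)"
      have r: "r1 < t" "t < r2" "{r1..t} \<subseteq> J'" "{t..r2} \<subseteq> J" "{r1..t} \<subseteq> I" "{t..r2} \<subseteq> I" "t - b < r1" "r2 < t + b"
        using 3 b(1) sub L(4) R(4) b(4,5) by (auto simp: r1_def r2_def subset_iff)
      have "(deriv ^^ k) g' t = (deriv ^^ k) g t" for k
      proof -
        have "(deriv ^^ k) g' t = (Y ^^ k) f (d' t)"
          by (rule IC_germ_derivs[OF Y L(1) f g'(2) _ r(3), of r1 t])
             (use r cL ceq(1)[OF L(1)] in \<open>auto simp: subset_iff\<close>)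
        moreover have "(deriv ^^ k) g t = (Y ^^ k) f (d t)"
          by (rule IC_germ_derivs[OF Y R(1) f g(2) _ r(4), of t r2])
             (use r cR ceq(1)[OF R(1)] in \<open>auto simp: subset_iff\<close>)
        ultimately show ?thesis using ceq(1)[OF L(1,2)] ceq(1)[OF R(1,2)] by simp
      qed
      from real_smooth_glue[OF g'(2) g(2) this]
      show ?thesis
        by (intro exI[of _ b] conjI b(1) bexI[of _ "\<lambda>s. if s \<le> t then g' s else g s"]) (use cL cR in auto)
    qed
  qed
  then show ?thesis using ceq by blast
qed

definition dm where "dm Y x = fst (exp_curve (topspace X) F Y x)"
definition fl where "fl Y x = snd (exp_curve (topspace X) F Y x)"

text \<open>The union of all integral curves extends each of them, so it is the only maximal one.
  This gives the definite description in \<open>exp_curve\<close> its meaning.\<close>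

lemma fl_max:
  assumes Y: "Y \<in> F \<rightarrow> F" and x: "x \<in> topspace X"
  shows fl_IC: "IC Y x (dm Y x) (fl Y x)"
    and fl_maximal: "IC Y x J d \<Longrightarrow> J \<subseteq> dm Y x \<and> (\<forall>t\<in>J. d t = fl Y x t)"
proof -
  obtain I c where c: "IC Y x I c" "\<And>J d. IC Y x J d \<Longrightarrow> J \<subseteq> I \<and> (\<forall>t\<in>J. d t = c t)"
    using IC_union[OF assms] by blast
  have "exp_curve (topspace X) F Y x = (I, c)"
    unfolding exp_curve_def
  proof (rule the_equality)
    have "J = I" if "IC Y x J d" "I \<subseteq> J" for J d using c(2)[OF that(1)] that(2) by blast
    then show "case (I, c) of (I, c) \<Rightarrow> maximal_integral_curve (topspace X) F Y x I c"
      unfolding prod.case maximal_integral_curve_def using c(1) by blast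
    fix p assume p: "case p of (I, c) \<Rightarrow> maximal_integral_curve (topspace X) F Y x I c"
    obtain J d where pe: "p = (J, d)" by (cases p)
    have J: "IC Y x J d" and max: "\<And>K k. IC Y x K k \<Longrightarrow> J \<subseteq> K \<Longrightarrow> \<forall>t\<in>J. k t = d t \<Longrightarrow> K = J"
      using p unfolding pe prod.case maximal_integral_curve_def by blast+
    have "J \<subseteq> I" "\<forall>t\<in>J. c t = d t" using c(2)[OF J] by auto
    then have "I = J" by (rule max[OF c(1)])
    moreover have "c = d"
      by (rule extensionalityI[OF ICD(3)[OF c(1)]]) (use ICD(3)[OF J] \<open>I = J\<close> \<open>\<forall>t\<in>J. c t = d t\<close> in auto)
    ultimately show "p = (I, c)" using pe by simp
  qed
  then show "IC Y x (dm Y x) (fl Y x)" "IC Y x J d \<Longrightarrow> J \<subseteq> dm Y x \<and> (\<forall>t\<in>J. d t = fl Y x t)"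
    using c by (auto simp: dm_def fl_def)
qed

text \<open>The shifted curve is an integral curve from the new point, so maximality there gives one
  inclusion of domains. Shifting back by \<open>- t0\<close> and maximality at \<open>x\<close> give
  the other.\<close>

lemma fl_shift:
  assumes Y: "Y \<in> F \<rightarrow> F" and x: "x \<in> topspace X" and t0: "t0 \<in> dm Y x"
  shows "s \<in> dm Y (fl Y x t0) \<longleftrightarrow> s + t0 \<in> dm Y x"
    and "s + t0 \<in> dm Y x \<Longrightarrow> fl Y (fl Y x t0) s = fl Y x (s + t0)"
proof -
  note c = fl_IC[OF Y x]
  let ?y = "fl Y x t0"
  have y: "?y \<in> topspace X" by (rule ICD(5)[OF c t0])
  note d = fl_IC[OF Y y]
  note a = fl_maximal[OF Y y IC_shift[OF c t0]]
  show "fl Y ?y s = fl Y x (s + t0)" if "s + t0 \<in> dm Y x"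
    using bspec[OF conjunct2[OF a], of s] that by simp
  have m: "- t0 \<in> dm Y ?y" using a ICD(2)[OF c] by auto
  have bk: "fl Y ?y (- t0) = x" using bspec[OF conjunct2[OF a], of "- t0"] ICD(2,4)[OF c] by simp
  have "IC Y x {s. s + - t0 \<in> dm Y ?y} (\<lambda>s\<in>{s. s + - t0 \<in> dm Y ?y}. fl Y ?y (s + - t0))"
    using IC_shift[OF d m] unfolding bk .
  from conjunct1[OF fl_maximal[OF Y x this]]
  have sub: "{s. s + - t0 \<in> dm Y ?y} \<subseteq> dm Y x" .
  show "s \<in> dm Y ?y \<longleftrightarrow> s + t0 \<in> dm Y x"
  proof
    show "s + t0 \<in> dm Y x" if "s \<in> dm Y ?y" using subsetD[OF sub, of "s + t0"] that by simp
    show "s \<in> dm Y ?y" if "s + t0 \<in> dm Y x" using subsetD[OF conjunct1[OF a], of s] that by simp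
  qed
qed

end

section \<open>A flow on the line with compactly supported generator\<close>

definition hfun :: "real \<Rightarrow> real" where
  "hfun s = ebump (1 - s\<^sup>2) * (1 - s\<^sup>2)\<^sup>2 / (1 + s ^ 4)"

lemma hfun_zero: "1 \<le> \<bar>s\<bar> \<Longrightarrow> hfun s = 0"
  using abs_le_square_iff[of 1 s] by (simp add: hfun_def ebump_zero)

lemma hfun_smooth:
  assumes P: "openin (Euclidean_space n) P" and f: "smooth_fun n P f"
  shows "smooth_fun n P (\<lambda>x. hfun (f x))"
  unfolding hfun_def
proof (rule smooth_fun_divide[OF P])
  show "1 + f x ^ 4 \<noteq> 0" for x
  proof -
    have "0 \<le> ((f x)\<^sup>2)\<^sup>2" by simp
    then have "0 \<le> f x ^ 4" by (simp add: power_mult[symmetric])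
    then show ?thesis by linarith
  qed
qed (intro P smooth_fun_add smooth_fun_mult smooth_fun_power smooth_fun_comp_real_smooth[where \<phi> = ebump]
    ebump_smooth smooth_fun_diff smooth_fun_const f)+

text \<open>On \<open>(-1, 1)\<close> the field \<open>hfun\<close> is \<open>1 / \<tau>'\<close> for the diffeomorphism \<open>\<tau> s = s exp (1 / (1 - s\<^sup>2))\<close> onto
  the line, hence \<open>\<tau>\<close> conjugates its flow to the translations.\<close>

lemma flow_hfun:
  "\<exists>\<psi>. (\<forall>y. \<bar>\<psi> y\<bar> < 1 \<and> (\<psi> has_real_derivative hfun (\<psi> y)) (at y)) \<and> (\<forall>s. \<bar>s\<bar> < 1 \<longrightarrow> (\<exists>y. \<psi> y = s))"
proof -
  define \<tau> where "\<tau> s = s * exp (1 / (1 - s\<^sup>2))" for s :: real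
  have pos: "1 - s\<^sup>2 > 0" if "\<bar>s\<bar> < 1" for s :: real
    using that abs_square_less_1[of s] by simp
  have h_eq: "hfun s * (exp (1 / (1 - s\<^sup>2)) * (1 + s ^ 4) / (1 - s\<^sup>2)\<^sup>2) = 1" if "\<bar>s\<bar> < 1" for s
  proof -
    have "1 + s ^ 4 \<noteq> 0" using zero_le_power2[of "s\<^sup>2"] by (simp add: power_mult[symmetric] add_nonneg_eq_0_iff)
    then show ?thesis using pos[OF that] by (simp add: hfun_def ebump_def exp_minus)
  qed
  have der: "(\<tau> has_real_derivative exp (1 / (1 - s\<^sup>2)) * (1 + s ^ 4) / (1 - s\<^sup>2)\<^sup>2) (at s)" if "\<bar>s\<bar> < 1" for s
  proof -
    have nz: "1 - s\<^sup>2 \<noteq> 0" using pos[OF that] by simp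
    have "(\<tau> has_real_derivative exp (1 / (1 - s\<^sup>2)) + s * (exp (1 / (1 - s\<^sup>2)) * (2 * s / (1 - s\<^sup>2)\<^sup>2))) (at s)"
      unfolding \<tau>_def[abs_def] using nz
      by (auto intro!: derivative_eq_intros simp: power2_eq_square field_simps)
    moreover have "exp (1 / (1 - s\<^sup>2)) + s * (exp (1 / (1 - s\<^sup>2)) * (2 * s / (1 - s\<^sup>2)\<^sup>2)) =
        exp (1 / (1 - s\<^sup>2)) * (((1 - s\<^sup>2)\<^sup>2 + 2 * s\<^sup>2) / (1 - s\<^sup>2)\<^sup>2)"
    proof -
      have "E + s * (E * (2 * s / D\<^sup>2)) = E * ((D\<^sup>2 + 2 * s\<^sup>2) / D\<^sup>2)" if "D \<noteq> 0" for E D :: real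
        using that by (simp add: field_simps power2_eq_square)
      from this[OF nz] show ?thesis .
    qed
    moreover have "(1 - s\<^sup>2)\<^sup>2 + 2 * s\<^sup>2 = 1 + s ^ 4" by (simp add: power2_diff algebra_simps power_mult[symmetric])
    ultimately show ?thesis by simp
  qed
  have dpos: "exp (1 / (1 - s\<^sup>2)) * (1 + s ^ 4) / (1 - s\<^sup>2)\<^sup>2 > 0" if "\<bar>s\<bar> < 1" for s :: real
  proof -
    have "0 < 1 + s ^ 4" using zero_le_power2[of "s\<^sup>2"] by (simp add: power_mult[symmetric] add_pos_nonneg)
    then show ?thesis using pos[OF that] by simp
  qed
  have mono: "\<tau> s < \<tau> t" if "s < t" "\<bar>s\<bar> < 1" "\<bar>t\<bar> < 1" for s t
  proof (rule DERIV_pos_imp_increasing[OF that(1)])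
    fix x assume "s \<le> x" "x \<le> t"
    then have "\<bar>x\<bar> < 1" using that by auto
    then show "\<exists>y. (\<tau> has_real_derivative y) (at x) \<and> 0 < y" using der dpos by blast
  qed
  have inj: "s = t" if "\<tau> s = \<tau> t" "\<bar>s\<bar> < 1" "\<bar>t\<bar> < 1" for s t
    using mono[of s t] mono[of t s] that by (metis less_irrefl linorder_neqE_linordered_idom)
  have surj0: "\<exists>s. \<bar>s\<bar> < 1 \<and> \<tau> s = y" if y: "y \<ge> 0" for y
  proof -
    \<comment> \<open>Chosen so that \<open>1 - b\<^sup>2\<close> is at most 1 / (2 (y + 1)). The
      exponential in \<open>\<tau> b\<close> is then at least 2 (y + 1), and \<open>b\<close> is at
      least 3 / 4.\<close>
    define b where "b = 1 - 1 / (4 * (y + 1))"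
    have b: "3 / 4 \<le> b" "b < 1" using y by (auto simp: b_def field_simps)
    have "1 - b\<^sup>2 = (1 - b) * (1 + b)" by (simp add: power2_eq_square algebra_simps)
    also have "\<dots> \<le> (1 - b) * 2" using b by (intro mult_left_mono) auto
    also have "\<dots> = 1 / (2 * (y + 1))" using y by (simp add: b_def field_simps)
    finally have le: "1 - b\<^sup>2 \<le> 1 / (2 * (y + 1))" .
    have p: "1 - b\<^sup>2 > 0" using b by (intro pos) auto
    have "2 * (y + 1) \<le> 1 / (1 - b\<^sup>2)" using le p y by (simp add: field_simps)
    also have "\<dots> \<le> exp (1 / (1 - b\<^sup>2))" using exp_ge_add_one_self[of "1 / (1 - b\<^sup>2)"] by linarith
    finally have "2 * (y + 1) \<le> exp (1 / (1 - b\<^sup>2))" .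
    then have "3 / 4 * (2 * (y + 1)) \<le> \<tau> b" unfolding \<tau>_def using b y by (intro mult_mono) auto
    then have "y \<le> \<tau> b" using y by simp
    moreover have "\<tau> 0 \<le> y" using y by (simp add: \<tau>_def)
    moreover have "\<forall>x. 0 \<le> x \<and> x \<le> b \<longrightarrow> isCont \<tau> x"
    proof (intro allI impI)
      fix x assume "0 \<le> x \<and> x \<le> b"
      then have "\<bar>x\<bar> < 1" using b by auto
      then show "isCont \<tau> x" using der DERIV_isCont by blast
    qed
    ultimately obtain x where "0 \<le> x" "x \<le> b" "\<tau> x = y" using IVT[of \<tau> 0 y b] b by auto
    then show ?thesis using b by (intro exI[of _ x]) auto
  qed
  have odd: "\<tau> (- s) = - \<tau> s" for s by (simp add: \<tau>_def)
  have surj: "\<exists>s. \<bar>s\<bar> < 1 \<and> \<tau> s = y" for y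
  proof (cases "y \<ge> 0")
    case False
    then obtain s where "\<bar>s\<bar> < 1" "\<tau> s = - y" using surj0[of "- y"] by auto
    then show ?thesis using odd[of s] by (intro exI[of _ "- s"]) auto
  qed (rule surj0)
  then have "\<forall>y. \<exists>s. \<bar>s\<bar> < 1 \<and> \<tau> s = y" by blast
  from choice[OF this] obtain \<psi> where \<psi>: "\<forall>y. \<bar>\<psi> y\<bar> < 1 \<and> \<tau> (\<psi> y) = y" ..
  have \<psi>\<tau>: "\<psi> (\<tau> s) = s" if "\<bar>s\<bar> < 1" for s using inj[of "\<psi> (\<tau> s)" s] \<psi> that by blast
  have "(\<psi> has_real_derivative hfun (\<psi> y)) (at y)" for y
  proof -
    let ?s = "\<psi> y" and ?D = "exp (1 / (1 - (\<psi> y)\<^sup>2)) * (1 + \<psi> y ^ 4) / (1 - (\<psi> y)\<^sup>2)\<^sup>2"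
    have s: "\<bar>?s\<bar> < 1" "\<tau> ?s = y" using \<psi> by auto
    define d where "d = (1 - \<bar>?s\<bar>) / 2"
    have d: "d > 0" using s by (simp add: d_def)
    have near: "\<bar>z\<bar> < 1" if "\<bar>z - ?s\<bar> \<le> d" for z
    proof -
      have "\<bar>z\<bar> \<le> \<bar>z - ?s\<bar> + \<bar>?s\<bar>" by simp
      moreover have "2 * \<bar>z - ?s\<bar> \<le> 1 - \<bar>?s\<bar>" using that unfolding d_def by simp
      moreover have "a \<le> b + c \<Longrightarrow> 2 * b \<le> 1 - c \<Longrightarrow> c < 1 \<Longrightarrow> a < 1" for a b c :: real by linarith
      ultimately show ?thesis using s(1) by blast
    qed
    have "isCont \<psi> (\<tau> ?s)"
      by (rule isCont_inverse_function[OF d]) (use near \<psi>\<tau> der DERIV_isCont in blast)+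
    then have "isCont \<psi> y" using s(2) by simp
    have Dnz: "?D \<noteq> 0" using dpos[OF s(1)] by (rule less_imp_neq[symmetric])
    have "(\<psi> has_real_derivative inverse ?D) (at y)"
      by (rule DERIV_inverse_function[of \<tau> ?D \<psi> y "y - 1" "y + 1", OF der[OF s(1)] Dnz])
         (use \<psi> \<open>isCont \<psi> y\<close> in auto)
    moreover have "inverse ?D = hfun ?s" using h_eq[OF s(1)] by (metis inverse_unique mult.commute)
    ultimately show ?thesis by simp
  qed
  moreover have "\<exists>y. \<psi> y = s" if "\<bar>s\<bar> < 1" for s using \<psi>\<tau>[OF that] by blast
  ultimately show ?thesis using \<psi> by blast
qed

section \<open>Vector fields are tangent to the strata\<close>

lemma topspace_initial: "topspace (initial_topology S F) = S"
  unfolding initial_topology_def by auto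

context orbifold_ctx
begin

text \<open>The domain of the maximal curve is a slice of the open flow domain. Every point is thus
  interior to its own curve, which the argument with minima requires.\<close>

lemma vectD:
  assumes "Y \<in> vect (topspace X) F"
  shows vect_F: "Y \<in> F \<rightarrow> F"
    and vect_dm_open: "x \<in> topspace X \<Longrightarrow> open (dm Y x)"
proof -
  show "Y \<in> F \<rightarrow> F" using assms by (auto simp: vect_def derivation_def PiE_iff)
  assume x: "x \<in> topspace X"
  have "openin (prod_topology euclideanreal (initial_topology (topspace X) F)) (exp_domain (topspace X) F Y)"
    using assms by (auto simp: vect_def local_flow_def)
  moreover have "continuous_map euclideanreal (prod_topology euclideanreal (initial_topology (topspace X) F)) (\<lambda>t. (t, x))"
    using x by (simp add: continuous_map_pairwise comp_def topspace_initial)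
  ultimately have "openin euclideanreal {t \<in> topspace euclideanreal. (t, x) \<in> exp_domain (topspace X) F Y}"
    using openin_continuous_map_preimage by blast
  moreover have "{t \<in> topspace euclideanreal. (t, x) \<in> exp_domain (topspace X) F Y} = dm Y x"
    using x by (auto simp: exp_domain_def dm_def)
  ultimately show "open (dm Y x)" by simp
qed

end

context lin_model
begin

definition Fix where "Fix = {v \<in> Esp n. \<forall>\<gamma>\<in>G. A \<gamma> v = v}"

text \<open>The projection onto \<open>Fix\<close> by averaging. The complement \<open>dev v\<close>
  has average zero, and \<open>qG (dev v)\<close> is the squared distance to \<open>Fix\<close> that
  the proof uses.\<close>

definition avg where "avg v = (\<lambda>k. (\<Sum>\<gamma>\<in>G. A \<gamma> v k) / card G)"

definition dev where "dev v = (\<lambda>k. v k - avg v k)"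

lemma avg_Esp: "avg v \<in> Esp n"
  using A_Esp by (auto simp: avg_def Esp_iff)

lemma avg_inv: "\<delta> \<in> G \<Longrightarrow> avg (A \<delta> v) = avg v"
  unfolding avg_def using reindex_right[of \<delta> "\<lambda>w. w _" v] by (auto simp: fun_eq_iff)

lemma A_avg: assumes "\<delta> \<in> G" shows "A \<delta> (avg v) = avg v"
proof
  fix k
  have "A \<delta> (avg v) k = (\<Sum>\<gamma>\<in>G. A \<delta> (A \<gamma> v) k) / card G" unfolding A_def[of \<delta>] avg_def mv_sum ..
  also have "\<dots> = avg v k" using reindex_left[OF assms, of "\<lambda>w. w k" v] by (simp add: avg_def)
  finally show "A \<delta> (avg v) k = avg v k" .
qed

lemma avg_Fix: "avg v \<in> Fix" using A_avg avg_Esp by (simp add: Fix_def)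

lemma avg_of_Fix: "v \<in> Fix \<Longrightarrow> avg v = v"
  using card_G by (auto simp: avg_def Fix_def fun_eq_iff)

lemma avg_lin: "avg (\<lambda>i. a * v i + b * w i) = (\<lambda>i. a * avg v i + b * avg w i)"
  by (auto simp: avg_def A_lin fun_eq_iff sum.distrib sum_distrib_left add_divide_distrib)

lemma dev_Esp: "v \<in> Esp n \<Longrightarrow> dev v \<in> Esp n"
  using avg_Esp[of v] by (auto simp: dev_def Esp_iff)

lemma dev_eq: "dev v = (\<lambda>k. 1 * v k + (- 1) * avg v k)"
  by (simp add: dev_def fun_eq_iff)

lemma A_dev: "\<delta> \<in> G \<Longrightarrow> A \<delta> (dev v) = dev (A \<delta> v)"
  unfolding dev_eq A_lin by (simp add: avg_inv A_avg)

lemma avg_dev: "avg (dev v) = (\<lambda>_. 0)"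
  unfolding dev_eq avg_lin by (simp add: avg_of_Fix[OF avg_Fix])

lemma Fix_iff: assumes "v \<in> Esp n" shows "v \<in> Fix \<longleftrightarrow> qG (dev v) = 0"
proof
  assume "v \<in> Fix" then show "qG (dev v) = 0" by (simp add: dev_def avg_of_Fix qG_zero)
next
  assume "qG (dev v) = 0"
  then have "dev v = (\<lambda>_. 0)" by (rule qG_eq_0[OF dev_Esp[OF assms]])
  then have "v = avg v" by (auto simp: dev_def fun_eq_iff)
  then show "v \<in> Fix" using avg_Fix by metis
qed

lemma zero_Fix: "(\<lambda>_. 0) \<in> Fix" by (simp add: Fix_def A_zero Esp_iff)

lemma smooth_avg: "openin (Euclidean_space m) P \<Longrightarrow> (\<And>i. i < n \<Longrightarrow> smooth_fun m P (\<lambda>x. v x i)) \<Longrightarrow> smooth_fun m P (\<lambda>x. avg (v x) k)"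
  unfolding avg_def divide_inverse
  by (intro smooth_fun_mult smooth_fun_sum smooth_A smooth_fun_const)

lemma smooth_rho: "smooth_fun n V (\<lambda>v. qG (dev v))"
  unfolding dev_def
  by (intro smooth_qG smooth_fun_diff smooth_avg smooth_fun_coord open_V)

lemma rho_inv: "\<gamma> \<in> G \<Longrightarrow> qG (dev (A \<gamma> v)) = qG (dev v)"
  by (simp add: A_dev[symmetric] qG_inv)

lemma line_deriv:
  assumes f: "smooth_fun n V f" and v: "(\<lambda>i. v i + t * q i) \<in> V" and vE: "v \<in> Esp n" and qE: "q \<in> Esp n"
  shows "((\<lambda>t. f (\<lambda>i. v i + t * q i)) has_real_derivative (\<Sum>i<n. partial_deriv i f (\<lambda>i. v i + t * q i) * q i)) (at t)"
proof (rule smooth_fun_chain_curve[where c = "\<lambda>t i. v i + t * q i" and t = t, OF open_V f])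
  show "(\<lambda>i. v i + t * q i) \<in> V" by (rule v)
  show "((\<lambda>s. v i + s * q i) has_real_derivative q i) (at t)" for i
    by (auto intro!: derivative_eq_intros)
  show "\<forall>\<^sub>F s in at t. (\<lambda>i. v i + s * q i) \<in> Esp n"
    using vE qE by (auto simp: Esp_iff)
qed

text \<open>Directional derivatives of invariant functions at a fixed point are invariant, so they vanish
  in the directions whose average is \<open>0\<close>; hence such a function grows quadratically off \<open>Fix\<close>.\<close>

lemma eventually_line_in_V:
  assumes "v \<in> V" "q \<in> Esp n"
  shows "eventually (\<lambda>t. (\<lambda>i. v i + t * q i) \<in> V) (nhds (0::real))"
proof -
  obtain e where e: "e > 0" "cbx n v e \<subseteq> V" using open_contains_cbx[OF open_V assms(1)] by blast
  define M where "M = (\<Sum>i<n. \<bar>q i\<bar>) + 1"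
  have M: "M > 0" unfolding M_def by (intro add_nonneg_pos sum_nonneg) auto
  have qM: "\<bar>q i\<bar> \<le> M" if "i < n" for i
  proof -
    have "\<bar>q i\<bar> \<le> (\<Sum>i<n. \<bar>q i\<bar>)" using that by (intro member_le_sum) auto
    then show ?thesis by (simp add: M_def)
  qed
  have "(\<lambda>i. v i + t * q i) \<in> V" if "dist t 0 < e / M" for t
  proof (rule subsetD[OF e(2)])
    have "\<bar>t * q i\<bar> \<le> e" if "i < n" for i
    proof -
      have "\<bar>t\<bar> * \<bar>q i\<bar> \<le> (e / M) * M"
        using \<open>dist t 0 < e / M\<close> qM[OF that] M e(1) by (intro mult_mono) (auto simp: dist_real_def)
      then show ?thesis using M by (simp add: abs_mult)
    qed
    then show "(\<lambda>i. v i + t * q i) \<in> cbx n v e"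
      using assms V_Esp by (auto simp: cbx_def Esp_iff)
  qed
  then show ?thesis unfolding eventually_nhds_metric using e(1) M by (intro exI[of _ "e / M"]) auto
qed

text \<open>The derivative at t = 0 of \<open>f\<close> along \<open>v + t q\<close> equals that
  along its image under \<open>A \<gamma>\<close>, which by linearity is the line through
  \<open>A \<gamma> v\<close> in direction \<open>A \<gamma> q\<close>.\<close>

lemma dderiv_inv:
  assumes f: "smooth_fun n V f" and inv: "\<And>\<gamma> v. \<gamma> \<in> G \<Longrightarrow> v \<in> V \<Longrightarrow> f (A \<gamma> v) = f v"
    and v: "v \<in> V" and q: "q \<in> Esp n" and g: "\<gamma> \<in> G"
  shows "(\<Sum>i<n. partial_deriv i f (A \<gamma> v) * A \<gamma> q i) = (\<Sum>i<n. partial_deriv i f v * q i)"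
proof -
  have d1: "((\<lambda>t. f (\<lambda>i. A \<gamma> v i + t * A \<gamma> q i)) has_real_derivative (\<Sum>i<n. partial_deriv i f (A \<gamma> v) * A \<gamma> q i)) (at 0)"
    using line_deriv[OF f, of "A \<gamma> v" 0 "A \<gamma> q"] A_V[OF g v] A_Esp by simp
  have d2: "((\<lambda>t. f (\<lambda>i. v i + t * q i)) has_real_derivative (\<Sum>i<n. partial_deriv i f v * q i)) (at 0)"
    using line_deriv[OF f, of v 0 q] v V_Esp q by simp
  have ev: "\<forall>\<^sub>F t in nhds 0. f (\<lambda>i. A \<gamma> v i + t * A \<gamma> q i) = f (\<lambda>i. v i + t * q i)"
    using eventually_line_in_V[OF v q]
  proof eventually_elim
    case (elim t)
    have "A \<gamma> (\<lambda>i. 1 * v i + t * q i) = (\<lambda>i. 1 * A \<gamma> v i + t * A \<gamma> q i)" by (rule A_lin)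
    then show ?case using inv[OF g elim] by simp
  qed
  have "((\<lambda>t. f (\<lambda>i. v i + t * q i)) has_real_derivative (\<Sum>i<n. partial_deriv i f (A \<gamma> v) * A \<gamma> q i)) (at 0)"
    using DERIV_cong_ev[OF refl ev refl] d1 by simp
  then show ?thesis using d2 DERIV_unique by blast
qed

lemma quadratic_growth:
  assumes f: "smooth_fun n V f" and inv: "\<And>\<gamma> v. \<gamma> \<in> G \<Longrightarrow> v \<in> V \<Longrightarrow> f (A \<gamma> v) = f v"
    and zero: "\<And>v. v \<in> Fix \<Longrightarrow> v \<in> V \<Longrightarrow> f v = 0"
  shows "\<exists>s>0. \<exists>C. \<forall>v\<in>Esp n. qG v < s \<longrightarrow> \<bar>f v\<bar> \<le> C * qG (dev v)"
proof -
  obtain e where e: "e > 0" "cbx n (\<lambda>_. 0) e \<subseteq> V" using open_contains_cbx[OF open_V zero_V] by blast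
  obtain s where s: "s > 0" "\<forall>v\<in>Esp n. qG v < 2 * s \<longrightarrow> v \<in> obx n (\<lambda>_. 0) e"
    using small_ball[OF openin_obx obx_self[of "\<lambda>_. 0" n e]] e(1) by (auto simp: Esp_iff)
  have "\<exists>M. \<forall>x\<in>cbx n (\<lambda>_. 0) e. \<bar>partial_deriv j (partial_deriv i f) x\<bar> \<le> M" if "i < n" "j < n" for i j
    by (rule bounded_on_cbx[OF e(2) V_sub smooth_funD(2)[OF smooth_funD(2)[OF f that(1)] that(2)]])
  then have "\<forall>ij\<in>{..<n}\<times>{..<n}. \<exists>M. \<forall>x\<in>cbx n (\<lambda>_. 0) e. \<bar>partial_deriv (snd ij) (partial_deriv (fst ij) f) x\<bar> \<le> M" by auto
  from bchoice[OF this] obtain Mb where Mb: "\<forall>ij\<in>{..<n}\<times>{..<n}. \<forall>x\<in>cbx n (\<lambda>_. 0) e. \<bar>partial_deriv (snd ij) (partial_deriv (fst ij) f) x\<bar> \<le> Mb ij" ..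
  define M where "M = (\<Sum>ij\<in>{..<n}\<times>{..<n}. \<bar>Mb ij\<bar>)"
  have M0: "M \<ge> 0" unfolding M_def by (intro sum_nonneg) auto
  have M: "\<bar>partial_deriv j (partial_deriv i f) x\<bar> \<le> M" if "i < n" "j < n" "x \<in> cbx n (\<lambda>_. 0) e" for i j x
  proof -
    have "\<bar>Mb (i, j)\<bar> \<le> M" unfolding M_def using that by (intro member_le_sum) auto
    moreover have "\<bar>partial_deriv j (partial_deriv i f) x\<bar> \<le> Mb (i, j)"
      using bspec[OF Mb, of "(i, j)"] that by auto
    ultimately show ?thesis by linarith
  qed
  have bound: "\<bar>f v\<bar> \<le> (M * n) * qG (dev v)" if v: "v \<in> Esp n" "qG v < 2 * s" for v
  proof -
    let ?a = "avg v" and ?w = "dev v"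
    let ?y = "\<lambda>t i. ?a i + t * ?w i"
    have wE: "?w \<in> Esp n" by (rule dev_Esp[OF v(1)])
    have Ab: "\<bar>A \<gamma> v i\<bar> \<le> e" if "\<gamma> \<in> G" "i < n" for \<gamma> i
    proof -
      have "A \<gamma> v \<in> obx n (\<lambda>_. 0) e" using s(2) A_Esp qG_inv[OF that(1)] v(2) by simp
      then show ?thesis using that(2) by (auto simp: obx_def less_imp_le)
    qed
    have ab: "\<bar>?a i\<bar> \<le> e" if i: "i < n" for i
    proof -
      have "\<bar>\<Sum>\<gamma>\<in>G. A \<gamma> v i\<bar> \<le> (\<Sum>\<gamma>\<in>G. e)" by (rule order_trans[OF sum_abs sum_mono]) (rule Ab[OF _ i])
      then show ?thesis using card_G by (simp add: avg_def field_simps)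
    qed
    have vb: "\<bar>v i\<bar> \<le> e" if "i < n" for i using Ab[OF G_closed(1) that] A_one[OF v(1)] by simp
    have yb: "?y t \<in> cbx n (\<lambda>_. 0) e" if t: "0 \<le> t" "t \<le> 1" for t
    proof -
      have "\<bar>?y t i\<bar> \<le> e" if i: "i < n" for i
      proof -
        have "?y t i = (1 - t) * ?a i + t * v i" by (simp add: dev_def algebra_simps)
        also have "\<bar>\<dots>\<bar> \<le> (1 - t) * \<bar>?a i\<bar> + t * \<bar>v i\<bar>"
          using t by (intro order_trans[OF abs_triangle_ineq]) (simp add: abs_mult)
        also have "\<dots> \<le> (1 - t) * e + t * e" using t ab[OF i] vb[OF i] by (intro add_mono mult_left_mono) auto
        finally show ?thesis by (simp add: algebra_simps)
      qed
      then show ?thesis using avg_Esp[of v] wE by (auto simp: cbx_def Esp_iff)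
    qed
    have yV: "?y t \<in> V" if "0 \<le> t" "t \<le> 1" for t using yb[OF that] e(2) by blast
    have y0: "?y 0 = ?a" and y1: "?y 1 = v" by (auto simp: dev_def)
    have aV: "?a \<in> V" using yV[of 0] y0 by simp
    define g where "g t = f (?y t)" for t
    define g' where "g' t = (\<Sum>i<n. partial_deriv i f (?y t) * ?w i)" for t
    define g'' where "g'' t = (\<Sum>i<n. (\<Sum>j<n. partial_deriv j (partial_deriv i f) (?y t) * ?w j) * ?w i)" for t
    have dg: "(g has_real_derivative g' t) (at t)" if "0 \<le> t" "t \<le> 1" for t
      unfolding g_def[abs_def] g'_def by (rule line_deriv[OF f yV[OF that] avg_Esp wE])
    have dg': "(g' has_real_derivative g'' t) (at t)" if "0 \<le> t" "t \<le> 1" for t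
    proof -
      have "((\<lambda>t. partial_deriv i f (?y t) * ?w i) has_real_derivative (\<Sum>j<n. partial_deriv j (partial_deriv i f) (?y t) * ?w j) * ?w i) (at t)"
        if "i < n" for i
        by (rule DERIV_cmult_right[OF line_deriv[OF smooth_funD(2)[OF f that] yV[OF \<open>0 \<le> t\<close> \<open>t \<le> 1\<close>] avg_Esp wE]])
      then show ?thesis unfolding g'_def[abs_def] g''_def by (intro DERIV_sum) auto
    qed
    \<comment> \<open>The directions \<open>A \<gamma> ?w\<close> all give the same derivative at
      the fixed point \<open>?a\<close>, and their sum over \<open>G\<close> is zero.\<close>
    have "g' 0 = 0"
    proof -
      have "g' 0 = (\<Sum>i<n. partial_deriv i f ?a * A \<gamma> ?w i)" if "\<gamma> \<in> G" for \<gamma>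
        using dderiv_inv[OF f inv aV wE that] A_avg[OF that] by (simp add: g'_def)
      then have "card G * g' 0 = (\<Sum>\<gamma>\<in>G. \<Sum>i<n. partial_deriv i f ?a * A \<gamma> ?w i)"
        using sum_constant[of "g' 0" G] by (metis (no_types, lifting) sum.cong)
      also have "\<dots> = (\<Sum>i<n. partial_deriv i f ?a * (\<Sum>\<gamma>\<in>G. A \<gamma> ?w i))"
        unfolding sum_distrib_left by (rule sum.swap)
      also have "\<dots> = 0"
      proof (intro sum.neutral ballI)
        fix i
        have "(\<Sum>\<gamma>\<in>G. A \<gamma> ?w i) / card G = 0" using fun_cong[OF avg_dev[of v], of i] by (simp add: avg_def)
        then show "partial_deriv i f ?a * (\<Sum>\<gamma>\<in>G. A \<gamma> ?w i) = 0" using card_G by simp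
      qed
      finally show ?thesis using card_G by simp
    qed
    \<comment> \<open>The mean value theorem, applied twice, yields \<open>f v = x * g'' z\<close>
      with \<open>x\<close> between 0 and 1, which is enough of Taylor's formula.\<close>
    obtain x where x: "0 < x" "x < 1" "g 1 - g 0 = (1 - 0) * g' x" using MVT2[of 0 1 g g'] dg by auto
    obtain z where z: "0 < z" "z < x" "g' x - g' 0 = (x - 0) * g'' z" using MVT2[of 0 x g' g''] dg' x by auto
    have "g 0 = 0" unfolding g_def y0 by (rule zero[OF avg_Fix aV])
    moreover have "g 1 = f v" unfolding g_def y1 ..
    ultimately have "f v = x * g'' z" using x(3) z(3) \<open>g' 0 = 0\<close> by simp
    then have "\<bar>f v\<bar> = \<bar>x\<bar> * \<bar>g'' z\<bar>" by (simp only: abs_mult)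
    also have "\<dots> \<le> 1 * \<bar>g'' z\<bar>" using x by (intro mult_right_mono) auto
    also have "\<bar>g'' z\<bar> \<le> (\<Sum>i<n. \<Sum>j<n. M * \<bar>?w j\<bar> * \<bar>?w i\<bar>)"
    proof -
      have zb: "?y z \<in> cbx n (\<lambda>_. 0) e" using yb[of z] z x by simp
      have "\<bar>g'' z\<bar> \<le> (\<Sum>i<n. \<bar>(\<Sum>j<n. partial_deriv j (partial_deriv i f) (?y z) * ?w j) * ?w i\<bar>)"
        unfolding g''_def by (rule sum_abs)
      also have "\<dots> \<le> (\<Sum>i<n. (\<Sum>j<n. M * \<bar>?w j\<bar>) * \<bar>?w i\<bar>)"
        unfolding abs_mult
      proof (intro sum_mono mult_right_mono)
        fix i assume i: "i \<in> {..<n}"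
        show "\<bar>\<Sum>j<n. partial_deriv j (partial_deriv i f) (?y z) * ?w j\<bar> \<le> (\<Sum>j<n. M * \<bar>?w j\<bar>)"
          using M i zb by (intro order_trans[OF sum_abs sum_mono]) (auto simp: abs_mult intro: mult_right_mono)
      qed auto
      also have "\<dots> = (\<Sum>i<n. \<Sum>j<n. M * \<bar>?w j\<bar> * \<bar>?w i\<bar>)" by (simp add: sum_distrib_right)
      finally show ?thesis .
    qed
    also have "(\<Sum>i<n. \<Sum>j<n. M * \<bar>?w j\<bar> * \<bar>?w i\<bar>) = M * (\<Sum>i<n. \<bar>?w i\<bar>)\<^sup>2"
    proof -
      have "M * (\<Sum>i<n. \<bar>?w i\<bar>)\<^sup>2 = M * (\<Sum>i<n. \<Sum>j<n. \<bar>?w i\<bar> * \<bar>?w j\<bar>)"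
        by (simp only: power2_eq_square sum_product)
      also have "\<dots> = (\<Sum>i<n. \<Sum>j<n. M * (\<bar>?w i\<bar> * \<bar>?w j\<bar>))" by (simp only: sum_distrib_left)
      finally show ?thesis by (simp add: mult_ac)
    qed
    also have "(\<Sum>i<n. \<bar>?w i\<bar>)\<^sup>2 \<le> n * (\<Sum>i<n. (?w i)\<^sup>2)"
      using Cauchy_Schwarz_ineq_sum[of "\<lambda>_. 1" "\<lambda>i. \<bar>?w i\<bar>" "{..<n}"] by simp
    also have "n * (\<Sum>i<n. (?w i)\<^sup>2) \<le> n * qG ?w" using qG_ge[OF wE] by (intro mult_left_mono) auto
    finally show ?thesis using M0 by (simp add: mult_left_mono mult.assoc)
  qed
  show ?thesis using s(1) bound by (intro exI[of _ "2 * s"] conjI exI[of _ "M * n"]) auto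
qed

proposition flow_stays:
  assumes Y: "Y \<in> vect (topspace X) F"
  shows "\<exists>e>0. \<forall>t. \<bar>t\<bar> < e \<longrightarrow> t \<in> dm Y (\<phi> u) \<and> fl Y (\<phi> u) t \<in> p ` (Fix \<inter> V)"
proof -
  note YF = vect_F[OF Y]
  define s where "s = r / 3"
  have s: "s > 0" "2 * s < r" using r_pos by (auto simp: s_def)
  let ?\<rho> = "cut s (\<lambda>v. qG (dev v))"
  have \<rho>F: "?\<rho> \<in> F" by (rule cut_F[OF rho_inv smooth_rho s])
  have \<rho>p: "?\<rho> (p v) = qG (dev v) * th s v" if "v \<in> V" for v by (rule cut_p[OF rho_inv that])
  have \<rho>0: "0 \<le> ?\<rho> x" if x: "x \<in> topspace X" for x
  proof (cases "x \<in> p ` V")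
    case True
    then show ?thesis using \<rho>p qG_nonneg th_nonneg by auto
  next
    case False
    then show ?thesis using cut_outside[of "\<lambda>v. qG (dev v)", OF rho_inv x] by simp
  qed
  define f where "f = Y ?\<rho>"
  have fF: "f \<in> F" using YF \<rho>F by (auto simp: f_def)
  have f0: "f (p v) = 0" if v: "v \<in> Fix" "v \<in> V" for v
  proof -
    let ?z = "p v"
    have z: "?z \<in> topspace X" by (rule p_into[OF v(2)])
    note c = fl_IC[OF YF z]
    have op: "open (dm Y ?z)" by (rule vect_dm_open[OF Y z])
    have 0: "0 \<in> dm Y ?z" by (rule ICD(2)[OF c])
    have "((\<lambda>t. ?\<rho> (fl Y ?z t)) has_real_derivative f (fl Y ?z 0)) (at 0 within dm Y ?z)"
      unfolding f_def by (rule ICD(6)[OF c \<rho>F 0])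
    then have d: "((\<lambda>t. ?\<rho> (fl Y ?z t)) has_real_derivative f ?z) (at 0)"
      using at_within_open[OF 0 op] ICD(4)[OF c] by simp
    obtain e where e: "e > 0" "ball 0 e \<subseteq> dm Y ?z" using op 0 open_contains_ball by blast
    have "\<rho> z0 = 0" if "\<rho> = ?\<rho>" "z0 = ?z" for \<rho> z0 using that \<rho>p[OF v(2)] v Fix_iff[OF V_Esp[OF v(2)]] by simp
    then have rz: "?\<rho> (fl Y ?z 0) = 0" using ICD(4)[OF c] by simp
    have "?\<rho> (fl Y ?z 0) \<le> ?\<rho> (fl Y ?z t)" if "\<bar>0 - t\<bar> < e" for t
      unfolding rz using e(2) that by (intro \<rho>0 ICD(5)[OF c]) (auto simp: dist_real_def)
    then show ?thesis using DERIV_local_min[OF d e(1)] by blast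
  qed
  have finv: "f (p (A \<gamma> v)) = f (p v)" if "\<gamma> \<in> G" "v \<in> V" for \<gamma> v using p_inv[OF that] by simp
  obtain s' C where C: "s' > 0" "\<forall>v\<in>Esp n. qG v < s' \<longrightarrow> \<bar>f (p v)\<bar> \<le> C * qG (dev v)"
    using quadratic_growth[of "\<lambda>v. f (p v)", OF p_smooth[OF fF] finv f0] by blast
  \<comment> \<open>Below \<open>s\<close> the cut-off is 1, so \<open>?\<rho>\<close> is the
    squared distance; below \<open>s'\<close> the quadratic bound on \<open>f\<close> holds.\<close>
  define s0 where "s0 = min s s'"
  let ?V0 = "{v \<in> Esp n. qG v < s0}"
  have V0: "?V0 \<subseteq> V" using s by (auto simp: s0_def V_iff)
  have z0: "(\<lambda>_. 0) \<in> ?V0" using s C(1) by (simp add: s0_def qG_zero Esp_iff)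
  have N: "openin X (p ` ?V0)" by (rule p_open[OF open_qG_ball V0])
  have x: "\<phi> u \<in> topspace X" by (rule \<phi>_into[OF u])
  note c = fl_IC[OF YF x]
  have 0: "0 \<in> dm Y (\<phi> u)" by (rule ICD(2)[OF c])
  have fl0: "fl Y (\<phi> u) 0 = p (\<lambda>_. 0)" using ICD(4)[OF c] p_zero by simp
  have "fl Y (\<phi> u) 0 \<in> p ` ?V0" unfolding fl0 using z0 by (rule imageI)
  from IC_near[OF c 0 N this] obtain e1 where e1: "e1 > 0" "\<forall>t\<in>dm Y (\<phi> u). \<bar>t - 0\<bar> < e1 \<longrightarrow> fl Y (\<phi> u) t \<in> p ` ?V0" by blast
  obtain e2 where e2: "e2 > 0" "ball 0 e2 \<subseteq> dm Y (\<phi> u)" using vect_dm_open[OF Y x] 0 open_contains_ball by blast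
  define e where "e = min e1 e2"
  have e: "e > 0" "ball 0 e \<subseteq> dm Y (\<phi> u)" using e1 e2 by (auto simp: e_def)
  have near: "\<exists>v. v \<in> ?V0 \<and> fl Y (\<phi> u) t = p v" if "t \<in> ball 0 e" for t
  proof -
    have "t \<in> dm Y (\<phi> u)" "\<bar>t - 0\<bar> < e1" using e(2) that by (auto simp: e_def dist_real_def)
    then show ?thesis using e1(2) by blast
  qed
  have \<rho>V0: "?\<rho> (p v) = qG (dev v)" if "v \<in> ?V0" for v
    using \<rho>p[of v] V0 that th_1[OF s(1), of v] by (auto simp: s0_def)
  have "fl Y (\<phi> u) t \<in> p ` (Fix \<inter> V)" if t: "t \<in> ball 0 e" for t
  proof -
    have "?\<rho> (fl Y (\<phi> u) t) = 0"
    proof (rule gronwall_zero[where w = "\<lambda>t. ?\<rho> (fl Y (\<phi> u) t)"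
          and w' = "\<lambda>t. f (fl Y (\<phi> u) t)" and K = "ball 0 e" and ?s0.0 = 0 and C = C])
      show "((\<lambda>t. ?\<rho> (fl Y (\<phi> u) t)) has_real_derivative f (fl Y (\<phi> u) s)) (at s within ball 0 e)" if "s \<in> ball 0 e" for s
        unfolding f_def using DERIV_subset[OF ICD(6)[OF c \<rho>F] e(2)] that e(2) by blast
      show "\<bar>f (fl Y (\<phi> u) s)\<bar> \<le> C * ?\<rho> (fl Y (\<phi> u) s)" if sb: "s \<in> ball 0 e" for s
      proof -
        obtain v where v: "v \<in> ?V0" "fl Y (\<phi> u) s = p v" using near[OF sb] by blast
        then have "qG v < s'" "v \<in> Esp n" by (auto simp: s0_def)
        then show ?thesis unfolding v(2) \<rho>V0[OF v(1)] using C(2) by blast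
      qed
      show "0 \<le> ?\<rho> (fl Y (\<phi> u) s)" if "s \<in> ball 0 e" for s
        using e(2) that by (intro \<rho>0 ICD(5)[OF c]) auto
      show "?\<rho> (fl Y (\<phi> u) 0) = 0"
        unfolding fl0 \<rho>V0[OF z0] using Fix_iff[of "\<lambda>_. 0"] zero_Fix by (simp add: Esp_iff)
    qed (use t e(1) in auto)
    moreover obtain v where v: "v \<in> ?V0" "fl Y (\<phi> u) t = p v" using near[OF t] by blast
    ultimately have "qG (dev v) = 0" using \<rho>V0[OF v(1)] by simp
    then have "v \<in> Fix" using Fix_iff[of v] v(1) by simp
    then show ?thesis using v V0 by blast
  qed
  then show ?thesis using e by (intro exI[of _ e]) (auto simp: dist_real_def subset_iff)
qed

end

section \<open>Vector fields along the strata\<close>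

context orbifold_ctx
begin

lemma F_combine:
  assumes "f \<in> F" "g \<in> F"
    and op: "\<And>P h k. openin (Euclidean_space n) P \<Longrightarrow> smooth_fun n P h \<Longrightarrow> smooth_fun n P k \<Longrightarrow> smooth_fun n P (\<lambda>x. b (h x) (k x))"
  shows "(\<lambda>x\<in>topspace X. b (f x) (g x)) \<in> F"
proof -
  have "smooth_fun n U ((\<lambda>x\<in>topspace X. b (f x) (g x)) \<circ> \<phi>)" if c: "(U, \<Gamma>, \<phi>) \<in> \<A>" for U \<Gamma> \<phi>
  proof -
    interpret c: orb_chart X n U \<Gamma> \<phi> by (rule chart_in[OF c])
    show ?thesis
      by (rule smooth_fun_cong[OF c.open_U op[OF c.open_U F_pull[OF assms(1) c] F_pull[OF assms(2) c]]])
         (simp add: c.\<phi>_into)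
  qed
  then show ?thesis unfolding orbifold_smooth_def by auto
qed

lemma F_add: "f \<in> F \<Longrightarrow> g \<in> F \<Longrightarrow> (\<lambda>x\<in>topspace X. f x + g x) \<in> F"
  by (rule F_combine[where b = "(+)"]) (auto intro: smooth_fun_add)

lemma F_mult: "f \<in> F \<Longrightarrow> g \<in> F \<Longrightarrow> (\<lambda>x\<in>topspace X. f x * g x) \<in> F"
  by (rule F_combine[where b = "(*)"]) (auto intro: smooth_fun_mult)

lemma F_scale: "f \<in> F \<Longrightarrow> (\<lambda>x\<in>topspace X. a * f x) \<in> F"
  by (rule F_combine[where b = "\<lambda>s t. a * s"]) (auto intro: smooth_fun_mult smooth_fun_const)

text \<open>The derivative of f along \<open>c\<close> is \<open>Y f\<close> along \<open>c\<close>,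
  a function of the same kind, so smoothness of the curve comes for free.\<close>

lemma IC_of_ode:
  assumes Y: "Y \<in> F \<rightarrow> F" and c: "\<And>t. c t \<in> topspace X"
    and der: "\<And>f t. f \<in> F \<Longrightarrow> ((\<lambda>s. f (c s)) has_real_derivative Y f (c t)) (at t)"
  shows "IC Y (c 0) UNIV c"
proof (rule ICI)
  fix f t assume f: "f \<in> F"
  show "((\<lambda>s. f (c s)) has_real_derivative Y f (c t)) (at t within UNIV)" using der[OF f] by simp
  have "(\<lambda>s. f (c s)) \<in> real_smooth"
  proof (rule real_smooth_coinduct[where P = "\<lambda>h. \<exists>f\<in>F. h = (\<lambda>s. f (c s))"])
    fix h assume "\<exists>f\<in>F. h = (\<lambda>s. f (c s))"
    then obtain f where f: "f \<in> F" "h = (\<lambda>s. f (c s))" by auto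
    show "\<exists>f'. (\<exists>f\<in>F. f' = (\<lambda>s. f (c s))) \<and> (\<forall>t. (h has_real_derivative f' t) (at t))"
      unfolding f(2) using der[OF f(1)] Y f(1) by (intro exI[of _ "\<lambda>s. Y f (c s)"] conjI bexI[of _ "Y f"]) auto
  qed (use f in auto)
  then show "\<exists>e>0. \<exists>h\<in>real_smooth. \<forall>s\<in>UNIV. \<bar>s - t\<bar> < e \<longrightarrow> f (c s) = h s"
    by (intro exI[of _ 1] conjI bexI[of _ "\<lambda>s. f (c s)"]) auto
qed (use c in auto)

text \<open>If every curve exists for all times, the flow domain is the whole product, so its
  openness and the connectedness of its slices need no argument.\<close>

lemma complete_vect:
  assumes Y: "derivation (topspace X) F Y"
    and complete: "\<And>x. x \<in> topspace X \<Longrightarrow> \<exists>c. IC Y x UNIV c"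
  shows "Y \<in> vect (topspace X) F"
proof -
  have YF: "Y \<in> F \<rightarrow> F" using Y by (auto simp: derivation_def PiE_iff)
  have dm: "dm Y x = UNIV" if "x \<in> topspace X" for x
    using complete[OF that] fl_maximal[OF YF that] by blast
  have D: "exp_domain (topspace X) F Y = UNIV \<times> topspace X"
    using dm by (auto simp: exp_domain_def dm_def)
  let ?T = "initial_topology (topspace X) F"
  have "local_flow ?T (exp_domain (topspace X) F Y) (exp_flow (topspace X) F Y)"
    unfolding local_flow_def D topspace_initial
  proof (intro conjI ballI allI impI)
    show "openin (prod_topology euclideanreal ?T) (UNIV \<times> topspace X)"
      using openin_topspace[of "prod_topology euclideanreal ?T"] by (simp add: topspace_initial)
    show "{0} \<times> topspace X \<subseteq> UNIV \<times> topspace X" by auto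
    fix x assume x: "x \<in> topspace X"
    have "UNIV \<times> topspace X \<inter> UNIV \<times> {x} = (UNIV :: real set) \<times> {x}" using x by auto
    then show "connectedin (prod_topology euclideanreal ?T) (UNIV \<times> topspace X \<inter> UNIV \<times> {x})"
      using x by (simp add: connectedin_Times topspace_initial)
    show "exp_flow (topspace X) F Y 0 x = x" using ICD(4)[OF fl_IC[OF YF x]] by (simp add: exp_flow_def fl_def)
  next
    fix s t x assume "(s, x) \<in> UNIV \<times> topspace X \<and> (t, exp_flow (topspace X) F Y s x) \<in> UNIV \<times> topspace X \<and>
        (t + s, x) \<in> UNIV \<times> topspace X"
    then have x: "x \<in> topspace X" by simp
    show "exp_flow (topspace X) F Y t (exp_flow (topspace X) F Y s x) = exp_flow (topspace X) F Y (t + s) x"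
      using fl_shift(2)[OF YF x, of s t] dm[OF x] by (simp add: exp_flow_def fl_def)
  qed
  then show ?thesis using Y by (simp add: vect_def)
qed

definition step where
  "step x y \<longleftrightarrow> (\<exists>Y\<in>vect (topspace X) F. x \<in> topspace X \<and> (\<exists>t\<in>dm Y x. y = fl Y x t))"

lemma vect_orbit_eq: "vect_orbit (topspace X) F x = {y. step\<^sup>*\<^sup>* x y}"
proof -
  have "(\<lambda>u v. \<exists>Y\<in>vect (topspace X) F. \<exists>t. (t, u) \<in> exp_domain (topspace X) F Y \<and> v = exp_flow (topspace X) F Y t u) = step"
    by (intro ext) (auto simp: step_def exp_domain_def exp_flow_def dm_def fl_def)
  then show ?thesis by (simp add: vect_orbit_def)
qed

end

context lin_model
begin

lemma qG_add: "qG (\<lambda>i. a i + b i) \<le> 2 * qG a + 2 * qG b"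
proof -
  have "(x + y)\<^sup>2 \<le> 2 * x\<^sup>2 + 2 * y\<^sup>2" for x y :: real
    using zero_le_power2[of "x - y"] by (simp add: power2_eq_square algebra_simps)
  then have "(\<Sum>\<gamma>\<in>G. \<Sum>k<n. (A \<gamma> a k + A \<gamma> b k)\<^sup>2) \<le> (\<Sum>\<gamma>\<in>G. \<Sum>k<n. 2 * (A \<gamma> a k)\<^sup>2 + 2 * (A \<gamma> b k)\<^sup>2)"
    by (intro sum_mono)
  moreover have "A \<gamma> (\<lambda>i. a i + b i) = (\<lambda>i. A \<gamma> a i + A \<gamma> b i)" for \<gamma> using A_lin[of \<gamma> 1 a 1 b] by simp
  ultimately show ?thesis unfolding qG_def by (simp add: sum.distrib sum_distrib_left)
qed

lemma qG_scale: "qG (\<lambda>i. t * a i) = t\<^sup>2 * qG a"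
proof -
  have "A \<gamma> (\<lambda>i. t * a i) = (\<lambda>i. t * A \<gamma> a i)" for \<gamma> using A_lin[of \<gamma> t a 0 a] by simp
  then show ?thesis unfolding qG_def by (simp add: power_mult_distrib sum_distrib_left)
qed

end

section \<open>A complete vector field along a fixed direction\<close>

locale fix_direction = lin_model +
  fixes Q assumes Q_Fix: "Q \<in> Fix" and Q_nz: "Q \<noteq> (\<lambda>_. 0)" and Q_small: "qG Q \<le> r / 7"
begin

lemma Q_Esp: "Q \<in> Esp n" using Q_Fix by (simp add: Fix_def)

lemma A_Q: "\<gamma> \<in> G \<Longrightarrow> A \<gamma> Q = Q" using Q_Fix by (simp add: Fix_def)

text \<open>The coordinate along \<open>Q\<close>. The standard inner product need not be invariant;
  inserting \<open>avg\<close> makes \<open>ell\<close> so.\<close>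

definition ell where "ell v = (\<Sum>k<n. avg v k * Q k) / (\<Sum>k<n. (Q k)\<^sup>2)"

definition dd where "dd v = (\<lambda>i. v i - ell v * Q i)"

definition fac where "fac v = plateau (qG (dd v) / (r / 7))"

text \<open>The speed of the field in direction \<open>Q\<close>. The transverse cut-off
  \<open>fac\<close> is constant on lines parallel to \<open>Q\<close>, so on each of them the field
  is \<open>hfun\<close> in the coordinate \<open>ell\<close>, slowed down by a constant.\<close>

definition xi where "xi v = hfun (ell v) * fac v"

lemma norm_Q: "(\<Sum>k<n. (Q k)\<^sup>2) > 0"
proof (rule ccontr)
  assume "\<not> (\<Sum>k<n. (Q k)\<^sup>2) > 0"
  then have "(\<Sum>k<n. (Q k)\<^sup>2) = 0" using sum_nonneg[of "{..<n}" "\<lambda>k. (Q k)\<^sup>2"] by simp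
  then have "\<forall>k<n. Q k = 0" by (simp add: sum_nonneg_eq_0_iff)
  then have "Q = (\<lambda>_. 0)" using Q_Esp by (intro Esp_ext[of Q n]) (auto simp: Esp_iff)
  then show False using Q_nz by simp
qed

lemma ell_inv: "\<gamma> \<in> G \<Longrightarrow> ell (A \<gamma> v) = ell v" by (simp add: ell_def avg_inv)

lemma ell_line: "ell (\<lambda>i. v i + t * Q i) = ell v + t"
proof -
  have "avg (\<lambda>i. v i + t * Q i) = (\<lambda>i. avg v i + t * Q i)"
    using avg_lin[of 1 v t Q] avg_of_Fix[OF Q_Fix] by simp
  then have "(\<Sum>k<n. avg (\<lambda>i. v i + t * Q i) k * Q k) = (\<Sum>k<n. avg v k * Q k) + t * (\<Sum>k<n. (Q k)\<^sup>2)"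
    by (simp add: sum.distrib sum_distrib_left algebra_simps power2_eq_square)
  then show ?thesis using norm_Q unfolding ell_def by (simp add: field_simps)
qed

lemma dd_line: "dd (\<lambda>i. v i + t * Q i) = dd v"
  by (simp add: dd_def ell_line algebra_simps)

lemma A_dd: assumes "\<gamma> \<in> G" shows "A \<gamma> (dd v) = dd (A \<gamma> v)"
proof -
  have "A \<gamma> (\<lambda>i. 1 * v i + (- ell v) * Q i) = (\<lambda>i. 1 * A \<gamma> v i + (- ell v) * A \<gamma> Q i)" by (rule A_lin)
  then show ?thesis using A_Q[OF assms] ell_inv[OF assms] by (simp add: dd_def)
qed

lemma fac_inv: "\<gamma> \<in> G \<Longrightarrow> fac (A \<gamma> v) = fac v" by (simp add: fac_def A_dd[symmetric] qG_inv)

lemma xi_inv: "\<gamma> \<in> G \<Longrightarrow> xi (A \<gamma> v) = xi v" by (simp add: xi_def fac_inv ell_inv)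

lemma smooth_ell: "smooth_fun n V ell"
  unfolding ell_def[abs_def] divide_inverse
  by (intro smooth_fun_mult smooth_fun_sum smooth_avg smooth_fun_const smooth_fun_coord open_V)

lemma smooth_xi: "smooth_fun n V xi"
proof -
  have "smooth_fun n V (\<lambda>v. dd v i)" for i
    unfolding dd_def by (intro smooth_fun_diff smooth_fun_mult smooth_ell smooth_fun_const smooth_fun_coord open_V)
  then have "smooth_fun n V (\<lambda>v. qG (dd v))" by (intro smooth_qG open_V)
  then show ?thesis
    unfolding xi_def[abs_def] fac_def divide_inverse
    by (intro smooth_fun_mult hfun_smooth plateau_smooth smooth_ell smooth_fun_const open_V)
qed

text \<open>In the support \<open>qG (dd v)\<close> is below 2r / 7 and \<open>ell v\<close> times
  \<open>Q\<close> contributes at most r / 7. By \<open>qG_add\<close> the total is at most 2 (2r /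
  7) + 2 (r / 7) = 6r / 7, which is less than \<open>r\<close>: hence the constant 7.\<close>

lemma line_bound:
  assumes "\<bar>ell v\<bar> < 1" "fac v \<noteq> 0"
  shows "qG v \<le> 6 * r / 7"
proof -
  have "qG (dd v) / (r / 7) < 2" using assms(2) plateau_0 unfolding fac_def by (metis not_le)
  then have a: "qG (dd v) < 2 * (r / 7)" using r_pos by (simp add: field_simps)
  have "(ell v)\<^sup>2 \<le> 1" using assms(1) by (simp add: abs_square_le_1)
  then have "(ell v)\<^sup>2 * qG Q \<le> 1 * (r / 7)" using Q_small qG_nonneg by (intro mult_mono) auto
  moreover have "qG (\<lambda>i. dd v i + ell v * Q i) \<le> 2 * qG (dd v) + 2 * qG (\<lambda>i. ell v * Q i)" by (rule qG_add)
  moreover have "(\<lambda>i. dd v i + ell v * Q i) = v" by (simp add: dd_def)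
  ultimately show ?thesis using a unfolding qG_scale by simp
qed

lemma xi_nonzero: assumes "xi v \<noteq> 0" shows "\<bar>ell v\<bar> < 1" "fac v \<noteq> 0"
  using hfun_zero[of "ell v"] assms by (force simp: xi_def)+

lemma xi_support: "xi v \<noteq> 0 \<Longrightarrow> qG v \<le> 6 * r / 7"
  using line_bound[OF xi_nonzero] .

definition dQ where "dQ h v = (\<Sum>i<n. partial_deriv i h v * Q i)"

text \<open>The derivative along \<open>xi v\<close> times \<open>Q\<close>, extended by zero. It
  descends to X because \<open>Q\<close> is fixed by \<open>G\<close> and \<open>xi\<close> is
  invariant, and the extension is smooth because \<open>xi\<close> vanishes beyond 6r / 7.\<close>

definition Y where "Y = (\<lambda>f\<in>F. push (\<lambda>v. xi v * dQ (\<lambda>v. f (p v)) v))"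

lemma smooth_dQ: "smooth_fun n V h \<Longrightarrow> smooth_fun n V (dQ h)"
  unfolding dQ_def[abs_def] by (intro smooth_fun_sum smooth_fun_mult smooth_fun_const smooth_funD(2) open_V) auto

lemma xi_dQ_inv:
  assumes "f \<in> F" "\<gamma> \<in> G" "v \<in> V"
  shows "xi (A \<gamma> v) * dQ (\<lambda>v. f (p v)) (A \<gamma> v) = xi v * dQ (\<lambda>v. f (p v)) v"
  using dderiv_inv[OF p_smooth[OF assms(1)] _ assms(3) Q_Esp assms(2)] p_inv xi_inv[OF assms(2)] A_Q[OF assms(2)]
  by (simp add: dQ_def)

lemma Y_p: "f \<in> F \<Longrightarrow> v \<in> V \<Longrightarrow> Y f (p v) = xi v * dQ (\<lambda>v. f (p v)) v"
  unfolding Y_def using push_p[of "\<lambda>v. xi v * dQ (\<lambda>v. f (p v)) v" v] xi_dQ_inv[of f] by simp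

lemma Y_outside: "f \<in> F \<Longrightarrow> x \<in> topspace X \<Longrightarrow> x \<notin> p ` V \<Longrightarrow> Y f x = 0"
  unfolding Y_def using push_outside by simp

lemma Y_F: assumes f: "f \<in> F" shows "Y f \<in> F"
proof -
  have "push (\<lambda>v. xi v * dQ (\<lambda>v. f (p v)) v) \<in> F"
  proof (rule push_F[where s = "6 * r / 7"])
    show "smooth_fun n V (\<lambda>v. xi v * dQ (\<lambda>v. f (p v)) v)"
      by (intro smooth_fun_mult smooth_xi smooth_dQ p_smooth f open_V)
    show "6 * r / 7 < r" using r_pos by simp
    show "xi v * dQ (\<lambda>v. f (p v)) v = 0" if "6 * r / 7 < qG v" for v
      using xi_support[of v] that by auto
  qed (rule xi_dQ_inv[OF f])
  then show ?thesis using f by (simp add: Y_def)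
qed

lemma dQ_eqI:
  assumes h: "smooth_fun n V h" and v: "v \<in> V" and eq: "\<And>w. w \<in> V \<Longrightarrow> h w = k w"
    and der: "((\<lambda>t. k (\<lambda>i. v i + t * Q i)) has_real_derivative D) (at 0)"
  shows "dQ h v = D"
proof -
  have "((\<lambda>t. h (\<lambda>i. v i + t * Q i)) has_real_derivative dQ h v) (at 0)"
    unfolding dQ_def using line_deriv[OF h, of v 0 Q] v V_Esp Q_Esp by simp
  moreover have ev: "\<forall>\<^sub>F t in nhds 0. h (\<lambda>i. v i + t * Q i) = k (\<lambda>i. v i + t * Q i)"
    using eventually_line_in_V[OF v Q_Esp] by eventually_elim (rule eq)
  ultimately have "((\<lambda>t. k (\<lambda>i. v i + t * Q i)) has_real_derivative dQ h v) (at 0)"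
    using DERIV_cong_ev[OF refl ev refl] by simp
  then show ?thesis using der DERIV_unique by blast
qed

lemma dQ_line:
  assumes "f \<in> F" "v \<in> V"
  shows "((\<lambda>t. f (p (\<lambda>i. v i + t * Q i))) has_real_derivative dQ (\<lambda>v. f (p v)) v) (at 0)"
  unfolding dQ_def using line_deriv[OF p_smooth[OF assms(1)], of v 0 Q] assms(2) V_Esp Q_Esp by simp

text \<open>One argument for sums and products: \<open>b\<close> is the pointwise operation,
  \<open>b'\<close> its derivative rule in terms of the two values and the two derivatives, and
  \<open>c\<close> the common value of \<open>xi\<close> at all preimages of
  \<open>x\<close>.\<close>

lemma Y_combine:
  assumes f: "f \<in> F" and g: "g \<in> F" and h: "(\<lambda>x\<in>topspace X. b (f x) (g x)) \<in> F"
    and x: "x \<in> topspace X" and b0: "b' (f x) (g x) 0 0 = 0"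
    and scale: "\<And>s t y z. c * b' s t y z = b' s t (c * y) (c * z)"
    and der: "\<And>F G f' g'. (F has_real_derivative f') (at 0) \<Longrightarrow> (G has_real_derivative g') (at 0) \<Longrightarrow>
       ((\<lambda>t. b (F t) (G t)) has_real_derivative b' (F 0) (G 0) f' g') (at (0::real))"
    and cc: "\<And>v. x = p v \<Longrightarrow> v \<in> V \<Longrightarrow> c = xi v"
  shows "Y (\<lambda>x\<in>topspace X. b (f x) (g x)) x = b' (f x) (g x) (Y f x) (Y g x)"
proof (cases "x \<in> p ` V")
  case True
  then obtain v where v: "v \<in> V" "x = p v" by auto
  have "dQ (\<lambda>v. (\<lambda>x\<in>topspace X. b (f x) (g x)) (p v)) v = b' (f (p v)) (g (p v)) (dQ (\<lambda>v. f (p v)) v) (dQ (\<lambda>v. g (p v)) v)"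
  proof (rule dQ_eqI[OF p_smooth[OF h] v(1), of "\<lambda>v. b (f (p v)) (g (p v))"])
    show "(\<lambda>x\<in>topspace X. b (f x) (g x)) (p w) = b (f (p w)) (g (p w))" if "w \<in> V" for w using p_into[OF that] by simp
    show "((\<lambda>t. b (f (p (\<lambda>i. v i + t * Q i))) (g (p (\<lambda>i. v i + t * Q i)))) has_real_derivative
        b' (f (p v)) (g (p v)) (dQ (\<lambda>v. f (p v)) v) (dQ (\<lambda>v. g (p v)) v)) (at 0)"
      using der[OF dQ_line[OF f v(1)] dQ_line[OF g v(1)]] by simp
  qed
  then show ?thesis unfolding v(2) using Y_p[OF h v(1)] Y_p[OF f v(1)] Y_p[OF g v(1)] scale cc[OF v(2,1)] by simp
next
  case False
  then show ?thesis using Y_outside[OF f x] Y_outside[OF g x] Y_outside[OF h x] b0 by simp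
qed

lemma Y_ext: "f \<in> F \<Longrightarrow> Y f \<in> extensional (topspace X)"
  using Y_F F_ext by blast

lemma Y_derivation: "derivation (topspace X) F Y"
  unfolding derivation_def
proof (intro conjI ballI allI)
  show "Y \<in> F \<rightarrow>\<^sub>E F" using Y_F by (auto simp: Y_def)
  have ex: "\<exists>c. \<forall>v. x = p v \<longrightarrow> v \<in> V \<longrightarrow> c = xi v" for x
  proof (cases "x \<in> p ` V")
    case True
    then obtain w where w: "w \<in> V" "x = p w" by auto
    have "xi w = xi v" if "x = p v" "v \<in> V" for v
      using p_eqD[OF w(1) that(2)] that(1) w(2) xi_inv by metis
    then show ?thesis by blast
  qed auto
  fix f g assume f: "f \<in> F" and g: "g \<in> F"
  show "Y (\<lambda>x\<in>topspace X. f x + g x) = (\<lambda>x\<in>topspace X. Y f x + Y g x)"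
  proof (rule extensionalityI[OF Y_ext[OF F_add[OF f g]]])
    fix x assume x: "x \<in> topspace X"
    obtain c where c: "\<And>v. x = p v \<Longrightarrow> v \<in> V \<Longrightarrow> c = xi v" using ex[of x] by blast
    show "Y (\<lambda>x\<in>topspace X. f x + g x) x = (\<lambda>x\<in>topspace X. Y f x + Y g x) x"
      using Y_combine[where b = "(+)" and b' = "\<lambda>s t y z. y + z" and c = c, OF f g F_add[OF f g] x] c x
      by (simp add: DERIV_add distrib_left)
  qed simp
  show "Y (\<lambda>x\<in>topspace X. f x * g x) = (\<lambda>x\<in>topspace X. f x * Y g x + g x * Y f x)"
  proof (rule extensionalityI[OF Y_ext[OF F_mult[OF f g]]])
    fix x assume x: "x \<in> topspace X"
    obtain c where c: "\<And>v. x = p v \<Longrightarrow> v \<in> V \<Longrightarrow> c = xi v" using ex[of x] by blast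
    have "Y (\<lambda>x\<in>topspace X. f x * g x) x = f x * Y g x + g x * Y f x"
    proof (rule Y_combine[where b = "(*)" and b' = "\<lambda>s t y z. s * z + t * y" and c = c, OF f g F_mult[OF f g] x _ _ _ c])
      show "((\<lambda>t. F t * G t) has_real_derivative F 0 * g' + G 0 * f') (at 0)"
        if "(F has_real_derivative f') (at 0)" "(G has_real_derivative g') (at 0)" for F G :: "real \<Rightarrow> real" and f' g'
        using DERIV_mult[OF that] by (simp add: algebra_simps)
    qed (auto simp: algebra_simps)
    then show "Y (\<lambda>x\<in>topspace X. f x * g x) x = (\<lambda>x\<in>topspace X. f x * Y g x + g x * Y f x) x" using x by simp
  qed simp
next
  fix a f assume f: "f \<in> F"
  show "Y (\<lambda>x\<in>topspace X. a * f x) = (\<lambda>x\<in>topspace X. a * Y f x)"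
  proof (rule extensionalityI[OF Y_ext[OF F_scale[OF f]]])
    fix x assume x: "x \<in> topspace X"
    have "Y (\<lambda>x\<in>topspace X. a * f x) x = a * Y f x"
    proof (cases "x \<in> p ` V")
      case True
      then obtain v where v: "v \<in> V" "x = p v" by auto
      have "dQ (\<lambda>v. (\<lambda>x\<in>topspace X. a * f x) (p v)) v = a * dQ (\<lambda>v. f (p v)) v"
        by (rule dQ_eqI[OF p_smooth[OF F_scale[OF f]] v(1), of _ "\<lambda>v. a * f (p v)"])
           (simp_all add: p_into DERIV_cmult dQ_line[OF f v(1)])
      then show ?thesis unfolding v(2) using Y_p[OF F_scale[OF f] v(1)] Y_p[OF f v(1)] by simp
    next
      case False
      then show ?thesis using Y_outside[OF f x] Y_outside[OF F_scale[OF f] x] by simp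
    qed
    then show "Y (\<lambda>x\<in>topspace X. a * f x) x = (\<lambda>x\<in>topspace X. a * Y f x) x" using x by simp
  qed simp
qed

lemma Y_funcset: "Y \<in> F \<rightarrow> F" using Y_F by blast

text \<open>The curve moves parallel to \<open>Q\<close>, so that \<open>dd\<close> and
  \<open>fac\<close> stay constant and \<open>ell\<close> equals \<open>\<sigma>\<close>. The
  equation of the integral curve reduces to the scalar one, and since \<open>\<sigma>\<close> stays
  between -1 and 1 the curve never leaves \<open>V\<close>.\<close>

lemma Y_curve:
  assumes v: "v \<in> Esp n" and fac: "fac v \<noteq> 0"
    and \<sigma>: "\<And>t. \<bar>\<sigma> t\<bar> < 1 \<and> (\<sigma> has_real_derivative fac v * hfun (\<sigma> t)) (at t)" and \<sigma>0: "\<sigma> 0 = ell v"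
  shows "IC Y (p v) UNIV (\<lambda>t. p (\<lambda>i. v i + (\<sigma> t - ell v) * Q i))"
proof -
  let ?v = "\<lambda>t i. v i + (\<sigma> t - ell v) * Q i"
  have ell: "ell (?v t) = \<sigma> t" and fv: "fac (?v t) = fac v" for t
    by (simp_all add: ell_line fac_def dd_line)
  have vE: "?v t \<in> Esp n" for t using v Q_Esp by (auto simp: Esp_iff)
  have vV: "?v t \<in> V" for t
  proof -
    have "qG (?v t) \<le> 6 * r / 7" using line_bound[of "?v t"] ell fv fac \<sigma> by simp
    then show ?thesis using vE[of t] r_pos unfolding V_iff by simp
  qed
  have "IC Y (p (?v 0)) UNIV (\<lambda>t. p (?v t))"
  proof (rule IC_of_ode[OF Y_funcset, of "\<lambda>t. p (?v t)"])
    show "p (?v t) \<in> topspace X" for t by (rule p_into[OF vV])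
    fix f t assume f: "f \<in> F"
    have "((\<lambda>s. f (p (?v s))) has_real_derivative
        (\<Sum>i<n. partial_deriv i (\<lambda>v. f (p v)) (?v t) * (fac v * hfun (\<sigma> t) * Q i))) (at t)"
    proof (rule smooth_fun_chain_curve[where c = ?v and f = "\<lambda>v. f (p v)", OF open_V p_smooth[OF f] vV])
      show "((\<lambda>s. ?v s i) has_real_derivative fac v * hfun (\<sigma> t) * Q i) (at t)" for i
      proof -
        have "((\<lambda>s. v i + (\<sigma> s - ell v) * Q i) has_real_derivative 0 + (fac v * hfun (\<sigma> t) - 0) * Q i) (at t)"
          using \<sigma>[of t] by (intro DERIV_add DERIV_const DERIV_cmult_right DERIV_diff) auto
        then show ?thesis by simp
      qed
      show "\<forall>\<^sub>F s in at t. ?v s \<in> Esp n" using vE by simp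
    qed
    also have "(\<Sum>i<n. partial_deriv i (\<lambda>v. f (p v)) (?v t) * (fac v * hfun (\<sigma> t) * Q i)) = Y f (p (?v t))"
      unfolding Y_p[OF f vV] dQ_def xi_def ell fv by (simp add: sum_distrib_left mult_ac)
    finally show "((\<lambda>s. f (p (?v s))) has_real_derivative Y f (p (?v t))) (at t)" .
  qed
  then show ?thesis using \<sigma>0 by simp
qed

lemma Y_const_curve:
  assumes x: "x \<in> topspace X" and z: "\<And>f. f \<in> F \<Longrightarrow> Y f x = 0"
  shows "IC Y x UNIV (\<lambda>_. x)"
  using IC_of_ode[OF Y_funcset, of "\<lambda>_. x"] x z by simp

lemma Y_vect: "Y \<in> vect (topspace X) F"
proof (rule complete_vect[OF Y_derivation])
  fix x assume x: "x \<in> topspace X"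
  show "\<exists>c. IC Y x UNIV c"
  proof (cases "x \<in> p ` V")
    case True
    then obtain v where v: "v \<in> V" "x = p v" by auto
    show ?thesis
    proof (cases "xi v = 0")
      case True
      then show ?thesis using Y_const_curve[OF x] Y_p[OF _ v(1)] v(2) by auto
    next
      case False
      then have fac: "fac v \<noteq> 0" and l: "\<bar>ell v\<bar> < 1" using xi_nonzero[OF False] by auto
      obtain \<psi> where \<psi>: "\<And>y. \<bar>\<psi> y\<bar> < 1 \<and> (\<psi> has_real_derivative hfun (\<psi> y)) (at y)" "\<And>s. \<bar>s\<bar> < 1 \<Longrightarrow> \<exists>y. \<psi> y = s"
        using flow_hfun by blast
      obtain y where y: "\<psi> y = ell v" using \<psi>(2)[OF l] by blast
      have "\<bar>\<psi> (y + fac v * t)\<bar> < 1 \<and> ((\<lambda>t. \<psi> (y + fac v * t)) has_real_derivative fac v * hfun (\<psi> (y + fac v * t))) (at t)" for t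
      proof -
        have "((\<lambda>t. y + fac v * t) has_real_derivative fac v) (at t)" by (auto intro!: derivative_eq_intros)
        from DERIV_chain2[OF conjunct2[OF \<psi>(1)] this] show ?thesis using \<psi>(1) by (simp add: mult.commute)
      qed
      from Y_curve[OF V_Esp[OF v(1)] fac this] show ?thesis using y v(2) by auto
    qed
  next
    case False
    then show ?thesis using Y_const_curve[OF x] Y_outside[OF _ x] by auto
  qed
qed

text \<open>From the origin the coordinate \<open>ell\<close> runs through the open interval from -1
  to 1 without reaching its ends, so the target is half of \<open>Q\<close> and not \<open>Q\<close>
  itself.\<close>

lemma Y_reaches: "\<exists>t\<in>dm Y (\<phi> u). fl Y (\<phi> u) t = p (\<lambda>i. 1 / 2 * Q i)"
proof -
  let ?z = "\<lambda>_::nat. 0::real"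
  have zE: "?z \<in> Esp n" by (simp add: Esp_iff)
  have ell0: "ell ?z = 0" by (simp add: ell_def avg_of_Fix[OF zero_Fix])
  have fac0: "fac ?z = 1" by (simp add: fac_def dd_def ell0 qG_zero plateau_1)
  obtain \<psi> where \<psi>: "\<And>y. \<bar>\<psi> y\<bar> < 1 \<and> (\<psi> has_real_derivative hfun (\<psi> y)) (at y)" "\<And>s. \<bar>s\<bar> < 1 \<Longrightarrow> \<exists>y. \<psi> y = s"
    using flow_hfun by blast
  obtain y where y: "\<psi> y = 0" using \<psi>(2)[of 0] by auto
  obtain y' where y': "\<psi> y' = 1 / 2" using \<psi>(2)[of "1 / 2"] by auto
  define \<sigma> where "\<sigma> t = \<psi> (y + t)" for t
  have "\<bar>\<sigma> t\<bar> < 1 \<and> (\<sigma> has_real_derivative fac ?z * hfun (\<sigma> t)) (at t)" for t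
  proof -
    have "((\<lambda>t. y + t) has_real_derivative 1) (at t)" by (auto intro!: derivative_eq_intros)
    from DERIV_chain2[OF conjunct2[OF \<psi>(1)] this] show ?thesis using \<psi>(1) unfolding \<sigma>_def[abs_def] fac0 by simp
  qed
  from Y_curve[OF zE _ this] have c: "IC Y (\<phi> u) UNIV (\<lambda>t. p (\<lambda>i. 0 + (\<sigma> t - ell ?z) * Q i))"
    using fac0 ell0 y p_zero by (simp add: \<sigma>_def)
  note m = fl_maximal[OF Y_funcset \<phi>_into[OF u] c]
  have "fl Y (\<phi> u) (y' - y) = p (\<lambda>i. 0 + (\<sigma> (y' - y) - ell ?z) * Q i)" using m by simp
  also have "\<sigma> (y' - y) - ell ?z = 1 / 2" using y' ell0 by (simp add: \<sigma>_def)
  also have "p (\<lambda>i. 0 + 1 / 2 * Q i) = p (\<lambda>i. 1 / 2 * Q i)" by simp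
  finally show ?thesis using m by (intro bexI[of _ "y' - y"]) auto
qed

end

context lin_model
begin

text \<open>Taking \<open>Q\<close> as twice \<open>q\<close> multiplies \<open>qG\<close> by 4, so
  the bound r / 28 becomes the bound r / 7 of \<open>fix_direction\<close>. The origin is treated
  apart because \<open>Q\<close> must not vanish.\<close>

proposition reach:
  assumes q: "q \<in> Fix" "qG q \<le> r / 28"
  shows "p q \<in> vect_orbit (topspace X) F (\<phi> u)"
proof (cases "q = (\<lambda>_. 0)")
  case True
  then show ?thesis unfolding vect_orbit_eq using p_zero by simp
next
  case False
  define Q where "Q = (\<lambda>i. 2 * q i)"
  have "A \<gamma> (\<lambda>i. 2 * q i + 0 * q i) = (\<lambda>i. 2 * A \<gamma> q i + 0 * A \<gamma> q i)" for \<gamma> by (rule A_lin)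
  then have "Q \<in> Fix" using q(1) by (simp add: Fix_def Q_def Esp_iff)
  moreover have "Q \<noteq> (\<lambda>_. 0)" using False by (auto simp: Q_def fun_eq_iff)
  moreover have "qG Q \<le> r / 7" unfolding Q_def qG_scale using q(2) by simp
  ultimately interpret fix_direction X n \<A> U \<Gamma> \<phi> u r B S Q by unfold_locales
  obtain t where "t \<in> dm Y (\<phi> u)" "fl Y (\<phi> u) t = p (\<lambda>i. 1 / 2 * Q i)" using Y_reaches by blast
  then have "step (\<phi> u) (p q)"
    unfolding step_def using Y_vect \<phi>_into[OF u] by (intro bexI[of _ Y] conjI bexI[of _ t]) (auto simp: Q_def)
  then show ?thesis unfolding vect_orbit_eq by blast
qed

end

section \<open>Orbit types\<close>

definition stab_set :: "('b \<Rightarrow> 'b) set \<Rightarrow> 'b \<Rightarrow> ('b \<Rightarrow> 'b) set" where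
  "stab_set \<Gamma> x = {\<gamma> \<in> \<Gamma>. \<gamma> x = x}"

text \<open>Conjugacy of stabilisers, expressed as equality of stabilisers at suitable points of the
  two fibres.\<close>

definition same_type :: "'b set \<Rightarrow> ('b \<Rightarrow> 'b) set \<Rightarrow> ('b \<Rightarrow> 'a) \<Rightarrow> 'a \<Rightarrow> 'a \<Rightarrow> bool" where
  "same_type U \<Gamma> \<phi> a b \<longleftrightarrow> (\<exists>x\<in>U. \<exists>y\<in>U. \<phi> x = a \<and> \<phi> y = b \<and> stab_set \<Gamma> x = stab_set \<Gamma> y)"

text \<open>The choice of the preimage is harmless, as stabilisers along a fibre are conjugate.
  Orders are numbers, so they can be compared and minimised.\<close>

definition stab_card :: "'b set \<Rightarrow> ('b \<Rightarrow> 'b) set \<Rightarrow> ('b \<Rightarrow> 'a) \<Rightarrow> 'a \<Rightarrow> nat" where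
  "stab_card U \<Gamma> \<phi> a = card (stab_set \<Gamma> (SOME x. x \<in> U \<and> \<phi> x = a))"

definition conn_comp :: "'a topology \<Rightarrow> 'a set \<Rightarrow> 'a \<Rightarrow> 'a set" where
  "conn_comp X Z a = \<Union>{K. connectedin X K \<and> K \<subseteq> Z \<and> a \<in> K}"

lemma conn_comp_max: "connectedin X K \<Longrightarrow> K \<subseteq> Z \<Longrightarrow> a \<in> K \<Longrightarrow> K \<subseteq> conn_comp X Z a"
  by (auto simp: conn_comp_def)

lemma conn_comp_connected: "connectedin X (conn_comp X Z a)"
  unfolding conn_comp_def by (rule connectedin_Union) auto

lemma conn_comp_subset: "conn_comp X Z a \<subseteq> Z"
  by (auto simp: conn_comp_def)

lemma conn_comp_self: "a \<in> topspace X \<Longrightarrow> a \<in> Z \<Longrightarrow> a \<in> conn_comp X Z a"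
  by (auto simp: conn_comp_def intro!: exI[of _ "{a}"])

lemma connected_components_of_subtopology:
  assumes "Z \<subseteq> topspace X"
  shows "connected_components_of (subtopology X Z) = conn_comp X Z ` Z"
proof -
  have "connected_component_of_set (subtopology X Z) a = conn_comp X Z a" for a
    by (auto simp: connected_component_of_def conn_comp_def connectedin_subtopology)
  moreover have "topspace (subtopology X Z) = Z" using assms by auto
  ultimately show ?thesis by (simp add: connected_components_of_def)
qed

lemma connected_locally_constant:
  assumes K: "connectedin X K" and ab: "a \<in> K" "b \<in> K" and Ra: "R a"
    and loc: "\<And>c. c \<in> K \<Longrightarrow> \<exists>N. openin X N \<and> c \<in> N \<and> (\<forall>d\<in>K \<inter> N. R d \<longleftrightarrow> R c)"
  shows "R b"
proof -
  have KX: "K \<subseteq> topspace X" and con: "connected_space (subtopology X K)" using K by (auto simp: connectedin_def)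
  have op: "openin (subtopology X K) {c \<in> K. R c = q}" for q
  proof (subst openin_subopen, intro ballI)
    fix c assume c: "c \<in> {c \<in> K. R c = q}"
    then obtain N where N: "openin X N" "c \<in> N" "\<forall>d\<in>K \<inter> N. R d \<longleftrightarrow> R c" using loc by blast
    have "openin (subtopology X K) (K \<inter> N)" using N(1) by (metis inf_commute openin_subtopology)
    then show "\<exists>T. openin (subtopology X K) T \<and> c \<in> T \<and> T \<subseteq> {c \<in> K. R c = q}"
      using N c by (intro exI[of _ "K \<inter> N"]) auto
  qed
  have top: "topspace (subtopology X K) = K" using KX by auto
  have "K - {c \<in> K. R c = True} = {c \<in> K. R c = False}" by auto
  then have "closedin (subtopology X K) {c \<in> K. R c = True}"
    unfolding closedin_def top using op[of False] by simp
  then have "{c \<in> K. R c = True} = {} \<or> {c \<in> K. R c = True} = K"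
    using con[unfolded connected_space_clopen_in] op[of True] unfolding top by blast
  then show ?thesis
  proof
    assume "{c \<in> K. R c = True} = {}" then show ?thesis using ab(1) Ra by blast
  next
    assume "{c \<in> K. R c = True} = K"
    then have "b \<in> {c \<in> K. R c = True}" using ab(2) by simp
    then show ?thesis by simp
  qed
qed

context orb_chart
begin

lemma stab_set_move:
  assumes d: "\<delta> \<in> \<Gamma>" and x: "x \<in> U"
  shows "stab_set \<Gamma> (\<delta> x) = (\<lambda>h. \<delta> \<odot> h \<odot> gi \<delta>) ` stab_set \<Gamma> x"
proof
  show "stab_set \<Gamma> (\<delta> x) \<subseteq> (\<lambda>h. \<delta> \<odot> h \<odot> gi \<delta>) ` stab_set \<Gamma> x"
  proof
    fix g assume "g \<in> stab_set \<Gamma> (\<delta> x)"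
    then have g: "g \<in> \<Gamma>" "g (\<delta> x) = \<delta> x" by (auto simp: stab_set_def)
    interpret B: group "BijGroup U" by (rule group_BijGroup)
    note cl = \<Gamma>_carrier[OF d] \<Gamma>_carrier[OF g(1)]
    have "(gi \<delta> \<odot> g \<odot> \<delta>) \<in> \<Gamma>" using d g(1) by (intro \<Gamma>_closed)
    moreover have "(gi \<delta> \<odot> g \<odot> \<delta>) x = x" using d g x
      by (simp add: mul_apply \<Gamma>_closed \<Gamma>_into gi_apply)
    moreover have "g = \<delta> \<odot> (gi \<delta> \<odot> g \<odot> \<delta>) \<odot> gi \<delta>"
    proof -
      have "\<delta> \<odot> (gi \<delta> \<odot> g \<odot> \<delta>) \<odot> gi \<delta> = (\<delta> \<odot> gi \<delta>) \<odot> g \<odot> (\<delta> \<odot> gi \<delta>)"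
        using cl by (simp only: B.m_assoc B.m_closed B.inv_closed)
      then show ?thesis using cl by simp
    qed
    ultimately show "g \<in> (\<lambda>h. \<delta> \<odot> h \<odot> gi \<delta>) ` stab_set \<Gamma> x" unfolding stab_set_def by blast
  qed
  show "(\<lambda>h. \<delta> \<odot> h \<odot> gi \<delta>) ` stab_set \<Gamma> x \<subseteq> stab_set \<Gamma> (\<delta> x)"
    using d x by (auto simp: stab_set_def mul_apply \<Gamma>_closed \<Gamma>_into gi_apply)
qed

lemma card_stb_move:
  assumes d: "\<delta> \<in> \<Gamma>" and x: "x \<in> U"
  shows "card (stab_set \<Gamma> (\<delta> x)) = card (stab_set \<Gamma> x)"
proof -
  have le: "card (stab_set \<Gamma> (\<delta> x)) \<le> card (stab_set \<Gamma> x)" if "\<delta> \<in> \<Gamma>" "x \<in> U" for \<delta> x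
    unfolding stab_set_move[OF that] using finite_\<Gamma> by (intro card_image_le) (simp add: stab_set_def)
  have "card (stab_set \<Gamma> (gi \<delta> (\<delta> x))) \<le> card (stab_set \<Gamma> (\<delta> x))" by (rule le[OF \<Gamma>_closed(3)[OF d] \<Gamma>_into[OF d x]])
  then show ?thesis using le[OF d x] d x by (simp add: gi_apply)
qed

lemma stab_card_eq: assumes x: "x \<in> U" shows "stab_card U \<Gamma> \<phi> (\<phi> x) = card (stab_set \<Gamma> x)"
proof -
  let ?y = "SOME y. y \<in> U \<and> \<phi> y = \<phi> x"
  have "?y \<in> U \<and> \<phi> ?y = \<phi> x" by (rule someI[of _ x]) (simp add: x)
  then have y: "?y \<in> U" "\<phi> x = \<phi> ?y" by auto
  then obtain \<gamma> where "\<gamma> \<in> \<Gamma>" "?y = \<gamma> x" using \<phi>_eq_iff[OF x y(1)] by blast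
  then show ?thesis unfolding stab_card_def using card_stb_move[OF _ x] by simp
qed

lemma same_type_sz: "same_type U \<Gamma> \<phi> a b \<Longrightarrow> stab_card U \<Gamma> \<phi> a = stab_card U \<Gamma> \<phi> b"
  using stab_card_eq by (auto simp: same_type_def)

lemma same_type_image: "same_type U \<Gamma> \<phi> a b \<Longrightarrow> a \<in> \<phi> ` U \<and> b \<in> \<phi> ` U"
  by (auto simp: same_type_def)

lemma same_type_refl: "a \<in> \<phi> ` U \<Longrightarrow> same_type U \<Gamma> \<phi> a a"
  by (auto simp: same_type_def)

lemma same_type_sym: "same_type U \<Gamma> \<phi> a b \<Longrightarrow> same_type U \<Gamma> \<phi> b a"
  by (auto simp: same_type_def)

lemma same_type_trans: assumes "same_type U \<Gamma> \<phi> a b" "same_type U \<Gamma> \<phi> b c" shows "same_type U \<Gamma> \<phi> a c"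
proof -
  obtain x y where xy: "x \<in> U" "y \<in> U" "\<phi> x = a" "\<phi> y = b" "stab_set \<Gamma> x = stab_set \<Gamma> y"
    using assms(1) unfolding same_type_def by blast
  obtain w z where wz: "w \<in> U" "z \<in> U" "\<phi> w = b" "\<phi> z = c" "stab_set \<Gamma> w = stab_set \<Gamma> z"
    using assms(2) unfolding same_type_def by blast
  have "\<phi> y = \<phi> w" using xy wz by simp
  then obtain \<delta> where d: "\<delta> \<in> \<Gamma>" "w = \<delta> y" using \<phi>_eq_iff[OF xy(2) wz(1)] by blast
  have "stab_set \<Gamma> (\<delta> x) = stab_set \<Gamma> z" using wz(5) d xy by (simp add: stab_set_move)
  moreover have "\<delta> x \<in> U" "\<phi> (\<delta> x) = a" using d xy \<phi>_inv \<Gamma>_into by auto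
  ultimately show ?thesis using wz unfolding same_type_def by blast
qed

abbreviation "ty a \<equiv> {b. same_type U \<Gamma> \<phi> a b}"

lemma ty_eq: "same_type U \<Gamma> \<phi> a b \<Longrightarrow> ty a = ty b"
  using same_type_trans same_type_sym by blast

lemma stabilizer_eq: "stabilizer (chart_group U \<Gamma>) (\<lambda>\<gamma>. \<gamma>) x = stab_set \<Gamma> x"
  by (simp add: stabilizer_def stab_set_def chart_group_def)

lemma stab_set_subgroup: assumes x: "x \<in> U" shows "subgroup (stab_set \<Gamma> x) (chart_group U \<Gamma>)"
proof -
  interpret B: group "BijGroup U" by (rule group_BijGroup)
  have inv: "inv\<^bsub>chart_group U \<Gamma>\<^esub> \<gamma> = gi \<gamma>" if "\<gamma> \<in> \<Gamma>" for \<gamma>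
    unfolding chart_group_def by (rule B.m_inv_consistent[OF sub_\<Gamma> that])
  show ?thesis
  proof (rule subgroup.intro)
    fix \<gamma> assume g: "\<gamma> \<in> stab_set \<Gamma> x"
    then have gx: "\<gamma> \<in> \<Gamma>" "\<gamma> x = x" by (auto simp: stab_set_def)
    then have "gi \<gamma> x = x" using gi_apply(1)[OF gx(1) x] by simp
    then show "inv\<^bsub>chart_group U \<Gamma>\<^esub> \<gamma> \<in> stab_set \<Gamma> x" using gx by (simp add: inv stab_set_def \<Gamma>_closed)
  qed (use x in \<open>auto simp: stab_set_def chart_group_def \<Gamma>_closed mul_apply one_apply\<close>)
qed

lemma orbit_type_iff:
  assumes H: "subgroup H (chart_group U \<Gamma>)"
  shows "x \<in> orbit_type_set U \<Gamma> H \<longleftrightarrow> x \<in> U \<and> (\<exists>\<gamma>\<in>\<Gamma>. stab_set \<Gamma> x = (\<lambda>h. \<gamma> \<odot> h \<odot> gi \<gamma>) ` H)"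
proof -
  interpret B: group "BijGroup U" by (rule group_BijGroup)
  have inv: "inv\<^bsub>chart_group U \<Gamma>\<^esub> \<gamma> = gi \<gamma>" if "\<gamma> \<in> \<Gamma>" for \<gamma>
    unfolding chart_group_def by (rule B.m_inv_consistent[OF sub_\<Gamma> that])
  have "\<gamma> <#\<^bsub>chart_group U \<Gamma>\<^esub> H #>\<^bsub>chart_group U \<Gamma>\<^esub> (inv\<^bsub>chart_group U \<Gamma>\<^esub> \<gamma>) = (\<lambda>h. \<gamma> \<odot> h \<odot> gi \<gamma>) ` H"
    if "\<gamma> \<in> \<Gamma>" for \<gamma>
    unfolding inv[OF that] by (auto simp: l_coset_def r_coset_def chart_group_def)
  then show ?thesis unfolding orbit_type_set_def stabilizer_eq by auto
qed

text \<open>A point whose stabiliser is conjugate to \<open>H\<close> can be reached by moving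
  \<open>x\<close> within its fibre until both stabilisers coincide.\<close>

lemma orbit_type_image:
  assumes H: "subgroup H (chart_group U \<Gamma>)" and x: "x \<in> orbit_type_set U \<Gamma> H"
  shows "\<phi> ` orbit_type_set U \<Gamma> H = ty (\<phi> x)"
proof -
  interpret B: group "BijGroup U" by (rule group_BijGroup)
  have HG: "H \<subseteq> \<Gamma>" using subgroup.subset[OF H] by (simp add: chart_group_def)
  obtain \<gamma> where g: "x \<in> U" "\<gamma> \<in> \<Gamma>" "stab_set \<Gamma> x = (\<lambda>h. \<gamma> \<odot> h \<odot> gi \<gamma>) ` H" using x orbit_type_iff[OF H] by blast
  have conj: "(\<lambda>h. \<delta> \<odot> h \<odot> gi \<delta>) ` (\<lambda>h. \<epsilon> \<odot> h \<odot> gi \<epsilon>) ` H = (\<lambda>h. (\<delta> \<odot> \<epsilon>) \<odot> h \<odot> gi (\<delta> \<odot> \<epsilon>)) ` H"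
    if "\<delta> \<in> \<Gamma>" "\<epsilon> \<in> \<Gamma>" for \<delta> \<epsilon>
    unfolding image_image
  proof (rule image_cong[OF refl])
    fix h assume "h \<in> H"
    then have "h \<in> carrier (BijGroup U)" "\<delta> \<in> carrier (BijGroup U)" "\<epsilon> \<in> carrier (BijGroup U)"
      using HG that \<Gamma>_carrier by auto
    then show "\<delta> \<odot> (\<epsilon> \<odot> h \<odot> gi \<epsilon>) \<odot> gi \<delta> = (\<delta> \<odot> \<epsilon>) \<odot> h \<odot> gi (\<delta> \<odot> \<epsilon>)"
      by (simp add: B.m_assoc B.inv_mult_group)
  qed
  show ?thesis
  proof (intro Set.set_eqI iffI)
    fix b assume "b \<in> \<phi> ` orbit_type_set U \<Gamma> H"
    then obtain y \<delta> where y: "b = \<phi> y" "y \<in> U" "\<delta> \<in> \<Gamma>" "stab_set \<Gamma> y = (\<lambda>h. \<delta> \<odot> h \<odot> gi \<delta>) ` H"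
      using orbit_type_iff[OF H] by blast
    have dg: "\<delta> \<odot> gi \<gamma> \<in> \<Gamma>" using y g by (intro \<Gamma>_closed)
    have "stab_set \<Gamma> ((\<delta> \<odot> gi \<gamma>) x) = (\<lambda>h. (\<delta> \<odot> gi \<gamma> \<odot> \<gamma>) \<odot> h \<odot> gi (\<delta> \<odot> gi \<gamma> \<odot> \<gamma>)) ` H"
      unfolding stab_set_move[OF dg g(1)] g(3) by (rule conj[OF dg g(2)])
    also have "\<delta> \<odot> gi \<gamma> \<odot> \<gamma> = \<delta>"
      using \<Gamma>_carrier[OF y(3)] \<Gamma>_carrier[OF g(2)] by (simp add: B.m_assoc)
    finally have "stab_set \<Gamma> ((\<delta> \<odot> gi \<gamma>) x) = stab_set \<Gamma> y" using y(4) by simp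
    moreover have "(\<delta> \<odot> gi \<gamma>) x \<in> U" "\<phi> ((\<delta> \<odot> gi \<gamma>) x) = \<phi> x"
      using dg g(1) \<phi>_inv \<Gamma>_into by auto
    ultimately show "b \<in> ty (\<phi> x)" using y(1,2) unfolding same_type_def by blast
  next
    fix b assume "b \<in> ty (\<phi> x)"
    then obtain w y where w: "w \<in> U" "y \<in> U" "\<phi> w = \<phi> x" "\<phi> y = b" "stab_set \<Gamma> w = stab_set \<Gamma> y"
      unfolding same_type_def by blast
    then obtain \<delta> where d: "\<delta> \<in> \<Gamma>" "w = \<delta> x" using \<phi>_eq_iff[OF g(1) w(1)] by auto
    have "stab_set \<Gamma> y = (\<lambda>h. (\<delta> \<odot> \<gamma>) \<odot> h \<odot> gi (\<delta> \<odot> \<gamma>)) ` H"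
      unfolding w(5)[symmetric] d(2) stab_set_move[OF d(1) g(1)] g(3) by (rule conj[OF d(1) g(2)])
    then have "y \<in> orbit_type_set U \<Gamma> H" unfolding orbit_type_iff[OF H] using w(2) d g \<Gamma>_closed(2) by blast
    then show "b \<in> \<phi> ` orbit_type_set U \<Gamma> H" using w(4) by blast
  qed
qed

text \<open>A nonempty orbit type set projects to the type of any of its points, and conversely
  \<open>H\<close> may be taken as the stabiliser of \<open>x\<close>. From here on strata are
  described without subgroups and cosets.\<close>

lemma chart_strata_eq: "chart_strata X (U, \<Gamma>, \<phi>) = (\<lambda>a. conn_comp X (ty a) a) ` (\<phi> ` U)"
proof -
  have tyX: "ty a \<subseteq> topspace X" for a using same_type_image \<phi>_into by blast
  show ?thesis
  proof (intro Set.set_eqI iffI)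
    fix C assume "C \<in> chart_strata X (U, \<Gamma>, \<phi>)"
    then obtain H where H: "subgroup H (chart_group U \<Gamma>)"
      and C: "C \<in> connected_components_of (subtopology X (\<phi> ` orbit_type_set U \<Gamma> H))"
      by (auto simp: chart_strata_def)
    show "C \<in> (\<lambda>a. conn_comp X (ty a) a) ` (\<phi> ` U)"
    proof (cases "orbit_type_set U \<Gamma> H = {}")
      case True
      then show ?thesis using C by (simp add: connected_components_of_def)
    next
      case False
      then obtain x where x: "x \<in> orbit_type_set U \<Gamma> H" by blast
      from C obtain b where b: "b \<in> ty (\<phi> x)" "C = conn_comp X (ty (\<phi> x)) b"
        unfolding orbit_type_image[OF H x] connected_components_of_subtopology[OF tyX] by blast
      have "same_type U \<Gamma> \<phi> (\<phi> x) b" using b(1) by simp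
      from ty_eq[OF this] same_type_image[OF this] b(2) show ?thesis by auto
    qed
  next
    fix C assume "C \<in> (\<lambda>a. conn_comp X (ty a) a) ` (\<phi> ` U)"
    then obtain x where x: "x \<in> U" and C: "C = conn_comp X (ty (\<phi> x)) (\<phi> x)" by blast
    note H = stab_set_subgroup[OF x]
    interpret B: group "BijGroup U" by (rule group_BijGroup)
    have "(\<lambda>h. \<one>\<^bsub>BijGroup U\<^esub> \<odot> h \<odot> gi \<one>\<^bsub>BijGroup U\<^esub>) ` stab_set \<Gamma> x = (\<lambda>h. h) ` stab_set \<Gamma> x"
      by (rule image_cong[OF refl]) (auto simp: stab_set_def dest!: \<Gamma>_carrier)
    then have xH: "x \<in> orbit_type_set U \<Gamma> (stab_set \<Gamma> x)"
      unfolding orbit_type_iff[OF H] using x \<Gamma>_closed(1) by (auto intro!: bexI[of _ "\<one>\<^bsub>BijGroup U\<^esub>"])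
    have "\<phi> x \<in> ty (\<phi> x)" using same_type_refl x by blast
    then have "C \<in> connected_components_of (subtopology X (\<phi> ` orbit_type_set U \<Gamma> (stab_set \<Gamma> x)))"
      unfolding orbit_type_image[OF H xH] connected_components_of_subtopology[OF tyX] C by blast
    then show "C \<in> chart_strata X (U, \<Gamma>, \<phi>)" using H by (auto simp: chart_strata_def)
  qed
qed

end

section \<open>Strata near a point\<close>

context lin_model
begin

lemma stab_set_S: "v \<in> V \<Longrightarrow> stab_set \<Gamma> (S v) = {\<gamma> \<in> G. A \<gamma> v = v}"
  unfolding stab_set_def by (rule stab_S)

lemma stab_set_u: "stab_set \<Gamma> u = G"
  by (simp add: stab_set_def G_def)

lemma stab_card_p: "v \<in> V \<Longrightarrow> stab_card U \<Gamma> \<phi> (p v) = card {\<gamma> \<in> G. A \<gamma> v = v}"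
  unfolding p_def stab_card_eq[OF S_U] by (simp add: stab_set_S)

lemma stab_card_u: "stab_card U \<Gamma> \<phi> (\<phi> u) = card G"
  unfolding stab_card_eq[OF u] stab_set_u ..

lemma p_Fix_iff: assumes v: "v \<in> V" shows "p v \<in> p ` (Fix \<inter> V) \<longleftrightarrow> v \<in> Fix"
proof
  assume "p v \<in> p ` (Fix \<inter> V)"
  then obtain w where w: "w \<in> Fix" "w \<in> V" "p w = p v" by auto
  then obtain \<gamma> where "\<gamma> \<in> G" "v = A \<gamma> w" using p_eqD[OF w(2) v] by blast
  then show "v \<in> Fix" using w(1) by (simp add: Fix_def)
qed (use v in blast)

text \<open>The stabiliser of \<open>S v\<close> is the subgroup of \<open>G\<close> fixing
  \<open>v\<close>, so its order is largest exactly on \<open>Fix\<close>.\<close>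

lemma stab_card_le:
  assumes "v \<in> V"
  shows "stab_card U \<Gamma> \<phi> (p v) \<le> stab_card U \<Gamma> \<phi> (\<phi> u)" "stab_card U \<Gamma> \<phi> (p v) = stab_card U \<Gamma> \<phi> (\<phi> u) \<longleftrightarrow> v \<in> Fix"
proof -
  have le: "card {\<gamma> \<in> G. A \<gamma> v = v} \<le> card G" by (rule card_mono[OF finite_G]) auto
  then show "stab_card U \<Gamma> \<phi> (p v) \<le> stab_card U \<Gamma> \<phi> (\<phi> u)" by (simp add: stab_card_p[OF assms] stab_card_u)
  have "card {\<gamma> \<in> G. A \<gamma> v = v} = card G \<longleftrightarrow> {\<gamma> \<in> G. A \<gamma> v = v} = G"
    using card_subset_eq[OF finite_G, of "{\<gamma> \<in> G. A \<gamma> v = v}"] by auto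
  also have "\<dots> \<longleftrightarrow> v \<in> Fix" using V_Esp[OF assms] by (auto simp: Fix_def)
  finally show "stab_card U \<Gamma> \<phi> (p v) = stab_card U \<Gamma> \<phi> (\<phi> u) \<longleftrightarrow> v \<in> Fix" by (simp add: stab_card_p[OF assms] stab_card_u)
qed

lemma same_type_u_iff: assumes v: "v \<in> V" shows "same_type U \<Gamma> \<phi> (\<phi> u) (p v) \<longleftrightarrow> v \<in> Fix"
proof
  assume "same_type U \<Gamma> \<phi> (\<phi> u) (p v)"
  then show "v \<in> Fix" using same_type_sz stab_card_le(2)[OF v] by simp
next
  assume "v \<in> Fix"
  then have "stab_set \<Gamma> (S v) = stab_set \<Gamma> u" unfolding stab_set_S[OF v] stab_set_u by (auto simp: Fix_def)
  then show "same_type U \<Gamma> \<phi> (\<phi> u) (p v)" unfolding same_type_def p_def using S_U[OF v] u by (intro bexI[of _ u] bexI[of _ "S v"]) auto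
qed

definition seg where "seg v w s = (\<lambda>i::nat. s * v i + (1 - s) * w i :: real)"

lemma seg_V: assumes v: "v \<in> V" and w: "w \<in> V" and s: "s \<in> {0..1}" shows "seg v w s \<in> V"
proof -
  have "A \<gamma> (seg v w s) = (\<lambda>i. s * A \<gamma> v i + (1 - s) * A \<gamma> w i)" for \<gamma> unfolding seg_def by (rule A_lin)
  then have "qG (seg v w s) = (\<Sum>\<gamma>\<in>G. \<Sum>k<n. (s * A \<gamma> v k + (1 - s) * A \<gamma> w k)\<^sup>2)" by (simp add: qG_def)
  also have "\<dots> \<le> (\<Sum>\<gamma>\<in>G. \<Sum>k<n. s * (A \<gamma> v k)\<^sup>2 + (1 - s) * (A \<gamma> w k)\<^sup>2)"
  proof (intro sum_mono)
    fix \<gamma> k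
    define a where "a = A \<gamma> v k"
    define b where "b = A \<gamma> w k"
    have "0 \<le> s * (1 - s) * (a - b)\<^sup>2" using s by auto
    then show "(s * A \<gamma> v k + (1 - s) * A \<gamma> w k)\<^sup>2 \<le> s * (A \<gamma> v k)\<^sup>2 + (1 - s) * (A \<gamma> w k)\<^sup>2"
      unfolding a_def[symmetric] b_def[symmetric] by (simp add: power2_eq_square algebra_simps)
  qed
  also have "\<dots> = s * qG v + (1 - s) * qG w" by (simp add: qG_def sum.distrib sum_distrib_left)
  also have "\<dots> \<le> s * max (qG v) (qG w) + (1 - s) * max (qG v) (qG w)"
    using s by (intro add_mono mult_left_mono) auto
  also have "\<dots> = max (qG v) (qG w)" by (simp add: algebra_simps)
  also have "\<dots> < r" using v w by (simp add: V_iff)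
  finally show ?thesis using v w by (simp add: V_iff Esp_iff seg_def)
qed

lemma seg_ends: "seg v w 0 = w" "seg v w 1 = v"
  by (auto simp: seg_def)

lemma seg_continuous:
  assumes v: "v \<in> V" and w: "w \<in> V"
  shows "continuous_map (top_of_set {0..1}) X (\<lambda>s. p (seg v w s))"
proof -
  have "continuous_on {0..1} (seg v w)"
    unfolding seg_def by (intro continuous_on_coordinatewise_then_product) (auto intro!: continuous_intros)
  then have "continuous_map (top_of_set {0..1}) (top_of_set V) (seg v w)"
    using seg_V[OF assms] by (auto simp: continuous_map_in_subtopology)
  from continuous_map_compose[OF this p_continuous] show ?thesis by (simp add: o_def)
qed

lemma Fix_connected: "connectedin X (p ` (Fix \<inter> V))"
proof -
  let ?z = "\<lambda>_. 0"
  have sF: "seg v ?z s \<in> Fix \<inter> V" if "v \<in> Fix \<inter> V" "s \<in> {0..1}" for v s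
  proof -
    have "A \<gamma> (seg v ?z s) = (\<lambda>i. s * A \<gamma> v i + (1 - s) * A \<gamma> ?z i)" for \<gamma> unfolding seg_def by (rule A_lin)
    then have "A \<gamma> (seg v ?z s) = seg v ?z s" if "\<gamma> \<in> G" for \<gamma>
      using \<open>v \<in> Fix \<inter> V\<close> that by (simp add: A_zero Fix_def seg_def)
    moreover have "seg v ?z s \<in> V" using that zero_V by (intro seg_V) auto
    ultimately show ?thesis using V_Esp by (simp add: Fix_def)
  qed
  have "p ` (Fix \<inter> V) = (\<Union>v\<in>Fix \<inter> V. (\<lambda>s. p (seg v ?z s)) ` {0..1})" (is "_ = ?R")
  proof
    show "p ` (Fix \<inter> V) \<subseteq> ?R"
    proof
      fix y assume "y \<in> p ` (Fix \<inter> V)"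
      then obtain v where v: "v \<in> Fix \<inter> V" "y = p v" by blast
      then have "y = p (seg v ?z 1)" by (simp add: seg_ends)
      moreover have "(1::real) \<in> {0..1}" by simp
      ultimately show "y \<in> ?R" using v(1) by blast
    qed
    show "?R \<subseteq> p ` (Fix \<inter> V)" using sF by blast
  qed
  moreover have "connectedin X ?R"
  proof (rule connectedin_Union)
    show "connectedin X K" if K: "K \<in> (\<lambda>v. (\<lambda>s. p (seg v ?z s)) ` {0..1}) ` (Fix \<inter> V)" for K
    proof -
      obtain v where v: "v \<in> V" "K = (\<lambda>s. p (seg v ?z s)) ` {0..1}" using K by blast
      have "connectedin (top_of_set {0..1::real}) {0..1}" by (simp add: connectedin_subtopology)
      then show ?thesis unfolding v(2) by (rule connectedin_continuous_map_image[OF seg_continuous[OF v(1) zero_V]])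
    qed
    have "p ?z \<in> (\<lambda>s. p (seg v ?z s)) ` {0..1}" for v
      by (rule image_eqI[of _ _ 0]) (simp_all add: seg_ends)
    then have "p ?z \<in> \<Inter> ((\<lambda>v. (\<lambda>s. p (seg v ?z s)) ` {0..1}) ` (Fix \<inter> V))" by blast
    then show "\<Inter> ((\<lambda>v. (\<lambda>s. p (seg v ?z s)) ` {0..1}) ` (Fix \<inter> V)) \<noteq> {}" by blast
  qed
  ultimately show ?thesis by simp
qed

text \<open>Since \<open>w\<close> is fixed by all of \<open>G\<close>, every point of the segment
  from \<open>w\<close> to \<open>v\<close> other than \<open>w\<close> has the stabiliser of
  \<open>v\<close>. This half-open segment is \<open>K\<close>, and its missing end point maps to
  \<open>p w\<close>.\<close>

lemma stratum_adheres:
  assumes v: "v \<in> V" and w: "w \<in> Fix \<inter> V"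
  shows "\<exists>K. connectedin X K \<and> p v \<in> K \<and> (\<forall>k\<in>K. same_type U \<Gamma> \<phi> (p v) k) \<and> p w \<in> X closure_of K"
proof -
  have wV: "w \<in> V" using w by blast
  let ?c = "\<lambda>s. p (seg v w s)"
  have st: "stab_set \<Gamma> (S (seg v w s)) = stab_set \<Gamma> (S v)" if s: "s \<in> {0<..1}" for s
  proof -
    have "A \<gamma> (seg v w s) = seg v w s \<longleftrightarrow> A \<gamma> v = v" if g: "\<gamma> \<in> G" for \<gamma>
    proof -
      have "A \<gamma> (seg v w s) = (\<lambda>i. s * A \<gamma> v i + (1 - s) * A \<gamma> w i)" unfolding seg_def by (rule A_lin)
      also have "\<dots> = seg (A \<gamma> v) w s" using w g by (simp add: Fix_def seg_def)
      finally show ?thesis using s by (auto simp: seg_def fun_eq_iff)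
    qed
    moreover have "seg v w s \<in> V" using seg_V[OF v wV] s by simp
    ultimately show ?thesis using stab_set_S v by auto
  qed
  have "connectedin (top_of_set {0..1::real}) {0<..1}" by (auto simp: connectedin_subtopology)
  then have "connectedin X (?c ` {0<..1})" by (rule connectedin_continuous_map_image[OF seg_continuous[OF v wV]])
  moreover have "p v \<in> ?c ` {0<..1}" by (rule image_eqI[of _ _ 1]) (simp_all add: seg_ends)
  moreover have "same_type U \<Gamma> \<phi> (p v) (?c s)" if "s \<in> {0<..1}" for s
    unfolding same_type_def p_def using S_U[OF v] S_U[OF seg_V[OF v wV, of s]] st[OF that] that
    by (intro bexI[of _ "S v"] bexI[of _ "S (seg v w s)"]) auto
  moreover have "p w \<in> X closure_of (?c ` {0<..1})"
  proof -
    have "{0..1} \<inter> {0<..1} = {0<..1::real}" by auto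
    then have "(top_of_set {0..1::real}) closure_of {0<..1} = {0..1}"
      by (simp add: closure_of_subtopology)
    then have "?c 0 \<in> ?c ` ((top_of_set {0..1}) closure_of {0<..1})" by simp
    then show ?thesis using continuous_map_image_closure_subset[OF seg_continuous[OF v wV], of "{0<..1}"]
      by (auto simp: seg_ends)
  qed
  ultimately show ?thesis by (intro exI[of _ "?c ` {0<..1}"]) auto
qed

text \<open>All preimages of a point in the slice lie on one orbit of \<open>G\<close>, on which
  \<open>qG\<close> is constant. So the image of a small ball has no preimages in \<open>B\<close>
  outside that ball.\<close>

lemma preimages_near:
  assumes P: "openin (Euclidean_space n) P" "u \<in> P"
  shows "\<exists>N. openin X N \<and> \<phi> u \<in> N \<and> (\<forall>z\<in>B. \<phi> z \<in> N \<longrightarrow> z \<in> P)"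
proof -
  note dS = dif_sym[OF dif_BV]
  have B: "S ` V = B" by (rule difD(9)[OF dS])
  have "openin (Euclidean_space n) {v \<in> V. S v \<in> P}"
    by (rule openin_Euclidean_preimage[OF open_V dif_continuous[OF dS] P(1)]) (use difD(7)[OF dif_BV] B in auto)
  moreover have "(\<lambda>_. 0) \<in> {v \<in> V. S v \<in> P}" using zero_V P(2) by (simp add: S_zero)
  ultimately obtain s where s: "s > 0" "2 * s < r" "\<forall>v\<in>Esp n. qG v < 2 * s \<longrightarrow> v \<in> {v \<in> V. S v \<in> P}"
    using small_ball by blast
  let ?W = "{v \<in> Esp n. qG v < 2 * s}"
  have WV: "?W \<subseteq> V" using s(3) by blast
  have "openin X (p ` ?W)" by (rule p_open[OF open_qG_ball WV])
  moreover have "\<phi> u \<in> p ` ?W" using s(1) by (intro image_eqI[of _ _ "\<lambda>_. 0"]) (simp_all add: p_zero qG_zero Esp_iff)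
  moreover have "z \<in> P" if z: "z \<in> B" "\<phi> z \<in> p ` ?W" for z
  proof -
    obtain v where v: "v \<in> V" "z = S v" using z(1) B by blast
    obtain w where w: "w \<in> ?W" "p w = p v" using z(2) v(2) by (auto simp: p_def)
    have wV: "w \<in> V" using w(1) WV by blast
    obtain \<gamma> where g: "\<gamma> \<in> G" "v = A \<gamma> w" using p_eqD[OF wV v(1) w(2)] by blast
    then have "qG v < 2 * s" using w(1) by (simp add: qG_inv)
    then show ?thesis using s(3) V_Esp[OF v(1)] v(2) by blast
  qed
  ultimately show ?thesis by blast
qed

lemma Fix_iff_unique:
  assumes z: "z \<in> B"
  shows "\<phi> z \<in> p ` (Fix \<inter> V) \<longleftrightarrow> (\<forall>w\<in>B. \<phi> w = \<phi> z \<longrightarrow> w = z)"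
proof -
  have B: "S ` V = B" by (rule difD(9)[OF dif_sym[OF dif_BV]])
  obtain v where v: "v \<in> V" "z = S v" using z B by blast
  have "(\<forall>w\<in>B. \<phi> w = \<phi> z \<longrightarrow> w = z) \<longleftrightarrow> (\<forall>w\<in>V. p w = p v \<longrightarrow> w = v)"
    unfolding B[symmetric] ball_simps v(2) p_def using S_inj[OF _ v(1)] by blast
  also have "\<dots> \<longleftrightarrow> v \<in> Fix"
  proof
    assume *: "\<forall>w\<in>V. p w = p v \<longrightarrow> w = v"
    have "A \<gamma> v = v" if "\<gamma> \<in> G" for \<gamma> using * A_V[OF that v(1)] p_inv[OF that v(1)] by blast
    then show "v \<in> Fix" using V_Esp[OF v(1)] by (simp add: Fix_def)
  next
    assume F: "v \<in> Fix"
    show "\<forall>w\<in>V. p w = p v \<longrightarrow> w = v"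
    proof (intro ballI impI)
      fix w assume w: "w \<in> V" "p w = p v"
      then obtain \<gamma> where "\<gamma> \<in> G" "w = A \<gamma> v" using p_eqD[OF v(1) w(1)] by auto
      then show "w = v" using F by (simp add: Fix_def)
    qed
  qed
  also have "\<dots> \<longleftrightarrow> \<phi> z \<in> p ` (Fix \<inter> V)" using p_Fix_iff[OF v(1)] v(2) by (simp add: p_def)
  finally show ?thesis by blast
qed

lemma reach_near: "\<exists>N. openin X N \<and> \<phi> u \<in> N \<and> p ` (Fix \<inter> V) \<inter> N \<subseteq> vect_orbit (topspace X) F (\<phi> u)"
proof -
  let ?W = "{v \<in> Esp n. qG v < r / 28}"
  have WV: "?W \<subseteq> V" using r_pos by (auto simp: V_iff)
  have "y \<in> vect_orbit (topspace X) F (\<phi> u)" if y: "y \<in> p ` (Fix \<inter> V)" "y \<in> p ` ?W" for y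
  proof -
    obtain v where v: "v \<in> ?W" "y = p v" using y(2) by blast
    then have "v \<in> Fix" using y(1) p_Fix_iff WV by blast
    then show ?thesis using reach v by simp
  qed
  moreover have "openin X (p ` ?W)" by (rule p_open[OF open_qG_ball WV])
  moreover have "\<phi> u \<in> p ` ?W" using r_pos by (intro image_eqI[of _ _ "\<lambda>_. 0"]) (simp_all add: p_zero qG_zero Esp_iff)
  ultimately show ?thesis by blast
qed

end

context orbifold_ctx
begin

text \<open>\<open>L\<close> is the stratum through \<open>x\<close> inside the small neighbourhood \<open>N0\<close>. The last clause says that \<open>L\<close>
  consists of the points with a single preimage in a slice; this does not involve \<open>\<Gamma>\<close> and makes \<open>L\<close>
  independent of the chart near \<open>x\<close>.\<close>

definition germ where
  "germ U \<Gamma> \<phi> x N0 L \<longleftrightarrow>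
     (U, \<Gamma>, \<phi>) \<in> \<A> \<and> openin X N0 \<and> x \<in> L \<and> L \<subseteq> N0 \<and> N0 \<subseteq> \<phi> ` U \<and> connectedin X L \<and>
     (\<forall>y\<in>N0. (same_type U \<Gamma> \<phi> x y \<longleftrightarrow> y \<in> L) \<and> stab_card U \<Gamma> \<phi> y \<le> stab_card U \<Gamma> \<phi> x \<and> (stab_card U \<Gamma> \<phi> y = stab_card U \<Gamma> \<phi> x \<longleftrightarrow> y \<in> L)) \<and>
     (\<forall>y\<in>N0. \<forall>z\<in>L. \<exists>K. connectedin X K \<and> y \<in> K \<and> (\<forall>k\<in>K. same_type U \<Gamma> \<phi> y k) \<and> z \<in> X closure_of K) \<and>
     (\<exists>N. openin X N \<and> x \<in> N \<and> L \<inter> N \<subseteq> vect_orbit (topspace X) F x) \<and>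
     (\<forall>Y\<in>vect (topspace X) F. \<exists>e>0. \<forall>t. \<bar>t\<bar> < e \<longrightarrow> t \<in> dm Y x \<and> fl Y x t \<in> L) \<and>
     (\<exists>B u. openin (Euclidean_space n) B \<and> u \<in> B \<and> B \<subseteq> U \<and> \<phi> u = x \<and> \<phi> ` B = N0 \<and>
        (\<forall>P. openin (Euclidean_space n) P \<and> u \<in> P \<longrightarrow> (\<exists>N. openin X N \<and> x \<in> N \<and> (\<forall>z\<in>B. \<phi> z \<in> N \<longrightarrow> z \<in> P))) \<and>
        (\<forall>z\<in>B. \<phi> z \<in> L \<longleftrightarrow> (\<forall>w\<in>B. \<phi> w = \<phi> z \<longrightarrow> w = z)))"

lemma germD:
  assumes "germ U \<Gamma> \<phi> x N0 L"
  shows "(U, \<Gamma>, \<phi>) \<in> \<A>" "openin X N0" "x \<in> L" "L \<subseteq> N0" "N0 \<subseteq> \<phi> ` U" "connectedin X L"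
    "y \<in> N0 \<Longrightarrow> same_type U \<Gamma> \<phi> x y \<longleftrightarrow> y \<in> L" "y \<in> N0 \<Longrightarrow> stab_card U \<Gamma> \<phi> y \<le> stab_card U \<Gamma> \<phi> x"
    "y \<in> N0 \<Longrightarrow> stab_card U \<Gamma> \<phi> y = stab_card U \<Gamma> \<phi> x \<longleftrightarrow> y \<in> L"
    "y \<in> N0 \<Longrightarrow> z \<in> L \<Longrightarrow> \<exists>K. connectedin X K \<and> y \<in> K \<and> (\<forall>k\<in>K. same_type U \<Gamma> \<phi> y k) \<and> z \<in> X closure_of K"
    "\<exists>N. openin X N \<and> x \<in> N \<and> L \<inter> N \<subseteq> vect_orbit (topspace X) F x"
    "Y \<in> vect (topspace X) F \<Longrightarrow> \<exists>e>0. \<forall>t. \<bar>t\<bar> < e \<longrightarrow> t \<in> dm Y x \<and> fl Y x t \<in> L"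
    "\<exists>B u. openin (Euclidean_space n) B \<and> u \<in> B \<and> B \<subseteq> U \<and> \<phi> u = x \<and> \<phi> ` B = N0 \<and>
        (\<forall>P. openin (Euclidean_space n) P \<and> u \<in> P \<longrightarrow> (\<exists>N. openin X N \<and> x \<in> N \<and> (\<forall>z\<in>B. \<phi> z \<in> N \<longrightarrow> z \<in> P))) \<and>
        (\<forall>z\<in>B. \<phi> z \<in> L \<longleftrightarrow> (\<forall>w\<in>B. \<phi> w = \<phi> z \<longrightarrow> w = z))"
  using assms unfolding germ_def by simp_all

lemma germ_exists:
  assumes c: "(U, \<Gamma>, \<phi>) \<in> \<A>" and x: "x \<in> \<phi> ` U"
  obtains N0 L where "germ U \<Gamma> \<phi> x N0 L"
proof -
  obtain u where xu: "u \<in> U" "x = \<phi> u" using x by blast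
  obtain r B S where "lin_model X n \<A> U \<Gamma> \<phi> u r B S" using model_exists[OF c xu(1)] by blast
  then interpret lin_model X n \<A> U \<Gamma> \<phi> u r B S .
  have B: "S ` V = B" by (rule difD(9)[OF dif_sym[OF dif_BV]])
  have uB: "u \<in> B" using S_B[OF zero_V] by (simp add: S_zero)
  have "germ U \<Gamma> \<phi> x (p ` V) (p ` (Fix \<inter> V))"
    unfolding germ_def xu(2)
  proof (intro conjI)
    show "openin X (p ` V)" by (rule p_open[OF open_V order_refl])
    show "\<phi> u \<in> p ` (Fix \<inter> V)" using zero_Fix zero_V p_zero by (intro image_eqI[of _ _ "\<lambda>_. 0"]) auto
    show "p ` V \<subseteq> \<phi> ` U" using S_U by (auto simp: p_def)
    show "\<forall>y\<in>p ` V. (same_type U \<Gamma> \<phi> (\<phi> u) y \<longleftrightarrow> y \<in> p ` (Fix \<inter> V)) \<and> stab_card U \<Gamma> \<phi> y \<le> stab_card U \<Gamma> \<phi> (\<phi> u) \<and>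
        (stab_card U \<Gamma> \<phi> y = stab_card U \<Gamma> \<phi> (\<phi> u) \<longleftrightarrow> y \<in> p ` (Fix \<inter> V))"
      using same_type_u_iff stab_card_le p_Fix_iff by (auto simp del: image_Int)
    show "\<forall>y\<in>p ` V. \<forall>z\<in>p ` (Fix \<inter> V). \<exists>K. connectedin X K \<and> y \<in> K \<and> (\<forall>k\<in>K. same_type U \<Gamma> \<phi> y k) \<and> z \<in> X closure_of K"
    proof (intro ballI)
      fix y z assume "y \<in> p ` V" "z \<in> p ` (Fix \<inter> V)"
      then obtain v w where vw: "v \<in> V" "w \<in> Fix \<inter> V" "y = p v" "z = p w" by blast
      show "\<exists>K. connectedin X K \<and> y \<in> K \<and> (\<forall>k\<in>K. same_type U \<Gamma> \<phi> y k) \<and> z \<in> X closure_of K"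
        unfolding vw(3,4) by (rule stratum_adheres[OF vw(1,2)])
    qed
    show "\<exists>B u'. openin (Euclidean_space n) B \<and> u' \<in> B \<and> B \<subseteq> U \<and> \<phi> u' = \<phi> u \<and> \<phi> ` B = p ` V \<and>
        (\<forall>P. openin (Euclidean_space n) P \<and> u' \<in> P \<longrightarrow> (\<exists>N. openin X N \<and> \<phi> u \<in> N \<and> (\<forall>z\<in>B. \<phi> z \<in> N \<longrightarrow> z \<in> P))) \<and>
        (\<forall>z\<in>B. \<phi> z \<in> p ` (Fix \<inter> V) \<longleftrightarrow> (\<forall>w\<in>B. \<phi> w = \<phi> z \<longrightarrow> w = z))"
    proof (intro exI conjI)
      show "openin (Euclidean_space n) B" by (rule difD(1)[OF dif_BV])
      show "\<phi> ` B = p ` V" unfolding B[symmetric] p_def image_image ..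
      show "\<forall>P. openin (Euclidean_space n) P \<and> u \<in> P \<longrightarrow> (\<exists>N. openin X N \<and> \<phi> u \<in> N \<and> (\<forall>z\<in>B. \<phi> z \<in> N \<longrightarrow> z \<in> P))"
        using preimages_near by simp
      show "\<forall>z\<in>B. \<phi> z \<in> p ` (Fix \<inter> V) \<longleftrightarrow> (\<forall>w\<in>B. \<phi> w = \<phi> z \<longrightarrow> w = z)"
        using Fix_iff_unique by simp
    qed (rule uB B_U refl)+
    show "\<forall>Y\<in>vect (topspace X) F. \<exists>e>0. \<forall>t. \<bar>t\<bar> < e \<longrightarrow> t \<in> dm Y (\<phi> u) \<and> fl Y (\<phi> u) t \<in> p ` (Fix \<inter> V)"
      using flow_stays by simp
    show "p ` (Fix \<inter> V) \<subseteq> p ` V" by blast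
  qed (rule c Fix_connected reach_near)+
  then show ?thesis by (rule that)
qed

text \<open>A transition map carries a small part of one slice into the other and preserves fibres.
  Being alone in its fibre near \<open>x\<close> is thus a property of a point that both charts see
  alike.\<close>

lemma germ_compat:
  assumes g: "germ U \<Gamma> \<phi> x N0 L" and g': "germ V \<Delta> \<psi> x N0' L'"
  shows "\<exists>N. openin X N \<and> x \<in> N \<and> L \<inter> N \<subseteq> L'"
proof -
  obtain B u where B: "openin (Euclidean_space n) B" "u \<in> B" "B \<subseteq> U" "\<phi> u = x" "\<phi> ` B = N0"
    and near: "\<forall>P. openin (Euclidean_space n) P \<and> u \<in> P \<longrightarrow> (\<exists>N. openin X N \<and> x \<in> N \<and> (\<forall>z\<in>B. \<phi> z \<in> N \<longrightarrow> z \<in> P))"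
    and L: "\<forall>z\<in>B. \<phi> z \<in> L \<longleftrightarrow> (\<forall>w\<in>B. \<phi> w = \<phi> z \<longrightarrow> w = z)"
    using germD(13)[OF g] by (elim exE conjE) (rule that)
  obtain B' v where B': "openin (Euclidean_space n) B'" "v \<in> B'" "B' \<subseteq> V" "\<psi> v = x" "\<psi> ` B' = N0'"
    and near': "\<forall>P. openin (Euclidean_space n) P \<and> v \<in> P \<longrightarrow> (\<exists>N. openin X N \<and> x \<in> N \<and> (\<forall>z\<in>B'. \<psi> z \<in> N \<longrightarrow> z \<in> P))"
    and L': "\<forall>z\<in>B'. \<psi> z \<in> L' \<longleftrightarrow> (\<forall>w\<in>B'. \<psi> w = \<psi> z \<longrightarrow> w = z)"
    using germD(13)[OF g'] by (elim exE conjE) (rule that)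
  have uv: "u \<in> U" "v \<in> V" "\<phi> u = \<psi> v" using B B' by auto
  obtain P Q f h where d: "dif n P Q f h" and P: "u \<in> P" "f u = v" "\<forall>y\<in>P. \<psi> (f y) = \<phi> y"
    using transition[OF germD(1)[OF g] germD(1)[OF g'] uv] by (elim exE conjE) simp
  note d' = dif_sym[OF d]
  have v: "v \<in> Q" "h v = u" using difD(3)[OF d P(1)] difD(4)[OF d P(1)] P(2) by auto
  have "openin (Euclidean_space n) {z \<in> P. f z \<in> B'}"
    by (rule openin_Euclidean_preimage[OF difD(1)[OF d] dif_continuous[OF d] B'(1)]) (use difD(8,9)[OF d] in auto)
  then obtain N1 where N1: "openin X N1" "x \<in> N1" "\<forall>z\<in>B. \<phi> z \<in> N1 \<longrightarrow> z \<in> {z \<in> P. f z \<in> B'}"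
    using near[rule_format, of "{z \<in> P. f z \<in> B'}"] P B'(2) by auto
  have "openin (Euclidean_space n) {w \<in> Q. h w \<in> B}"
    by (rule openin_Euclidean_preimage[OF difD(1)[OF d'] dif_continuous[OF d'] B(1)]) (use difD(8,9)[OF d'] in auto)
  then obtain N2 where N2: "openin X N2" "x \<in> N2" "\<forall>z\<in>B'. \<psi> z \<in> N2 \<longrightarrow> z \<in> {w \<in> Q. h w \<in> B}"
    using near'[rule_format, of "{w \<in> Q. h w \<in> B}"] v B(2) by auto
  have "y \<in> L'" if y: "y \<in> L" "y \<in> N1" "y \<in> N2" for y
  proof -
    obtain z where z: "z \<in> B" "y = \<phi> z" using germD(4)[OF g] B(5) y(1) by blast
    then have z': "z \<in> P" "f z \<in> B'" using N1(3) y(2) by auto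
    have y': "y = \<psi> (f z)" using P(3) z' z(2) by simp
    show ?thesis unfolding y' L'[rule_format, OF z'(2)]
    proof (intro ballI impI)
      fix w assume w: "w \<in> B'" "\<psi> w = \<psi> (f z)"
      then have w': "w \<in> Q" "h w \<in> B" using N2(3) y(3) y' by auto
      have "\<phi> (h w) = \<psi> (f (h w))" using P(3) difD(5)[OF d w'(1)] by simp
      also have "\<dots> = \<phi> z" using difD(6)[OF d w'(1)] w(2) y' z(2) by simp
      finally have "h w = z" using L[rule_format, OF z(1)] w'(2) y(1) z(2) by simp
      then show "w = f z" using difD(6)[OF d w'(1)] by simp
    qed
  qed
  then show ?thesis using N1(1,2) N2(1,2) by (intro exI[of _ "N1 \<inter> N2"]) auto
qed

end

section \<open>Orbits are strata\<close>

lemma conn_comp_eq: assumes "x \<in> conn_comp X Z a" shows "conn_comp X Z x = conn_comp X Z a"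
proof -
  have a: "a \<in> conn_comp X Z a" using assms by (auto simp: conn_comp_def)
  have 1: "conn_comp X Z a \<subseteq> conn_comp X Z x" by (rule conn_comp_max[OF conn_comp_connected conn_comp_subset assms])
  have "conn_comp X Z x \<subseteq> conn_comp X Z a" by (rule conn_comp_max[OF conn_comp_connected conn_comp_subset subsetD[OF 1 a]])
  then show ?thesis using 1 by blast
qed

context orbifold_ctx
begin

abbreviation "Orb x \<equiv> vect_orbit (topspace X) F x"

section \<open>Orbits as connected equivalence classes, and the sets that are unions of
  strata\<close>

lemma step_sym: assumes "step x y" shows "step y x"
proof -
  obtain Y t where Y: "Y \<in> vect (topspace X) F" "x \<in> topspace X" "t \<in> dm Y x" "y = fl Y x t"
    using assms unfolding step_def by blast
  note YF = vect_F[OF Y(1)]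
  note c = fl_IC[OF YF Y(2)]
  have "y \<in> topspace X" using ICD(5)[OF c Y(3)] Y(4) by simp
  moreover have "- t \<in> dm Y y" using fl_shift(1)[OF YF Y(2,3), of "- t"] ICD(2)[OF c] Y(4) by simp
  moreover have "x = fl Y y (- t)"
    using fl_shift(2)[OF YF Y(2,3), of "- t"] ICD(2)[OF c] ICD(4)[OF c] Y(4) by simp
  ultimately show ?thesis unfolding step_def using Y(1) by blast
qed

lemma step_into: assumes "step x y" shows "x \<in> topspace X" "y \<in> topspace X"
  using assms step_sym[OF assms] unfolding step_def by blast+

lemma orb_refl: "x \<in> Orb x"
  by (simp add: vect_orbit_eq)

lemma orb_sym: "y \<in> Orb x \<Longrightarrow> x \<in> Orb y"
proof -
  have "symp step\<^sup>*\<^sup>*" by (rule symp_rtranclp) (simp add: symp_def step_sym)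
  then show "y \<in> Orb x \<Longrightarrow> x \<in> Orb y" by (simp add: vect_orbit_eq symp_def)
qed

lemma orb_trans: "y \<in> Orb x \<Longrightarrow> z \<in> Orb y \<Longrightarrow> z \<in> Orb x"
  unfolding vect_orbit_eq by auto

lemma orb_eq: assumes "y \<in> Orb x" shows "Orb y = Orb x"
  using orb_trans[OF assms] orb_trans[OF orb_sym[OF assms]] by blast

lemma orb_into: assumes x: "x \<in> topspace X" and y: "y \<in> Orb x" shows "y \<in> topspace X"
proof -
  have "step\<^sup>*\<^sup>* x y" using y by (simp add: vect_orbit_eq)
  then show ?thesis using x by induction (auto dest: step_into)
qed

lemma curve_connected:
  assumes Y: "Y \<in> vect (topspace X) F" and x: "x \<in> topspace X"
  shows "connectedin X (fl Y x ` dm Y x)"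
proof -
  note c = fl_IC[OF vect_F[OF Y] x]
  have "continuous_map (top_of_set (dm Y x)) X (fl Y x)"
    unfolding continuous_map_def
  proof (intro conjI allI impI)
    show "fl Y x \<in> topspace (top_of_set (dm Y x)) \<rightarrow> topspace X" using ICD(5)[OF c] by auto
    fix N assume N: "openin X N"
    show "openin (top_of_set (dm Y x)) {t \<in> topspace (top_of_set (dm Y x)). fl Y x t \<in> N}"
      unfolding openin_euclidean_subtopology_iff
      using IC_near[OF c _ N] by (auto simp: dist_real_def)
  qed
  moreover have "connectedin (top_of_set (dm Y x)) (dm Y x)"
    using ICD(1)[OF c] by (simp add: connectedin_subtopology)
  ultimately show ?thesis by (rule connectedin_continuous_map_image)
qed

lemma orb_connected: assumes x: "x \<in> topspace X" shows "connectedin X (Orb x)"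
proof -
  have "y \<in> conn_comp X (Orb x) x" if "y \<in> Orb x" for y
  proof -
    have "step\<^sup>*\<^sup>* x y" using that by (simp add: vect_orbit_eq)
    then show ?thesis
    proof induction
      case base
      show ?case by (rule conn_comp_self[OF x orb_refl])
    next
      case (step y z)
      obtain Y t where Y: "Y \<in> vect (topspace X) F" "y \<in> topspace X" "t \<in> dm Y y" "z = fl Y y t"
        using step(2) unfolding step_def by blast
      note c = fl_IC[OF vect_F[OF Y(1)] Y(2)]
      have y: "y \<in> Orb x" using step(1) by (simp add: vect_orbit_eq)
      have "fl Y y ` dm Y y \<subseteq> Orb x"
      proof
        fix w assume "w \<in> fl Y y ` dm Y y"
        then have "orbifold_ctx.step X n \<A> y w" unfolding step_def using Y by blast
        then have "w \<in> Orb y" by (simp add: vect_orbit_eq)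
        then show "w \<in> Orb x" by (rule orb_trans[OF y])
      qed
      moreover have "y \<in> fl Y y ` dm Y y" using ICD(2,4)[OF c] by force
      ultimately have "fl Y y ` dm Y y \<subseteq> conn_comp X (Orb x) y" by (intro conn_comp_max curve_connected Y)
      then show ?case using conn_comp_eq[OF step(3)] Y(3,4) by blast
    qed
  qed
  then have "conn_comp X (Orb x) x = Orb x" using conn_comp_subset[of X "Orb x" x] by blast
  then show ?thesis using conn_comp_connected[of X "Orb x" x] by simp
qed

text \<open>The property shared by the orbits and by the blocks of any partition compatible with the
  chart strata; the local comparison uses little more.\<close>

definition saturated where
  "saturated M \<longleftrightarrow> (\<forall>U \<Gamma> \<phi> x K. (U, \<Gamma>, \<phi>) \<in> \<A> \<and> x \<in> M \<and> x \<in> K \<and> connectedin X K \<and> (\<forall>k\<in>K. same_type U \<Gamma> \<phi> x k) \<longrightarrow> K \<subseteq> M)"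

lemma saturatedD:
  assumes "saturated M" "(U, \<Gamma>, \<phi>) \<in> \<A>" "x \<in> M" "x \<in> K" "connectedin X K" "\<And>k. k \<in> K \<Longrightarrow> same_type U \<Gamma> \<phi> x k"
  shows "K \<subseteq> M"
  using assms(1)[unfolded saturated_def, rule_format, of U \<Gamma> \<phi> x K] assms(2-6) by blast

text \<open>Near each point the stratum lies in the orbit of that point, so membership in a given
  orbit is locally constant along a connected set of a single type.\<close>

lemma saturated_orbit: "saturated (Orb x)"
  unfolding saturated_def
proof (intro allI impI, elim conjE, rule subsetI)
  fix U \<Gamma> \<phi> y K k
  assume c: "(U, \<Gamma>, \<phi>) \<in> \<A>" and y: "y \<in> Orb x" "y \<in> K" and K: "connectedin X K" "\<forall>k\<in>K. same_type U \<Gamma> \<phi> y k" and k: "k \<in> K"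
  interpret c: orb_chart X n U \<Gamma> \<phi> by (rule chart_in[OF c])
  show "k \<in> Orb x"
  proof (rule connected_locally_constant[OF K(1) y(2) k, where R = "\<lambda>z. z \<in> Orb x"])
    fix z assume z: "z \<in> K"
    then have zU: "z \<in> \<phi> ` U" using K(2) c.same_type_image by blast
    obtain N0 L where g: "germ U \<Gamma> \<phi> z N0 L" by (rule germ_exists[OF c zU])
    obtain N where N: "openin X N" "z \<in> N" "L \<inter> N \<subseteq> Orb z" using germD(11)[OF g] by blast
    have "d \<in> Orb x \<longleftrightarrow> z \<in> Orb x" if d: "d \<in> K" "d \<in> N" "d \<in> N0" for d
    proof -
      have "same_type U \<Gamma> \<phi> z d" using K(2) z d(1) c.same_type_sym c.same_type_trans by blast
      then have "d \<in> Orb z" using germD(7)[OF g d(3)] N(3) d(2) by blast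
      then show ?thesis using orb_trans orb_sym by blast
    qed
    then show "\<exists>N. openin X N \<and> z \<in> N \<and> (\<forall>d\<in>K \<inter> N. d \<in> Orb x \<longleftrightarrow> z \<in> Orb x)"
      using N(1,2) germD(2,3,4)[OF g] by (intro exI[of _ "N \<inter> N0"]) auto
  qed (rule y(1))
qed

lemma germ_subset_saturated:
  assumes M: "saturated M" and g: "germ U \<Gamma> \<phi> x N0 L" and y: "y \<in> M" "y \<in> L"
  shows "L \<subseteq> M"
proof (rule saturatedD[OF M germD(1)[OF g] y germD(6)[OF g]])
  interpret c: orb_chart X n U \<Gamma> \<phi> by (rule chart_in[OF germD(1)[OF g]])
  fix k assume k: "k \<in> L"
  have "same_type U \<Gamma> \<phi> x z" if "z \<in> L" for z using germD(7)[OF g] germD(4)[OF g] that by blast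
  then show "same_type U \<Gamma> \<phi> y k" using y(2) k c.same_type_sym c.same_type_trans by blast
qed

text \<open>A point of \<open>M\<close> in \<open>N0\<close> off \<open>L\<close> would lie on a stratum contained in \<open>M\<close> that accumulates at every point
  of \<open>L\<close>. So whether \<open>M\<close> stays in the stratum does not change along \<open>L\<close>, hence along an orbit.\<close>

lemma saturated_local:
  assumes M: "saturated M" and g: "germ U \<Gamma> \<phi> x N0 L" and y: "y \<in> L"
    and g': "germ V \<Delta> \<psi> y N' L'" and N: "openin X N" "y \<in> N" "M \<inter> N \<subseteq> L'"
  shows "M \<inter> N0 \<subseteq> L"
proof (intro subsetI, elim IntE)
  fix z assume z: "z \<in> M" "z \<in> N0"
  note c = germD(1)[OF g]
  interpret c: orb_chart X n U \<Gamma> \<phi> by (rule chart_in[OF c])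
  obtain K where K: "connectedin X K" "z \<in> K" "\<forall>k\<in>K. same_type U \<Gamma> \<phi> z k" "y \<in> X closure_of K"
    using germD(10)[OF g z(2) y] by blast
  have KM: "K \<subseteq> M" by (rule saturatedD[OF M c z(1) K(2,1)]) (use K(3) in blast)
  have yU: "y \<in> \<phi> ` U" and yN0: "y \<in> N0" using y germD(4,5)[OF g] by auto
  obtain N'' L'' where g'': "germ U \<Gamma> \<phi> y N'' L''" by (rule germ_exists[OF c yU])
  \<comment> \<open>The hypothesis on \<open>M\<close> may concern another chart; it is transferred
    to \<phi>, where stabiliser orders can be compared.\<close>
  obtain N2 where N2: "openin X N2" "y \<in> N2" "L' \<inter> N2 \<subseteq> L''" using germ_compat[OF g' g''] by blast
  have "openin X (N \<inter> N2)" "y \<in> N \<inter> N2" using N N2 by auto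
  then obtain k where k: "k \<in> K" "k \<in> N" "k \<in> N2" using K(4) unfolding in_closure_of by blast
  then have "k \<in> L''" using KM N(3) N2(3) by blast
  \<comment> \<open>The orders agree along the chain z, k, y, x: by equality of type, by the germ at
    \<open>y\<close>, and because \<open>y\<close> lies in \<open>L\<close>. An order equal to that
    at \<open>x\<close> means membership in \<open>L\<close>.\<close>
  then have "stab_card U \<Gamma> \<phi> k = stab_card U \<Gamma> \<phi> y" using germD(9)[OF g''] germD(4)[OF g''] by blast
  moreover have "stab_card U \<Gamma> \<phi> z = stab_card U \<Gamma> \<phi> k" by (rule c.same_type_sz) (use K(3) k(1) in blast)
  moreover have "stab_card U \<Gamma> \<phi> y = stab_card U \<Gamma> \<phi> x" using germD(9)[OF g yN0] y by blast
  ultimately show "z \<in> L" using germD(9)[OF g z(2)] by simp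
qed

text \<open>One chart is asked for, but \<open>tame_iff\<close> shows that any germ at the point can
  be used.\<close>

definition tame where
  "tame M y \<longleftrightarrow> (\<exists>U \<Gamma> \<phi> N0 L. germ U \<Gamma> \<phi> y N0 L \<and> M \<inter> N0 \<subseteq> L)"

text \<open>The right-hand side does not mention \<open>y\<close>, so tameness is constant along
  \<open>L\<close>; with \<open>y\<close> equal to \<open>x\<close> it is independence of the
  chart.\<close>

lemma tame_iff:
  assumes M: "saturated M" and g: "germ U \<Gamma> \<phi> x N0 L" and y: "y \<in> L"
  shows "tame M y \<longleftrightarrow> M \<inter> N0 \<subseteq> L"
proof
  assume "tame M y"
  then obtain V \<Delta> \<psi> N' L' where g': "germ V \<Delta> \<psi> y N' L'" "M \<inter> N' \<subseteq> L'" unfolding tame_def by blast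
  show "M \<inter> N0 \<subseteq> L"
    by (rule saturated_local[OF M g y g'(1) germD(2)[OF g'(1)] subsetD[OF germD(4,3)[OF g'(1)]] g'(2)])
next
  assume *: "M \<inter> N0 \<subseteq> L"
  have yN0: "y \<in> N0" and yU: "y \<in> \<phi> ` U" using y germD(4,5)[OF g] by auto
  obtain N' L' where g': "germ U \<Gamma> \<phi> y N' L'" by (rule germ_exists[OF germD(1)[OF g] yU])
  have "M \<inter> (N0 \<inter> N') \<subseteq> L'"
  proof
    fix z assume z: "z \<in> M \<inter> (N0 \<inter> N')"
    then have "stab_card U \<Gamma> \<phi> z = stab_card U \<Gamma> \<phi> x" using * germD(9)[OF g] by blast
    moreover have "stab_card U \<Gamma> \<phi> y = stab_card U \<Gamma> \<phi> x" using germD(9)[OF g yN0] y by blast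
    ultimately show "z \<in> L'" using germD(9)[OF g'] z by simp
  qed
  moreover have "openin X (N0 \<inter> N')" "y \<in> N0 \<inter> N'" using yN0 germD(2,3,4)[OF g'] germD(2)[OF g] by auto
  ultimately have "M \<inter> N' \<subseteq> L'" using saturated_local[OF M g' germD(3)[OF g'] g'] by blast
  then show "tame M y" unfolding tame_def using g' by blast
qed

text \<open>Around each time the flow line stays in the stratum of its current point, so tameness is
  locally constant in time, and the domain of the curve is an interval.\<close>

lemma tame_step:
  assumes M: "saturated M" and xy: "step x y" and x: "tame M x"
  shows "tame M y"
proof -
  obtain Y t where Y: "Y \<in> vect (topspace X) F" "x \<in> topspace X" "t \<in> dm Y x" "y = fl Y x t"
    using xy unfolding step_def by blast
  note YF = vect_F[OF Y(1)]
  note c = fl_IC[OF YF Y(2)]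
  have "tame M (fl Y x t)"
  proof (rule connected_locally_constant[of euclideanreal "dm Y x" 0 t "\<lambda>s. tame M (fl Y x s)"])
    fix s assume s: "s \<in> dm Y x"
    let ?q = "fl Y x s"
    have q: "?q \<in> topspace X" by (rule ICD(5)[OF c s])
    obtain U \<Gamma> \<phi> where ch: "(U, \<Gamma>, \<phi>) \<in> \<A>" "?q \<in> \<phi> ` U" using cover[OF q] by blast
    obtain N0 L where g: "germ U \<Gamma> \<phi> ?q N0 L" by (rule germ_exists[OF ch])
    obtain e where e: "e > 0" "\<forall>\<tau>. \<bar>\<tau>\<bar> < e \<longrightarrow> \<tau> \<in> dm Y ?q \<and> fl Y ?q \<tau> \<in> L" using germD(12)[OF g Y(1)] by blast
    have "tame M (fl Y x d) \<longleftrightarrow> tame M ?q" if d: "d \<in> dm Y x" "d \<in> ball s e" for d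
    proof -
      have "\<bar>d - s\<bar> < e" using d(2) by (simp add: dist_real_def abs_minus_commute)
      then have "fl Y ?q (d - s) \<in> L" using e(2) by blast
      moreover have "fl Y ?q (d - s) = fl Y x d" using fl_shift(2)[OF YF Y(2) s, of "d - s"] d(1) by simp
      ultimately show ?thesis using tame_iff[OF M g] germD(3)[OF g] by simp
    qed
    then show "\<exists>N. openin euclideanreal N \<and> s \<in> N \<and> (\<forall>d\<in>dm Y x \<inter> N. tame M (fl Y x d) \<longleftrightarrow> tame M ?q)"
      using e(1) by (intro exI[of _ "ball s e"]) auto
  qed (use ICD(1,2,4)[OF c] Y(3) x in simp_all)
  then show ?thesis using Y(4) by simp
qed

text \<open>Stabilisers are of locally maximal order on \<open>L\<close>, so a point with smallest stabiliser is tame.\<close>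

lemma tame_exists:
  assumes M: "M \<subseteq> topspace X" "M \<noteq> {}"
  shows "\<exists>a\<in>M. tame M a"
proof -
  obtain x where x: "x \<in> M" using M(2) by blast
  then obtain U \<Gamma> \<phi> where c: "(U, \<Gamma>, \<phi>) \<in> \<A>" "x \<in> \<phi> ` U" using cover M(1) by blast
  obtain a where a: "a \<in> M \<inter> \<phi> ` U" and min: "\<forall>y. y \<in> M \<inter> \<phi> ` U \<longrightarrow> stab_card U \<Gamma> \<phi> a \<le> stab_card U \<Gamma> \<phi> y"
    using ex_has_least_nat[of "\<lambda>y. y \<in> M \<inter> \<phi> ` U" x "stab_card U \<Gamma> \<phi>"] x c(2) by blast
  then obtain N0 L where g: "germ U \<Gamma> \<phi> a N0 L" using germ_exists[OF c(1)] by blast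
  have "M \<inter> N0 \<subseteq> L"
  proof
    fix z assume z: "z \<in> M \<inter> N0"
    then have "stab_card U \<Gamma> \<phi> a \<le> stab_card U \<Gamma> \<phi> z" using min germD(5)[OF g] by blast
    then show "z \<in> L" using germD(8,9)[OF g, of z] z by simp
  qed
  then show ?thesis using g a unfolding tame_def by blast
qed

lemma orbit_local:
  assumes x: "x \<in> topspace X" and g: "germ U \<Gamma> \<phi> y N0 L" and y: "y \<in> Orb x"
  shows "Orb x \<inter> N0 \<subseteq> L"
proof -
  obtain a where a: "a \<in> Orb x" "tame (Orb x) a"
    using tame_exists[of "Orb x"] orb_into[OF x] orb_refl by blast
  have "y \<in> Orb a" using orb_trans[OF orb_sym[OF a(1)] y] .
  then have "step\<^sup>*\<^sup>* a y" by (simp add: vect_orbit_eq)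
  then have "tame (Orb x) y" using a(2) by induction (auto intro: tame_step[OF saturated_orbit])
  then show ?thesis using tame_iff[OF saturated_orbit g germD(3)[OF g]] by simp
qed

text \<open>Saturation puts the stratum into the orbit. Conversely, by \<open>orbit_local\<close>
  the type is locally constant along the orbit inside the chart, hence constant on a connected
  piece.\<close>

lemma stratum_eq_orbit:
  assumes c: "(U, \<Gamma>, \<phi>) \<in> \<A>" and x: "x \<in> \<phi> ` U"
  shows "conn_comp X {b. same_type U \<Gamma> \<phi> x b} x = conn_comp X (Orb x \<inter> \<phi> ` U) x"
proof
  interpret c: orb_chart X n U \<Gamma> \<phi> by (rule chart_in[OF c])
  have xX: "x \<in> topspace X" using x c.\<phi>_into by blast
  let ?K = "conn_comp X {b. same_type U \<Gamma> \<phi> x b} x" and ?K' = "conn_comp X (Orb x \<inter> \<phi> ` U) x"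
  have xK: "x \<in> ?K" "x \<in> ?K'" using conn_comp_self[OF xX] x c.same_type_refl orb_refl by auto
  have sub: "?K \<subseteq> {b. same_type U \<Gamma> \<phi> x b}" by (rule conn_comp_subset)
  then have KU: "?K \<subseteq> \<phi> ` U" using c.same_type_image by blast
  have KO: "?K \<subseteq> Orb x" by (rule saturatedD[OF saturated_orbit c orb_refl xK(1) conn_comp_connected]) (use sub in blast)
  show "?K \<subseteq> ?K'" by (rule conn_comp_max[OF conn_comp_connected Int_greatest[OF KO KU] xK(1)])
  have sub': "?K' \<subseteq> Orb x \<inter> \<phi> ` U" by (rule conn_comp_subset)
  have "same_type U \<Gamma> \<phi> x k" if k: "k \<in> ?K'" for k
  proof (rule connected_locally_constant[OF conn_comp_connected xK(2) k, where R = "same_type U \<Gamma> \<phi> x"])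
    show "same_type U \<Gamma> \<phi> x x" by (rule c.same_type_refl[OF x])
    fix z assume z: "z \<in> ?K'"
    obtain N0 L where g: "germ U \<Gamma> \<phi> z N0 L" using germ_exists[OF c] z sub' by blast
    have L: "Orb x \<inter> N0 \<subseteq> L" by (rule orbit_local[OF xX g]) (use z sub' in blast)
    have "same_type U \<Gamma> \<phi> x d \<longleftrightarrow> same_type U \<Gamma> \<phi> x z" if "d \<in> ?K' \<inter> N0" for d
    proof -
      have "same_type U \<Gamma> \<phi> z d" using germD(7)[OF g, of d] that L sub' by blast
      then show ?thesis using c.same_type_trans c.same_type_sym by blast
    qed
    then show "\<exists>N. openin X N \<and> z \<in> N \<and> (\<forall>d\<in>?K' \<inter> N. same_type U \<Gamma> \<phi> x d \<longleftrightarrow> same_type U \<Gamma> \<phi> x z)"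
      using germD(2,3,4)[OF g] by (intro exI[of _ N0]) auto
  qed
  then have "?K' \<subseteq> {b. same_type U \<Gamma> \<phi> x b}" by blast
  then show "?K' \<subseteq> ?K" by (rule conn_comp_max[OF conn_comp_connected _ xK(2)])
qed

section \<open>The orbits form the stratification, and it is unique\<close>

lemma block_components:
  assumes "(U, \<Gamma>, \<phi>) \<in> \<A>"
  shows "connected_components_of (subtopology X (M \<inter> chart_image (U, \<Gamma>, \<phi>))) = conn_comp X (M \<inter> \<phi> ` U) ` (M \<inter> \<phi> ` U)"
proof -
  interpret c: orb_chart X n U \<Gamma> \<phi> by (rule chart_in[OF assms])
  have "M \<inter> \<phi> ` U \<subseteq> topspace X" using c.\<phi>_into by blast
  then show ?thesis by (simp add: chart_image_def connected_components_of_subtopology)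
qed

lemma orbits_partition: "partition_on (topspace X) (Orb ` topspace X)"
proof (rule partition_onI)
  show "\<Union> (Orb ` topspace X) = topspace X" using orb_into orb_refl by blast
  show "{} \<notin> Orb ` topspace X" using orb_refl by blast
  show "disjnt q q'" if q: "q \<in> Orb ` topspace X" "q' \<in> Orb ` topspace X" "q \<noteq> q'" for q q'
  proof -
    obtain x y where "q = Orb x" "q' = Orb y" using q(1,2) by blast
    then show ?thesis using orb_eq q(3) unfolding disjnt_iff by metis
  qed
qed

lemma orbits_stratification: "is_orbifold_stratification X \<A> (Orb ` topspace X)"
  unfolding is_orbifold_stratification_def
proof (intro conjI ballI orbits_partition)
  show "connectedin X M" if "M \<in> Orb ` topspace X" for M using that orb_connected by blast
  fix c assume "c \<in> \<A>"
  then obtain U \<Gamma> \<phi> where c: "c = (U, \<Gamma>, \<phi>)" "(U, \<Gamma>, \<phi>) \<in> \<A>" by (cases c) auto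
  interpret c: orb_chart X n U \<Gamma> \<phi> by (rule chart_in[OF c(2)])
  show "chart_strata X c = (\<Union>M\<in>Orb ` topspace X. connected_components_of (subtopology X (M \<inter> chart_image c)))"
    unfolding c(1) c.chart_strata_eq block_components[OF c(2)]
  proof (intro equalityI subsetI)
    fix C assume "C \<in> (\<lambda>a. conn_comp X {b. same_type U \<Gamma> \<phi> a b} a) ` \<phi> ` U"
    then obtain a where a: "a \<in> \<phi> ` U" "C = conn_comp X (Orb a \<inter> \<phi> ` U) a" using stratum_eq_orbit[OF c(2)] by blast
    moreover have "a \<in> topspace X" using a(1) c.\<phi>_into by blast
    ultimately show "C \<in> (\<Union>M\<in>Orb ` topspace X. conn_comp X (M \<inter> \<phi> ` U) ` (M \<inter> \<phi> ` U))" using orb_refl by blast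
  next
    fix C assume "C \<in> (\<Union>M\<in>Orb ` topspace X. conn_comp X (M \<inter> \<phi> ` U) ` (M \<inter> \<phi> ` U))"
    then obtain x a where a: "a \<in> Orb x" "a \<in> \<phi> ` U" "C = conn_comp X (Orb x \<inter> \<phi> ` U) a" by blast
    then have "C = conn_comp X {b. same_type U \<Gamma> \<phi> a b} a" using stratum_eq_orbit[OF c(2) a(2)] orb_eq[OF a(1)] by simp
    then show "C \<in> (\<lambda>a. conn_comp X {b. same_type U \<Gamma> \<phi> a b} a) ` \<phi> ` U" using a(2) by blast
  qed
qed

lemma stratification_unique:
  assumes P: "is_orbifold_stratification X \<A> P"
  shows "P = Orb ` topspace X"
proof -
  have part: "partition_on (topspace X) P" and con: "\<And>M. M \<in> P \<Longrightarrow> connectedin X M"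
    and str: "\<And>c. c \<in> \<A> \<Longrightarrow> chart_strata X c = (\<Union>M\<in>P. connected_components_of (subtopology X (M \<inter> chart_image c)))"
    using P by (auto simp: is_orbifold_stratification_def)
  have same: "M = M'" if "M \<in> P" "M' \<in> P" "x \<in> M" "x \<in> M'" for M M' x
    using disjointD[OF partition_onD2[OF part] that(1,2)] that(3,4) by blast
  have MX: "M \<subseteq> topspace X" if "M \<in> P" for M using partition_onD1[OF part] that by blast
  \<comment> \<open>Compatibility only says that the stratum is a component of some block in the
    chart; disjointness of blocks identifies that block as \<open>M\<close>.\<close>
  have stratum: "conn_comp X {b. same_type U \<Gamma> \<phi> x b} x = conn_comp X (M \<inter> \<phi> ` U) x"
    if c: "(U, \<Gamma>, \<phi>) \<in> \<A>" and M: "M \<in> P" and x: "x \<in> M" "x \<in> \<phi> ` U" for U \<Gamma> \<phi> M x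
  proof -
    interpret c: orb_chart X n U \<Gamma> \<phi> by (rule chart_in[OF c])
    let ?C = "conn_comp X {b. same_type U \<Gamma> \<phi> x b} x"
    have "?C \<in> chart_strata X (U, \<Gamma>, \<phi>)" unfolding c.chart_strata_eq using x(2) by blast
    then obtain M' a where M': "M' \<in> P" "?C = conn_comp X (M' \<inter> \<phi> ` U) a"
      unfolding str[OF c] block_components[OF c] by blast
    have "x \<in> ?C" using conn_comp_self[of x X] c.same_type_refl[OF x(2)] MX[OF M] x(1) by blast
    then have xC: "x \<in> conn_comp X (M' \<inter> \<phi> ` U) a" using M'(2) by simp
    then have "x \<in> M'" using subsetD[OF conn_comp_subset xC] by simp
    then have "M' = M" using same[OF M'(1) M] x(1) by blast
    then show ?thesis using M'(2) conn_comp_eq[OF xC] by simp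
  qed
  have sat: "saturated M" if M: "M \<in> P" for M
    unfolding saturated_def
  proof (intro allI impI, elim conjE)
    fix U \<Gamma> \<phi> x K
    assume c: "(U, \<Gamma>, \<phi>) \<in> \<A>" and x: "x \<in> M" "x \<in> K" and K: "connectedin X K" "\<forall>k\<in>K. same_type U \<Gamma> \<phi> x k"
    interpret c: orb_chart X n U \<Gamma> \<phi> by (rule chart_in[OF c])
    have xU: "x \<in> \<phi> ` U" using K(2) x(2) c.same_type_image by blast
    have "K \<subseteq> {b. same_type U \<Gamma> \<phi> x b}" using K(2) by blast
    then have "K \<subseteq> conn_comp X {b. same_type U \<Gamma> \<phi> x b} x" by (rule conn_comp_max[OF K(1) _ x(2)])
    also have "\<dots> = conn_comp X (M \<inter> \<phi> ` U) x" by (rule stratum[OF c M x(1) xU])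
    also have "\<dots> \<subseteq> M \<inter> \<phi> ` U" by (rule conn_comp_subset)
    finally show "K \<subseteq> M" by blast
  qed
  \<comment> \<open>No propagation along \<open>M\<close> is needed here: \<open>K\<close> with its
    adherent point \<open>x\<close> is connected and contained in \<open>M\<close>, so it lies in
    one component, which by compatibility is the stratum of \<open>x\<close>.\<close>
  have local: "M \<inter> N0 \<subseteq> L" if M: "M \<in> P" and g: "germ U \<Gamma> \<phi> x N0 L" and x: "x \<in> M" for U \<Gamma> \<phi> x N0 L M
  proof
    note c = germD(1)[OF g]
    interpret c: orb_chart X n U \<Gamma> \<phi> by (rule chart_in[OF c])
    have xU: "x \<in> \<phi> ` U" using germD(3,4,5)[OF g] by blast
    fix z assume z: "z \<in> M \<inter> N0"
    then obtain K where K: "connectedin X K" "z \<in> K" "\<forall>k\<in>K. same_type U \<Gamma> \<phi> z k" "x \<in> X closure_of K"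
      using germD(10)[OF g _ germD(3)[OF g]] by blast
    have KM: "K \<subseteq> M" by (rule saturatedD[OF sat[OF M] c _ K(2,1)]) (use z K(3) in blast)+
    have KU: "K \<subseteq> \<phi> ` U" using K(3) c.same_type_image by blast
    have "connectedin X (insert x K)"
      using K(1,4) closure_of_subset[OF connectedin_subset_topspace[OF K(1)]]
      by (intro connectedin_intermediate_closure_of[OF K(1)]) auto
    then have "insert x K \<subseteq> conn_comp X (M \<inter> \<phi> ` U) x" using KM KU x xU by (intro conn_comp_max) auto
    also have "\<dots> = conn_comp X {b. same_type U \<Gamma> \<phi> x b} x" by (rule stratum[OF c M x xU, symmetric])
    also have "\<dots> \<subseteq> {b. same_type U \<Gamma> \<phi> x b}" by (rule conn_comp_subset)
    finally have "same_type U \<Gamma> \<phi> x z" using K(2) by blast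
    then show "z \<in> L" using germD(7)[OF g] z by blast
  qed
  \<comment> \<open>Both sets are connected, and near each of their points they lie in the stratum
    through that point, which belongs to blocks and orbits alike. So membership in one is locally
    constant along the other.\<close>
  have eq: "M = Orb x" if M: "M \<in> P" and x: "x \<in> M" for M x
  proof (intro equalityI subsetI)
    have xX: "x \<in> topspace X" using MX[OF M] x by blast
    fix y assume y: "y \<in> M"
    show "y \<in> Orb x"
    proof (rule connected_locally_constant[OF con[OF M] x y, where R = "\<lambda>z. z \<in> Orb x"])
      fix z assume z: "z \<in> M"
      obtain U \<Gamma> \<phi> where c: "(U, \<Gamma>, \<phi>) \<in> \<A>" "z \<in> \<phi> ` U" using cover MX[OF M] z by blast
      obtain N0 L where g: "germ U \<Gamma> \<phi> z N0 L" by (rule germ_exists[OF c])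
      obtain N where N: "openin X N" "z \<in> N" "L \<inter> N \<subseteq> Orb z" using germD(11)[OF g] by blast
      have "M \<inter> (N0 \<inter> N) \<subseteq> Orb z" using local[OF M g z] N(3) by blast
      then show "\<exists>N. openin X N \<and> z \<in> N \<and> (\<forall>d\<in>M \<inter> N. d \<in> Orb x \<longleftrightarrow> z \<in> Orb x)"
        using N(1,2) germD(2,3,4)[OF g] orb_trans orb_sym by (intro exI[of _ "N0 \<inter> N"]) blast
    qed (rule orb_refl)
  next
    have xX: "x \<in> topspace X" using MX[OF M] x by blast
    fix y assume y: "y \<in> Orb x"
    show "y \<in> M"
    proof (rule connected_locally_constant[OF orb_connected[OF xX] orb_refl y, where R = "\<lambda>z. z \<in> M"])
      fix z assume z: "z \<in> Orb x"
      have zX: "z \<in> topspace X" by (rule orb_into[OF xX z])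
      obtain U \<Gamma> \<phi> where c: "(U, \<Gamma>, \<phi>) \<in> \<A>" "z \<in> \<phi> ` U" using cover[OF zX] by blast
      obtain N0 L where g: "germ U \<Gamma> \<phi> z N0 L" by (rule germ_exists[OF c])
      obtain M' where M': "M' \<in> P" "z \<in> M'" using partition_onD1[OF part] zX by blast
      have "L \<subseteq> M'" by (rule germ_subset_saturated[OF sat[OF M'(1)] g M'(2) germD(3)[OF g]])
      then have "Orb x \<inter> N0 \<subseteq> M'" using orbit_local[OF xX g z] by blast
      then show "\<exists>N. openin X N \<and> z \<in> N \<and> (\<forall>d\<in>Orb x \<inter> N. d \<in> M \<longleftrightarrow> z \<in> M)"
        using germD(2,3,4)[OF g] M' same[OF M M'(1)] by (intro exI[of _ N0]) blast
    qed (rule x)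
  qed
  show ?thesis
  proof (intro equalityI subsetI)
    fix M assume M: "M \<in> P"
    moreover have "M \<noteq> {}" using M partition_onD3[OF part] by blast
    ultimately show "M \<in> Orb ` topspace X" using eq[OF M] MX[OF M] by blast
  next
    fix M assume "M \<in> Orb ` topspace X"
    then obtain x where x: "x \<in> topspace X" "M = Orb x" by blast
    then obtain M' where "M' \<in> P" "x \<in> M'" using partition_onD1[OF part] by blast
    then show "M \<in> P" using eq[of M' x] x(2) by simp
  qed
qed

end

theorem theorem4p14:
  fixes X :: "'a topology" and n :: nat and \<A> :: "'a chart set"
  assumes "orbifold X n \<A>"
  shows "orbifold_stratification X \<A> = vect_orbits (topspace X) (orbifold_smooth X n \<A>)"
proof -
  interpret orbifold_ctx X n \<A> by unfold_locales (rule assms)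
  show ?thesis
    unfolding orbifold_stratification_def vect_orbits_def
    by (rule the_equality) (rule orbits_stratification, rule stratification_unique)
qed

end
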